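(* Let $S \colon \mathrm{FP}^{\mathrm{op}} \to \mathscr S$ be an algebraic 2-theory and let $\mathscr C$ be a 2-category. For each weakness $w \in \{s,p,l,c\}$, there is an isomorphism of 2-categories $$\mathrm{Mod}_w(S, \mathscr C) \cong (\mathbb{M}\mathrm{od}_w(\mathcal S^\Pi, \mathcal C^+))_\lambda,$$ in which $\mathcal C$ is the finite power 2-sketch whose cones are given by all finite power cones in $\mathscr C$.
   Context: **Algebraic 2-theories.** $\mathrm{FP}$ is a skeleton of the full sub-2-category of the 2-category of small categories spanned by the finitely presentable categories. Each $\mathscr X\in\mathrm{FP}$ is the copower $\mathbf 1\cdot\mathscr X$ of the terminal category $\mathbf 1$ by $\mathscr X$, so $\mathrm{FP}^{\mathrm{op}}$ has finite powers, i.e. powers by finitely presentable categories. An algebraic 2-theory is a small 2-category $\mathscr S$ with a finite power-preserving identity-on-objects 2-functor $S\colon\mathrm{FP}^{\mathrm{op}}\to\mathscr S$. A model of $S$ in $\mathscr C$ is a finite power-preserving 2-functor $\mathscr S\to\mathscr C$. For models $M,N$, a $w$-weak morphism $M\to N$ is a $w$-natural transformation $\phi\colon M\Rightarrow N$ (2-natural, pseudonatural, lax natural, colax natural for $w=s,p,l,c$) whose restriction $\phi_S\colon MS\Rightarrow NS$ along $S$ is 2-natural. $\mathrm{Mod}_w(S,\mathscr C)$ is the 2-category of models, $w$-weak morphisms and modifications. **$\mathcal F$-categories.** $\mathcal F$ is the full subcategory of the arrow category $\mathrm{CAT}^{\to}$ of small categories spanned by the full embeddings $A\colon A_\tau\to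 A_\lambda$ (fully faithful, injective-on-objects functors). An $\mathcal F$-category $\mathbb C$ is a category enriched in the cartesian closed category $\mathcal F$; equivalently, a 2-category $\mathbb C_\lambda$ of loose morphisms with a wide, locally full sub-2-category $\mathbb C_\tau$ of tight morphisms. An $\mathcal F$-functor is a 2-functor on loose parts preserving tightness. $\mathcal F$ is itself an $\mathcal F$-category $\mathbb F$ (loose morphisms: functors $A_\lambda\to B_\lambda$; tight: those restricting to $A_\tau\to B_\tau$). An $\mathcal F$-sketch is a small $\mathcal F$-category with a class of weighted cones (an $\mathcal F$-weight $W\colon\mathbb J\to\mathbb F$, an $\mathcal F$-functor $D\colon\mathbb J\to\mathbb S$, an object $X$ and an $\mathcal F$-natural $\gamma\colon W\Rightarrow\mathbb S(X,D-)$); a model of one $\mathcal F$-sketch in another is an $\mathcal F$-functor sending specified cones to specified cones. A 2-sketch is the $\mathrm{CAT}$-enriched analogue. **The sketches.** $\Pi$ is the class of $\mathcal F$-weights for tight finite powers, i.e. the weights $\mathbb 1\to\mathbb F$ picking out an identity embedding $\mathscr X\to\mathscr X$ with $\mathscr X$ finitely presentable. The finite power 2-sketch $\mathcal S$ is $\mathscr S$ with specified cones the images under $S$ of the canonical power cones exhibiting each $\mathscr X\in\mathrm{FP}^{\mathrm{op}}$ as the power of $\mathbf 1$ by $\mathscr X$; its cone projections are $S(\pi_X)\colon S(\mathscr X)\to S(\mathbf 1)$, where, for $X\in\mathscr X$, $\pi_X$ is the morphism in $\mathrm{FP}^{\mathrm{op}}$ corresponding to the functor $\mathbf 1\to\mathscr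 X$ picking out $X$. $\mathcal S^\Pi$ is the $\mathcal F$-sketch with underlying 2-category of loose morphisms $\mathscr S$, with tight morphisms generated under identities and composition by the cone projections $S(\pi_X)$, and with these power cones regarded as tight power cones (weights in $\Pi$). $\mathcal C^+$ is the $\mathcal F$-sketch on the chordate $\mathcal F$-category on $\mathscr C$ (all morphisms tight) whose specified cones are the finite power cones of $\mathscr C$ regarded as tight power cones. **Models.** For $\mathcal F$-sketches $\mathcal A,\mathcal B$, $\mathbb{M}\mathrm{od}_w(\mathcal A,\mathcal B)$ is the $\mathcal F$-category whose objects are models; whose loose morphisms are the $w$-natural transformations between underlying 2-functors on loose parts whose 2-cell components at tight morphisms are identities; in which such a morphism is tight when its 1-cell components are tight and all its 2-cell components are identities; and whose 2-cells are modifications. $(-)_\lambda$ denotes the underlying 2-category of loose morphisms. *)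

theory Defs
  imports "HOL-Library.FuncSet" "HOL-Library.Infinite_Typeclass"
begin

text \<open>
  Size conventions.  A small set is a subset of an infinite type \<open>'u\<close>, so that
  a small category is a category whose objects and arrows are elements of \<open>'u\<close>.
  The types of the other 2-categories are arbitrary.

  All function-valued components (the actions of functors, the components of
  transformations) are extensional, i.e. \<open>undefined\<close> outside their domain, so
  that equality of records is equality of the mathematical objects.
\<close>

section \<open>Categories\<close>

record ('o, 'a) cat =
  Obj :: "'o set"
  Arr :: "'a set"
  Dom :: "'a \<Rightarrow> 'o"
  Cod :: "'a \<Rightarrow> 'o"
  Ide :: "'o \<Rightarrow> 'a"
  Comp :: "'a \<Rightarrow> 'a \<Rightarrow> 'a"  \<comment> \<open>\<open>Comp A g f\<close> is g after f\<close>

definition category :: "('o, 'a) cat \<Rightarrow> bool" where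
  "category A \<longleftrightarrow>
     (\<forall>f\<in>Arr A. Dom A f \<in> Obj A \<and> Cod A f \<in> Obj A) \<and>
     (\<forall>x\<in>Obj A. Ide A x \<in> Arr A \<and> Dom A (Ide A x) = x \<and> Cod A (Ide A x) = x) \<and>
     (\<forall>f\<in>Arr A. \<forall>g\<in>Arr A. Dom A g = Cod A f \<longrightarrow>
        Comp A g f \<in> Arr A \<and> Dom A (Comp A g f) = Dom A f \<and> Cod A (Comp A g f) = Cod A g) \<and>
     (\<forall>f\<in>Arr A. Comp A f (Ide A (Dom A f)) = f \<and> Comp A (Ide A (Cod A f)) f = f) \<and>
     (\<forall>f\<in>Arr A. \<forall>g\<in>Arr A. \<forall>h\<in>Arr A. Dom A g = Cod A f \<longrightarrow> Dom A h = Cod A g \<longrightarrow>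
        Comp A h (Comp A g f) = Comp A (Comp A h g) f)"

definition hom :: "('o, 'a) cat \<Rightarrow> 'o \<Rightarrow> 'o \<Rightarrow> 'a set" where
  "hom A x y = {f \<in> Arr A. Dom A f = x \<and> Cod A f = y}"

definition is_identity :: "('o, 'a) cat \<Rightarrow> 'a \<Rightarrow> bool" where
  "is_identity A f \<longleftrightarrow> (\<exists>x\<in>Obj A. f = Ide A x)"

definition invertible :: "('o, 'a) cat \<Rightarrow> 'a \<Rightarrow> bool" where
  "invertible A f \<longleftrightarrow> (\<exists>g\<in>hom A (Cod A f) (Dom A f).
     Comp A g f = Ide A (Dom A f) \<and> Comp A f g = Ide A (Cod A f))"

record ('o, 'a, 'p, 'b) func =
  fdom :: "('o, 'a) cat"
  fcod :: "('p, 'b) cat"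
  fob :: "'o \<Rightarrow> 'p"
  far :: "'a \<Rightarrow> 'b"

definition is_functor :: "('o, 'a, 'p, 'b) func \<Rightarrow> bool" where
  "is_functor F \<longleftrightarrow>
     fob F \<in> Obj (fdom F) \<rightarrow>\<^sub>E Obj (fcod F) \<and>
     far F \<in> Arr (fdom F) \<rightarrow>\<^sub>E Arr (fcod F) \<and>
     (\<forall>f\<in>Arr (fdom F). Dom (fcod F) (far F f) = fob F (Dom (fdom F) f) \<and>
        Cod (fcod F) (far F f) = fob F (Cod (fdom F) f)) \<and>
     (\<forall>x\<in>Obj (fdom F). far F (Ide (fdom F) x) = Ide (fcod F) (fob F x)) \<and>
     (\<forall>f\<in>Arr (fdom F). \<forall>g\<in>Arr (fdom F). Dom (fdom F) g = Cod (fdom F) f \<longrightarrow>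
        far F (Comp (fdom F) g f) = Comp (fcod F) (far F g) (far F f))"

definition functors :: "('o, 'a) cat \<Rightarrow> ('p, 'b) cat \<Rightarrow> ('o, 'a, 'p, 'b) func set" where
  "functors A B = {F. is_functor F \<and> fdom F = A \<and> fcod F = B}"

definition id_func :: "('o, 'a) cat \<Rightarrow> ('o, 'a, 'o, 'a) func" where
  "id_func A = \<lparr>fdom = A, fcod = A, fob = (\<lambda>x\<in>Obj A. x), far = (\<lambda>f\<in>Arr A. f)\<rparr>"

definition comp_func ::
    "('p, 'b, 'q, 'c) func \<Rightarrow> ('o, 'a, 'p, 'b) func \<Rightarrow> ('o, 'a, 'q, 'c) func" where
  "comp_func G F = \<lparr>fdom = fdom F, fcod = fcod G,
     fob = (\<lambda>x\<in>Obj (fdom F). fob G (fob F x)),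
     far = (\<lambda>f\<in>Arr (fdom F). far G (far F f))\<rparr>"

definition is_iso_func :: "('o, 'a, 'p, 'b) func \<Rightarrow> bool" where
  "is_iso_func F \<longleftrightarrow> is_functor F \<and> (\<exists>G\<in>functors (fcod F) (fdom F).
     comp_func G F = id_func (fdom F) \<and> comp_func F G = id_func (fcod F))"

definition isomorphic_cat :: "('o, 'a) cat \<Rightarrow> ('p, 'b) cat \<Rightarrow> bool" where
  "isomorphic_cat A B \<longleftrightarrow> (\<exists>F\<in>functors A B. is_iso_func F)"

record ('o, 'a, 'p, 'b) nattr =
  ndom :: "('o, 'a, 'p, 'b) func"
  ncod :: "('o, 'a, 'p, 'b) func"
  ncmp :: "'o \<Rightarrow> 'b"

definition is_nattr :: "('o, 'a, 'p, 'b) nattr \<Rightarrow> bool" where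
  "is_nattr \<eta> \<longleftrightarrow>
     is_functor (ndom \<eta>) \<and> is_functor (ncod \<eta>) \<and>
     fdom (ndom \<eta>) = fdom (ncod \<eta>) \<and> fcod (ndom \<eta>) = fcod (ncod \<eta>) \<and>
     ncmp \<eta> \<in> extensional (Obj (fdom (ndom \<eta>))) \<and>
     (\<forall>x\<in>Obj (fdom (ndom \<eta>)).
        ncmp \<eta> x \<in> hom (fcod (ndom \<eta>)) (fob (ndom \<eta>) x) (fob (ncod \<eta>) x)) \<and>
     (\<forall>f\<in>Arr (fdom (ndom \<eta>)).
        Comp (fcod (ndom \<eta>)) (ncmp \<eta> (Cod (fdom (ndom \<eta>)) f)) (far (ndom \<eta>) f) =
        Comp (fcod (ndom \<eta>)) (far (ncod \<eta>) f) (ncmp \<eta> (Dom (fdom (ndom \<eta>)) f)))"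

definition id_nattr :: "('o, 'a, 'p, 'b) func \<Rightarrow> ('o, 'a, 'p, 'b) nattr" where
  "id_nattr F = \<lparr>ndom = F, ncod = F, ncmp = (\<lambda>x\<in>Obj (fdom F). Ide (fcod F) (fob F x))\<rparr>"

definition vcomp_nattr ::
    "('o, 'a, 'p, 'b) nattr \<Rightarrow> ('o, 'a, 'p, 'b) nattr \<Rightarrow> ('o, 'a, 'p, 'b) nattr" where
  "vcomp_nattr \<theta> \<eta> = \<lparr>ndom = ndom \<eta>, ncod = ncod \<theta>,
     ncmp = (\<lambda>x\<in>Obj (fdom (ndom \<eta>)). Comp (fcod (ndom \<eta>)) (ncmp \<theta> x) (ncmp \<eta> x))\<rparr>"

definition hcomp_nattr ::
    "('p, 'b, 'q, 'c) nattr \<Rightarrow> ('o, 'a, 'p, 'b) nattr \<Rightarrow> ('o, 'a, 'q, 'c) nattr" where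
  "hcomp_nattr \<theta> \<eta> = \<lparr>ndom = comp_func (ndom \<theta>) (ndom \<eta>), ncod = comp_func (ncod \<theta>) (ncod \<eta>),
     ncmp = (\<lambda>x\<in>Obj (fdom (ndom \<eta>)).
       Comp (fcod (ndom \<theta>)) (ncmp \<theta> (fob (ncod \<eta>) x)) (far (ndom \<theta>) (ncmp \<eta> x)))\<rparr>"

definition func_cat :: "('o, 'a) cat \<Rightarrow> ('p, 'b) cat \<Rightarrow>
    (('o, 'a, 'p, 'b) func, ('o, 'a, 'p, 'b) nattr) cat" where
  "func_cat A B = \<lparr>Obj = functors A B,
     Arr = {\<eta>. is_nattr \<eta> \<and> ndom \<eta> \<in> functors A B \<and> ncod \<eta> \<in> functors A B},
     Dom = ndom, Cod = ncod, Ide = id_nattr, Comp = vcomp_nattr\<rparr>"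

section \<open>2-categories and 2-functors\<close>

text \<open>
  A 2-category consists of its underlying category \<open>und\<close> of objects and 1-cells, the
  disjoint union \<open>vert\<close> of its hom-categories (whose objects are the 1-cells and whose
  arrows are the 2-cells), and horizontal composition of 2-cells.
\<close>

record ('o, 'm, 'c) two_cat =
  und :: "('o, 'm) cat"
  vert :: "('m, 'c) cat"
  hcomp :: "'c \<Rightarrow> 'c \<Rightarrow> 'c"  \<comment> \<open>\<open>hcomp K \<beta> \<alpha>\<close> is \<beta> after \<alpha>\<close>

abbreviation Ob :: "('o, 'm, 'c) two_cat \<Rightarrow> 'o set" where
  "Ob K \<equiv> Obj (und K)"

abbreviation Mor :: "('o, 'm, 'c) two_cat \<Rightarrow> 'm set" where
  "Mor K \<equiv> Arr (und K)"

abbreviation Cell :: "('o, 'm, 'c) two_cat \<Rightarrow> 'c set" where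
  "Cell K \<equiv> Arr (vert K)"

definition horiz :: "('o, 'm, 'c) two_cat \<Rightarrow> ('o, 'c) cat" where
  "horiz K = \<lparr>Obj = Ob K, Arr = Cell K,
     Dom = (\<lambda>\<alpha>. Dom (und K) (Dom (vert K) \<alpha>)), Cod = (\<lambda>\<alpha>. Cod (und K) (Dom (vert K) \<alpha>)),
     Ide = (\<lambda>X. Ide (vert K) (Ide (und K) X)), Comp = hcomp K\<rparr>"

definition two_category :: "('o, 'm, 'c) two_cat \<Rightarrow> bool" where
  "two_category K \<longleftrightarrow>
     category (und K) \<and> category (vert K) \<and> Obj (vert K) = Mor K \<and>
     (\<forall>\<alpha>\<in>Cell K. Dom (und K) (Dom (vert K) \<alpha>) = Dom (und K) (Cod (vert K) \<alpha>) \<and>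
        Cod (und K) (Dom (vert K) \<alpha>) = Cod (und K) (Cod (vert K) \<alpha>)) \<and>
     category (horiz K) \<and>
     (\<forall>\<alpha>\<in>Cell K. \<forall>\<beta>\<in>Cell K. Dom (horiz K) \<beta> = Cod (horiz K) \<alpha> \<longrightarrow>
        Dom (vert K) (hcomp K \<beta> \<alpha>) = Comp (und K) (Dom (vert K) \<beta>) (Dom (vert K) \<alpha>) \<and>
        Cod (vert K) (hcomp K \<beta> \<alpha>) = Comp (und K) (Cod (vert K) \<beta>) (Cod (vert K) \<alpha>)) \<and>
     (\<forall>f\<in>Mor K. \<forall>g\<in>Mor K. Dom (und K) g = Cod (und K) f \<longrightarrow>
        hcomp K (Ide (vert K) g) (Ide (vert K) f) = Ide (vert K) (Comp (und K) g f)) \<and>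
     (\<forall>\<alpha>\<in>Cell K. \<forall>\<alpha>'\<in>Cell K. \<forall>\<beta>\<in>Cell K. \<forall>\<beta>'\<in>Cell K.
        Dom (vert K) \<alpha>' = Cod (vert K) \<alpha> \<longrightarrow> Dom (vert K) \<beta>' = Cod (vert K) \<beta> \<longrightarrow>
        Dom (horiz K) \<beta> = Cod (horiz K) \<alpha> \<longrightarrow>
        hcomp K (Comp (vert K) \<beta>' \<beta>) (Comp (vert K) \<alpha>' \<alpha>) =
        Comp (vert K) (hcomp K \<beta>' \<alpha>') (hcomp K \<beta> \<alpha>))"

definition lwhisker :: "('o, 'm, 'c) two_cat \<Rightarrow> 'm \<Rightarrow> 'c \<Rightarrow> 'c" where
  "lwhisker K g \<alpha> = hcomp K (Ide (vert K) g) \<alpha>"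

definition rwhisker :: "('o, 'm, 'c) two_cat \<Rightarrow> 'c \<Rightarrow> 'm \<Rightarrow> 'c" where
  "rwhisker K \<beta> f = hcomp K \<beta> (Ide (vert K) f)"

definition hom_cat :: "('o, 'm, 'c) two_cat \<Rightarrow> 'o \<Rightarrow> 'o \<Rightarrow> ('m, 'c) cat" where
  "hom_cat K X Y = (vert K)\<lparr>Obj := hom (und K) X Y,
     Arr := {\<alpha> \<in> Cell K. Dom (vert K) \<alpha> \<in> hom (und K) X Y \<and> Cod (vert K) \<alpha> \<in> hom (und K) X Y}\<rparr>"

text \<open>The dual that reverses 1-cells but not 2-cells.\<close>

definition op_two_cat :: "('o, 'm, 'c) two_cat \<Rightarrow> ('o, 'm, 'c) two_cat" where
  "op_two_cat K = \<lparr>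
     und = (und K)\<lparr>Dom := Cod (und K), Cod := Dom (und K), Comp := (\<lambda>g f. Comp (und K) f g)\<rparr>,
     vert = vert K,
     hcomp = (\<lambda>\<beta> \<alpha>. hcomp K \<alpha> \<beta>)\<rparr>"

record ('o, 'm, 'c, 'p, 'n, 'd) two_func =
  F0 :: "'o \<Rightarrow> 'p"
  F1 :: "'m \<Rightarrow> 'n"
  F2 :: "'c \<Rightarrow> 'd"

definition two_functor ::
    "('o, 'm, 'c) two_cat \<Rightarrow> ('p, 'n, 'd) two_cat \<Rightarrow> ('o, 'm, 'c, 'p, 'n, 'd) two_func \<Rightarrow> bool" where
  "two_functor K L F \<longleftrightarrow>
     is_functor \<lparr>fdom = und K, fcod = und L, fob = F0 F, far = F1 F\<rparr> \<and>
     is_functor \<lparr>fdom = vert K, fcod = vert L, fob = F1 F, far = F2 F\<rparr> \<and>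
     (\<forall>\<alpha>\<in>Cell K. \<forall>\<beta>\<in>Cell K. Dom (horiz K) \<beta> = Cod (horiz K) \<alpha> \<longrightarrow>
        F2 F (hcomp K \<beta> \<alpha>) = hcomp L (F2 F \<beta>) (F2 F \<alpha>))"

definition comp_two_func :: "('o, 'm, 'c) two_cat \<Rightarrow> ('p, 'n, 'd, 'q, 'k, 'e) two_func \<Rightarrow>
    ('o, 'm, 'c, 'p, 'n, 'd) two_func \<Rightarrow> ('o, 'm, 'c, 'q, 'k, 'e) two_func" where
  "comp_two_func K G F = \<lparr>F0 = (\<lambda>X\<in>Ob K. F0 G (F0 F X)), F1 = (\<lambda>f\<in>Mor K. F1 G (F1 F f)),
     F2 = (\<lambda>\<alpha>\<in>Cell K. F2 G (F2 F \<alpha>))\<rparr>"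

definition id_two_func :: "('o, 'm, 'c) two_cat \<Rightarrow> ('o, 'm, 'c, 'o, 'm, 'c) two_func" where
  "id_two_func K = \<lparr>F0 = (\<lambda>X\<in>Ob K. X), F1 = (\<lambda>f\<in>Mor K. f), F2 = (\<lambda>\<alpha>\<in>Cell K. \<alpha>)\<rparr>"

text \<open>The action \<open>K(X, Y) \<rightarrow> L(FX, FY)\<close> of a 2-functor on hom-categories.\<close>

definition hom_action :: "('o, 'm, 'c) two_cat \<Rightarrow> ('p, 'n, 'd) two_cat \<Rightarrow>
    ('o, 'm, 'c, 'p, 'n, 'd) two_func \<Rightarrow> 'o \<Rightarrow> 'o \<Rightarrow> ('m, 'c, 'n, 'd) func" where
  "hom_action K L F X Y = \<lparr>fdom = hom_cat K X Y, fcod = hom_cat L (F0 F X) (F0 F Y),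
     fob = restrict (F1 F) (Obj (hom_cat K X Y)), far = restrict (F2 F) (Arr (hom_cat K X Y))\<rparr>"

definition isomorphic_two_cat :: "('o, 'm, 'c) two_cat \<Rightarrow> ('p, 'n, 'd) two_cat \<Rightarrow> bool" where
  "isomorphic_two_cat K L \<longleftrightarrow> two_category K \<and> two_category L \<and>
     (\<exists>F G. two_functor K L F \<and> two_functor L K G \<and>
        comp_two_func K G F = id_two_func K \<and> comp_two_func L F G = id_two_func L)"

text \<open>The full sub-2-category of the 2-category of categories spanned by a class of categories.\<close>

definition Cat_on :: "('u, 'v) cat set \<Rightarrow>
    (('u, 'v) cat, ('u, 'v, 'u, 'v) func, ('u, 'v, 'u, 'v) nattr) two_cat" where
  "Cat_on \<X> = (let M = {F. is_functor F \<and> fdom F \<in> \<X> \<and> fcod F \<in> \<X>} in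
     \<lparr>und = \<lparr>Obj = \<X>, Arr = M, Dom = fdom, Cod = fcod, Ide = id_func, Comp = comp_func\<rparr>,
      vert = \<lparr>Obj = M, Arr = {\<eta>. is_nattr \<eta> \<and> ndom \<eta> \<in> M \<and> ncod \<eta> \<in> M},
        Dom = ndom, Cod = ncod, Ide = id_nattr, Comp = vcomp_nattr\<rparr>,
      hcomp = hcomp_nattr\<rparr>)"

definition CAT :: "(('u, 'v) cat, ('u, 'v, 'u, 'v) func, ('u, 'v, 'u, 'v) nattr) two_cat" where
  "CAT = Cat_on {A. category A}"

section \<open>Finitely presentable categories\<close>

definition cocone :: "('j, 'k, 'o, 'a) func \<Rightarrow> 'o \<Rightarrow> ('j \<Rightarrow> 'a) \<Rightarrow> bool" where
  "cocone D L \<gamma> \<longleftrightarrow> L \<in> Obj (fcod D) \<and>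
     (\<forall>j\<in>Obj (fdom D). \<gamma> j \<in> hom (fcod D) (fob D j) L) \<and>
     (\<forall>k\<in>Arr (fdom D). Comp (fcod D) (\<gamma> (Cod (fdom D) k)) (far D k) = \<gamma> (Dom (fdom D) k))"

definition colimit_cocone :: "('j, 'k, 'o, 'a) func \<Rightarrow> 'o \<Rightarrow> ('j \<Rightarrow> 'a) \<Rightarrow> bool" where
  "colimit_cocone D L \<gamma> \<longleftrightarrow> cocone D L \<gamma> \<and>
     (\<forall>B \<mu>. cocone D B \<mu> \<longrightarrow>
        (\<exists>!h. h \<in> hom (fcod D) L B \<and> (\<forall>j\<in>Obj (fdom D). Comp (fcod D) h (\<gamma> j) = \<mu> j)))"

definition filtered :: "('j, 'k) cat \<Rightarrow> bool" where
  "filtered J \<longleftrightarrow> category J \<and> Obj J \<noteq> {} \<and>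
     (\<forall>i\<in>Obj J. \<forall>j\<in>Obj J. \<exists>k\<in>Obj J. hom J i k \<noteq> {} \<and> hom J j k \<noteq> {}) \<and>
     (\<forall>i\<in>Obj J. \<forall>j\<in>Obj J. \<forall>f\<in>hom J i j. \<forall>g\<in>hom J i j.
        \<exists>k\<in>Obj J. \<exists>h\<in>hom J j k. Comp J h f = Comp J h g)"

text \<open>The category of subsets of a type; an arrow is a map together with its source and target.\<close>

definition SET :: "('a set, 'a set \<times> ('a \<Rightarrow> 'a) \<times> 'a set) cat" where
  "SET = \<lparr>Obj = UNIV, Arr = {(A, f, B). f \<in> A \<rightarrow>\<^sub>E B},
     Dom = (\<lambda>(A, f, B). A), Cod = (\<lambda>(A, f, B). B), Ide = (\<lambda>A. (A, \<lambda>x\<in>A. x, A)),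
     Comp = (\<lambda>(B', g, C) (A, f, B). (A, \<lambda>x\<in>A. g (f x), C))\<rparr>"

definition hom_func :: "('o, 'a) cat \<Rightarrow> 'o \<Rightarrow>
    ('o, 'a, 'a set, 'a set \<times> ('a \<Rightarrow> 'a) \<times> 'a set) func" where
  "hom_func A X = \<lparr>fdom = A, fcod = SET, fob = (\<lambda>Y\<in>Obj A. hom A X Y),
     far = (\<lambda>g\<in>Arr A. (hom A X (Dom A g), \<lambda>f\<in>hom A X (Dom A g). Comp A g f, hom A X (Cod A g)))\<rparr>"

text \<open>
  A small category is finitely presentable if it is a finitely presentable object of the
  category of small categories: its covariant hom-functor preserves small filtered colimits.
  (Colimit cocones in \<open>SET\<close> are tested only against sets over the type of functors, which
  suffices because two-element sets already detect them.)
\<close>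

definition finitely_presentable :: "('u, 'u) cat \<Rightarrow> bool" where
  "finitely_presentable X \<longleftrightarrow> category X \<and>
     (\<forall>(D :: ('u, 'u, ('u, 'u) cat, ('u, 'u, 'u, 'u) func) func) L \<gamma>.
        is_functor D \<and> filtered (fdom D) \<and> fcod D = und CAT \<and> colimit_cocone D L \<gamma> \<longrightarrow>
        colimit_cocone (comp_func (hom_func (und CAT) X) D)
          (fob (hom_func (und CAT) X) L) (\<lambda>j. far (hom_func (und CAT) X) (\<gamma> j)))"

text \<open>Skeletality is up to isomorphism (not equivalence) of categories.\<close>

definition FP_skeleton :: "('u, 'u) cat set \<Rightarrow> bool" where
  "FP_skeleton FP \<longleftrightarrow> (\<forall>X\<in>FP. finitely_presentable X) \<and>
     (\<forall>X :: ('u, 'u) cat. finitely_presentable X \<longrightarrow> (\<exists>!Y. Y \<in> FP \<and> isomorphic_cat X Y))"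

abbreviation FP_op :: "('u, 'u) cat set \<Rightarrow>
    (('u, 'u) cat, ('u, 'u, 'u, 'u) func, ('u, 'u, 'u, 'u) nattr) two_cat" where
  "FP_op FP \<equiv> op_two_cat (Cat_on FP)"

section \<open>Powers\<close>

text \<open>
  For \<open>\<gamma> : X \<rightarrow> K(P, A)\<close>, the functor \<open>K(Y, P) \<rightarrow> CAT(X, K(Y, A))\<close> given by
  precomposition with \<open>\<gamma>\<close>.
\<close>

definition power_comparison :: "('o, 'm, 'c) two_cat \<Rightarrow> ('u, 'v) cat \<Rightarrow> 'o \<Rightarrow> 'o \<Rightarrow>
    ('u, 'v, 'm, 'c) func \<Rightarrow> 'o \<Rightarrow>
    ('m, 'c, ('u, 'v, 'm, 'c) func, ('u, 'v, 'm, 'c) nattr) func" where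
  "power_comparison K X A P \<gamma> Y =
     (let H = (\<lambda>f. \<lparr>fdom = X, fcod = hom_cat K Y A,
                fob = (\<lambda>x\<in>Obj X. Comp (und K) (fob \<gamma> x) f),
                far = (\<lambda>a\<in>Arr X. rwhisker K (far \<gamma> a) f)\<rparr>)
      in \<lparr>fdom = hom_cat K Y P, fcod = func_cat X (hom_cat K Y A),
          fob = (\<lambda>f\<in>Obj (hom_cat K Y P). H f),
          far = (\<lambda>\<alpha>\<in>Arr (hom_cat K Y P). \<lparr>ndom = H (Dom (vert K) \<alpha>), ncod = H (Cod (vert K) \<alpha>),
                  ncmp = (\<lambda>x\<in>Obj X. lwhisker K (fob \<gamma> x) \<alpha>)\<rparr>)\<rparr>)"

definition is_power :: "('o, 'm, 'c) two_cat \<Rightarrow> ('u, 'v) cat \<Rightarrow> 'o \<Rightarrow> 'o \<Rightarrow>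
    ('u, 'v, 'm, 'c) func \<Rightarrow> bool" where
  "is_power K X A P \<gamma> \<longleftrightarrow> A \<in> Ob K \<and> P \<in> Ob K \<and> \<gamma> \<in> functors X (hom_cat K P A) \<and>
     (\<forall>Y\<in>Ob K. is_iso_func (power_comparison K X A P \<gamma> Y))"

definition preserves_powers :: "('u, 'v) cat set \<Rightarrow> ('o, 'm, 'c) two_cat \<Rightarrow>
    ('p, 'n, 'd) two_cat \<Rightarrow> ('o, 'm, 'c, 'p, 'n, 'd) two_func \<Rightarrow> bool" where
  "preserves_powers \<W> K L F \<longleftrightarrow> (\<forall>X\<in>\<W>. \<forall>A P \<gamma>. is_power K X A P \<gamma> \<longrightarrow>
     is_power L X (F0 F A) (F0 F P) (comp_func (hom_action K L F P A) \<gamma>))"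

section \<open>Weak transformations and modifications\<close>

datatype weakness = Strict | Pseudo | Lax | Colax

text \<open>
  For a transformation \<open>\<phi> : M \<Rightarrow> N\<close>, the 2-cell component at \<open>f : X \<rightarrow> Y\<close> is directed
  \<open>Nf \<circ> \<phi>\<^sub>X \<Rightarrow> \<phi>\<^sub>Y \<circ> Mf\<close>, and oppositely in the colax case.  The 2-natural transformations
  are those whose 2-cell components are identities.
\<close>

record ('o, 'm, 'c, 'p, 'n, 'd) transf =
  tdom :: "('o, 'm, 'c, 'p, 'n, 'd) two_func"
  tcod :: "('o, 'm, 'c, 'p, 'n, 'd) two_func"
  t1 :: "'o \<Rightarrow> 'n"
  t2 :: "'m \<Rightarrow> 'd"

definition weak_natural :: "weakness \<Rightarrow> ('o, 'm, 'c) two_cat \<Rightarrow> ('p, 'n, 'd) two_cat \<Rightarrow>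
    ('o, 'm, 'c, 'p, 'n, 'd) transf \<Rightarrow> bool" where
  "weak_natural w K L \<phi> \<longleftrightarrow>
     (let M = tdom \<phi>; N = tcod \<phi>;
          NF = (\<lambda>f. Comp (und L) (F1 N f) (t1 \<phi> (Dom (und K) f)));
          FM = (\<lambda>f. Comp (und L) (t1 \<phi> (Cod (und K) f)) (F1 M f))
      in two_functor K L M \<and> two_functor K L N \<and>
         t1 \<phi> \<in> extensional (Ob K) \<and> t2 \<phi> \<in> extensional (Mor K) \<and>
         (\<forall>X\<in>Ob K. t1 \<phi> X \<in> hom (und L) (F0 M X) (F0 N X)) \<and>
         (\<forall>f\<in>Mor K. t2 \<phi> f \<in> (if w = Colax then hom (vert L) (FM f) (NF f)
                                            else hom (vert L) (NF f) (FM f))) \<and>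
         (w = Strict \<longrightarrow> (\<forall>f\<in>Mor K. is_identity (vert L) (t2 \<phi> f))) \<and>
         (w = Pseudo \<longrightarrow> (\<forall>f\<in>Mor K. invertible (vert L) (t2 \<phi> f))) \<and>
         (\<forall>X\<in>Ob K. t2 \<phi> (Ide (und K) X) = Ide (vert L) (t1 \<phi> X)) \<and>
         (\<forall>f\<in>Mor K. \<forall>g\<in>Mor K. Dom (und K) g = Cod (und K) f \<longrightarrow>
            t2 \<phi> (Comp (und K) g f) =
              (if w = Colax
               then Comp (vert L) (lwhisker L (F1 N g) (t2 \<phi> f)) (rwhisker L (t2 \<phi> g) (F1 M f))
               else Comp (vert L) (rwhisker L (t2 \<phi> g) (F1 M f)) (lwhisker L (F1 N g) (t2 \<phi> f)))) \<and>
         (\<forall>\<alpha>\<in>Cell K.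
            let f = Dom (vert K) \<alpha>; g = Cod (vert K) \<alpha>;
                N\<alpha> = rwhisker L (F2 N \<alpha>) (t1 \<phi> (Dom (und K) f));
                M\<alpha> = lwhisker L (t1 \<phi> (Cod (und K) f)) (F2 M \<alpha>)
            in if w = Colax then Comp (vert L) N\<alpha> (t2 \<phi> f) = Comp (vert L) (t2 \<phi> g) M\<alpha>
               else Comp (vert L) M\<alpha> (t2 \<phi> f) = Comp (vert L) (t2 \<phi> g) N\<alpha>))"

definition id_transf :: "('o, 'm, 'c) two_cat \<Rightarrow> ('p, 'n, 'd) two_cat \<Rightarrow>
    ('o, 'm, 'c, 'p, 'n, 'd) two_func \<Rightarrow> ('o, 'm, 'c, 'p, 'n, 'd) transf" where
  "id_transf K L M = \<lparr>tdom = M, tcod = M,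
     t1 = (\<lambda>X\<in>Ob K. Ide (und L) (F0 M X)), t2 = (\<lambda>f\<in>Mor K. Ide (vert L) (F1 M f))\<rparr>"

definition comp_transf :: "weakness \<Rightarrow> ('o, 'm, 'c) two_cat \<Rightarrow> ('p, 'n, 'd) two_cat \<Rightarrow>
    ('o, 'm, 'c, 'p, 'n, 'd) transf \<Rightarrow> ('o, 'm, 'c, 'p, 'n, 'd) transf \<Rightarrow>
    ('o, 'm, 'c, 'p, 'n, 'd) transf" where
  "comp_transf w K L \<psi> \<phi> = \<lparr>tdom = tdom \<phi>, tcod = tcod \<psi>,
     t1 = (\<lambda>X\<in>Ob K. Comp (und L) (t1 \<psi> X) (t1 \<phi> X)),
     t2 = (\<lambda>f\<in>Mor K.
       let \<psi>f = rwhisker L (t2 \<psi> f) (t1 \<phi> (Dom (und K) f));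
           \<phi>f = lwhisker L (t1 \<psi> (Cod (und K) f)) (t2 \<phi> f)
       in if w = Colax then Comp (vert L) \<psi>f \<phi>f else Comp (vert L) \<phi>f \<psi>f)\<rparr>"

definition restrict_transf :: "('s, 't, 'e) two_cat \<Rightarrow> ('o, 'm, 'c, 'p, 'n, 'd) transf \<Rightarrow>
    ('s, 't, 'e, 'o, 'm, 'c) two_func \<Rightarrow> ('s, 't, 'e, 'p, 'n, 'd) transf" where
  "restrict_transf H \<phi> S = \<lparr>tdom = comp_two_func H (tdom \<phi>) S, tcod = comp_two_func H (tcod \<phi>) S,
     t1 = (\<lambda>X\<in>Ob H. t1 \<phi> (F0 S X)), t2 = (\<lambda>f\<in>Mor H. t2 \<phi> (F1 S f))\<rparr>"

record ('o, 'm, 'c, 'p, 'n, 'd) modif =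
  mdom :: "('o, 'm, 'c, 'p, 'n, 'd) transf"
  mcod :: "('o, 'm, 'c, 'p, 'n, 'd) transf"
  mcmp :: "'o \<Rightarrow> 'd"

definition modification :: "weakness \<Rightarrow> ('o, 'm, 'c) two_cat \<Rightarrow> ('p, 'n, 'd) two_cat \<Rightarrow>
    ('o, 'm, 'c, 'p, 'n, 'd) modif \<Rightarrow> bool" where
  "modification w K L \<Gamma> \<longleftrightarrow>
     (let \<phi> = mdom \<Gamma>; \<psi> = mcod \<Gamma> in
        weak_natural w K L \<phi> \<and> weak_natural w K L \<psi> \<and>
        tdom \<phi> = tdom \<psi> \<and> tcod \<phi> = tcod \<psi> \<and>
        mcmp \<Gamma> \<in> extensional (Ob K) \<and>
        (\<forall>X\<in>Ob K. mcmp \<Gamma> X \<in> hom (vert L) (t1 \<phi> X) (t1 \<psi> X)) \<and>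
        (\<forall>f\<in>Mor K.
           let N\<Gamma> = lwhisker L (F1 (tcod \<phi>) f) (mcmp \<Gamma> (Dom (und K) f));
               \<Gamma>M = rwhisker L (mcmp \<Gamma> (Cod (und K) f)) (F1 (tdom \<phi>) f)
           in if w = Colax then Comp (vert L) N\<Gamma> (t2 \<phi> f) = Comp (vert L) (t2 \<psi> f) \<Gamma>M
              else Comp (vert L) \<Gamma>M (t2 \<phi> f) = Comp (vert L) (t2 \<psi> f) N\<Gamma>))"

text \<open>
  The 2-category whose objects are the 2-functors \<open>K \<rightarrow> L\<close> in \<open>\<M>\<close>, whose 1-cells are the
  \<open>w\<close>-natural transformations in \<open>\<T>\<close> between these, and whose 2-cells are all modifications
  between these.
\<close>

definition transf_two_cat :: "weakness \<Rightarrow> ('o, 'm, 'c) two_cat \<Rightarrow> ('p, 'n, 'd) two_cat \<Rightarrow>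
    ('o, 'm, 'c, 'p, 'n, 'd) two_func set \<Rightarrow> ('o, 'm, 'c, 'p, 'n, 'd) transf set \<Rightarrow>
    (('o, 'm, 'c, 'p, 'n, 'd) two_func, ('o, 'm, 'c, 'p, 'n, 'd) transf,
     ('o, 'm, 'c, 'p, 'n, 'd) modif) two_cat" where
  "transf_two_cat w K L \<M> \<T> =
     (let T = {\<phi> \<in> \<T>. weak_natural w K L \<phi> \<and> tdom \<phi> \<in> \<M> \<and> tcod \<phi> \<in> \<M>} in
      \<lparr>und = \<lparr>Obj = {M \<in> \<M>. two_functor K L M}, Arr = T, Dom = tdom, Cod = tcod,
         Ide = id_transf K L, Comp = comp_transf w K L\<rparr>,
       vert = \<lparr>Obj = T, Arr = {\<Gamma>. modification w K L \<Gamma> \<and> mdom \<Gamma> \<in> T \<and> mcod \<Gamma> \<in> T},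
         Dom = mdom, Cod = mcod,
         Ide = (\<lambda>\<phi>. \<lparr>mdom = \<phi>, mcod = \<phi>, mcmp = (\<lambda>X\<in>Ob K. Ide (vert L) (t1 \<phi> X))\<rparr>),
         Comp = (\<lambda>\<Delta> \<Gamma>. \<lparr>mdom = mdom \<Gamma>, mcod = mcod \<Delta>,
           mcmp = (\<lambda>X\<in>Ob K. Comp (vert L) (mcmp \<Delta> X) (mcmp \<Gamma> X))\<rparr>)\<rparr>,
       hcomp = (\<lambda>\<Delta> \<Gamma>. \<lparr>mdom = comp_transf w K L (mdom \<Delta>) (mdom \<Gamma>),
         mcod = comp_transf w K L (mcod \<Delta>) (mcod \<Gamma>),
         mcmp = (\<lambda>X\<in>Ob K. hcomp L (mcmp \<Delta> X) (mcmp \<Gamma> X))\<rparr>)\<rparr>)"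

section \<open>Algebraic 2-theories\<close>

definition algebraic_two_theory :: "('u, 'u) cat set \<Rightarrow> (('u, 'u) cat, 'm, 'c) two_cat \<Rightarrow>
    (('u, 'u) cat, ('u, 'u, 'u, 'u) func, ('u, 'u, 'u, 'u) nattr, ('u, 'u) cat, 'm, 'c) two_func \<Rightarrow>
    bool" where
  "algebraic_two_theory FP \<S> S \<longleftrightarrow>
     two_category \<S> \<and> two_functor (FP_op FP) \<S> S \<and>
     Ob \<S> = FP \<and> (\<forall>X\<in>FP. F0 S X = X) \<and>
     preserves_powers {X :: ('u, 'u) cat. finitely_presentable X} (FP_op FP) \<S> S"

definition theory_model :: "(('u, 'u) cat, 'm, 'c) two_cat \<Rightarrow> ('p, 'n, 'd) two_cat \<Rightarrow>
    (('u, 'u) cat, 'm, 'c, 'p, 'n, 'd) two_func \<Rightarrow> bool" where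
  "theory_model \<S> C M \<longleftrightarrow> two_functor \<S> C M \<and>
     preserves_powers {X :: ('u, 'u) cat. finitely_presentable X} \<S> C M"

definition Mod :: "weakness \<Rightarrow> ('u, 'u) cat set \<Rightarrow> (('u, 'u) cat, 'm, 'c) two_cat \<Rightarrow>
    (('u, 'u) cat, ('u, 'u, 'u, 'u) func, ('u, 'u, 'u, 'u) nattr, ('u, 'u) cat, 'm, 'c) two_func \<Rightarrow>
    ('p, 'n, 'd) two_cat \<Rightarrow>
    ((('u, 'u) cat, 'm, 'c, 'p, 'n, 'd) two_func, (('u, 'u) cat, 'm, 'c, 'p, 'n, 'd) transf,
     (('u, 'u) cat, 'm, 'c, 'p, 'n, 'd) modif) two_cat" where
  "Mod w FP \<S> S C = transf_two_cat w \<S> C {M. theory_model \<S> C M}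
     {\<phi>. weak_natural Strict (FP_op FP) C (restrict_transf (FP_op FP) \<phi> S)}"

section \<open>2-sketches\<close>

text \<open>
  A weighted cone in \<open>K\<close>: a weight \<open>W : J \<rightarrow> CAT\<close>, a diagram \<open>D : J \<rightarrow> K\<close>, an apex \<open>X\<close> and a
  2-natural transformation \<open>W \<Rightarrow> K(X, D-)\<close>.  Since \<open>K(X, D-)\<close> takes values in categories
  over types that may differ from those of \<open>W\<close>, its 2-naturality is spelled out.
\<close>

record ('i, 'j, 'k, 'u, 'v, 'o, 'm, 'c) wcone =
  shape :: "('i, 'j, 'k) two_cat"
  weight :: "('i, 'j, 'k, ('u, 'v) cat, ('u, 'v, 'u, 'v) func, ('u, 'v, 'u, 'v) nattr) two_func"
  diagram :: "('i, 'j, 'k, 'o, 'm, 'c) two_func"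
  apex :: 'o
  legs :: "'i \<Rightarrow> ('u, 'v, 'm, 'c) func"

definition is_wcone :: "('o, 'm, 'c) two_cat \<Rightarrow> ('i, 'j, 'k, 'u, 'v, 'o, 'm, 'c) wcone \<Rightarrow> bool" where
  "is_wcone K c \<longleftrightarrow>
     (let J = shape c; W = weight c; D = diagram c; \<gamma> = legs c in
        two_category J \<and> two_functor J CAT W \<and> two_functor J K D \<and> apex c \<in> Ob K \<and>
        \<gamma> \<in> extensional (Ob J) \<and>
        (\<forall>i\<in>Ob J. \<gamma> i \<in> functors (F0 W i) (hom_cat K (apex c) (F0 D i))) \<and>
        (\<forall>f\<in>Mor J.
           let i = Dom (und J) f; j = Cod (und J) f in
           (\<forall>x\<in>Obj (F0 W i). fob (\<gamma> j) (fob (F1 W f) x) = Comp (und K) (F1 D f) (fob (\<gamma> i) x)) \<and>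
           (\<forall>a\<in>Arr (F0 W i). far (\<gamma> j) (far (F1 W f) a) = lwhisker K (F1 D f) (far (\<gamma> i) a))) \<and>
        (\<forall>\<theta>\<in>Cell J.
           let i = Dom (horiz J) \<theta>; j = Cod (horiz J) \<theta> in
           \<forall>x\<in>Obj (F0 W i). far (\<gamma> j) (ncmp (F2 W \<theta>) x) = rwhisker K (F2 D \<theta>) (fob (\<gamma> i) x)))"

record ('i, 'j, 'k, 'u, 'v, 'o, 'm, 'c) two_sketch =
  sk_cat :: "('o, 'm, 'c) two_cat"
  sk_cones :: "('i, 'j, 'k, 'u, 'v, 'o, 'm, 'c) wcone set"

definition two_sketch :: "('i, 'j, 'k, 'u, 'v, 'o, 'm, 'c) two_sketch \<Rightarrow> bool" where
  "two_sketch A \<longleftrightarrow> two_category (sk_cat A) \<and> (\<forall>c\<in>sk_cones A. is_wcone (sk_cat A) c)"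

definition map_wcone :: "('o, 'm, 'c) two_cat \<Rightarrow> ('p, 'n, 'd) two_cat \<Rightarrow>
    ('o, 'm, 'c, 'p, 'n, 'd) two_func \<Rightarrow>
    ('i, 'j, 'k, 'u, 'v, 'o, 'm, 'c) wcone \<Rightarrow> ('i, 'j, 'k, 'u, 'v, 'p, 'n, 'd) wcone" where
  "map_wcone K L H c = \<lparr>shape = shape c, weight = weight c,
     diagram = comp_two_func (shape c) H (diagram c), apex = F0 H (apex c),
     legs = (\<lambda>i\<in>Ob (shape c).
       comp_func (hom_action K L H (apex c) (F0 (diagram c) i)) (legs c i))\<rparr>"

definition one_two_cat :: "(unit, unit, unit) two_cat" where
  "one_two_cat =
     (let I = \<lparr>Obj = UNIV, Arr = UNIV, Dom = id, Cod = id, Ide = id, Comp = (\<lambda>_ _. ())\<rparr>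
      in \<lparr>und = I, vert = I, hcomp = (\<lambda>_ _. ())\<rparr>)"

definition pick :: "('o, 'm, 'c) two_cat \<Rightarrow> 'o \<Rightarrow> (unit, unit, unit, 'o, 'm, 'c) two_func" where
  "pick K X = \<lparr>F0 = (\<lambda>_. X), F1 = (\<lambda>_. Ide (und K) X), F2 = (\<lambda>_. Ide (horiz K) X)\<rparr>"

text \<open>The data of a power \<open>P\<close> of \<open>A\<close> by \<open>X\<close> as a weighted cone whose shape is terminal.\<close>

definition power_cone :: "('o, 'm, 'c) two_cat \<Rightarrow> ('u, 'v) cat \<Rightarrow> 'o \<Rightarrow> 'o \<Rightarrow>
    ('u, 'v, 'm, 'c) func \<Rightarrow> (unit, unit, unit, 'u, 'v, 'o, 'm, 'c) wcone" where
  "power_cone K X A P \<gamma> = \<lparr>shape = one_two_cat, weight = pick CAT X, diagram = pick K A,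
     apex = P, legs = (\<lambda>_. \<gamma>)\<rparr>"

definition all_powers_sketch :: "('o, 'm, 'c) two_cat \<Rightarrow>
    (unit, unit, unit, 'u, 'u, 'o, 'm, 'c) two_sketch" where
  "all_powers_sketch C = \<lparr>sk_cat = C,
     sk_cones = {power_cone C X A P \<gamma> | X A P \<gamma>. finitely_presentable X \<and> is_power C X A P \<gamma>}\<rparr>"

definition terminal_category :: "('o, 'a) cat \<Rightarrow> bool" where
  "terminal_category A \<longleftrightarrow> category A \<and> (\<exists>x f. Obj A = {x} \<and> Arr A = {f})"

definition FP_one :: "('u, 'u) cat set \<Rightarrow> ('u, 'u) cat" where
  "FP_one FP = (THE I. I \<in> FP \<and> terminal_category I)"

text \<open>The functor from \<open>I\<close> to \<open>X\<close> constant at \<open>x\<close>; for terminal \<open>I\<close>, this is the projection \<open>\<pi>\<^sub>x\<close>.\<close>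

definition point :: "('u, 'v) cat \<Rightarrow> ('o, 'a) cat \<Rightarrow> 'o \<Rightarrow> ('u, 'v, 'o, 'a) func" where
  "point I X x = \<lparr>fdom = I, fcod = X, fob = (\<lambda>_\<in>Obj I. x), far = (\<lambda>_\<in>Arr I. Ide X x)\<rparr>"

text \<open>The canonical functor \<open>X \<rightarrow> FP(1, X) = FP\<^sup>o\<^sup>p(X, 1)\<close>.\<close>

definition canonical_functor :: "('u, 'u) cat set \<Rightarrow> ('u, 'u) cat \<Rightarrow>
    ('u, 'u, ('u, 'u, 'u, 'u) func, ('u, 'u, 'u, 'u) nattr) func" where
  "canonical_functor FP X = (let I = FP_one FP in
     \<lparr>fdom = X, fcod = hom_cat (FP_op FP) X I,
      fob = (\<lambda>x\<in>Obj X. point I X x),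
      far = (\<lambda>a\<in>Arr X. \<lparr>ndom = point I X (Dom X a), ncod = point I X (Cod X a),
               ncmp = (\<lambda>_\<in>Obj I. a)\<rparr>)\<rparr>)"

definition theory_sketch :: "('u, 'u) cat set \<Rightarrow> (('u, 'u) cat, 'm, 'c) two_cat \<Rightarrow>
    (('u, 'u) cat, ('u, 'u, 'u, 'u) func, ('u, 'u, 'u, 'u) nattr, ('u, 'u) cat, 'm, 'c) two_func \<Rightarrow>
    (unit, unit, unit, 'u, 'u, ('u, 'u) cat, 'm, 'c) two_sketch" where
  "theory_sketch FP \<S> S = \<lparr>sk_cat = \<S>,
     sk_cones = {map_wcone (FP_op FP) \<S> S
                   (power_cone (FP_op FP) X (FP_one FP) X (canonical_functor FP X)) | X. X \<in> FP}\<rparr>"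

section \<open>\<open>\<F>\<close>-categories and \<open>\<F>\<close>-sketches\<close>

text \<open>
  An \<open>\<F>\<close>-category is a 2-category of loose morphisms with a wide, locally full
  sub-2-category of tight morphisms; the latter is determined by its set of 1-cells.
\<close>

record ('o, 'm, 'c) fcat =
  loose :: "('o, 'm, 'c) two_cat"
  tight :: "'m set"

definition f_category :: "('o, 'm, 'c) fcat \<Rightarrow> bool" where
  "f_category K \<longleftrightarrow> two_category (loose K) \<and> tight K \<subseteq> Mor (loose K) \<and>
     (\<forall>X\<in>Ob (loose K). Ide (und (loose K)) X \<in> tight K) \<and>
     (\<forall>f\<in>tight K. \<forall>g\<in>tight K. Dom (und (loose K)) g = Cod (und (loose K)) f \<longrightarrow>
        Comp (und (loose K)) g f \<in> tight K)"

definition f_functor :: "('o, 'm, 'c) fcat \<Rightarrow> ('p, 'n, 'd) fcat \<Rightarrow>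
    ('o, 'm, 'c, 'p, 'n, 'd) two_func \<Rightarrow> bool" where
  "f_functor K L F \<longleftrightarrow> two_functor (loose K) (loose L) F \<and> F1 F ` tight K \<subseteq> tight L"

definition chordate :: "('o, 'm, 'c) two_cat \<Rightarrow> ('o, 'm, 'c) fcat" where
  "chordate K = \<lparr>loose = K, tight = Mor K\<rparr>"

text \<open>
  A full embedding \<open>A\<^sub>\<tau> \<rightarrow> A\<^sub>\<lambda>\<close> is given by the category \<open>A\<^sub>\<lambda>\<close> together with the set of those
  of its objects that lie in the full subcategory \<open>A\<^sub>\<tau>\<close>.
\<close>

record ('u, 'v) embed =
  eloose :: "('u, 'v) cat"
  etight :: "'u set"

definition full_embedding :: "('u, 'v) embed \<Rightarrow> bool" where
  "full_embedding A \<longleftrightarrow> category (eloose A) \<and> etight A \<subseteq> Obj (eloose A)"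

definition identity_embedding :: "('u, 'v) cat \<Rightarrow> ('u, 'v) embed" where
  "identity_embedding X = \<lparr>eloose = X, etight = Obj X\<rparr>"

text \<open>
  The \<open>\<F>\<close>-category of full embeddings; its 1-cells and 2-cells are functors and natural
  transformations between loose parts, labelled by their source and target embeddings.
\<close>

definition FF :: "(('u, 'v) embed,
    ('u, 'v) embed \<times> ('u, 'v, 'u, 'v) func \<times> ('u, 'v) embed,
    ('u, 'v) embed \<times> ('u, 'v, 'u, 'v) nattr \<times> ('u, 'v) embed) fcat" where
  "FF = (let M = {(A, F, B). full_embedding A \<and> full_embedding B \<and> F \<in> functors (eloose A) (eloose B)} in
     \<lparr>loose = \<lparr>
        und = \<lparr>Obj = {A. full_embedding A}, Arr = M,
          Dom = (\<lambda>(A, F, B). A), Cod = (\<lambda>(A, F, B). B),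
          Ide = (\<lambda>A. (A, id_func (eloose A), A)),
          Comp = (\<lambda>(B', G, C) (A, F, B). (A, comp_func G F, C))\<rparr>,
        vert = \<lparr>Obj = M,
          Arr = {(A, \<eta>, B). is_nattr \<eta> \<and> (A, ndom \<eta>, B) \<in> M \<and> (A, ncod \<eta>, B) \<in> M},
          Dom = (\<lambda>(A, \<eta>, B). (A, ndom \<eta>, B)), Cod = (\<lambda>(A, \<eta>, B). (A, ncod \<eta>, B)),
          Ide = (\<lambda>(A, F, B). (A, id_nattr F, B)),
          Comp = (\<lambda>(A', \<theta>, B') (A, \<eta>, B). (A, vcomp_nattr \<theta> \<eta>, B))\<rparr>,
        hcomp = (\<lambda>(B', \<theta>, C) (A, \<eta>, B). (A, hcomp_nattr \<theta> \<eta>, C))\<rparr>,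
      tight = {(A, F, B) \<in> M. fob F ` etight A \<subseteq> etight B}\<rparr>)"

record ('i, 'j, 'k, 'u, 'v, 'o, 'm, 'c) fcone =
  fshape :: "('i, 'j, 'k) fcat"
  fweight :: "('i, 'j, 'k, ('u, 'v) embed,
    ('u, 'v) embed \<times> ('u, 'v, 'u, 'v) func \<times> ('u, 'v) embed,
    ('u, 'v) embed \<times> ('u, 'v, 'u, 'v) nattr \<times> ('u, 'v) embed) two_func"
  fdiagram :: "('i, 'j, 'k, 'o, 'm, 'c) two_func"
  fapex :: 'o
  flegs :: "'i \<Rightarrow> ('u, 'v, 'm, 'c) func"

definition loose_cone :: "('i, 'j, 'k, 'u, 'v, 'o, 'm, 'c) fcone \<Rightarrow>
    ('i, 'j, 'k, 'u, 'v, 'o, 'm, 'c) wcone" where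
  "loose_cone c = (let J = loose (fshape c); W = fweight c in
     \<lparr>shape = J,
      weight = \<lparr>F0 = (\<lambda>i\<in>Ob J. eloose (F0 W i)), F1 = (\<lambda>f\<in>Mor J. fst (snd (F1 W f))),
                F2 = (\<lambda>\<theta>\<in>Cell J. fst (snd (F2 W \<theta>)))\<rparr>,
      diagram = fdiagram c, apex = fapex c, legs = flegs c\<rparr>)"

text \<open>
  An \<open>\<F>\<close>-natural transformation \<open>W \<Rightarrow> K(X, D-)\<close> is a 2-natural transformation between
  loose parts whose components send tight objects of the weight to tight morphisms.
\<close>

definition is_fcone :: "('o, 'm, 'c) fcat \<Rightarrow> ('i, 'j, 'k, 'u, 'v, 'o, 'm, 'c) fcone \<Rightarrow> bool" where
  "is_fcone K c \<longleftrightarrow> f_category (fshape c) \<and>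
     f_functor (fshape c) FF (fweight c) \<and> f_functor (fshape c) K (fdiagram c) \<and>
     is_wcone (loose K) (loose_cone c) \<and>
     (\<forall>i\<in>Ob (loose (fshape c)). fob (flegs c i) ` etight (F0 (fweight c) i) \<subseteq> tight K)"

record ('i, 'j, 'k, 'u, 'v, 'o, 'm, 'c) fsketch =
  fsk_cat :: "('o, 'm, 'c) fcat"
  fsk_cones :: "('i, 'j, 'k, 'u, 'v, 'o, 'm, 'c) fcone set"

definition f_sketch :: "('i, 'j, 'k, 'u, 'v, 'o, 'm, 'c) fsketch \<Rightarrow> bool" where
  "f_sketch A \<longleftrightarrow> f_category (fsk_cat A) \<and> (\<forall>c\<in>fsk_cones A. is_fcone (fsk_cat A) c)"

definition map_fcone :: "('o, 'm, 'c) fcat \<Rightarrow> ('p, 'n, 'd) fcat \<Rightarrow>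
    ('o, 'm, 'c, 'p, 'n, 'd) two_func \<Rightarrow>
    ('i, 'j, 'k, 'u, 'v, 'o, 'm, 'c) fcone \<Rightarrow> ('i, 'j, 'k, 'u, 'v, 'p, 'n, 'd) fcone" where
  "map_fcone K L H c = (let J = loose (fshape c) in
     \<lparr>fshape = fshape c, fweight = fweight c,
      fdiagram = comp_two_func J H (fdiagram c), fapex = F0 H (fapex c),
      flegs = (\<lambda>i\<in>Ob J.
        comp_func (hom_action (loose K) (loose L) H (fapex c) (F0 (fdiagram c) i)) (flegs c i))\<rparr>)"

definition sketch_model :: "('i, 'j, 'k, 'u, 'v, 'o, 'm, 'c) fsketch \<Rightarrow>
    ('i, 'j, 'k, 'u, 'v, 'p, 'n, 'd) fsketch \<Rightarrow> ('o, 'm, 'c, 'p, 'n, 'd) two_func \<Rightarrow> bool" where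
  "sketch_model A B H \<longleftrightarrow> f_sketch A \<and> f_sketch B \<and> f_functor (fsk_cat A) (fsk_cat B) H \<and>
     map_fcone (fsk_cat A) (fsk_cat B) H ` fsk_cones A \<subseteq> fsk_cones B"

definition FMod :: "weakness \<Rightarrow> ('i, 'j, 'k, 'u, 'v, 'o, 'm, 'c) fsketch \<Rightarrow>
    ('i, 'j, 'k, 'u, 'v, 'p, 'n, 'd) fsketch \<Rightarrow>
    (('o, 'm, 'c, 'p, 'n, 'd) two_func, ('o, 'm, 'c, 'p, 'n, 'd) transf,
     ('o, 'm, 'c, 'p, 'n, 'd) modif) fcat" where
  "FMod w A B =
     (let K = loose (fsk_cat A); L = loose (fsk_cat B);
          Q = transf_two_cat w K L {H. sketch_model A B H}
                {\<phi>. \<forall>f\<in>tight (fsk_cat A). is_identity (vert L) (t2 \<phi> f)}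
      in \<lparr>loose = Q,
          tight = {\<phi> \<in> Mor Q. (\<forall>X\<in>Ob K. t1 \<phi> X \<in> tight (fsk_cat B)) \<and>
                               (\<forall>f\<in>Mor K. is_identity (vert L) (t2 \<phi> f))}\<rparr>)"

text \<open>
  A weighted cone regarded as a tight one: its shape becomes chordate, and its weight takes
  values in identity embeddings.
\<close>

definition tight_cone :: "('i, 'j, 'k, 'u, 'v, 'o, 'm, 'c) wcone \<Rightarrow>
    ('i, 'j, 'k, 'u, 'v, 'o, 'm, 'c) fcone" where
  "tight_cone c = (let J = shape c; W = weight c; E = (\<lambda>i. identity_embedding (F0 W i)) in
     \<lparr>fshape = chordate J,
      fweight = \<lparr>F0 = (\<lambda>i\<in>Ob J. E i),
        F1 = (\<lambda>f\<in>Mor J. (E (Dom (und J) f), F1 W f, E (Cod (und J) f))),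
        F2 = (\<lambda>\<theta>\<in>Cell J. (E (Dom (horiz J) \<theta>), F2 W \<theta>, E (Cod (horiz J) \<theta>)))\<rparr>,
      fdiagram = diagram c, fapex = apex c, flegs = legs c\<rparr>)"

inductive_set generated :: "('o, 'a) cat \<Rightarrow> 'a set \<Rightarrow> 'a set" for A G where
  gen: "g \<in> G \<Longrightarrow> g \<in> generated A G"
| ide: "x \<in> Obj A \<Longrightarrow> Ide A x \<in> generated A G"
| comp: "f \<in> generated A G \<Longrightarrow> g \<in> generated A G \<Longrightarrow> Dom A g = Cod A f \<Longrightarrow>
    Comp A g f \<in> generated A G"

definition projections :: "('i, 'j, 'k, 'u, 'v, 'o, 'm, 'c) two_sketch \<Rightarrow> 'm set" where
  "projections A = (\<Union>c\<in>sk_cones A. \<Union>i\<in>Ob (shape c). fob (legs c i) ` Obj (F0 (weight c) i))"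

text \<open>
  Meaningful for finite power 2-sketches, whose cones have terminal shape and so become cones
  for tight finite powers, the class \<open>\<Pi>\<close>.
\<close>

definition Pi_sketch :: "('i, 'j, 'k, 'u, 'v, 'o, 'm, 'c) two_sketch \<Rightarrow>
    ('i, 'j, 'k, 'u, 'v, 'o, 'm, 'c) fsketch" where
  "Pi_sketch A = \<lparr>fsk_cat = \<lparr>loose = sk_cat A, tight = generated (und (sk_cat A)) (projections A)\<rparr>,
     fsk_cones = tight_cone ` sk_cones A\<rparr>"

definition plus_sketch :: "('i, 'j, 'k, 'u, 'v, 'o, 'm, 'c) two_sketch \<Rightarrow>
    ('i, 'j, 'k, 'u, 'v, 'o, 'm, 'c) fsketch" where
  "plus_sketch A = \<lparr>fsk_cat = chordate (sk_cat A), fsk_cones = tight_cone ` sk_cones A\<rparr>"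

end

(*  The two 2-categories are equal.  A 2-functor on the theory preserves all finite powers as soon as it
    preserves the powers of the terminal category 1: a power of A by X is one of 1 by X x A, because A is
    itself the power of 1 by A.  This needs X x A to be finitely presentable, which holds since a category
    is finitely presentable iff it is finitely generated and every functor from it to a filtered colimit
    factors through some stage.  A transformation is strict on FP as soon as it is so on the projections
    from the powers of 1, because the projections jointly detect identity 2-cells. *)

theory Submission
  imports Defs
begin

section \<open>Categories, functors and 2-categories\<close>

text \<open>Equality, and not only isomorphism, is within reach because both sides are instances of
  \<open>transf_two_cat\<close> with the same \<open>w\<close>, \<open>\<S>\<close> and
  \<open>C\<close>, and all data are extensional records: what has to be compared is a set of models
  and a set of transformations. That these data form a 2-category is verified for non-colax
  \<open>w\<close>, and the colax case is obtained by reversing 2-cells. The obstacle on the side of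
  models is that power preservation speaks of every power that exists in \<open>\<S>\<close>, with
  any base and any cone, whereas the sketch only names the chosen cones on \<open>one\<close>. As
  \<open>S\<close> is the identity on objects and preserves powers, each such power is isomorphic to
  the image of one constructed in the opposite of FP, and there preservation can be traced back to
  the named cones. Finite presentability is defined by filtered colimits among categories over
  \<open>'u\<close>. Concrete colimits, products and diagrams of finite subsets therefore have to be
  coded inside this infinite type; injections from pairs and from finite sets serve this
  purpose.\<close>

lemma categoryD [simp]:
  assumes "category A"
  shows "f \<in> Arr A \<Longrightarrow> Dom A f \<in> Obj A" "f \<in> Arr A \<Longrightarrow> Cod A f \<in> Obj A"
    "x \<in> Obj A \<Longrightarrow> Ide A x \<in> Arr A" "x \<in> Obj A \<Longrightarrow> Dom A (Ide A x) = x"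
    "x \<in> Obj A \<Longrightarrow> Cod A (Ide A x) = x"
    "f \<in> Arr A \<Longrightarrow> g \<in> Arr A \<Longrightarrow> Dom A g = Cod A f \<Longrightarrow> Comp A g f \<in> Arr A"
    "f \<in> Arr A \<Longrightarrow> g \<in> Arr A \<Longrightarrow> Dom A g = Cod A f \<Longrightarrow> Dom A (Comp A g f) = Dom A f"
    "f \<in> Arr A \<Longrightarrow> g \<in> Arr A \<Longrightarrow> Dom A g = Cod A f \<Longrightarrow> Cod A (Comp A g f) = Cod A g"
    "f \<in> Arr A \<Longrightarrow> x = Dom A f \<Longrightarrow> Comp A f (Ide A x) = f"
    "f \<in> Arr A \<Longrightarrow> x = Cod A f \<Longrightarrow> Comp A (Ide A x) f = f"
  using assms unfolding category_def by auto

text \<open>Oriented opposite to the axiom, towards right-nested composites, so that it can serve as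
  a rewrite rule with a normal form.\<close>

lemma category_assoc:
  assumes "category A" "f \<in> Arr A" "g \<in> Arr A" "h \<in> Arr A" "Dom A g = Cod A f" "Dom A h = Cod A g"
  shows "Comp A (Comp A h g) f = Comp A h (Comp A g f)"
  using assms unfolding category_def by auto

lemma hom_iff: "f \<in> hom A x y \<longleftrightarrow> f \<in> Arr A \<and> Dom A f = x \<and> Cod A f = y"
  by (simp add: hom_def)

lemma is_functorD [simp]:
  assumes "is_functor F"
  shows "x \<in> Obj (fdom F) \<Longrightarrow> fob F x \<in> Obj (fcod F)"
    "f \<in> Arr (fdom F) \<Longrightarrow> far F f \<in> Arr (fcod F)"
    "f \<in> Arr (fdom F) \<Longrightarrow> Dom (fcod F) (far F f) = fob F (Dom (fdom F) f)"
    "f \<in> Arr (fdom F) \<Longrightarrow> Cod (fcod F) (far F f) = fob F (Cod (fdom F) f)"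
    "x \<in> Obj (fdom F) \<Longrightarrow> far F (Ide (fdom F) x) = Ide (fcod F) (fob F x)"
    "f \<in> Arr (fdom F) \<Longrightarrow> g \<in> Arr (fdom F) \<Longrightarrow> Dom (fdom F) g = Cod (fdom F) f \<Longrightarrow>
       far F (Comp (fdom F) g f) = Comp (fcod F) (far F g) (far F f)"
  using assms unfolding is_functor_def by (auto simp: PiE_def Pi_def)

lemma functorsD [simp]:
  assumes "F \<in> functors A B"
  shows "is_functor F" "fdom F = A" "fcod F = B"
  using assms unfolding functors_def by auto

lemma functorsD' [simp]:
  assumes "F \<in> functors A B"
  shows "x \<in> Obj A \<Longrightarrow> fob F x \<in> Obj B"
    "f \<in> Arr A \<Longrightarrow> far F f \<in> Arr B"
    "f \<in> Arr A \<Longrightarrow> Dom B (far F f) = fob F (Dom A f)"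
    "f \<in> Arr A \<Longrightarrow> Cod B (far F f) = fob F (Cod A f)"
    "x \<in> Obj A \<Longrightarrow> far F (Ide A x) = Ide B (fob F x)"
    "f \<in> Arr A \<Longrightarrow> g \<in> Arr A \<Longrightarrow> Dom A g = Cod A f \<Longrightarrow>
       far F (Comp A g f) = Comp B (far F g) (far F f)"
  using assms is_functorD[of F] unfolding functors_def by auto

lemma functors_undef:
  assumes "F \<in> functors A B"
  shows "x \<notin> Obj A \<Longrightarrow> fob F x = undefined" "f \<notin> Arr A \<Longrightarrow> far F f = undefined"
  using assms unfolding functors_def is_functor_def by (auto simp: PiE_def extensional_def)

lemma functorsI:
  assumes "fdom F = A" "fcod F = B"
    "\<And>x. x \<in> Obj A \<Longrightarrow> fob F x \<in> Obj B"
    "\<And>f. f \<in> Arr A \<Longrightarrow> far F f \<in> Arr B"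
    "\<And>x. x \<notin> Obj A \<Longrightarrow> fob F x = undefined" "\<And>f. f \<notin> Arr A \<Longrightarrow> far F f = undefined"
    "\<And>f. f \<in> Arr A \<Longrightarrow> Dom B (far F f) = fob F (Dom A f)"
    "\<And>f. f \<in> Arr A \<Longrightarrow> Cod B (far F f) = fob F (Cod A f)"
    "\<And>x. x \<in> Obj A \<Longrightarrow> far F (Ide A x) = Ide B (fob F x)"
    "\<And>f g. f \<in> Arr A \<Longrightarrow> g \<in> Arr A \<Longrightarrow> Dom A g = Cod A f \<Longrightarrow>
       far F (Comp A g f) = Comp B (far F g) (far F f)"
  shows "F \<in> functors A B"
  using assms unfolding functors_def is_functor_def by (auto simp: PiE_def extensional_def)

text \<open>Both functors are \<open>undefined\<close> off their domain, so agreement on the domain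
  makes the records equal.\<close>

lemma functors_eqI:
  assumes "F \<in> functors A B" "G \<in> functors A B"
    and "\<And>x. x \<in> Obj A \<Longrightarrow> fob F x = fob G x" "\<And>f. f \<in> Arr A \<Longrightarrow> far F f = far G f"
  shows "F = G"
proof (rule func.equality)
  show "fob F = fob G"
    using functors_undef[OF assms(1)] functors_undef[OF assms(2)] assms(3) by (metis ext)
  show "far F = far G"
    using functors_undef[OF assms(1)] functors_undef[OF assms(2)] assms(4) by (metis ext)
qed (use assms in simp_all)

text \<open>An object is recovered as the domain of its identity, so agreement on arrows already
  forces agreement on objects.\<close>

lemma functors_eqI_arr:
  assumes "category A" "category B" "F \<in> functors A B" "G \<in> functors A B"
    and "\<And>f. f \<in> Arr A \<Longrightarrow> far F f = far G f"
  shows "F = G"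
proof (rule functors_eqI[OF assms(3,4) _ assms(5)])
  fix x assume x: "x \<in> Obj A"
  have "Dom B (far F (Ide A x)) = Dom B (far G (Ide A x))"
    using x assms by (metis categoryD(3))
  then show "fob F x = fob G x"
    using x assms(1-4) by (metis categoryD(3,4) functorsD'(3))
qed

lemma id_functors [simp]: "category A \<Longrightarrow> id_func A \<in> functors A A"
  by (rule functorsI) (auto simp: id_func_def)

lemma comp_functors [simp]:
  assumes "category A" "F \<in> functors A B" "G \<in> functors B C"
  shows "comp_func G F \<in> functors A C"
  by (rule functorsI) (use assms in \<open>auto simp: comp_func_def\<close>)

lemma comp_func_sel [simp]:
  "fdom (comp_func G F) = fdom F" "fcod (comp_func G F) = fcod G"
  "x \<in> Obj (fdom F) \<Longrightarrow> fob (comp_func G F) x = fob G (fob F x)"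
  "f \<in> Arr (fdom F) \<Longrightarrow> far (comp_func G F) f = far G (far F f)"
  by (simp_all add: comp_func_def)

lemma id_func_sel [simp]:
  "fdom (id_func A) = A" "fcod (id_func A) = A"
  "x \<in> Obj A \<Longrightarrow> fob (id_func A) x = x"
  "f \<in> Arr A \<Longrightarrow> far (id_func A) f = f"
  by (simp_all add: id_func_def)

lemma comp_func_assoc:
  assumes "category A" "F \<in> functors A B" "G \<in> functors B C" "H \<in> functors C D"
  shows "comp_func (comp_func H G) F = comp_func H (comp_func G F)"
  using assms by (auto simp: comp_func_def restrict_def fun_eq_iff)

lemma comp_func_id:
  assumes "category A" "category B" "F \<in> functors A B"
  shows "comp_func F (id_func A) = F" "comp_func (id_func B) F = F"
proof -
  show "comp_func F (id_func A) = F"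
    by (rule functors_eqI[of _ A B]) (use assms in \<open>auto intro: comp_functors id_functors\<close>)
  show "comp_func (id_func B) F = F"
    by (rule functors_eqI[of _ A B]) (use assms in \<open>auto intro: comp_functors id_functors\<close>)
qed

lemma is_nattrD [simp]:
  assumes "is_nattr \<eta>" "ndom \<eta> \<in> functors A B"
  shows "ncod \<eta> \<in> functors A B"
    "x \<in> Obj A \<Longrightarrow> ncmp \<eta> x \<in> Arr B"
    "x \<in> Obj A \<Longrightarrow> Dom B (ncmp \<eta> x) = fob (ndom \<eta>) x"
    "x \<in> Obj A \<Longrightarrow> Cod B (ncmp \<eta> x) = fob (ncod \<eta>) x"
  using assms unfolding is_nattr_def functors_def hom_def by auto

lemma is_nattr_natural:
  assumes "is_nattr \<eta>" "ndom \<eta> \<in> functors A B" "f \<in> Arr A"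
  shows "Comp B (ncmp \<eta> (Cod A f)) (far (ndom \<eta>) f) = Comp B (far (ncod \<eta>) f) (ncmp \<eta> (Dom A f))"
  using assms unfolding is_nattr_def functors_def hom_def by auto

lemma is_nattr_undef:
  assumes "is_nattr \<eta>" "ndom \<eta> \<in> functors A B" "x \<notin> Obj A"
  shows "ncmp \<eta> x = undefined"
  using assms unfolding is_nattr_def functors_def by (auto simp: extensional_def)

lemma is_nattrI:
  assumes "ndom \<eta> \<in> functors A B" "ncod \<eta> \<in> functors A B"
    "\<And>x. x \<in> Obj A \<Longrightarrow> ncmp \<eta> x \<in> Arr B"
    "\<And>x. x \<in> Obj A \<Longrightarrow> Dom B (ncmp \<eta> x) = fob (ndom \<eta>) x"
    "\<And>x. x \<in> Obj A \<Longrightarrow> Cod B (ncmp \<eta> x) = fob (ncod \<eta>) x"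
    "\<And>x. x \<notin> Obj A \<Longrightarrow> ncmp \<eta> x = undefined"
    "\<And>f. f \<in> Arr A \<Longrightarrow>
       Comp B (ncmp \<eta> (Cod A f)) (far (ndom \<eta>) f) = Comp B (far (ncod \<eta>) f) (ncmp \<eta> (Dom A f))"
  shows "is_nattr \<eta>"
  using assms unfolding is_nattr_def functors_def hom_def by (auto simp: extensional_def)

lemma nattr_eqI:
  assumes "is_nattr \<eta>" "is_nattr \<theta>" "ndom \<eta> \<in> functors A B" "ndom \<theta> = ndom \<eta>" "ncod \<theta> = ncod \<eta>"
    and "\<And>x. x \<in> Obj A \<Longrightarrow> ncmp \<eta> x = ncmp \<theta> x"
  shows "\<eta> = \<theta>"
proof (rule nattr.equality)
  show "ncmp \<eta> = ncmp \<theta>"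
    using is_nattr_undef[OF assms(1,3)] is_nattr_undef[OF assms(2), of A B] assms by (metis ext)
qed (use assms in simp_all)

lemma id_nattr_nattr [simp]:
  assumes "category A" "category B" "F \<in> functors A B"
  shows "is_nattr (id_nattr F)"
  by (rule is_nattrI[of _ A B]) (use assms in \<open>auto simp: id_nattr_def\<close>)

lemma id_nattr_sel [simp]:
  "ndom (id_nattr F) = F" "ncod (id_nattr F) = F"
  "x \<in> Obj (fdom F) \<Longrightarrow> ncmp (id_nattr F) x = Ide (fcod F) (fob F x)"
  by (simp_all add: id_nattr_def)

lemma vcomp_nattr_sel [simp]:
  "ndom (vcomp_nattr \<theta> \<eta>) = ndom \<eta>" "ncod (vcomp_nattr \<theta> \<eta>) = ncod \<theta>"
  "x \<in> Obj (fdom (ndom \<eta>)) \<Longrightarrow> ncmp (vcomp_nattr \<theta> \<eta>) x = Comp (fcod (ndom \<eta>)) (ncmp \<theta> x) (ncmp \<eta> x)"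
  by (simp_all add: vcomp_nattr_def)

lemma hcomp_nattr_sel [simp]:
  "ndom (hcomp_nattr \<theta> \<eta>) = comp_func (ndom \<theta>) (ndom \<eta>)"
  "ncod (hcomp_nattr \<theta> \<eta>) = comp_func (ncod \<theta>) (ncod \<eta>)"
  "x \<in> Obj (fdom (ndom \<eta>)) \<Longrightarrow> ncmp (hcomp_nattr \<theta> \<eta>) x =
     Comp (fcod (ndom \<theta>)) (ncmp \<theta> (fob (ncod \<eta>) x)) (far (ndom \<theta>) (ncmp \<eta> x))"
  by (simp_all add: hcomp_nattr_def)

lemma vcomp_nattr_nattr [simp]:
  assumes "category A" "category B" "is_nattr \<eta>" "is_nattr \<theta>"
    and \<eta>: "ndom \<eta> \<in> functors A B" and \<theta>: "ndom \<theta> = ncod \<eta>"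
  shows "is_nattr (vcomp_nattr \<theta> \<eta>)"
proof -
  have \<eta>': "ncod \<eta> \<in> functors A B" using assms by simp
  have \<theta>': "ndom \<theta> \<in> functors A B" "ncod \<theta> \<in> functors A B" using assms \<eta>' by simp_all
  note n = is_nattrD[OF \<open>is_nattr \<eta>\<close> \<eta>] is_nattrD[OF \<open>is_nattr \<theta>\<close> \<theta>'(1)]
  show ?thesis
  proof (rule is_nattrI[of _ A B])
    fix f assume f: "f \<in> Arr A"
    have "Comp B (Comp B (ncmp \<theta> (Cod A f)) (ncmp \<eta> (Cod A f))) (far (ndom \<eta>) f) =
        Comp B (ncmp \<theta> (Cod A f)) (Comp B (ncmp \<eta> (Cod A f)) (far (ndom \<eta>) f))"
      by (rule category_assoc) (use f assms(1,2) \<eta> \<eta>' \<theta> \<theta>' n in auto)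
    also have "\<dots> = Comp B (ncmp \<theta> (Cod A f)) (Comp B (far (ncod \<eta>) f) (ncmp \<eta> (Dom A f)))"
      using is_nattr_natural[OF assms(3) \<eta> f] by simp
    also have "\<dots> = Comp B (Comp B (ncmp \<theta> (Cod A f)) (far (ncod \<eta>) f)) (ncmp \<eta> (Dom A f))"
      by (rule category_assoc[symmetric]) (use f assms(1,2) \<eta> \<eta>' \<theta> \<theta>' n in auto)
    also have "\<dots> = Comp B (Comp B (far (ncod \<theta>) f) (ncmp \<theta> (Dom A f))) (ncmp \<eta> (Dom A f))"
      using is_nattr_natural[OF assms(4) \<theta>'(1) f] \<theta> by simp
    also have "\<dots> = Comp B (far (ncod \<theta>) f) (Comp B (ncmp \<theta> (Dom A f)) (ncmp \<eta> (Dom A f)))"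
      by (rule category_assoc) (use f assms(1,2) \<eta> \<eta>' \<theta> \<theta>' n in auto)
    finally show "Comp B (ncmp (vcomp_nattr \<theta> \<eta>) (Cod A f)) (far (ndom (vcomp_nattr \<theta> \<eta>)) f) =
        Comp B (far (ncod (vcomp_nattr \<theta> \<eta>)) f) (ncmp (vcomp_nattr \<theta> \<eta>) (Dom A f))"
      using f assms(1,2) \<eta> by simp
  qed (use assms(1,2) \<eta> \<eta>' \<theta> \<theta>' n in \<open>auto simp: vcomp_nattr_def\<close>)
qed

lemma hcomp_nattr_nattr [simp]:
  assumes "category A" "category B" "category C" "is_nattr \<eta>" "is_nattr \<theta>"
    and \<eta>: "ndom \<eta> \<in> functors A B" and \<theta>: "ndom \<theta> \<in> functors B C"
  shows "is_nattr (hcomp_nattr \<theta> \<eta>)"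
proof -
  have \<eta>': "ncod \<eta> \<in> functors A B" using assms by simp
  have \<theta>': "ncod \<theta> \<in> functors B C" using assms by simp
  note n = is_nattrD[OF \<open>is_nattr \<eta>\<close> \<eta>] is_nattrD[OF \<open>is_nattr \<theta>\<close> \<theta>]
  show ?thesis
  proof (rule is_nattrI[of _ A C])
    fix f assume f: "f \<in> Arr A"
    let ?x = "Dom A f" and ?y = "Cod A f"
    \<comment> \<open>The naturality square of \<open>\<eta>\<close> is pushed through the functor
      \<open>ndom \<theta>\<close> and pasted to the square of \<open>\<theta>\<close> at the arrow
      \<open>far (ncod \<eta>) f\<close>.\<close>
    have "Comp C (Comp C (ncmp \<theta> (fob (ncod \<eta>) ?y)) (far (ndom \<theta>) (ncmp \<eta> ?y))) (far (ndom \<theta>) (far (ndom \<eta>) f)) =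
       Comp C (ncmp \<theta> (fob (ncod \<eta>) ?y)) (Comp C (far (ndom \<theta>) (ncmp \<eta> ?y)) (far (ndom \<theta>) (far (ndom \<eta>) f)))"
      by (rule category_assoc) (use f assms(1-3) \<eta> \<eta>' \<theta> \<theta>' n in auto)
    also have "\<dots> = Comp C (ncmp \<theta> (fob (ncod \<eta>) ?y)) (far (ndom \<theta>) (Comp B (ncmp \<eta> ?y) (far (ndom \<eta>) f)))"
      using f assms(1-3) \<eta> \<eta>' \<theta> \<theta>' n by auto
    also have "\<dots> = Comp C (ncmp \<theta> (fob (ncod \<eta>) ?y)) (far (ndom \<theta>) (Comp B (far (ncod \<eta>) f) (ncmp \<eta> ?x)))"
      using is_nattr_natural[OF assms(4) \<eta> f] by simp
    also have "\<dots> = Comp C (ncmp \<theta> (fob (ncod \<eta>) ?y)) (Comp C (far (ndom \<theta>) (far (ncod \<eta>) f)) (far (ndom \<theta>) (ncmp \<eta> ?x)))"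
      using f assms(1-3) \<eta> \<eta>' \<theta> \<theta>' n by auto
    also have "\<dots> = Comp C (Comp C (ncmp \<theta> (fob (ncod \<eta>) ?y)) (far (ndom \<theta>) (far (ncod \<eta>) f))) (far (ndom \<theta>) (ncmp \<eta> ?x))"
      by (rule category_assoc[symmetric]) (use f assms(1-3) \<eta> \<eta>' \<theta> \<theta>' n in auto)
    also have "\<dots> = Comp C (Comp C (far (ncod \<theta>) (far (ncod \<eta>) f)) (ncmp \<theta> (fob (ncod \<eta>) ?x))) (far (ndom \<theta>) (ncmp \<eta> ?x))"
      using is_nattr_natural[OF assms(5) \<theta>, of "far (ncod \<eta>) f"] f \<eta>' by simp
    also have "\<dots> = Comp C (far (ncod \<theta>) (far (ncod \<eta>) f)) (Comp C (ncmp \<theta> (fob (ncod \<eta>) ?x)) (far (ndom \<theta>) (ncmp \<eta> ?x)))"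
      by (rule category_assoc) (use f assms(1-3) \<eta> \<eta>' \<theta> \<theta>' n in auto)
    finally show "Comp C (ncmp (hcomp_nattr \<theta> \<eta>) ?y) (far (ndom (hcomp_nattr \<theta> \<eta>)) f) =
        Comp C (far (ncod (hcomp_nattr \<theta> \<eta>)) f) (ncmp (hcomp_nattr \<theta> \<eta>) ?x)"
      using f assms(1-3) \<eta> \<eta>' \<theta> \<theta>' by simp
  qed (use assms(1-3) \<eta> \<eta>' \<theta> \<theta>' n in \<open>auto simp: hcomp_nattr_def\<close>)
qed

section \<open>2-categories and horizontal composition\<close>

lemma two_categoryD [simp]:
  assumes "two_category K"
  shows "category (und K)" "category (vert K)" "Obj (vert K) = Mor K"
    "\<alpha> \<in> Cell K \<Longrightarrow> Dom (und K) (Cod (vert K) \<alpha>) = Dom (und K) (Dom (vert K) \<alpha>)"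
    "\<alpha> \<in> Cell K \<Longrightarrow> Cod (und K) (Cod (vert K) \<alpha>) = Cod (und K) (Dom (vert K) \<alpha>)"
    "category (horiz K)"
  using assms unfolding two_category_def by auto

lemma horiz_sel [simp]:
  "Obj (horiz K) = Ob K" "Arr (horiz K) = Cell K"
  "Dom (horiz K) \<alpha> = Dom (und K) (Dom (vert K) \<alpha>)" "Cod (horiz K) \<alpha> = Cod (und K) (Dom (vert K) \<alpha>)"
  "Ide (horiz K) X = Ide (vert K) (Ide (und K) X)" "Comp (horiz K) = hcomp K"
  by (simp_all add: horiz_def)

lemma two_category_Mor [simp]:
  assumes "two_category K"
  shows "\<alpha> \<in> Cell K \<Longrightarrow> Dom (vert K) \<alpha> \<in> Mor K" "\<alpha> \<in> Cell K \<Longrightarrow> Cod (vert K) \<alpha> \<in> Mor K"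
    "f \<in> Mor K \<Longrightarrow> Ide (vert K) f \<in> Cell K"
    "f \<in> Mor K \<Longrightarrow> Dom (vert K) (Ide (vert K) f) = f" "f \<in> Mor K \<Longrightarrow> Cod (vert K) (Ide (vert K) f) = f"
  using categoryD(1-5)[of "vert K"] assms by auto

lemma hcomp_simps [simp]:
  assumes "two_category K" "\<alpha> \<in> Cell K" "\<beta> \<in> Cell K"
    "Dom (und K) (Dom (vert K) \<beta>) = Cod (und K) (Dom (vert K) \<alpha>)"
  shows "hcomp K \<beta> \<alpha> \<in> Cell K"
    "Dom (vert K) (hcomp K \<beta> \<alpha>) = Comp (und K) (Dom (vert K) \<beta>) (Dom (vert K) \<alpha>)"
    "Cod (vert K) (hcomp K \<beta> \<alpha>) = Comp (und K) (Cod (vert K) \<beta>) (Cod (vert K) \<alpha>)"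
  using categoryD(6)[of "horiz K" \<alpha> \<beta>] assms unfolding two_category_def by auto

lemma hcomp_assoc:
  assumes "two_category K" "\<alpha> \<in> Cell K" "\<beta> \<in> Cell K" "\<gamma> \<in> Cell K"
    "Dom (und K) (Dom (vert K) \<beta>) = Cod (und K) (Dom (vert K) \<alpha>)"
    "Dom (und K) (Dom (vert K) \<gamma>) = Cod (und K) (Dom (vert K) \<beta>)"
  shows "hcomp K (hcomp K \<gamma> \<beta>) \<alpha> = hcomp K \<gamma> (hcomp K \<beta> \<alpha>)"
  using category_assoc[of "horiz K" \<alpha> \<beta> \<gamma>] assms by simp

lemma hcomp_id [simp]:
  assumes "two_category K" "\<alpha> \<in> Cell K"
  shows "X = Dom (und K) (Dom (vert K) \<alpha>) \<Longrightarrow> hcomp K \<alpha> (Ide (vert K) (Ide (und K) X)) = \<alpha>"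
    "X = Cod (und K) (Dom (vert K) \<alpha>) \<Longrightarrow> hcomp K (Ide (vert K) (Ide (und K) X)) \<alpha> = \<alpha>"
  using categoryD(9,10)[of "horiz K" \<alpha>] assms by auto

lemma hcomp_Ide [simp]:
  assumes "two_category K" "f \<in> Mor K" "g \<in> Mor K" "Dom (und K) g = Cod (und K) f"
  shows "hcomp K (Ide (vert K) g) (Ide (vert K) f) = Ide (vert K) (Comp (und K) g f)"
  using assms unfolding two_category_def by auto

lemma interchange:
  assumes "two_category K" "\<alpha> \<in> Cell K" "\<alpha>' \<in> Cell K" "\<beta> \<in> Cell K" "\<beta>' \<in> Cell K"
    "Dom (vert K) \<alpha>' = Cod (vert K) \<alpha>" "Dom (vert K) \<beta>' = Cod (vert K) \<beta>"
    "Dom (und K) (Dom (vert K) \<beta>) = Cod (und K) (Dom (vert K) \<alpha>)"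
  shows "hcomp K (Comp (vert K) \<beta>' \<beta>) (Comp (vert K) \<alpha>' \<alpha>) =
         Comp (vert K) (hcomp K \<beta>' \<alpha>') (hcomp K \<beta> \<alpha>)"
  using assms unfolding two_category_def horiz_sel by blast

section \<open>2-categories of weak transformations\<close>

lemma two_functorD [simp]:
  assumes "two_functor K L F"
  shows "X \<in> Ob K \<Longrightarrow> F0 F X \<in> Ob L" "f \<in> Mor K \<Longrightarrow> F1 F f \<in> Mor L"
    "f \<in> Mor K \<Longrightarrow> Dom (und L) (F1 F f) = F0 F (Dom (und K) f)"
    "f \<in> Mor K \<Longrightarrow> Cod (und L) (F1 F f) = F0 F (Cod (und K) f)"
    "X \<in> Ob K \<Longrightarrow> F1 F (Ide (und K) X) = Ide (und L) (F0 F X)"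
    "f \<in> Mor K \<Longrightarrow> g \<in> Mor K \<Longrightarrow> Dom (und K) g = Cod (und K) f \<Longrightarrow>
       F1 F (Comp (und K) g f) = Comp (und L) (F1 F g) (F1 F f)"
    "\<alpha> \<in> Cell K \<Longrightarrow> F2 F \<alpha> \<in> Cell L"
    "\<alpha> \<in> Cell K \<Longrightarrow> Dom (vert L) (F2 F \<alpha>) = F1 F (Dom (vert K) \<alpha>)"
    "\<alpha> \<in> Cell K \<Longrightarrow> Cod (vert L) (F2 F \<alpha>) = F1 F (Cod (vert K) \<alpha>)"
    "f \<in> Obj (vert K) \<Longrightarrow> F2 F (Ide (vert K) f) = Ide (vert L) (F1 F f)"
    "\<alpha> \<in> Cell K \<Longrightarrow> \<beta> \<in> Cell K \<Longrightarrow> Dom (vert K) \<beta> = Cod (vert K) \<alpha> \<Longrightarrow>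
       F2 F (Comp (vert K) \<beta> \<alpha>) = Comp (vert L) (F2 F \<beta>) (F2 F \<alpha>)"
    "\<alpha> \<in> Cell K \<Longrightarrow> \<beta> \<in> Cell K \<Longrightarrow> Dom (und K) (Dom (vert K) \<beta>) = Cod (und K) (Dom (vert K) \<alpha>) \<Longrightarrow>
       F2 F (hcomp K \<beta> \<alpha>) = hcomp L (F2 F \<beta>) (F2 F \<alpha>)"
  using assms unfolding two_functor_def
  using is_functorD[of "\<lparr>fdom = und K, fcod = und L, fob = F0 F, far = F1 F\<rparr>"]
    is_functorD[of "\<lparr>fdom = vert K, fcod = vert L, fob = F1 F, far = F2 F\<rparr>"] by auto

lemma two_functor_undef:
  assumes "two_functor K L F"
  shows "X \<notin> Ob K \<Longrightarrow> F0 F X = undefined" "f \<notin> Mor K \<Longrightarrow> F1 F f = undefined"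
    "\<alpha> \<notin> Cell K \<Longrightarrow> F2 F \<alpha> = undefined"
  using assms unfolding two_functor_def is_functor_def by (auto simp: PiE_def extensional_def)

lemma two_functorI:
  assumes "\<And>X. X \<in> Ob K \<Longrightarrow> F0 F X \<in> Ob L" "\<And>f. f \<in> Mor K \<Longrightarrow> F1 F f \<in> Mor L"
    "\<And>\<alpha>. \<alpha> \<in> Cell K \<Longrightarrow> F2 F \<alpha> \<in> Cell L"
    "Obj (vert K) = Mor K" "Obj (vert L) = Mor L"
    "\<And>X. X \<notin> Ob K \<Longrightarrow> F0 F X = undefined" "\<And>f. f \<notin> Mor K \<Longrightarrow> F1 F f = undefined"
    "\<And>\<alpha>. \<alpha> \<notin> Cell K \<Longrightarrow> F2 F \<alpha> = undefined"
    "\<And>f. f \<in> Mor K \<Longrightarrow> Dom (und L) (F1 F f) = F0 F (Dom (und K) f)"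
    "\<And>f. f \<in> Mor K \<Longrightarrow> Cod (und L) (F1 F f) = F0 F (Cod (und K) f)"
    "\<And>X. X \<in> Ob K \<Longrightarrow> F1 F (Ide (und K) X) = Ide (und L) (F0 F X)"
    "\<And>f g. f \<in> Mor K \<Longrightarrow> g \<in> Mor K \<Longrightarrow> Dom (und K) g = Cod (und K) f \<Longrightarrow>
       F1 F (Comp (und K) g f) = Comp (und L) (F1 F g) (F1 F f)"
    "\<And>\<alpha>. \<alpha> \<in> Cell K \<Longrightarrow> Dom (vert L) (F2 F \<alpha>) = F1 F (Dom (vert K) \<alpha>)"
    "\<And>\<alpha>. \<alpha> \<in> Cell K \<Longrightarrow> Cod (vert L) (F2 F \<alpha>) = F1 F (Cod (vert K) \<alpha>)"
    "\<And>f. f \<in> Mor K \<Longrightarrow> F2 F (Ide (vert K) f) = Ide (vert L) (F1 F f)"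
    "\<And>\<alpha> \<beta>. \<alpha> \<in> Cell K \<Longrightarrow> \<beta> \<in> Cell K \<Longrightarrow> Dom (vert K) \<beta> = Cod (vert K) \<alpha> \<Longrightarrow>
       F2 F (Comp (vert K) \<beta> \<alpha>) = Comp (vert L) (F2 F \<beta>) (F2 F \<alpha>)"
    "\<And>\<alpha> \<beta>. \<alpha> \<in> Cell K \<Longrightarrow> \<beta> \<in> Cell K \<Longrightarrow> Dom (und K) (Dom (vert K) \<beta>) = Cod (und K) (Dom (vert K) \<alpha>) \<Longrightarrow>
       F2 F (hcomp K \<beta> \<alpha>) = hcomp L (F2 F \<beta>) (F2 F \<alpha>)"
  shows "two_functor K L F"
  unfolding two_functor_def is_functor_def using assms
  by (auto simp: PiE_def extensional_def)

lemma comp_two_func_sel [simp]: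
  "X \<in> Ob K \<Longrightarrow> F0 (comp_two_func K G F) X = F0 G (F0 F X)"
  "f \<in> Mor K \<Longrightarrow> F1 (comp_two_func K G F) f = F1 G (F1 F f)"
  "\<alpha> \<in> Cell K \<Longrightarrow> F2 (comp_two_func K G F) \<alpha> = F2 G (F2 F \<alpha>)"
  by (simp_all add: comp_two_func_def)

lemma comp_two_functor [simp]:
  assumes "two_category K" "two_category L" "two_category M" "two_functor K L F" "two_functor L M G"
  shows "two_functor K M (comp_two_func K G F)"
  by (rule two_functorI) (use assms in \<open>auto simp: comp_two_func_def\<close>)

lemma id_two_functor [simp]:
  assumes "two_category K"
  shows "two_functor K K (id_two_func K)"
  by (rule two_functorI) (use assms in \<open>auto simp: id_two_func_def\<close>)

lemma weak_naturalD [simp]: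
  assumes "weak_natural w K L \<phi>"
  shows "two_functor K L (tdom \<phi>)" "two_functor K L (tcod \<phi>)"
    "X \<in> Ob K \<Longrightarrow> t1 \<phi> X \<in> Mor L"
    "X \<in> Ob K \<Longrightarrow> Dom (und L) (t1 \<phi> X) = F0 (tdom \<phi>) X"
    "X \<in> Ob K \<Longrightarrow> Cod (und L) (t1 \<phi> X) = F0 (tcod \<phi>) X"
    "f \<in> Mor K \<Longrightarrow> t2 \<phi> f \<in> Cell L"
    "X \<in> Ob K \<Longrightarrow> t2 \<phi> (Ide (und K) X) = Ide (vert L) (t1 \<phi> X)"
  using assms unfolding weak_natural_def by (auto simp: Let_def hom_iff split: if_splits)

lemma weak_natural_undef:
  assumes "weak_natural w K L \<phi>"
  shows "X \<notin> Ob K \<Longrightarrow> t1 \<phi> X = undefined" "f \<notin> Mor K \<Longrightarrow> t2 \<phi> f = undefined"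
  using assms unfolding weak_natural_def by (auto simp: Let_def extensional_def)

lemma weak_natural_boundary:
  assumes "weak_natural w K L \<phi>" "f \<in> Mor K"
  shows "w \<noteq> Colax \<Longrightarrow> Dom (vert L) (t2 \<phi> f) = Comp (und L) (F1 (tcod \<phi>) f) (t1 \<phi> (Dom (und K) f))"
    "w \<noteq> Colax \<Longrightarrow> Cod (vert L) (t2 \<phi> f) = Comp (und L) (t1 \<phi> (Cod (und K) f)) (F1 (tdom \<phi>) f)"
    "w = Colax \<Longrightarrow> Cod (vert L) (t2 \<phi> f) = Comp (und L) (F1 (tcod \<phi>) f) (t1 \<phi> (Dom (und K) f))"
    "w = Colax \<Longrightarrow> Dom (vert L) (t2 \<phi> f) = Comp (und L) (t1 \<phi> (Cod (und K) f)) (F1 (tdom \<phi>) f)"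
    "w = Strict \<Longrightarrow> is_identity (vert L) (t2 \<phi> f)"
    "w = Pseudo \<Longrightarrow> invertible (vert L) (t2 \<phi> f)"
  using assms unfolding weak_natural_def by (auto simp: Let_def hom_iff)

lemma weak_natural_comp:
  assumes "weak_natural w K L \<phi>" "f \<in> Mor K" "g \<in> Mor K" "Dom (und K) g = Cod (und K) f"
  shows "w \<noteq> Colax \<Longrightarrow> t2 \<phi> (Comp (und K) g f) =
       Comp (vert L) (hcomp L (t2 \<phi> g) (Ide (vert L) (F1 (tdom \<phi>) f)))
         (hcomp L (Ide (vert L) (F1 (tcod \<phi>) g)) (t2 \<phi> f))"
    "w = Colax \<Longrightarrow> t2 \<phi> (Comp (und K) g f) =
       Comp (vert L) (hcomp L (Ide (vert L) (F1 (tcod \<phi>) g)) (t2 \<phi> f))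
         (hcomp L (t2 \<phi> g) (Ide (vert L) (F1 (tdom \<phi>) f)))"
  using assms unfolding weak_natural_def lwhisker_def rwhisker_def by (auto simp: Let_def)

lemma weak_natural_cell:
  assumes "weak_natural w K L \<phi>" "\<alpha> \<in> Cell K"
  shows "w \<noteq> Colax \<Longrightarrow>
       Comp (vert L) (hcomp L (Ide (vert L) (t1 \<phi> (Cod (und K) (Dom (vert K) \<alpha>)))) (F2 (tdom \<phi>) \<alpha>)) (t2 \<phi> (Dom (vert K) \<alpha>)) =
       Comp (vert L) (t2 \<phi> (Cod (vert K) \<alpha>)) (hcomp L (F2 (tcod \<phi>) \<alpha>) (Ide (vert L) (t1 \<phi> (Dom (und K) (Dom (vert K) \<alpha>)))))"
    "w = Colax \<Longrightarrow>
       Comp (vert L) (hcomp L (F2 (tcod \<phi>) \<alpha>) (Ide (vert L) (t1 \<phi> (Dom (und K) (Dom (vert K) \<alpha>))))) (t2 \<phi> (Dom (vert K) \<alpha>)) =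
       Comp (vert L) (t2 \<phi> (Cod (vert K) \<alpha>)) (hcomp L (Ide (vert L) (t1 \<phi> (Cod (und K) (Dom (vert K) \<alpha>)))) (F2 (tdom \<phi>) \<alpha>))"
  using assms unfolding weak_natural_def lwhisker_def rwhisker_def by (auto simp: Let_def)

text \<open>Strict, pseudo and lax transformations share the direction of their 2-cells, hence also
  their equations; the first two add a condition on each single component. Whiskerings are spelled
  out with \<open>hcomp\<close>, so that \<open>interchange\<close> and \<open>hcomp_assoc\<close>
  apply directly.\<close>

lemma weak_naturalI_lax:
  assumes "w \<noteq> Colax" "two_functor K L (tdom \<phi>)" "two_functor K L (tcod \<phi>)"
    "\<And>X. X \<notin> Ob K \<Longrightarrow> t1 \<phi> X = undefined" "\<And>f. f \<notin> Mor K \<Longrightarrow> t2 \<phi> f = undefined"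
    "\<And>X. X \<in> Ob K \<Longrightarrow> t1 \<phi> X \<in> Mor L"
    "\<And>X. X \<in> Ob K \<Longrightarrow> Dom (und L) (t1 \<phi> X) = F0 (tdom \<phi>) X"
    "\<And>X. X \<in> Ob K \<Longrightarrow> Cod (und L) (t1 \<phi> X) = F0 (tcod \<phi>) X"
    "\<And>f. f \<in> Mor K \<Longrightarrow> t2 \<phi> f \<in> Cell L"
    "\<And>f. f \<in> Mor K \<Longrightarrow> Dom (vert L) (t2 \<phi> f) = Comp (und L) (F1 (tcod \<phi>) f) (t1 \<phi> (Dom (und K) f))"
    "\<And>f. f \<in> Mor K \<Longrightarrow> Cod (vert L) (t2 \<phi> f) = Comp (und L) (t1 \<phi> (Cod (und K) f)) (F1 (tdom \<phi>) f)"
    "\<And>f. w = Strict \<Longrightarrow> f \<in> Mor K \<Longrightarrow> is_identity (vert L) (t2 \<phi> f)"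
    "\<And>f. w = Pseudo \<Longrightarrow> f \<in> Mor K \<Longrightarrow> invertible (vert L) (t2 \<phi> f)"
    "\<And>X. X \<in> Ob K \<Longrightarrow> t2 \<phi> (Ide (und K) X) = Ide (vert L) (t1 \<phi> X)"
    "\<And>f g. f \<in> Mor K \<Longrightarrow> g \<in> Mor K \<Longrightarrow> Dom (und K) g = Cod (und K) f \<Longrightarrow> t2 \<phi> (Comp (und K) g f) =
       Comp (vert L) (hcomp L (t2 \<phi> g) (Ide (vert L) (F1 (tdom \<phi>) f)))
         (hcomp L (Ide (vert L) (F1 (tcod \<phi>) g)) (t2 \<phi> f))"
    "\<And>\<alpha>. \<alpha> \<in> Cell K \<Longrightarrow>
       Comp (vert L) (hcomp L (Ide (vert L) (t1 \<phi> (Cod (und K) (Dom (vert K) \<alpha>)))) (F2 (tdom \<phi>) \<alpha>)) (t2 \<phi> (Dom (vert K) \<alpha>)) =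
       Comp (vert L) (t2 \<phi> (Cod (vert K) \<alpha>)) (hcomp L (F2 (tcod \<phi>) \<alpha>) (Ide (vert L) (t1 \<phi> (Dom (und K) (Dom (vert K) \<alpha>)))))"
  shows "weak_natural w K L \<phi>"
  unfolding weak_natural_def lwhisker_def rwhisker_def Let_def using assms
  by (auto simp: hom_iff extensional_def)

lemma transf_eqI:
  assumes "weak_natural w K L \<phi>" "weak_natural w' K L \<psi>" "tdom \<phi> = tdom \<psi>" "tcod \<phi> = tcod \<psi>"
    "\<And>X. X \<in> Ob K \<Longrightarrow> t1 \<phi> X = t1 \<psi> X" "\<And>f. f \<in> Mor K \<Longrightarrow> t2 \<phi> f = t2 \<psi> f"
  shows "\<phi> = \<psi>"
proof (rule transf.equality)
  show "t1 \<phi> = t1 \<psi>"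
    using weak_natural_undef(1)[OF assms(1)] weak_natural_undef(1)[OF assms(2)] assms(5) by (metis ext)
  show "t2 \<phi> = t2 \<psi>"
    using weak_natural_undef(2)[OF assms(1)] weak_natural_undef(2)[OF assms(2)] assms(6) by (metis ext)
qed (use assms in simp_all)

text \<open>This dual exchanges colax and lax transformations.\<close>

definition co_two_cat :: "('o, 'm, 'c) two_cat \<Rightarrow> ('o, 'm, 'c) two_cat" where
  "co_two_cat K = \<lparr>und = und K,
     vert = (vert K)\<lparr>Dom := Cod (vert K), Cod := Dom (vert K), Comp := (\<lambda>\<beta> \<alpha>. Comp (vert K) \<alpha> \<beta>)\<rparr>,
     hcomp = hcomp K\<rparr>"

lemma co_two_cat_sel [simp]:
  "und (co_two_cat K) = und K" "Obj (vert (co_two_cat K)) = Obj (vert K)"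
  "Cell (co_two_cat K) = Cell K" "Dom (vert (co_two_cat K)) = Cod (vert K)"
  "Cod (vert (co_two_cat K)) = Dom (vert K)" "Ide (vert (co_two_cat K)) = Ide (vert K)"
  "Comp (vert (co_two_cat K)) \<beta> \<alpha> = Comp (vert K) \<alpha> \<beta>" "hcomp (co_two_cat K) = hcomp K"
  by (simp_all add: co_two_cat_def)

text \<open>The source and target of a cell in \<open>horiz\<close> are read off its vertical
  source, so the boundary, unit and associativity conditions on \<open>hcomp\<close> already make
  \<open>horiz\<close> a category.\<close>

lemma two_categoryI:
  assumes "category (und K)" "category (vert K)" "Obj (vert K) = Mor K"
    "\<And>\<alpha>. \<alpha> \<in> Cell K \<Longrightarrow> Dom (und K) (Cod (vert K) \<alpha>) = Dom (und K) (Dom (vert K) \<alpha>)"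
    "\<And>\<alpha>. \<alpha> \<in> Cell K \<Longrightarrow> Cod (und K) (Cod (vert K) \<alpha>) = Cod (und K) (Dom (vert K) \<alpha>)"
    "\<And>\<alpha> \<beta>. \<alpha> \<in> Cell K \<Longrightarrow> \<beta> \<in> Cell K \<Longrightarrow> Dom (und K) (Dom (vert K) \<beta>) = Cod (und K) (Dom (vert K) \<alpha>) \<Longrightarrow>
       hcomp K \<beta> \<alpha> \<in> Cell K \<and>
       Dom (vert K) (hcomp K \<beta> \<alpha>) = Comp (und K) (Dom (vert K) \<beta>) (Dom (vert K) \<alpha>) \<and>
       Cod (vert K) (hcomp K \<beta> \<alpha>) = Comp (und K) (Cod (vert K) \<beta>) (Cod (vert K) \<alpha>)"
    "\<And>\<alpha>. \<alpha> \<in> Cell K \<Longrightarrow>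
       hcomp K \<alpha> (Ide (vert K) (Ide (und K) (Dom (und K) (Dom (vert K) \<alpha>)))) = \<alpha> \<and>
       hcomp K (Ide (vert K) (Ide (und K) (Cod (und K) (Dom (vert K) \<alpha>)))) \<alpha> = \<alpha>"
    "\<And>\<alpha> \<beta> \<gamma>. \<alpha> \<in> Cell K \<Longrightarrow> \<beta> \<in> Cell K \<Longrightarrow> \<gamma> \<in> Cell K \<Longrightarrow>
       Dom (und K) (Dom (vert K) \<beta>) = Cod (und K) (Dom (vert K) \<alpha>) \<Longrightarrow>
       Dom (und K) (Dom (vert K) \<gamma>) = Cod (und K) (Dom (vert K) \<beta>) \<Longrightarrow>
       hcomp K \<gamma> (hcomp K \<beta> \<alpha>) = hcomp K (hcomp K \<gamma> \<beta>) \<alpha>"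
    "\<And>f g. f \<in> Mor K \<Longrightarrow> g \<in> Mor K \<Longrightarrow> Dom (und K) g = Cod (und K) f \<Longrightarrow>
       hcomp K (Ide (vert K) g) (Ide (vert K) f) = Ide (vert K) (Comp (und K) g f)"
    "\<And>\<alpha> \<alpha>' \<beta> \<beta>'. \<alpha> \<in> Cell K \<Longrightarrow> \<alpha>' \<in> Cell K \<Longrightarrow> \<beta> \<in> Cell K \<Longrightarrow> \<beta>' \<in> Cell K \<Longrightarrow>
       Dom (vert K) \<alpha>' = Cod (vert K) \<alpha> \<Longrightarrow> Dom (vert K) \<beta>' = Cod (vert K) \<beta> \<Longrightarrow>
       Dom (und K) (Dom (vert K) \<beta>) = Cod (und K) (Dom (vert K) \<alpha>) \<Longrightarrow>
       hcomp K (Comp (vert K) \<beta>' \<beta>) (Comp (vert K) \<alpha>' \<alpha>) =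
       Comp (vert K) (hcomp K \<beta>' \<alpha>') (hcomp K \<beta> \<alpha>)"
  shows "two_category K"
proof -
  have d: "Dom (vert K) \<alpha> \<in> Mor K" if "\<alpha> \<in> Cell K" for \<alpha>
    using that assms(2,3) by (metis categoryD(1))
  have i: "Ide (vert K) f \<in> Cell K \<and> Dom (vert K) (Ide (vert K) f) = f" if "f \<in> Mor K" for f
    using that assms(2,3) by (metis categoryD(3,4))
  have "category (horiz K)"
    unfolding category_def horiz_sel
    using assms(1) d i assms(6-8) by (simp add: Ball_def)
  then show ?thesis
    unfolding two_category_def using assms by simp
qed

lemma two_category_co [simp]:
  assumes "two_category K"
  shows "two_category (co_two_cat K)"
proof (rule two_categoryI)
  show "category (vert (co_two_cat K))"
    unfolding category_def using assms by (auto simp: category_assoc)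
next
  fix \<alpha> \<alpha>' \<beta> \<beta>'
  assume "\<alpha> \<in> Cell (co_two_cat K)" "\<alpha>' \<in> Cell (co_two_cat K)" "\<beta> \<in> Cell (co_two_cat K)" "\<beta>' \<in> Cell (co_two_cat K)"
    and "Dom (vert (co_two_cat K)) \<alpha>' = Cod (vert (co_two_cat K)) \<alpha>"
    "Dom (vert (co_two_cat K)) \<beta>' = Cod (vert (co_two_cat K)) \<beta>"
    "Dom (und (co_two_cat K)) (Dom (vert (co_two_cat K)) \<beta>) = Cod (und (co_two_cat K)) (Dom (vert (co_two_cat K)) \<alpha>)"
  then have c: "\<alpha> \<in> Cell K" "\<alpha>' \<in> Cell K" "\<beta> \<in> Cell K" "\<beta>' \<in> Cell K"
    "Dom (vert K) \<alpha> = Cod (vert K) \<alpha>'" "Dom (vert K) \<beta> = Cod (vert K) \<beta>'"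
    "Dom (und K) (Dom (vert K) \<beta>) = Cod (und K) (Dom (vert K) \<alpha>)"
    using assms by auto
  \<comment> \<open>\<open>interchange\<close> asks for horizontal composability of the cells that
    come first vertically. After the reversal these are the primed ones; composability passes to
    them because a 2-cell has parallel source and target.\<close>
  then have "Dom (und K) (Dom (vert K) \<beta>') = Cod (und K) (Dom (vert K) \<alpha>')"
    using assms by (metis two_categoryD(4,5))
  then show "hcomp (co_two_cat K) (Comp (vert (co_two_cat K)) \<beta>' \<beta>) (Comp (vert (co_two_cat K)) \<alpha>' \<alpha>) =
      Comp (vert (co_two_cat K)) (hcomp (co_two_cat K) \<beta>' \<alpha>') (hcomp (co_two_cat K) \<beta> \<alpha>)"
    using interchange[OF assms c(2,1,4,3,5,6)] by simp
qed (use assms in \<open>auto simp: hcomp_assoc\<close>)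

lemma two_functor_co:
  assumes "two_category K" "two_category L" "two_functor K L F"
  shows "two_functor (co_two_cat K) (co_two_cat L) F"
  by (rule two_functorI) (use assms in \<open>auto simp: two_functor_undef[OF assms(3)]\<close>)

lemma co_co [simp]: "co_two_cat (co_two_cat K) = K"
  by (simp add: co_two_cat_def)

lemma two_functor_co_iff:
  assumes "two_category K" "two_category L"
  shows "two_functor (co_two_cat K) (co_two_cat L) F \<longleftrightarrow> two_functor K L F"
  using two_functor_co[OF assms] two_functor_co[of "co_two_cat K" "co_two_cat L" F] assms by auto

text \<open>Reversing 2-cells exchanges the source and target of each component and the order of
  each vertical composite, and leaves whiskering unchanged. The two branches of
  \<open>weak_natural\<close> thereby become the same formula.\<close>

lemma weak_natural_Colax_iff:
  assumes "two_category K" "two_category L"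
  shows "weak_natural Colax K L \<phi> \<longleftrightarrow> weak_natural Lax (co_two_cat K) (co_two_cat L) \<phi>"
  unfolding weak_natural_def Let_def two_functor_co_iff[OF assms] using assms
  by (auto simp: lwhisker_def rwhisker_def hom_iff)

lemma comp_transf_Colax:
  "comp_transf Colax K L \<psi> \<phi> = comp_transf Lax (co_two_cat K) (co_two_cat L) \<psi> \<phi>"
  unfolding comp_transf_def by (simp add: lwhisker_def rwhisker_def)

lemma id_transf_co: "id_transf K L M = id_transf (co_two_cat K) (co_two_cat L) M"
  unfolding id_transf_def by simp

lemma is_identityD:
  assumes "category A" "is_identity A f"
  shows "f \<in> Arr A" "f = Ide A (Dom A f)" "Cod A f = Dom A f"
  using assms unfolding is_identity_def by auto

lemma is_identity_Ide [simp]: "x \<in> Obj A \<Longrightarrow> is_identity A (Ide A x)"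
  unfolding is_identity_def by auto

text \<open>Composable identities are equal, so the composite is again one of them.\<close>

lemma is_identity_comp:
  assumes "category A" "is_identity A f" "is_identity A g" "Dom A g = Cod A f"
  shows "is_identity A (Comp A g f)"
proof -
  have "Comp A g f = g"
    using is_identityD[OF assms(1,2)] is_identityD(1,2)[OF assms(1,3)] assms(1,4) by (metis categoryD(9))
  then show ?thesis using assms by simp
qed

lemma is_identity_hcomp:
  assumes "two_category L" "is_identity (vert L) \<alpha>" "is_identity (vert L) \<beta>"
    "Dom (und L) (Dom (vert L) \<beta>) = Cod (und L) (Dom (vert L) \<alpha>)"
  shows "is_identity (vert L) (hcomp L \<beta> \<alpha>)"
  using assms unfolding is_identity_def by auto

lemma invertible_Ide [simp]: "category A \<Longrightarrow> x \<in> Obj A \<Longrightarrow> invertible A (Ide A x)"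
  unfolding invertible_def by (rule bexI[of _ "Ide A x"]) (auto simp: hom_iff)

lemma invertible_comp:
  assumes A: "category A" and "f \<in> Arr A" "g \<in> Arr A" "Dom A g = Cod A f"
    and "invertible A f" "invertible A g"
  shows "invertible A (Comp A g f)"
proof -
  obtain f' where f': "f' \<in> Arr A" "Dom A f' = Cod A f" "Cod A f' = Dom A f"
      "Comp A f' f = Ide A (Dom A f)" "Comp A f f' = Ide A (Cod A f)"
    using assms unfolding invertible_def by (auto simp: hom_iff)
  obtain g' where g': "g' \<in> Arr A" "Dom A g' = Cod A g" "Cod A g' = Dom A g"
      "Comp A g' g = Ide A (Dom A g)" "Comp A g g' = Ide A (Cod A g)"
    using assms unfolding invertible_def by (auto simp: hom_iff)
  have 1: "Comp A (Comp A f' g') (Comp A g f) = Ide A (Dom A f)"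
  proof -
    have "Comp A g' (Comp A g f) = f"
      using category_assoc[OF A assms(2,3) g'(1)] assms f' g' by simp
    moreover have "Comp A (Comp A f' g') (Comp A g f) = Comp A f' (Comp A g' (Comp A g f))"
      using category_assoc[OF A _ g'(1) f'(1), of "Comp A g f"] assms f' g' by simp
    ultimately show ?thesis using assms f' g' by simp
  qed
  have 2: "Comp A (Comp A g f) (Comp A f' g') = Ide A (Cod A g)"
  proof -
    have "Comp A f (Comp A f' g') = g'"
      using category_assoc[OF A g'(1) f'(1) assms(2)] assms f' g' by simp
    moreover have "Comp A (Comp A g f) (Comp A f' g') = Comp A g (Comp A f (Comp A f' g'))"
      using category_assoc[OF A _ assms(2,3), of "Comp A f' g'"] assms f' g' by simp
    ultimately show ?thesis using assms f' g' by simp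
  qed
  show ?thesis
    unfolding invertible_def
    by (rule bexI[of _ "Comp A f' g'"]) (use 1 2 assms f' g' in \<open>auto simp: hom_iff\<close>)
qed

text \<open>By interchange, the horizontal composite of the two inverses is an inverse on both
  sides.\<close>

lemma invertible_hcomp:
  assumes L: "two_category L" and c: "\<alpha> \<in> Cell L" "\<beta> \<in> Cell L"
    "Dom (und L) (Dom (vert L) \<beta>) = Cod (und L) (Dom (vert L) \<alpha>)"
    and "invertible (vert L) \<alpha>" "invertible (vert L) \<beta>"
  shows "invertible (vert L) (hcomp L \<beta> \<alpha>)"
proof -
  obtain \<alpha>' where a: "\<alpha>' \<in> Cell L" "Dom (vert L) \<alpha>' = Cod (vert L) \<alpha>" "Cod (vert L) \<alpha>' = Dom (vert L) \<alpha>"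
      "Comp (vert L) \<alpha>' \<alpha> = Ide (vert L) (Dom (vert L) \<alpha>)" "Comp (vert L) \<alpha> \<alpha>' = Ide (vert L) (Cod (vert L) \<alpha>)"
    using assms unfolding invertible_def by (auto simp: hom_iff)
  obtain \<beta>' where b: "\<beta>' \<in> Cell L" "Dom (vert L) \<beta>' = Cod (vert L) \<beta>" "Cod (vert L) \<beta>' = Dom (vert L) \<beta>"
      "Comp (vert L) \<beta>' \<beta> = Ide (vert L) (Dom (vert L) \<beta>)" "Comp (vert L) \<beta> \<beta>' = Ide (vert L) (Cod (vert L) \<beta>)"
    using assms unfolding invertible_def by (auto simp: hom_iff)
  have 1: "Comp (vert L) (hcomp L \<beta>' \<alpha>') (hcomp L \<beta> \<alpha>) = Ide (vert L) (Comp (und L) (Dom (vert L) \<beta>) (Dom (vert L) \<alpha>))"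
    using interchange[OF L c(1) a(1) c(2) b(1)] a b c L by simp
  have 2: "Comp (vert L) (hcomp L \<beta> \<alpha>) (hcomp L \<beta>' \<alpha>') = Ide (vert L) (Comp (und L) (Cod (vert L) \<beta>) (Cod (vert L) \<alpha>))"
    using interchange[OF L a(1) c(1) b(1) c(2)] a b c L by simp
  show ?thesis
    unfolding invertible_def
    by (rule bexI[of _ "hcomp L \<beta>' \<alpha>'"]) (use 1 2 L a b c in \<open>auto simp: hom_iff\<close>)
qed

section \<open>Composition of weak transformations\<close>

lemma comp_transf_sel [simp]:
  "tdom (comp_transf w K L \<psi> \<phi>) = tdom \<phi>" "tcod (comp_transf w K L \<psi> \<phi>) = tcod \<psi>"
  "X \<in> Ob K \<Longrightarrow> t1 (comp_transf w K L \<psi> \<phi>) X = Comp (und L) (t1 \<psi> X) (t1 \<phi> X)"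
  "X \<notin> Ob K \<Longrightarrow> t1 (comp_transf w K L \<psi> \<phi>) X = undefined"
  "f \<notin> Mor K \<Longrightarrow> t2 (comp_transf w K L \<psi> \<phi>) f = undefined"
  "f \<in> Mor K \<Longrightarrow> w \<noteq> Colax \<Longrightarrow> t2 (comp_transf w K L \<psi> \<phi>) f =
     Comp (vert L) (hcomp L (Ide (vert L) (t1 \<psi> (Cod (und K) f))) (t2 \<phi> f))
       (hcomp L (t2 \<psi> f) (Ide (vert L) (t1 \<phi> (Dom (und K) f))))"
  "f \<in> Mor K \<Longrightarrow> t2 (comp_transf Colax K L \<psi> \<phi>) f =
     Comp (vert L) (hcomp L (t2 \<psi> f) (Ide (vert L) (t1 \<phi> (Dom (und K) f))))
       (hcomp L (Ide (vert L) (t1 \<psi> (Cod (und K) f))) (t2 \<phi> f))"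
  by (simp_all add: comp_transf_def lwhisker_def rwhisker_def)

text \<open>The component of the composite at a 1-cell is the pasting of two squares side by side.
  Compatibility with composition of 1-cells then says that a two by two grid of squares may be
  pasted by rows or by columns, and compatibility with 2-cells that two such conditions can be glued
  along their common side.\<close>

lemma comp_transf_natural_lax:
  assumes w: "w \<noteq> Colax" and K: "two_category K" and L: "two_category L"
    and \<phi>: "weak_natural w K L \<phi>" and \<psi>: "weak_natural w K L \<psi>" and m: "tdom \<psi> = tcod \<phi>"
  shows "weak_natural w K L (comp_transf w K L \<psi> \<phi>)"
proof (rule weak_naturalI_lax[OF w])
  note n\<phi> = weak_naturalD[OF \<phi>] and n\<psi> = weak_naturalD[OF \<psi>]
  note b\<phi> = weak_natural_boundary(1,2)[OF \<phi> _ w] and b\<psi> = weak_natural_boundary(1,2)[OF \<psi> _ w]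
  note F = two_functorD[OF n\<phi>(1)] two_functorD[OF n\<phi>(2)] two_functorD[OF n\<psi>(2)]
  have Cu: "category (und L)" and Cv: "category (vert L)" and Ku: "category (und K)" and Kv: "category (vert K)"
    using L K by simp_all
  note facts = K L w m n\<phi> n\<psi> b\<phi> b\<psi> F categoryD[OF Ku] categoryD[OF Kv] category_assoc[OF Cu]
  let ?I = "Ide (vert L)" and ?M = "tdom \<phi>" and ?N = "tcod \<phi>" and ?P = "tcod \<psi>"
  let ?c = "Comp (vert L)" and ?h = "hcomp L"
  show "f \<in> Mor K \<Longrightarrow> t2 (comp_transf w K L \<psi> \<phi>) f \<in> Cell L"
    "f \<in> Mor K \<Longrightarrow> Dom (vert L) (t2 (comp_transf w K L \<psi> \<phi>) f) =
       Comp (und L) (F1 (tcod (comp_transf w K L \<psi> \<phi>)) f) (t1 (comp_transf w K L \<psi> \<phi>) (Dom (und K) f))"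
    "f \<in> Mor K \<Longrightarrow> Cod (vert L) (t2 (comp_transf w K L \<psi> \<phi>) f) =
       Comp (und L) (t1 (comp_transf w K L \<psi> \<phi>) (Cod (und K) f)) (F1 (tdom (comp_transf w K L \<psi> \<phi>)) f)" for f
    by (simp_all add: facts)
  show "is_identity (vert L) (t2 (comp_transf w K L \<psi> \<phi>) f)" if "w = Strict" and f: "f \<in> Mor K" for f
    using weak_natural_boundary(5)[OF \<phi> f \<open>w = Strict\<close>] weak_natural_boundary(5)[OF \<psi> f \<open>w = Strict\<close>] f
    by (auto intro!: is_identity_comp is_identity_hcomp simp: facts)
  show "invertible (vert L) (t2 (comp_transf w K L \<psi> \<phi>) f)" if "w = Pseudo" and f: "f \<in> Mor K" for f
    using weak_natural_boundary(6)[OF \<phi> f \<open>w = Pseudo\<close>] weak_natural_boundary(6)[OF \<psi> f \<open>w = Pseudo\<close>] f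
    by (auto intro!: invertible_comp invertible_hcomp simp: facts)
  show "X \<in> Ob K \<Longrightarrow> t2 (comp_transf w K L \<psi> \<phi>) (Ide (und K) X) = ?I (t1 (comp_transf w K L \<psi> \<phi>) X)" for X
    by (simp add: facts)
next
  note n\<phi> = weak_naturalD[OF \<phi>] and n\<psi> = weak_naturalD[OF \<psi>]
  note b\<phi> = weak_natural_boundary(1,2)[OF \<phi> _ w] and b\<psi> = weak_natural_boundary(1,2)[OF \<psi> _ w]
  note F = two_functorD[OF n\<phi>(1)] two_functorD[OF n\<phi>(2)] two_functorD[OF n\<psi>(2)]
  have Cu: "category (und L)" and Cv: "category (vert L)" and Ku: "category (und K)" and Kv: "category (vert K)"
    using L K by simp_all
  note facts = K L w m n\<phi> n\<psi> b\<phi> b\<psi> F categoryD[OF Ku] categoryD[OF Kv] category_assoc[OF Cu]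
  let ?I = "Ide (vert L)" and ?M = "tdom \<phi>" and ?N = "tcod \<phi>" and ?P = "tcod \<psi>"
  let ?c = "Comp (vert L)" and ?h = "hcomp L"
  fix f g assume f: "f \<in> Mor K" and g: "g \<in> Mor K" and gf: "Dom (und K) g = Cod (und K) f"
  let ?X = "Dom (und K) f" and ?Y = "Cod (und K) f" and ?Z = "Cod (und K) g"
  let ?pX = "?I (t1 \<phi> ?X)" and ?qZ = "?I (t1 \<psi> ?Z)" and ?pY = "?I (t1 \<phi> ?Y)" and ?qY = "?I (t1 \<psi> ?Y)"
  let ?Mf = "?I (F1 ?M f)" and ?Pg = "?I (F1 ?P g)" and ?Nf = "?I (F1 ?N f)" and ?Ng = "?I (F1 ?N g)"
  let ?a = "t2 \<phi> f" and ?a' = "t2 \<phi> g" and ?b = "t2 \<psi> f" and ?b' = "t2 \<psi> g"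
  note fa = facts f g gf
  \<comment> \<open>Whiskering distributes over vertical composition: this is
    \<open>interchange\<close> with one factor replaced by a composite of an identity with
    itself.\<close>
  have s1: "?h ?qZ (t2 \<phi> (Comp (und K) g f)) = ?c (?h ?qZ (?h ?a' ?Mf)) (?h ?qZ (?h ?Ng ?a))"
  proof -
    have "?h (?c ?qZ ?qZ) (?c (?h ?a' ?Mf) (?h ?Ng ?a)) = ?c (?h ?qZ (?h ?a' ?Mf)) (?h ?qZ (?h ?Ng ?a))"
      by (rule interchange) (simp_all add: fa)
    then show ?thesis using weak_natural_comp(1)[OF \<phi> f g gf w] by (simp add: fa)
  qed
  have s2: "?h (t2 \<psi> (Comp (und K) g f)) ?pX = ?c (?h (?h ?b' ?Nf) ?pX) (?h (?h ?Pg ?b) ?pX)"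
  proof -
    have "?h (?c (?h ?b' ?Nf) (?h ?Pg ?b)) (?c ?pX ?pX) = ?c (?h (?h ?b' ?Nf) ?pX) (?h (?h ?Pg ?b) ?pX)"
      by (rule interchange) (simp_all add: fa)
    then show ?thesis using weak_natural_comp(1)[OF \<psi> f g gf w] by (simp add: fa)
  qed
  \<comment> \<open>The crucial exchange. The cells \<open>t2 \<psi> g\<close> and
    \<open>t2 \<phi> f\<close> sit on opposite sides of the composite, so either order of applying
    them equals their horizontal composite.\<close>
  have mid: "?c (?h ?qZ (?h ?Ng ?a)) (?h (?h ?b' ?Nf) ?pX) = ?c (?h ?b' (?h ?pY ?Mf)) (?h (?h ?Pg ?qY) ?a)"
  proof -
    have "?h (?c (?h ?qZ ?Ng) ?b') (?c ?a (?h ?Nf ?pX)) = ?c (?h (?h ?qZ ?Ng) ?a) (?h ?b' (?h ?Nf ?pX))"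
      by (rule interchange) (simp_all add: fa)
    moreover have "?h (?c ?b' (?h ?Pg ?qY)) (?c (?h ?pY ?Mf) ?a) = ?c (?h ?b' (?h ?pY ?Mf)) (?h (?h ?Pg ?qY) ?a)"
      by (rule interchange) (simp_all add: fa)
    moreover have "?c (?h ?qZ ?Ng) ?b' = ?b'" "?c ?a (?h ?Nf ?pX) = ?a"
      "?c ?b' (?h ?Pg ?qY) = ?b'" "?c (?h ?pY ?Mf) ?a = ?a"
      by (simp_all add: fa)
    moreover have "?h (?h ?qZ ?Ng) ?a = ?h ?qZ (?h ?Ng ?a)" "?h (?h ?b' ?Nf) ?pX = ?h ?b' (?h ?Nf ?pX)"
      by (rule hcomp_assoc; simp add: fa)+
    ultimately show ?thesis by simp
  qed
  have s3: "?h (?c (?h ?qZ ?a') (?h ?b' ?pY)) ?Mf = ?c (?h ?qZ (?h ?a' ?Mf)) (?h ?b' (?h ?pY ?Mf))"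
  proof -
    have "?h (?c (?h ?qZ ?a') (?h ?b' ?pY)) (?c ?Mf ?Mf) = ?c (?h (?h ?qZ ?a') ?Mf) (?h (?h ?b' ?pY) ?Mf)"
      by (rule interchange) (simp_all add: fa)
    moreover have "?h (?h ?qZ ?a') ?Mf = ?h ?qZ (?h ?a' ?Mf)" "?h (?h ?b' ?pY) ?Mf = ?h ?b' (?h ?pY ?Mf)"
      by (rule hcomp_assoc; simp add: fa)+
    ultimately show ?thesis by (simp add: fa)
  qed
  have s4: "?h ?Pg (?c (?h ?qY ?a) (?h ?b ?pX)) = ?c (?h (?h ?Pg ?qY) ?a) (?h (?h ?Pg ?b) ?pX)"
  proof -
    have "?h (?c ?Pg ?Pg) (?c (?h ?qY ?a) (?h ?b ?pX)) = ?c (?h ?Pg (?h ?qY ?a)) (?h ?Pg (?h ?b ?pX))"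
      by (rule interchange) (simp_all add: fa)
    moreover have "?h (?h ?Pg ?qY) ?a = ?h ?Pg (?h ?qY ?a)" "?h (?h ?Pg ?b) ?pX = ?h ?Pg (?h ?b ?pX)"
      by (rule hcomp_assoc; simp add: fa)+
    ultimately show ?thesis by (simp add: fa)
  qed
  let ?A = "?h ?qZ (?h ?a' ?Mf)" and ?B = "?h ?qZ (?h ?Ng ?a)" and ?C = "?h (?h ?b' ?Nf) ?pX"
    and ?D = "?h (?h ?Pg ?b) ?pX" and ?B' = "?h ?b' (?h ?pY ?Mf)" and ?C' = "?h (?h ?Pg ?qY) ?a"
  \<comment> \<open>Both pastings of the grid consist of four cells. The outer two keep their
    places, and only the middle pair is replaced, by \<open>mid\<close>.\<close>
  have "t2 (comp_transf w K L \<psi> \<phi>) (Comp (und K) g f) = ?c (?c ?A ?B) (?c ?C ?D)"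
    using s1 s2 by (simp add: fa)
  also have "\<dots> = ?c ?A (?c (?c ?B ?C) ?D)"
    by (simp add: fa category_assoc[OF Cv])
  also have "\<dots> = ?c ?A (?c (?c ?B' ?C') ?D)"
    by (simp only: mid)
  also have "\<dots> = ?c (?c ?A ?B') (?c ?C' ?D)"
    by (simp add: fa category_assoc[OF Cv])
  finally show "t2 (comp_transf w K L \<psi> \<phi>) (Comp (und K) g f) =
       ?c (?h (t2 (comp_transf w K L \<psi> \<phi>) g) (?I (F1 (tdom (comp_transf w K L \<psi> \<phi>)) f)))
         (?h (?I (F1 (tcod (comp_transf w K L \<psi> \<phi>)) g)) (t2 (comp_transf w K L \<psi> \<phi>) f))"
    using s3 s4 by (simp add: fa)
next
  note n\<phi> = weak_naturalD[OF \<phi>] and n\<psi> = weak_naturalD[OF \<psi>]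
  note b\<phi> = weak_natural_boundary(1,2)[OF \<phi> _ w] and b\<psi> = weak_natural_boundary(1,2)[OF \<psi> _ w]
  note F = two_functorD[OF n\<phi>(1)] two_functorD[OF n\<phi>(2)] two_functorD[OF n\<psi>(2)]
  have Cu: "category (und L)" and Cv: "category (vert L)" and Ku: "category (und K)" and Kv: "category (vert K)"
    using L K by simp_all
  note facts = K L w m n\<phi> n\<psi> b\<phi> b\<psi> F categoryD[OF Ku] categoryD[OF Kv] category_assoc[OF Cu]
  let ?I = "Ide (vert L)" and ?M = "tdom \<phi>" and ?N = "tcod \<phi>" and ?P = "tcod \<psi>"
  let ?c = "Comp (vert L)" and ?h = "hcomp L"
  fix \<alpha> assume \<alpha>: "\<alpha> \<in> Cell K"
  let ?f = "Dom (vert K) \<alpha>" and ?g = "Cod (vert K) \<alpha>"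
  let ?X = "Dom (und K) ?f" and ?Y = "Cod (und K) ?f"
  let ?pX = "?I (t1 \<phi> ?X)" and ?qX = "?I (t1 \<psi> ?X)" and ?pY = "?I (t1 \<phi> ?Y)" and ?qY = "?I (t1 \<psi> ?Y)"
  let ?a = "t2 \<phi> ?f" and ?a' = "t2 \<phi> ?g" and ?b = "t2 \<psi> ?f" and ?b' = "t2 \<psi> ?g"
  let ?Ma = "F2 ?M \<alpha>" and ?Na = "F2 ?N \<alpha>" and ?Pa = "F2 ?P \<alpha>"
  note fa = facts \<alpha>
  have c\<phi>: "?c (?h ?pY ?Ma) ?a = ?c ?a' (?h ?Na ?pX)"
    using weak_natural_cell(1)[OF \<phi> \<alpha> w] .
  have c\<psi>: "?c (?h ?qY ?Na) ?b = ?c ?b' (?h ?Pa ?qX)"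
    using weak_natural_cell(1)[OF \<psi> \<alpha> w] m by simp
  \<comment> \<open>The cell condition of \<open>\<phi>\<close>, whiskered by
    \<open>t1 \<psi> ?Y\<close>. It is to be glued to that of \<open>\<psi>\<close>, whiskered by
    \<open>t1 \<phi> ?X\<close>, along the cell \<open>F2 ?N \<alpha>\<close> in the middle.\<close>
  have s1: "?c (?h (?h ?qY ?pY) ?Ma) (?h ?qY ?a) = ?c (?h ?qY ?a') (?h ?qY (?h ?Na ?pX))"
  proof -
    have "?h (?c ?qY ?qY) (?c (?h ?pY ?Ma) ?a) = ?c (?h ?qY (?h ?pY ?Ma)) (?h ?qY ?a)"
      by (rule interchange) (simp_all add: fa)
    moreover have "?h (?c ?qY ?qY) (?c ?a' (?h ?Na ?pX)) = ?c (?h ?qY ?a') (?h ?qY (?h ?Na ?pX))"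
      by (rule interchange) (simp_all add: fa)
    moreover have "?h (?h ?qY ?pY) ?Ma = ?h ?qY (?h ?pY ?Ma)"
      by (rule hcomp_assoc; simp add: fa)
    ultimately show ?thesis using c\<phi> by (simp add: fa)
  qed
  have s2: "?c (?h ?qY (?h ?Na ?pX)) (?h ?b ?pX) = ?c (?h ?b' ?pX) (?h ?Pa (?h ?qX ?pX))"
  proof -
    have "?h (?c (?h ?qY ?Na) ?b) (?c ?pX ?pX) = ?c (?h (?h ?qY ?Na) ?pX) (?h ?b ?pX)"
      by (rule interchange) (simp_all add: fa)
    moreover have "?h (?c ?b' (?h ?Pa ?qX)) (?c ?pX ?pX) = ?c (?h ?b' ?pX) (?h (?h ?Pa ?qX) ?pX)"
      by (rule interchange) (simp_all add: fa)
    moreover have "?h (?h ?qY ?Na) ?pX = ?h ?qY (?h ?Na ?pX)" "?h (?h ?Pa ?qX) ?pX = ?h ?Pa (?h ?qX ?pX)"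
      by (rule hcomp_assoc; simp add: fa)+
    ultimately show ?thesis using c\<psi> by (simp add: fa)
  qed
  have "?c (?h (?h ?qY ?pY) ?Ma) (?c (?h ?qY ?a) (?h ?b ?pX)) = ?c (?c (?h (?h ?qY ?pY) ?Ma) (?h ?qY ?a)) (?h ?b ?pX)"
    by (rule category_assoc[OF Cv, symmetric]) (simp_all add: fa)
  also have "\<dots> = ?c (?c (?h ?qY ?a') (?h ?qY (?h ?Na ?pX))) (?h ?b ?pX)"
    by (simp only: s1)
  also have "\<dots> = ?c (?h ?qY ?a') (?c (?h ?qY (?h ?Na ?pX)) (?h ?b ?pX))"
    by (rule category_assoc[OF Cv]) (simp_all add: fa)
  also have "\<dots> = ?c (?h ?qY ?a') (?c (?h ?b' ?pX) (?h ?Pa (?h ?qX ?pX)))"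
    by (simp only: s2)
  also have "\<dots> = ?c (?c (?h ?qY ?a') (?h ?b' ?pX)) (?h ?Pa (?h ?qX ?pX))"
    by (rule category_assoc[OF Cv, symmetric]) (simp_all add: fa)
  finally show "?c (?h (?I (t1 (comp_transf w K L \<psi> \<phi>) ?Y)) (F2 (tdom (comp_transf w K L \<psi> \<phi>)) \<alpha>)) (t2 (comp_transf w K L \<psi> \<phi>) ?f) =
      ?c (t2 (comp_transf w K L \<psi> \<phi>) ?g) (?h (F2 (tcod (comp_transf w K L \<psi> \<phi>)) \<alpha>) (?I (t1 (comp_transf w K L \<psi> \<phi>) ?X)))"
    by (simp add: fa)
qed (use assms in simp_all)

text \<open>For \<open>Colax\<close>, the lax statement is applied to the duals of both
  2-categories, in which the same record is a lax transformation.\<close>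

lemma comp_transf_natural:
  assumes "two_category K" "two_category L"
    and "weak_natural w K L \<phi>" "weak_natural w K L \<psi>" "tdom \<psi> = tcod \<phi>"
  shows "weak_natural w K L (comp_transf w K L \<psi> \<phi>)"
proof (cases "w = Colax")
  case True
  have "weak_natural Lax (co_two_cat K) (co_two_cat L) (comp_transf Lax (co_two_cat K) (co_two_cat L) \<psi> \<phi>)"
    by (rule comp_transf_natural_lax) (use assms True in \<open>simp_all add: weak_natural_Colax_iff\<close>)
  then show ?thesis
    using True assms by (simp add: weak_natural_Colax_iff comp_transf_Colax)
qed (use assms comp_transf_natural_lax in blast)

lemma id_transf_sel [simp]:
  "tdom (id_transf K L M) = M" "tcod (id_transf K L M) = M"
  "X \<in> Ob K \<Longrightarrow> t1 (id_transf K L M) X = Ide (und L) (F0 M X)"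
  "f \<in> Mor K \<Longrightarrow> t2 (id_transf K L M) f = Ide (vert L) (F1 M f)"
  "X \<notin> Ob K \<Longrightarrow> t1 (id_transf K L M) X = undefined"
  "f \<notin> Mor K \<Longrightarrow> t2 (id_transf K L M) f = undefined"
  by (simp_all add: id_transf_def)

lemma id_transf_natural_lax:
  assumes "w \<noteq> Colax" "two_category K" "two_category L" "two_functor K L M"
  shows "weak_natural w K L (id_transf K L M)"
  by (rule weak_naturalI_lax) (use assms in simp_all)

lemma id_transf_natural:
  assumes "two_category K" "two_category L" "two_functor K L M"
  shows "weak_natural w K L (id_transf K L M)"
proof (cases "w = Colax")
  case True
  have "weak_natural Lax (co_two_cat K) (co_two_cat L) (id_transf (co_two_cat K) (co_two_cat L) M)"
    by (rule id_transf_natural_lax) (use assms True in \<open>simp_all add: two_functor_co_iff\<close>)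
  then show ?thesis
    using True assms by (simp add: weak_natural_Colax_iff id_transf_co[of K L])
qed (use assms id_transf_natural_lax in blast)

section \<open>Modifications and their two compositions\<close>

lemma modificationD [simp]:
  assumes "modification w K L \<Gamma>"
  shows "weak_natural w K L (mdom \<Gamma>)" "weak_natural w K L (mcod \<Gamma>)"
    "tdom (mcod \<Gamma>) = tdom (mdom \<Gamma>)" "tcod (mcod \<Gamma>) = tcod (mdom \<Gamma>)"
    "X \<in> Ob K \<Longrightarrow> mcmp \<Gamma> X \<in> Cell L"
    "X \<in> Ob K \<Longrightarrow> Dom (vert L) (mcmp \<Gamma> X) = t1 (mdom \<Gamma>) X"
    "X \<in> Ob K \<Longrightarrow> Cod (vert L) (mcmp \<Gamma> X) = t1 (mcod \<Gamma>) X"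
  using assms unfolding modification_def by (auto simp: Let_def hom_iff)

lemma modification_undef: "modification w K L \<Gamma> \<Longrightarrow> X \<notin> Ob K \<Longrightarrow> mcmp \<Gamma> X = undefined"
  unfolding modification_def by (auto simp: Let_def extensional_def)

lemma modification_natural:
  assumes "modification w K L \<Gamma>" "f \<in> Mor K" "w \<noteq> Colax"
  shows "Comp (vert L) (hcomp L (mcmp \<Gamma> (Cod (und K) f)) (Ide (vert L) (F1 (tdom (mdom \<Gamma>)) f))) (t2 (mdom \<Gamma>) f) =
    Comp (vert L) (t2 (mcod \<Gamma>) f) (hcomp L (Ide (vert L) (F1 (tcod (mdom \<Gamma>)) f)) (mcmp \<Gamma> (Dom (und K) f)))"
  using assms unfolding modification_def lwhisker_def rwhisker_def by (auto simp: Let_def)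

lemma modificationI_lax:
  assumes "w \<noteq> Colax" "weak_natural w K L (mdom \<Gamma>)" "weak_natural w K L (mcod \<Gamma>)"
    "tdom (mcod \<Gamma>) = tdom (mdom \<Gamma>)" "tcod (mcod \<Gamma>) = tcod (mdom \<Gamma>)"
    "\<And>X. X \<in> Ob K \<Longrightarrow> mcmp \<Gamma> X \<in> Cell L"
    "\<And>X. X \<in> Ob K \<Longrightarrow> Dom (vert L) (mcmp \<Gamma> X) = t1 (mdom \<Gamma>) X"
    "\<And>X. X \<in> Ob K \<Longrightarrow> Cod (vert L) (mcmp \<Gamma> X) = t1 (mcod \<Gamma>) X"
    "\<And>X. X \<notin> Ob K \<Longrightarrow> mcmp \<Gamma> X = undefined"
    "\<And>f. f \<in> Mor K \<Longrightarrow>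
      Comp (vert L) (hcomp L (mcmp \<Gamma> (Cod (und K) f)) (Ide (vert L) (F1 (tdom (mdom \<Gamma>)) f))) (t2 (mdom \<Gamma>) f) =
      Comp (vert L) (t2 (mcod \<Gamma>) f) (hcomp L (Ide (vert L) (F1 (tcod (mdom \<Gamma>)) f)) (mcmp \<Gamma> (Dom (und K) f)))"
  shows "modification w K L \<Gamma>"
  unfolding modification_def lwhisker_def rwhisker_def Let_def using assms
  by (auto simp: hom_iff extensional_def)

text \<open>The components of a modification are themselves 2-cells, so the reversal also exchanges
  its source and target transformations.\<close>

lemma modification_Colax_iff:
  assumes "two_category K" "two_category L"
  shows "modification Colax K L \<lparr>mdom = \<phi>, mcod = \<psi>, mcmp = m\<rparr> \<longleftrightarrow>
    modification Lax (co_two_cat K) (co_two_cat L) \<lparr>mdom = \<psi>, mcod = \<phi>, mcmp = m\<rparr>"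
  unfolding modification_def Let_def using assms
  by (auto simp: lwhisker_def rwhisker_def hom_iff weak_natural_Colax_iff)

lemma id_modification_lax:
  assumes w: "w \<noteq> Colax" and K: "two_category K" and L: "two_category L" and \<phi>: "weak_natural w K L \<phi>"
  shows "modification w K L \<lparr>mdom = \<phi>, mcod = \<phi>, mcmp = (\<lambda>X\<in>Ob K. Ide (vert L) (t1 \<phi> X))\<rparr>"
proof -
  have Cv: "category (vert L)" "category (und L)" using L by simp_all
  note n = weak_naturalD[OF \<phi>]
  note facts = K L n weak_natural_boundary(1,2)[OF \<phi> _ w] two_functorD[OF n(1)] two_functorD[OF n(2)]
  show ?thesis
    by (rule modificationI_lax) (use w \<phi> in \<open>simp_all add: facts\<close>)
qed

text \<open>The two modification squares are stacked along the component of the transformation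
  \<open>mcod \<Gamma>\<close> that they share.\<close>

lemma vcomp_modification_lax:
  assumes w: "w \<noteq> Colax" and K: "two_category K" and L: "two_category L"
    and \<Gamma>: "modification w K L \<Gamma>" and \<Delta>: "modification w K L \<Delta>" and m: "mdom \<Delta> = mcod \<Gamma>"
  shows "modification w K L \<lparr>mdom = mdom \<Gamma>, mcod = mcod \<Delta>,
    mcmp = (\<lambda>X\<in>Ob K. Comp (vert L) (mcmp \<Delta> X) (mcmp \<Gamma> X))\<rparr>"
proof -
  have Cu: "category (und L)" and Cv: "category (vert L)" using L by simp_all
  note g = modificationD[OF \<Gamma>] and d = modificationD[OF \<Delta>]
  note n = weak_naturalD[OF g(1)] weak_naturalD[OF g(2)] weak_naturalD[OF d(2)]
  note facts = K L g d m n weak_natural_boundary(1,2)[OF g(1) _ w] weak_natural_boundary(1,2)[OF g(2) _ w]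
    weak_natural_boundary(1,2)[OF d(2) _ w] two_functorD[OF n(1)] two_functorD[OF n(2)]
  let ?c = "Comp (vert L)" and ?h = "hcomp L" and ?I = "Ide (vert L)"
  show ?thesis
  proof (rule modificationI_lax[OF w])
    fix f assume f: "f \<in> Mor K"
    let ?X = "Dom (und K) f" and ?Y = "Cod (und K) f"
    let ?Mf = "?I (F1 (tdom (mdom \<Gamma>)) f)" and ?Nf = "?I (F1 (tcod (mdom \<Gamma>)) f)"
    have s1: "?h (?c (mcmp \<Delta> ?Y) (mcmp \<Gamma> ?Y)) ?Mf = ?c (?h (mcmp \<Delta> ?Y) ?Mf) (?h (mcmp \<Gamma> ?Y) ?Mf)"
    proof -
      have "?h (?c (mcmp \<Delta> ?Y) (mcmp \<Gamma> ?Y)) (?c ?Mf ?Mf) = ?c (?h (mcmp \<Delta> ?Y) ?Mf) (?h (mcmp \<Gamma> ?Y) ?Mf)"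
        by (rule interchange) (use f in \<open>simp_all add: facts\<close>)
      then show ?thesis using f by (simp add: facts)
    qed
    have s2: "?h ?Nf (?c (mcmp \<Delta> ?X) (mcmp \<Gamma> ?X)) = ?c (?h ?Nf (mcmp \<Delta> ?X)) (?h ?Nf (mcmp \<Gamma> ?X))"
    proof -
      have "?h (?c ?Nf ?Nf) (?c (mcmp \<Delta> ?X) (mcmp \<Gamma> ?X)) = ?c (?h ?Nf (mcmp \<Delta> ?X)) (?h ?Nf (mcmp \<Gamma> ?X))"
        by (rule interchange) (use f in \<open>simp_all add: facts\<close>)
      then show ?thesis using f by (simp add: facts)
    qed
    have g': "?c (?h (mcmp \<Gamma> ?Y) ?Mf) (t2 (mdom \<Gamma>) f) = ?c (t2 (mcod \<Gamma>) f) (?h ?Nf (mcmp \<Gamma> ?X))"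
      by (rule modification_natural[OF \<Gamma> f w])
    have d': "?c (?h (mcmp \<Delta> ?Y) ?Mf) (t2 (mcod \<Gamma>) f) = ?c (t2 (mcod \<Delta>) f) (?h ?Nf (mcmp \<Delta> ?X))"
      using modification_natural[OF \<Delta> f w] by (simp add: facts)
    have "?c (?c (?h (mcmp \<Delta> ?Y) ?Mf) (?h (mcmp \<Gamma> ?Y) ?Mf)) (t2 (mdom \<Gamma>) f) =
        ?c (?h (mcmp \<Delta> ?Y) ?Mf) (?c (?h (mcmp \<Gamma> ?Y) ?Mf) (t2 (mdom \<Gamma>) f))"
      by (rule category_assoc[OF Cv]) (use f in \<open>simp_all add: facts\<close>)
    also have "\<dots> = ?c (?h (mcmp \<Delta> ?Y) ?Mf) (?c (t2 (mcod \<Gamma>) f) (?h ?Nf (mcmp \<Gamma> ?X)))"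
      by (simp only: g')
    also have "\<dots> = ?c (?c (?h (mcmp \<Delta> ?Y) ?Mf) (t2 (mcod \<Gamma>) f)) (?h ?Nf (mcmp \<Gamma> ?X))"
      by (rule category_assoc[OF Cv, symmetric]) (use f in \<open>simp_all add: facts\<close>)
    also have "\<dots> = ?c (?c (t2 (mcod \<Delta>) f) (?h ?Nf (mcmp \<Delta> ?X))) (?h ?Nf (mcmp \<Gamma> ?X))"
      by (simp only: d')
    also have "\<dots> = ?c (t2 (mcod \<Delta>) f) (?c (?h ?Nf (mcmp \<Delta> ?X)) (?h ?Nf (mcmp \<Gamma> ?X)))"
      by (rule category_assoc[OF Cv]) (use f in \<open>simp_all add: facts\<close>)
    finally show "?c (?h (mcmp \<lparr>mdom = mdom \<Gamma>, mcod = mcod \<Delta>, mcmp = \<lambda>X\<in>Ob K. ?c (mcmp \<Delta> X) (mcmp \<Gamma> X)\<rparr> ?Y)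
         (?I (F1 (tdom (mdom \<lparr>mdom = mdom \<Gamma>, mcod = mcod \<Delta>, mcmp = \<lambda>X\<in>Ob K. ?c (mcmp \<Delta> X) (mcmp \<Gamma> X)\<rparr>)) f)))
         (t2 (mdom \<lparr>mdom = mdom \<Gamma>, mcod = mcod \<Delta>, mcmp = \<lambda>X\<in>Ob K. ?c (mcmp \<Delta> X) (mcmp \<Gamma> X)\<rparr>) f) =
       ?c (t2 (mcod \<lparr>mdom = mdom \<Gamma>, mcod = mcod \<Delta>, mcmp = \<lambda>X\<in>Ob K. ?c (mcmp \<Delta> X) (mcmp \<Gamma> X)\<rparr>) f)
         (?h (?I (F1 (tcod (mdom \<lparr>mdom = mdom \<Gamma>, mcod = mcod \<Delta>, mcmp = \<lambda>X\<in>Ob K. ?c (mcmp \<Delta> X) (mcmp \<Gamma> X)\<rparr>)) f))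
            (mcmp \<lparr>mdom = mdom \<Gamma>, mcod = mcod \<Delta>, mcmp = \<lambda>X\<in>Ob K. ?c (mcmp \<Delta> X) (mcmp \<Gamma> X)\<rparr> ?X))"
      using f s1 s2 K by simp
  qed (simp_all add: facts)
qed

lemma hcomp_modification_lax:
  assumes w: "w \<noteq> Colax" and K: "two_category K" and L: "two_category L"
    and \<Gamma>: "modification w K L \<Gamma>" and \<Delta>: "modification w K L \<Delta>" and m: "tdom (mdom \<Delta>) = tcod (mdom \<Gamma>)"
  shows "modification w K L \<lparr>mdom = comp_transf w K L (mdom \<Delta>) (mdom \<Gamma>),
    mcod = comp_transf w K L (mcod \<Delta>) (mcod \<Gamma>), mcmp = (\<lambda>X\<in>Ob K. hcomp L (mcmp \<Delta> X) (mcmp \<Gamma> X))\<rparr>"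
    (is "modification w K L ?R")
proof -
  have Cu: "category (und L)" and Cv: "category (vert L)" using L by simp_all
  note g = modificationD[OF \<Gamma>] and d = modificationD[OF \<Delta>]
  note n = weak_naturalD[OF g(1)] weak_naturalD[OF g(2)] weak_naturalD[OF d(1)] weak_naturalD[OF d(2)]
  note facts = K L w g d m n weak_natural_boundary(1,2)[OF g(1) _ w] weak_natural_boundary(1,2)[OF g(2) _ w]
    weak_natural_boundary(1,2)[OF d(1) _ w] weak_natural_boundary(1,2)[OF d(2) _ w]
    two_functorD[OF n(1)] two_functorD[OF n(2)] two_functorD[OF weak_naturalD(2)[OF d(1)]] category_assoc[OF Cu]
  let ?c = "Comp (vert L)" and ?h = "hcomp L" and ?I = "Ide (vert L)"
  show ?thesis
  proof (rule modificationI_lax[OF w])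
    show "weak_natural w K L (mdom ?R)" "weak_natural w K L (mcod ?R)"
      using comp_transf_natural[OF K L g(1) d(1)] comp_transf_natural[OF K L g(2) d(2)] by (simp_all add: facts)
  next
    fix f assume f: "f \<in> Mor K"
    let ?X = "Dom (und K) f" and ?Y = "Cod (und K) f"
    let ?Mf = "?I (F1 (tdom (mdom \<Gamma>)) f)" and ?Nf = "?I (F1 (tcod (mdom \<Gamma>)) f)"
      and ?Pf = "?I (F1 (tcod (mdom \<Delta>)) f)"
    let ?GX = "mcmp \<Gamma> ?X" and ?GY = "mcmp \<Gamma> ?Y" and ?DX = "mcmp \<Delta> ?X" and ?DY = "mcmp \<Delta> ?Y"
    let ?a = "t2 (mdom \<Gamma>) f" and ?a' = "t2 (mcod \<Gamma>) f" and ?b = "t2 (mdom \<Delta>) f" and ?b' = "t2 (mcod \<Delta>) f"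
    let ?qY = "?I (t1 (mdom \<Delta>) ?Y)" and ?qY' = "?I (t1 (mcod \<Delta>) ?Y)"
      and ?pX = "?I (t1 (mdom \<Gamma>) ?X)" and ?pX' = "?I (t1 (mcod \<Gamma>) ?X)"
    have g': "?c (?h ?GY ?Mf) ?a = ?c ?a' (?h ?Nf ?GX)"
      by (rule modification_natural[OF \<Gamma> f w])
    have d': "?c (?h ?DY ?Nf) ?b = ?c ?b' (?h ?Pf ?DX)"
      using modification_natural[OF \<Delta> f w] by (simp add: facts)
    \<comment> \<open>The cell \<open>?DY\<close> absorbs an identity on either side. Composed
      horizontally with it, the square of \<open>\<Gamma>\<close> therefore shows a whiskering by
      the source of \<open>\<Delta>\<close> at one end and by its target at the other.\<close>
    have s1: "?c (?h ?DY (?h ?GY ?Mf)) (?h ?qY ?a) = ?c (?h ?qY' ?a') (?h ?DY (?h ?Nf ?GX))"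
    proof -
      have "?h (?c ?DY ?qY) (?c (?h ?GY ?Mf) ?a) = ?c (?h ?DY (?h ?GY ?Mf)) (?h ?qY ?a)"
        by (rule interchange) (use f in \<open>simp_all add: facts\<close>)
      moreover have "?h (?c ?qY' ?DY) (?c ?a' (?h ?Nf ?GX)) = ?c (?h ?qY' ?a') (?h ?DY (?h ?Nf ?GX))"
        by (rule interchange) (use f in \<open>simp_all add: facts\<close>)
      moreover have "?c ?DY ?qY = ?DY" "?c ?qY' ?DY = ?DY"
        using f by (simp_all add: facts)
      ultimately show ?thesis using g' by simp
    qed
    have s2: "?c (?h (?h ?DY ?Nf) ?GX) (?h ?b ?pX) = ?c (?h ?b' ?pX') (?h (?h ?Pf ?DX) ?GX)"
    proof -
      have "?h (?c (?h ?DY ?Nf) ?b) (?c ?GX ?pX) = ?c (?h (?h ?DY ?Nf) ?GX) (?h ?b ?pX)"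
        by (rule interchange) (use f in \<open>simp_all add: facts\<close>)
      moreover have "?h (?c ?b' (?h ?Pf ?DX)) (?c ?pX' ?GX) = ?c (?h ?b' ?pX') (?h (?h ?Pf ?DX) ?GX)"
        by (rule interchange) (use f in \<open>simp_all add: facts\<close>)
      moreover have "?c ?GX ?pX = ?GX" "?c ?pX' ?GX = ?GX"
        using f by (simp_all add: facts)
      ultimately show ?thesis using d' by simp
    qed
    have a1: "?h (?h ?DY ?GY) ?Mf = ?h ?DY (?h ?GY ?Mf)" "?h (?h ?DY ?Nf) ?GX = ?h ?DY (?h ?Nf ?GX)"
      "?h (?h ?Pf ?DX) ?GX = ?h ?Pf (?h ?DX ?GX)"
      by (rule hcomp_assoc; use f in \<open>simp add: facts\<close>)+
    have "?c (?h ?DY (?h ?GY ?Mf)) (?c (?h ?qY ?a) (?h ?b ?pX)) = ?c (?c (?h ?DY (?h ?GY ?Mf)) (?h ?qY ?a)) (?h ?b ?pX)"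
      by (rule category_assoc[OF Cv, symmetric]) (use f in \<open>simp_all add: facts\<close>)
    also have "\<dots> = ?c (?c (?h ?qY' ?a') (?h ?DY (?h ?Nf ?GX))) (?h ?b ?pX)"
      by (simp only: s1)
    also have "\<dots> = ?c (?h ?qY' ?a') (?c (?h ?DY (?h ?Nf ?GX)) (?h ?b ?pX))"
      by (rule category_assoc[OF Cv]) (use f in \<open>simp_all add: facts\<close>)
    also have "\<dots> = ?c (?h ?qY' ?a') (?c (?h ?b' ?pX') (?h (?h ?Pf ?DX) ?GX))"
      by (simp only: s2 a1(2)[symmetric])
    also have "\<dots> = ?c (?c (?h ?qY' ?a') (?h ?b' ?pX')) (?h ?Pf (?h ?DX ?GX))"
      unfolding a1 by (rule category_assoc[OF Cv, symmetric]) (use f in \<open>simp_all add: facts\<close>)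
    finally show "?c (?h (mcmp ?R ?Y) (?I (F1 (tdom (mdom ?R)) f))) (t2 (mdom ?R) f) =
       ?c (t2 (mcod ?R) f) (?h (?I (F1 (tcod (mdom ?R)) f)) (mcmp ?R ?X))"
      using f K w a1 by simp
  qed (simp_all add: facts)
qed

lemma modif_collapse: "\<lparr>mdom = mdom \<Gamma>, mcod = mcod \<Gamma>, mcmp = mcmp \<Gamma>\<rparr> = \<Gamma>"
  by simp

lemma modification_co:
  assumes "two_category K" "two_category L" "modification Colax K L \<Gamma>"
  shows "modification Lax (co_two_cat K) (co_two_cat L) \<lparr>mdom = mcod \<Gamma>, mcod = mdom \<Gamma>, mcmp = mcmp \<Gamma>\<rparr>"
  using assms(3) modification_Colax_iff[OF assms(1,2), of "mdom \<Gamma>" "mcod \<Gamma>" "mcmp \<Gamma>"]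
  unfolding modif_collapse by blast

lemma id_modification:
  assumes "two_category K" "two_category L" "weak_natural w K L \<phi>"
  shows "modification w K L \<lparr>mdom = \<phi>, mcod = \<phi>, mcmp = (\<lambda>X\<in>Ob K. Ide (vert L) (t1 \<phi> X))\<rparr>"
proof (cases "w = Colax")
  case True
  then show ?thesis
    using assms id_modification_lax[of Lax "co_two_cat K" "co_two_cat L" \<phi>]
    by (simp add: modification_Colax_iff weak_natural_Colax_iff)
qed (use assms id_modification_lax in blast)

lemma vcomp_modification:
  assumes "two_category K" "two_category L"
    "modification w K L \<Gamma>" "modification w K L \<Delta>" "mdom \<Delta> = mcod \<Gamma>"
  shows "modification w K L \<lparr>mdom = mdom \<Gamma>, mcod = mcod \<Delta>,
    mcmp = (\<lambda>X\<in>Ob K. Comp (vert L) (mcmp \<Delta> X) (mcmp \<Gamma> X))\<rparr>"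
proof (cases "w = Colax")
  case True
  then show ?thesis
    using assms vcomp_modification_lax[OF _ _ _ modification_co[OF assms(1,2), of \<Delta>] modification_co[OF assms(1,2), of \<Gamma>]]
    by (simp add: modification_Colax_iff)
qed (use assms vcomp_modification_lax in blast)

lemma hcomp_modification:
  assumes "two_category K" "two_category L"
    "modification w K L \<Gamma>" "modification w K L \<Delta>" "tdom (mdom \<Delta>) = tcod (mdom \<Gamma>)"
  shows "modification w K L \<lparr>mdom = comp_transf w K L (mdom \<Delta>) (mdom \<Gamma>),
    mcod = comp_transf w K L (mcod \<Delta>) (mcod \<Gamma>), mcmp = (\<lambda>X\<in>Ob K. hcomp L (mcmp \<Delta> X) (mcmp \<Gamma> X))\<rparr>"
proof (cases "w = Colax")
  case True
  then show ?thesis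
    using assms modificationD(3,4)[OF assms(3)] modificationD(3,4)[OF assms(4)]
      hcomp_modification_lax[OF _ _ _ modification_co[OF assms(1,2), of \<Gamma>] modification_co[OF assms(1,2), of \<Delta>]]
    by (simp add: modification_Colax_iff comp_transf_Colax)
qed (use assms hcomp_modification_lax in blast)

section \<open>Unit and associativity laws for weak transformations\<close>

lemma comp_transf_id_lax:
  assumes w: "w \<noteq> Colax" and K: "two_category K" and L: "two_category L" and \<phi>: "weak_natural w K L \<phi>"
  shows "comp_transf w K L \<phi> (id_transf K L (tdom \<phi>)) = \<phi>"
    "comp_transf w K L (id_transf K L (tcod \<phi>)) \<phi> = \<phi>"
proof -
  have Cu: "category (und L)" and Cv: "category (vert L)" using L by simp_all
  note n = weak_naturalD[OF \<phi>]
  note facts = K L w n weak_natural_boundary(1,2)[OF \<phi> _ w] two_functorD[OF n(1)] two_functorD[OF n(2)] category_assoc[OF Cu]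
  show "comp_transf w K L \<phi> (id_transf K L (tdom \<phi>)) = \<phi>"
    by (rule transf_eqI[OF comp_transf_natural[OF K L id_transf_natural[OF K L] \<phi>] \<phi>]) (simp_all add: facts)
  show "comp_transf w K L (id_transf K L (tcod \<phi>)) \<phi> = \<phi>"
    by (rule transf_eqI[OF comp_transf_natural[OF K L \<phi> id_transf_natural[OF K L]] \<phi>]) (simp_all add: facts)
qed

lemma comp_transf_id:
  assumes "two_category K" "two_category L" "weak_natural w K L \<phi>"
  shows "comp_transf w K L \<phi> (id_transf K L (tdom \<phi>)) = \<phi>"
    "comp_transf w K L (id_transf K L (tcod \<phi>)) \<phi> = \<phi>"
  using assms comp_transf_id_lax[of w K L \<phi>] comp_transf_id_lax[of Lax "co_two_cat K" "co_two_cat L" \<phi>]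
  by (cases "w = Colax"; simp add: weak_natural_Colax_iff comp_transf_Colax id_transf_co[of K L])+

text \<open>Both sides paste the same three squares in a row. Once the whiskerings are distributed,
  only associativity of vertical and horizontal composition separates them.\<close>

lemma comp_transf_assoc_lax:
  assumes w: "w \<noteq> Colax" and K: "two_category K" and L: "two_category L"
    and \<phi>: "weak_natural w K L \<phi>" and \<psi>: "weak_natural w K L \<psi>" and \<chi>: "weak_natural w K L \<chi>"
    and m: "tdom \<psi> = tcod \<phi>" "tdom \<chi> = tcod \<psi>"
  shows "comp_transf w K L (comp_transf w K L \<chi> \<psi>) \<phi> = comp_transf w K L \<chi> (comp_transf w K L \<psi> \<phi>)"
proof -
  have Cu: "category (und L)" and Cv: "category (vert L)" using L by simp_all
  note n = weak_naturalD[OF \<phi>] weak_naturalD[OF \<psi>] weak_naturalD[OF \<chi>]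
  note facts = K L w m n weak_natural_boundary(1,2)[OF \<phi> _ w] weak_natural_boundary(1,2)[OF \<psi> _ w]
    weak_natural_boundary(1,2)[OF \<chi> _ w]
    two_functorD[OF n(1)] two_functorD[OF n(2)] two_functorD[OF weak_naturalD(2)[OF \<psi>]]
    two_functorD[OF weak_naturalD(2)[OF \<chi>]] category_assoc[OF Cu]
  let ?c = "Comp (vert L)" and ?h = "hcomp L" and ?I = "Ide (vert L)"
  show ?thesis
  proof (rule transf_eqI)
    show "weak_natural w K L (comp_transf w K L (comp_transf w K L \<chi> \<psi>) \<phi>)"
      "weak_natural w K L (comp_transf w K L \<chi> (comp_transf w K L \<psi> \<phi>))"
      using K L \<phi> \<psi> \<chi> m by (simp_all add: comp_transf_natural)
    fix f assume f: "f \<in> Mor K"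
    let ?X = "Dom (und K) f" and ?Y = "Cod (und K) f"
    let ?pX = "?I (t1 \<phi> ?X)" and ?qX = "?I (t1 \<psi> ?X)" and ?qY = "?I (t1 \<psi> ?Y)" and ?rY = "?I (t1 \<chi> ?Y)"
    let ?a = "t2 \<phi> f" and ?b = "t2 \<psi> f" and ?d = "t2 \<chi> f"
    have s1: "?h (?c (?h ?rY ?b) (?h ?d ?qX)) ?pX = ?c (?h (?h ?rY ?b) ?pX) (?h (?h ?d ?qX) ?pX)"
    proof -
      have "?h (?c (?h ?rY ?b) (?h ?d ?qX)) (?c ?pX ?pX) = ?c (?h (?h ?rY ?b) ?pX) (?h (?h ?d ?qX) ?pX)"
        by (rule interchange) (use f in \<open>simp_all add: facts\<close>)
      then show ?thesis using f by (simp add: facts)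
    qed
    have s2: "?h ?rY (?c (?h ?qY ?a) (?h ?b ?pX)) = ?c (?h ?rY (?h ?qY ?a)) (?h ?rY (?h ?b ?pX))"
    proof -
      have "?h (?c ?rY ?rY) (?c (?h ?qY ?a) (?h ?b ?pX)) = ?c (?h ?rY (?h ?qY ?a)) (?h ?rY (?h ?b ?pX))"
        by (rule interchange) (use f in \<open>simp_all add: facts\<close>)
      then show ?thesis using f by (simp add: facts)
    qed
    have a1: "?h (?h ?rY ?b) ?pX = ?h ?rY (?h ?b ?pX)" "?h (?h ?d ?qX) ?pX = ?h ?d (?h ?qX ?pX)"
      "?h (?h ?rY ?qY) ?a = ?h ?rY (?h ?qY ?a)"
      by (rule hcomp_assoc; use f in \<open>simp add: facts\<close>)+
    have "?c (?h ?rY (?h ?qY ?a)) (?c (?h ?rY (?h ?b ?pX)) (?h ?d (?h ?qX ?pX))) =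
        ?c (?c (?h ?rY (?h ?qY ?a)) (?h ?rY (?h ?b ?pX))) (?h ?d (?h ?qX ?pX))"
      by (rule category_assoc[OF Cv, symmetric]) (use f in \<open>simp_all add: facts\<close>)
    then show "t2 (comp_transf w K L (comp_transf w K L \<chi> \<psi>) \<phi>) f =
        t2 (comp_transf w K L \<chi> (comp_transf w K L \<psi> \<phi>)) f"
      using f s1 s2 a1 by (simp add: facts)
  qed (simp_all add: facts)
qed

lemma comp_transf_assoc:
  assumes "two_category K" "two_category L"
    "weak_natural w K L \<phi>" "weak_natural w K L \<psi>" "weak_natural w K L \<chi>" "tdom \<psi> = tcod \<phi>" "tdom \<chi> = tcod \<psi>"
  shows "comp_transf w K L (comp_transf w K L \<chi> \<psi>) \<phi> = comp_transf w K L \<chi> (comp_transf w K L \<psi> \<phi>)"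
  using assms comp_transf_assoc_lax[of w K L \<phi> \<psi> \<chi>] comp_transf_assoc_lax[of Lax "co_two_cat K" "co_two_cat L" \<phi> \<psi> \<chi>]
  by (cases "w = Colax"; simp add: weak_natural_Colax_iff comp_transf_Colax)

section \<open>The 2-category of models, transformations and modifications\<close>

lemma transf_two_cat_sel:
  "Ob (transf_two_cat w K L \<M> \<T>) = {M \<in> \<M>. two_functor K L M}"
  "Mor (transf_two_cat w K L \<M> \<T>) = {\<phi> \<in> \<T>. weak_natural w K L \<phi> \<and> tdom \<phi> \<in> \<M> \<and> tcod \<phi> \<in> \<M>}"
  "Dom (und (transf_two_cat w K L \<M> \<T>)) = tdom" "Cod (und (transf_two_cat w K L \<M> \<T>)) = tcod"
  "Ide (und (transf_two_cat w K L \<M> \<T>)) = id_transf K L"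
  "Comp (und (transf_two_cat w K L \<M> \<T>)) = comp_transf w K L"
  "Obj (vert (transf_two_cat w K L \<M> \<T>)) = {\<phi> \<in> \<T>. weak_natural w K L \<phi> \<and> tdom \<phi> \<in> \<M> \<and> tcod \<phi> \<in> \<M>}"
  "Cell (transf_two_cat w K L \<M> \<T>) = {\<Gamma>. modification w K L \<Gamma> \<and>
     mdom \<Gamma> \<in> {\<phi> \<in> \<T>. weak_natural w K L \<phi> \<and> tdom \<phi> \<in> \<M> \<and> tcod \<phi> \<in> \<M>} \<and>
     mcod \<Gamma> \<in> {\<phi> \<in> \<T>. weak_natural w K L \<phi> \<and> tdom \<phi> \<in> \<M> \<and> tcod \<phi> \<in> \<M>}}"
  "Dom (vert (transf_two_cat w K L \<M> \<T>)) = mdom" "Cod (vert (transf_two_cat w K L \<M> \<T>)) = mcod"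
  "Ide (vert (transf_two_cat w K L \<M> \<T>)) \<phi> = \<lparr>mdom = \<phi>, mcod = \<phi>, mcmp = (\<lambda>X\<in>Ob K. Ide (vert L) (t1 \<phi> X))\<rparr>"
  "Comp (vert (transf_two_cat w K L \<M> \<T>)) \<Delta> \<Gamma> = \<lparr>mdom = mdom \<Gamma>, mcod = mcod \<Delta>,
     mcmp = (\<lambda>X\<in>Ob K. Comp (vert L) (mcmp \<Delta> X) (mcmp \<Gamma> X))\<rparr>"
  "hcomp (transf_two_cat w K L \<M> \<T>) \<Delta> \<Gamma> = \<lparr>mdom = comp_transf w K L (mdom \<Delta>) (mdom \<Gamma>),
     mcod = comp_transf w K L (mcod \<Delta>) (mcod \<Gamma>), mcmp = (\<lambda>X\<in>Ob K. hcomp L (mcmp \<Delta> X) (mcmp \<Gamma> X))\<rparr>"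
  by (simp_all add: transf_two_cat_def Let_def)

lemma two_category_transf:
  assumes K: "two_category K" and L: "two_category L"
    and id: "\<And>M. M \<in> \<M> \<Longrightarrow> two_functor K L M \<Longrightarrow> id_transf K L M \<in> \<T>"
    and comp: "\<And>\<phi> \<psi>. \<phi> \<in> \<T> \<Longrightarrow> \<psi> \<in> \<T> \<Longrightarrow> weak_natural w K L \<phi> \<Longrightarrow> weak_natural w K L \<psi> \<Longrightarrow>
       tdom \<psi> = tcod \<phi> \<Longrightarrow> comp_transf w K L \<psi> \<phi> \<in> \<T>"
  shows "two_category (transf_two_cat w K L \<M> \<T>)"
proof (rule two_categoryI; (unfold transf_two_cat_sel)?)
  have Cu: "category (und L)" and Cv: "category (vert L)" using L by simp_all
  show "category (und (transf_two_cat w K L \<M> \<T>))"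
    unfolding category_def transf_two_cat_sel
    using id comp K L by (auto simp: id_transf_natural comp_transf_natural comp_transf_id comp_transf_assoc)
  show "category (vert (transf_two_cat w K L \<M> \<T>))"
    unfolding category_def transf_two_cat_sel
    using K L
    by (auto simp: id_modification vcomp_modification category_assoc[OF Cv]
       modification_undef intro!: modif.equality ext)
next
  fix \<alpha> \<beta>
  assume "\<alpha> \<in> {\<Gamma>. modification w K L \<Gamma> \<and>
     mdom \<Gamma> \<in> {\<phi> \<in> \<T>. weak_natural w K L \<phi> \<and> tdom \<phi> \<in> \<M> \<and> tcod \<phi> \<in> \<M>} \<and>
     mcod \<Gamma> \<in> {\<phi> \<in> \<T>. weak_natural w K L \<phi> \<and> tdom \<phi> \<in> \<M> \<and> tcod \<phi> \<in> \<M>}}"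
    "\<beta> \<in> {\<Gamma>. modification w K L \<Gamma> \<and>
     mdom \<Gamma> \<in> {\<phi> \<in> \<T>. weak_natural w K L \<phi> \<and> tdom \<phi> \<in> \<M> \<and> tcod \<phi> \<in> \<M>} \<and>
     mcod \<Gamma> \<in> {\<phi> \<in> \<T>. weak_natural w K L \<phi> \<and> tdom \<phi> \<in> \<M> \<and> tcod \<phi> \<in> \<M>}}"
    "tdom (mdom \<beta>) = tcod (mdom \<alpha>)"
  then show "\<lparr>mdom = comp_transf w K L (mdom \<beta>) (mdom \<alpha>), mcod = comp_transf w K L (mcod \<beta>) (mcod \<alpha>),
        mcmp = \<lambda>X\<in>Ob K. hcomp L (mcmp \<beta> X) (mcmp \<alpha> X)\<rparr>
       \<in> {\<Gamma>. modification w K L \<Gamma> \<and>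
          mdom \<Gamma> \<in> {\<phi> \<in> \<T>. weak_natural w K L \<phi> \<and> tdom \<phi> \<in> \<M> \<and> tcod \<phi> \<in> \<M>} \<and>
          mcod \<Gamma> \<in> {\<phi> \<in> \<T>. weak_natural w K L \<phi> \<and> tdom \<phi> \<in> \<M> \<and> tcod \<phi> \<in> \<M>}} \<and>
      mdom \<lparr>mdom = comp_transf w K L (mdom \<beta>) (mdom \<alpha>), mcod = comp_transf w K L (mcod \<beta>) (mcod \<alpha>),
        mcmp = \<lambda>X\<in>Ob K. hcomp L (mcmp \<beta> X) (mcmp \<alpha> X)\<rparr> = comp_transf w K L (mdom \<beta>) (mdom \<alpha>) \<and>
      mcod \<lparr>mdom = comp_transf w K L (mdom \<beta>) (mdom \<alpha>), mcod = comp_transf w K L (mcod \<beta>) (mcod \<alpha>),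
        mcmp = \<lambda>X\<in>Ob K. hcomp L (mcmp \<beta> X) (mcmp \<alpha> X)\<rparr> = comp_transf w K L (mcod \<beta>) (mcod \<alpha>)"
    using K L by (auto simp: hcomp_modification comp_transf_natural intro!: comp)
next
  fix \<alpha>
  assume "\<alpha> \<in> {\<Gamma>. modification w K L \<Gamma> \<and>
     mdom \<Gamma> \<in> {\<phi> \<in> \<T>. weak_natural w K L \<phi> \<and> tdom \<phi> \<in> \<M> \<and> tcod \<phi> \<in> \<M>} \<and>
     mcod \<Gamma> \<in> {\<phi> \<in> \<T>. weak_natural w K L \<phi> \<and> tdom \<phi> \<in> \<M> \<and> tcod \<phi> \<in> \<M>}}"
  then have a: "modification w K L \<alpha>" by simp
  note n = weak_naturalD[OF modificationD(1)[OF a]]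
  have i: "comp_transf w K L (mdom \<alpha>) (id_transf K L (tdom (mdom \<alpha>))) = mdom \<alpha>"
    "comp_transf w K L (mcod \<alpha>) (id_transf K L (tdom (mdom \<alpha>))) = mcod \<alpha>"
    "comp_transf w K L (id_transf K L (tcod (mdom \<alpha>))) (mdom \<alpha>) = mdom \<alpha>"
    "comp_transf w K L (id_transf K L (tcod (mdom \<alpha>))) (mcod \<alpha>) = mcod \<alpha>"
    using comp_transf_id[OF K L modificationD(1)[OF a]] comp_transf_id[OF K L modificationD(2)[OF a]]
      modificationD(3,4)[OF a] by simp_all
  show "\<lparr>mdom = comp_transf w K L (mdom \<alpha>) (mdom \<lparr>mdom = id_transf K L (tdom (mdom \<alpha>)), mcod = id_transf K L (tdom (mdom \<alpha>)),
           mcmp = \<lambda>X\<in>Ob K. Ide (vert L) (t1 (id_transf K L (tdom (mdom \<alpha>))) X)\<rparr>),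
        mcod = comp_transf w K L (mcod \<alpha>) (mcod \<lparr>mdom = id_transf K L (tdom (mdom \<alpha>)), mcod = id_transf K L (tdom (mdom \<alpha>)),
           mcmp = \<lambda>X\<in>Ob K. Ide (vert L) (t1 (id_transf K L (tdom (mdom \<alpha>))) X)\<rparr>),
        mcmp = \<lambda>X\<in>Ob K. hcomp L (mcmp \<alpha> X) (mcmp \<lparr>mdom = id_transf K L (tdom (mdom \<alpha>)), mcod = id_transf K L (tdom (mdom \<alpha>)),
           mcmp = \<lambda>X\<in>Ob K. Ide (vert L) (t1 (id_transf K L (tdom (mdom \<alpha>))) X)\<rparr> X)\<rparr> = \<alpha> \<and>
     \<lparr>mdom = comp_transf w K L (mdom \<lparr>mdom = id_transf K L (tcod (mdom \<alpha>)), mcod = id_transf K L (tcod (mdom \<alpha>)),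
           mcmp = \<lambda>X\<in>Ob K. Ide (vert L) (t1 (id_transf K L (tcod (mdom \<alpha>))) X)\<rparr>) (mdom \<alpha>),
        mcod = comp_transf w K L (mcod \<lparr>mdom = id_transf K L (tcod (mdom \<alpha>)), mcod = id_transf K L (tcod (mdom \<alpha>)),
           mcmp = \<lambda>X\<in>Ob K. Ide (vert L) (t1 (id_transf K L (tcod (mdom \<alpha>))) X)\<rparr>) (mcod \<alpha>),
        mcmp = \<lambda>X\<in>Ob K. hcomp L (mcmp \<lparr>mdom = id_transf K L (tcod (mdom \<alpha>)), mcod = id_transf K L (tcod (mdom \<alpha>)),
           mcmp = \<lambda>X\<in>Ob K. Ide (vert L) (t1 (id_transf K L (tcod (mdom \<alpha>))) X)\<rparr> X) (mcmp \<alpha> X)\<rparr> = \<alpha>"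
    by (auto intro!: modif.equality simp: i L a restrict_def fun_eq_iff modification_undef[OF a] n modificationD[OF a])
next
  have Cu: "category (und L)" using L by simp
  fix f g
  assume "f \<in> {\<phi> \<in> \<T>. weak_natural w K L \<phi> \<and> tdom \<phi> \<in> \<M> \<and> tcod \<phi> \<in> \<M>}"
    "g \<in> {\<phi> \<in> \<T>. weak_natural w K L \<phi> \<and> tdom \<phi> \<in> \<M> \<and> tcod \<phi> \<in> \<M>}" "tdom g = tcod f"
  then show "\<lparr>mdom = comp_transf w K L (mdom \<lparr>mdom = g, mcod = g, mcmp = \<lambda>X\<in>Ob K. Ide (vert L) (t1 g X)\<rparr>)
           (mdom \<lparr>mdom = f, mcod = f, mcmp = \<lambda>X\<in>Ob K. Ide (vert L) (t1 f X)\<rparr>),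
        mcod = comp_transf w K L (mcod \<lparr>mdom = g, mcod = g, mcmp = \<lambda>X\<in>Ob K. Ide (vert L) (t1 g X)\<rparr>)
           (mcod \<lparr>mdom = f, mcod = f, mcmp = \<lambda>X\<in>Ob K. Ide (vert L) (t1 f X)\<rparr>),
        mcmp = \<lambda>X\<in>Ob K. hcomp L (mcmp \<lparr>mdom = g, mcod = g, mcmp = \<lambda>X\<in>Ob K. Ide (vert L) (t1 g X)\<rparr> X)
           (mcmp \<lparr>mdom = f, mcod = f, mcmp = \<lambda>X\<in>Ob K. Ide (vert L) (t1 f X)\<rparr> X)\<rparr> =
       \<lparr>mdom = comp_transf w K L g f, mcod = comp_transf w K L g f,
        mcmp = \<lambda>X\<in>Ob K. Ide (vert L) (t1 (comp_transf w K L g f) X)\<rparr>"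
    using L by (auto simp: restrict_def fun_eq_iff)
next
  fix \<alpha> \<beta> \<gamma>
  assume "\<alpha> \<in> {\<Gamma>. modification w K L \<Gamma> \<and>
     mdom \<Gamma> \<in> {\<phi> \<in> \<T>. weak_natural w K L \<phi> \<and> tdom \<phi> \<in> \<M> \<and> tcod \<phi> \<in> \<M>} \<and>
     mcod \<Gamma> \<in> {\<phi> \<in> \<T>. weak_natural w K L \<phi> \<and> tdom \<phi> \<in> \<M> \<and> tcod \<phi> \<in> \<M>}}" "\<beta> \<in> {\<Gamma>. modification w K L \<Gamma> \<and>
     mdom \<Gamma> \<in> {\<phi> \<in> \<T>. weak_natural w K L \<phi> \<and> tdom \<phi> \<in> \<M> \<and> tcod \<phi> \<in> \<M>} \<and>
     mcod \<Gamma> \<in> {\<phi> \<in> \<T>. weak_natural w K L \<phi> \<and> tdom \<phi> \<in> \<M> \<and> tcod \<phi> \<in> \<M>}}" "\<gamma> \<in> {\<Gamma>. modification w K L \<Gamma> \<and>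
     mdom \<Gamma> \<in> {\<phi> \<in> \<T>. weak_natural w K L \<phi> \<and> tdom \<phi> \<in> \<M> \<and> tcod \<phi> \<in> \<M>} \<and>
     mcod \<Gamma> \<in> {\<phi> \<in> \<T>. weak_natural w K L \<phi> \<and> tdom \<phi> \<in> \<M> \<and> tcod \<phi> \<in> \<M>}}" and m: "tdom (mdom \<beta>) = tcod (mdom \<alpha>)" "tdom (mdom \<gamma>) = tcod (mdom \<beta>)"
  then have a: "modification w K L \<alpha>" "modification w K L \<beta>" "modification w K L \<gamma>" by blast+
  note d = modificationD[OF a(1)] modificationD[OF a(2)] modificationD[OF a(3)]
  have 1: "comp_transf w K L (mdom \<gamma>) (comp_transf w K L (mdom \<beta>) (mdom \<alpha>)) =
      comp_transf w K L (comp_transf w K L (mdom \<gamma>) (mdom \<beta>)) (mdom \<alpha>)"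
    by (rule comp_transf_assoc[symmetric]) (use K L in \<open>simp_all add: d m\<close>)
  have 2: "comp_transf w K L (mcod \<gamma>) (comp_transf w K L (mcod \<beta>) (mcod \<alpha>)) =
      comp_transf w K L (comp_transf w K L (mcod \<gamma>) (mcod \<beta>)) (mcod \<alpha>)"
    by (rule comp_transf_assoc[symmetric]) (use K L in \<open>simp_all add: d m\<close>)
  have 3: "hcomp L (mcmp \<gamma> X) (hcomp L (mcmp \<beta> X) (mcmp \<alpha> X)) =
      hcomp L (hcomp L (mcmp \<gamma> X) (mcmp \<beta> X)) (mcmp \<alpha> X)" if "X \<in> Ob K" for X
    by (rule hcomp_assoc[symmetric, OF L])
      (simp_all add: d m that weak_naturalD[OF d(1)] weak_naturalD[OF d(8)] weak_naturalD[OF d(15)])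
  show "\<lparr>mdom = comp_transf w K L (mdom \<gamma>) (mdom \<lparr>mdom = comp_transf w K L (mdom \<beta>) (mdom \<alpha>), mcod = comp_transf w K L (mcod \<beta>) (mcod \<alpha>),
        mcmp = \<lambda>X\<in>Ob K. hcomp L (mcmp \<beta> X) (mcmp \<alpha> X)\<rparr>), mcod = comp_transf w K L (mcod \<gamma>) (mcod \<lparr>mdom = comp_transf w K L (mdom \<beta>) (mdom \<alpha>), mcod = comp_transf w K L (mcod \<beta>) (mcod \<alpha>),
        mcmp = \<lambda>X\<in>Ob K. hcomp L (mcmp \<beta> X) (mcmp \<alpha> X)\<rparr>),
        mcmp = \<lambda>X\<in>Ob K. hcomp L (mcmp \<gamma> X) (mcmp \<lparr>mdom = comp_transf w K L (mdom \<beta>) (mdom \<alpha>), mcod = comp_transf w K L (mcod \<beta>) (mcod \<alpha>),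
        mcmp = \<lambda>X\<in>Ob K. hcomp L (mcmp \<beta> X) (mcmp \<alpha> X)\<rparr> X)\<rparr> =
      \<lparr>mdom = comp_transf w K L (mdom \<lparr>mdom = comp_transf w K L (mdom \<gamma>) (mdom \<beta>), mcod = comp_transf w K L (mcod \<gamma>) (mcod \<beta>),
        mcmp = \<lambda>X\<in>Ob K. hcomp L (mcmp \<gamma> X) (mcmp \<beta> X)\<rparr>) (mdom \<alpha>), mcod = comp_transf w K L (mcod \<lparr>mdom = comp_transf w K L (mdom \<gamma>) (mdom \<beta>), mcod = comp_transf w K L (mcod \<gamma>) (mcod \<beta>),
        mcmp = \<lambda>X\<in>Ob K. hcomp L (mcmp \<gamma> X) (mcmp \<beta> X)\<rparr>) (mcod \<alpha>),
        mcmp = \<lambda>X\<in>Ob K. hcomp L (mcmp \<lparr>mdom = comp_transf w K L (mdom \<gamma>) (mdom \<beta>), mcod = comp_transf w K L (mcod \<gamma>) (mcod \<beta>),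
        mcmp = \<lambda>X\<in>Ob K. hcomp L (mcmp \<gamma> X) (mcmp \<beta> X)\<rparr> X) (mcmp \<alpha> X)\<rparr>"
    by (rule modif.equality) (auto simp: 1 2 3 intro!: ext)
next
  fix \<alpha> \<alpha>' \<beta> \<beta>'
  assume "\<alpha> \<in> {\<Gamma>. modification w K L \<Gamma> \<and>
     mdom \<Gamma> \<in> {\<phi> \<in> \<T>. weak_natural w K L \<phi> \<and> tdom \<phi> \<in> \<M> \<and> tcod \<phi> \<in> \<M>} \<and>
     mcod \<Gamma> \<in> {\<phi> \<in> \<T>. weak_natural w K L \<phi> \<and> tdom \<phi> \<in> \<M> \<and> tcod \<phi> \<in> \<M>}}" "\<alpha>' \<in> {\<Gamma>. modification w K L \<Gamma> \<and>
     mdom \<Gamma> \<in> {\<phi> \<in> \<T>. weak_natural w K L \<phi> \<and> tdom \<phi> \<in> \<M> \<and> tcod \<phi> \<in> \<M>} \<and>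
     mcod \<Gamma> \<in> {\<phi> \<in> \<T>. weak_natural w K L \<phi> \<and> tdom \<phi> \<in> \<M> \<and> tcod \<phi> \<in> \<M>}}" "\<beta> \<in> {\<Gamma>. modification w K L \<Gamma> \<and>
     mdom \<Gamma> \<in> {\<phi> \<in> \<T>. weak_natural w K L \<phi> \<and> tdom \<phi> \<in> \<M> \<and> tcod \<phi> \<in> \<M>} \<and>
     mcod \<Gamma> \<in> {\<phi> \<in> \<T>. weak_natural w K L \<phi> \<and> tdom \<phi> \<in> \<M> \<and> tcod \<phi> \<in> \<M>}}" "\<beta>' \<in> {\<Gamma>. modification w K L \<Gamma> \<and>
     mdom \<Gamma> \<in> {\<phi> \<in> \<T>. weak_natural w K L \<phi> \<and> tdom \<phi> \<in> \<M> \<and> tcod \<phi> \<in> \<M>} \<and>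
     mcod \<Gamma> \<in> {\<phi> \<in> \<T>. weak_natural w K L \<phi> \<and> tdom \<phi> \<in> \<M> \<and> tcod \<phi> \<in> \<M>}}"
    and m: "mdom \<alpha>' = mcod \<alpha>" "mdom \<beta>' = mcod \<beta>" "tdom (mdom \<beta>) = tcod (mdom \<alpha>)"
  then have a: "modification w K L \<alpha>" "modification w K L \<alpha>'" "modification w K L \<beta>" "modification w K L \<beta>'"
    by blast+
  note d = modificationD[OF a(1)] modificationD[OF a(2)] modificationD[OF a(3)] modificationD[OF a(4)]
  have 1: "hcomp L (Comp (vert L) (mcmp \<beta>' X) (mcmp \<beta> X)) (Comp (vert L) (mcmp \<alpha>' X) (mcmp \<alpha> X)) =
      Comp (vert L) (hcomp L (mcmp \<beta>' X) (mcmp \<alpha>' X)) (hcomp L (mcmp \<beta> X) (mcmp \<alpha> X))" if "X \<in> Ob K" for X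
    by (rule interchange[OF L])
      (simp_all add: d m that weak_naturalD[OF d(1)] weak_naturalD[OF d(15)])
  show "\<lparr>mdom = comp_transf w K L (mdom \<lparr>mdom = mdom \<beta>, mcod = mcod \<beta>',
        mcmp = \<lambda>X\<in>Ob K. Comp (vert L) (mcmp \<beta>' X) (mcmp \<beta> X)\<rparr>) (mdom \<lparr>mdom = mdom \<alpha>, mcod = mcod \<alpha>',
        mcmp = \<lambda>X\<in>Ob K. Comp (vert L) (mcmp \<alpha>' X) (mcmp \<alpha> X)\<rparr>), mcod = comp_transf w K L (mcod \<lparr>mdom = mdom \<beta>, mcod = mcod \<beta>',
        mcmp = \<lambda>X\<in>Ob K. Comp (vert L) (mcmp \<beta>' X) (mcmp \<beta> X)\<rparr>) (mcod \<lparr>mdom = mdom \<alpha>, mcod = mcod \<alpha>',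
        mcmp = \<lambda>X\<in>Ob K. Comp (vert L) (mcmp \<alpha>' X) (mcmp \<alpha> X)\<rparr>),
        mcmp = \<lambda>X\<in>Ob K. hcomp L (mcmp \<lparr>mdom = mdom \<beta>, mcod = mcod \<beta>',
        mcmp = \<lambda>X\<in>Ob K. Comp (vert L) (mcmp \<beta>' X) (mcmp \<beta> X)\<rparr> X) (mcmp \<lparr>mdom = mdom \<alpha>, mcod = mcod \<alpha>',
        mcmp = \<lambda>X\<in>Ob K. Comp (vert L) (mcmp \<alpha>' X) (mcmp \<alpha> X)\<rparr> X)\<rparr> =
      \<lparr>mdom = mdom \<lparr>mdom = comp_transf w K L (mdom \<beta>) (mdom \<alpha>), mcod = comp_transf w K L (mcod \<beta>) (mcod \<alpha>),
        mcmp = \<lambda>X\<in>Ob K. hcomp L (mcmp \<beta> X) (mcmp \<alpha> X)\<rparr>, mcod = mcod \<lparr>mdom = comp_transf w K L (mdom \<beta>') (mdom \<alpha>'), mcod = comp_transf w K L (mcod \<beta>') (mcod \<alpha>'),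
        mcmp = \<lambda>X\<in>Ob K. hcomp L (mcmp \<beta>' X) (mcmp \<alpha>' X)\<rparr>,
        mcmp = \<lambda>X\<in>Ob K. Comp (vert L) (mcmp \<lparr>mdom = comp_transf w K L (mdom \<beta>') (mdom \<alpha>'), mcod = comp_transf w K L (mcod \<beta>') (mcod \<alpha>'),
        mcmp = \<lambda>X\<in>Ob K. hcomp L (mcmp \<beta>' X) (mcmp \<alpha>' X)\<rparr> X) (mcmp \<lparr>mdom = comp_transf w K L (mdom \<beta>) (mdom \<alpha>), mcod = comp_transf w K L (mcod \<beta>) (mcod \<alpha>),
        mcmp = \<lambda>X\<in>Ob K. hcomp L (mcmp \<beta> X) (mcmp \<alpha> X)\<rparr> X)\<rparr>"
    by (rule modif.equality) (auto simp: 1 intro!: ext)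
qed (auto simp: modificationD)

section \<open>Powers\<close>

declare functorsD [simp del] functorsD' [simp del] is_nattrD [simp del] comp_functors [simp del]
  id_nattr_nattr [simp del] vcomp_nattr_nattr [simp del] hcomp_nattr_nattr [simp del] id_functors [simp del]

section \<open>2-categories of categories and their opposites\<close>

lemma Cat_on_sel [simp]:
  "Ob (Cat_on \<X>) = \<X>" "Mor (Cat_on \<X>) = {F. is_functor F \<and> fdom F \<in> \<X> \<and> fcod F \<in> \<X>}"
  "Dom (und (Cat_on \<X>)) = fdom" "Cod (und (Cat_on \<X>)) = fcod" "Ide (und (Cat_on \<X>)) = id_func"
  "Comp (und (Cat_on \<X>)) = comp_func"
  "Obj (vert (Cat_on \<X>)) = {F. is_functor F \<and> fdom F \<in> \<X> \<and> fcod F \<in> \<X>}"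
  "Cell (Cat_on \<X>) = {\<eta>. is_nattr \<eta> \<and> is_functor (ndom \<eta>) \<and> fdom (ndom \<eta>) \<in> \<X> \<and> fcod (ndom \<eta>) \<in> \<X> \<and>
     is_functor (ncod \<eta>) \<and> fdom (ncod \<eta>) \<in> \<X> \<and> fcod (ncod \<eta>) \<in> \<X>}"
  "Dom (vert (Cat_on \<X>)) = ndom" "Cod (vert (Cat_on \<X>)) = ncod" "Ide (vert (Cat_on \<X>)) = id_nattr"
  "Comp (vert (Cat_on \<X>)) = vcomp_nattr" "hcomp (Cat_on \<X>) = hcomp_nattr"
  by (auto simp: Cat_on_def Let_def)

lemma op_two_cat_sel [simp]:
  "Ob (op_two_cat K) = Ob K" "Mor (op_two_cat K) = Mor K"
  "Dom (und (op_two_cat K)) = Cod (und K)" "Cod (und (op_two_cat K)) = Dom (und K)"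
  "Ide (und (op_two_cat K)) = Ide (und K)" "Comp (und (op_two_cat K)) g f = Comp (und K) f g"
  "vert (op_two_cat K) = vert K" "hcomp (op_two_cat K) \<beta> \<alpha> = hcomp K \<alpha> \<beta>"
  by (simp_all add: op_two_cat_def)

text \<open>Reversing 1-cells exchanges the two factors of \<open>hcomp\<close>, so interchange is
  instantiated with the two pairs of cells swapped.\<close>

lemma two_category_op:
  assumes K: "two_category K"
  shows "two_category (op_two_cat K)"
proof -
  have Cu: "category (und K)" and Cv: "category (vert K)" using K by simp_all
  show ?thesis
  proof (rule two_categoryI)
    show "category (und (op_two_cat K))"
      unfolding category_def using Cu by (auto simp: category_assoc[OF Cu])
  next
    fix \<alpha> \<alpha>' \<beta> \<beta>'
    assume c: "\<alpha> \<in> Cell (op_two_cat K)" "\<alpha>' \<in> Cell (op_two_cat K)" "\<beta> \<in> Cell (op_two_cat K)" "\<beta>' \<in> Cell (op_two_cat K)"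
      "Dom (vert (op_two_cat K)) \<alpha>' = Cod (vert (op_two_cat K)) \<alpha>"
      "Dom (vert (op_two_cat K)) \<beta>' = Cod (vert (op_two_cat K)) \<beta>"
      "Dom (und (op_two_cat K)) (Dom (vert (op_two_cat K)) \<beta>) = Cod (und (op_two_cat K)) (Dom (vert (op_two_cat K)) \<alpha>)"
    then show "hcomp (op_two_cat K) (Comp (vert (op_two_cat K)) \<beta>' \<beta>) (Comp (vert (op_two_cat K)) \<alpha>' \<alpha>) =
       Comp (vert (op_two_cat K)) (hcomp (op_two_cat K) \<beta>' \<alpha>') (hcomp (op_two_cat K) \<beta> \<alpha>)"
      using interchange[OF K, of \<beta> \<beta>' \<alpha> \<alpha>'] by simp
  qed (use K Cv in \<open>auto simp: hcomp_assoc\<close>)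
qed

lemma is_functor_functors: "is_functor F \<longleftrightarrow> F \<in> functors (fdom F) (fcod F)"
  by (simp add: functors_def)

lemma comp_func_functor [simp]:
  assumes "is_functor F" "is_functor G" "fdom G = fcod F" "category (fdom F)"
  shows "is_functor (comp_func G F)"
  using comp_functors[of "fdom F" F "fcod F" G "fcod G"] assms by (simp add: functors_def)

lemma id_func_functor [simp]: "category A \<Longrightarrow> is_functor (id_func A)"
  using id_functors functorsD(1) by blast

lemma is_nattr_sel:
  assumes "is_nattr \<eta>"
  shows "is_functor (ndom \<eta>)" "is_functor (ncod \<eta>)" "fdom (ncod \<eta>) = fdom (ndom \<eta>)" "fcod (ncod \<eta>) = fcod (ndom \<eta>)"
  using assms by (auto simp: is_nattr_def)

lemma hcomp_nattr_is_nattr: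
  assumes "is_nattr \<eta>" "is_nattr \<theta>" "fdom (ndom \<theta>) = fcod (ndom \<eta>)"
    "category (fdom (ndom \<eta>))" "category (fcod (ndom \<eta>))" "category (fcod (ndom \<theta>))"
  shows "is_nattr (hcomp_nattr \<theta> \<eta>)"
  using hcomp_nattr_nattr[of "fdom (ndom \<eta>)" "fcod (ndom \<eta>)" "fcod (ndom \<theta>)" \<eta> \<theta>] assms
  by (simp add: functors_def is_nattr_sel)

lemma vcomp_nattr_is_nattr:
  assumes "is_nattr \<eta>" "is_nattr \<theta>" "ndom \<theta> = ncod \<eta>"
    "category (fdom (ndom \<eta>))" "category (fcod (ndom \<eta>))"
  shows "is_nattr (vcomp_nattr \<theta> \<eta>)"
  using vcomp_nattr_nattr[of "fdom (ndom \<eta>)" "fcod (ndom \<eta>)" \<eta> \<theta>] assms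
  by (simp add: functors_def is_nattr_sel)

lemma id_nattr_is_nattr:
  assumes "is_functor F" "category (fdom F)" "category (fcod F)"
  shows "is_nattr (id_nattr F)"
  using id_nattr_nattr[of "fdom F" "fcod F" F] assms by (simp add: functors_def)

lemma is_nattr_cmp:
  assumes "is_nattr \<eta>" "x \<in> Obj (fdom (ndom \<eta>))"
  shows "ncmp \<eta> x \<in> Arr (fcod (ndom \<eta>))" "Dom (fcod (ndom \<eta>)) (ncmp \<eta> x) = fob (ndom \<eta>) x"
    "Cod (fcod (ndom \<eta>)) (ncmp \<eta> x) = fob (ncod \<eta>) x"
  using is_nattrD(2-4)[of \<eta> "fdom (ndom \<eta>)" "fcod (ndom \<eta>)"] assms is_nattr_sel[OF assms(1)]
  by (auto simp: functors_def)

lemma nattr_eqI':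
  assumes "is_nattr \<eta>" "is_nattr \<theta>" "ndom \<eta> = ndom \<theta>" "ncod \<eta> = ncod \<theta>"
    and "\<And>x. x \<in> Obj (fdom (ndom \<eta>)) \<Longrightarrow> ncmp \<eta> x = ncmp \<theta> x"
  shows "\<eta> = \<theta>"
  by (rule nattr_eqI[OF assms(1,2) iffD1[OF is_functor_functors[of "ndom \<eta>"] is_nattr_sel(1)[OF assms(1)]]
        assms(3)[symmetric] assms(4)[symmetric] assms(5)])

lemma two_category_Cat_on:
  assumes X: "\<And>A. A \<in> \<X> \<Longrightarrow> category A"
  shows "two_category (Cat_on \<X>)"
proof (rule two_categoryI)
  show "category (und (Cat_on \<X>))"
    unfolding category_def
  proof (intro conjI ballI impI)
    fix f assume "f \<in> Mor (Cat_on \<X>)"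
    then show "Comp (und (Cat_on \<X>)) f (Ide (und (Cat_on \<X>)) (Dom (und (Cat_on \<X>)) f)) = f"
      "Comp (und (Cat_on \<X>)) (Ide (und (Cat_on \<X>)) (Cod (und (Cat_on \<X>)) f)) f = f"
      using comp_func_id[of "fdom f" "fcod f" f] X by (auto simp: functors_def)
  next
    fix f g h assume "f \<in> Mor (Cat_on \<X>)" "g \<in> Mor (Cat_on \<X>)" "h \<in> Mor (Cat_on \<X>)"
      "Dom (und (Cat_on \<X>)) g = Cod (und (Cat_on \<X>)) f" "Dom (und (Cat_on \<X>)) h = Cod (und (Cat_on \<X>)) g"
    then show "Comp (und (Cat_on \<X>)) h (Comp (und (Cat_on \<X>)) g f) = Comp (und (Cat_on \<X>)) (Comp (und (Cat_on \<X>)) h g) f"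
      using comp_func_assoc[of "fdom f" f "fcod f" g "fcod g" h "fcod h"] X by (auto simp: functors_def)
  qed (use X in auto)
  show "category (vert (Cat_on \<X>))"
    unfolding category_def
  proof (intro conjI ballI impI)
    fix f g h assume "f \<in> Cell (Cat_on \<X>)" "g \<in> Cell (Cat_on \<X>)" "h \<in> Cell (Cat_on \<X>)"
      "Dom (vert (Cat_on \<X>)) g = Cod (vert (Cat_on \<X>)) f" "Dom (vert (Cat_on \<X>)) h = Cod (vert (Cat_on \<X>)) g"
    then show "Comp (vert (Cat_on \<X>)) h (Comp (vert (Cat_on \<X>)) g f) = Comp (vert (Cat_on \<X>)) (Comp (vert (Cat_on \<X>)) h g) f"
      using X is_nattr_cmp[of f] is_nattr_cmp[of g] is_nattr_cmp[of h] is_nattr_sel[of f] is_nattr_sel[of g]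
      by (auto intro!: nattr_eqI' vcomp_nattr_is_nattr simp: category_assoc)
  qed (use X in \<open>auto intro!: vcomp_nattr_is_nattr id_nattr_is_nattr nattr_eqI' simp: is_nattr_cmp is_nattr_sel\<close>)
next
  fix \<alpha> \<beta>
  assume "\<alpha> \<in> Cell (Cat_on \<X>)" "\<beta> \<in> Cell (Cat_on \<X>)"
    "Dom (und (Cat_on \<X>)) (Dom (vert (Cat_on \<X>)) \<beta>) = Cod (und (Cat_on \<X>)) (Dom (vert (Cat_on \<X>)) \<alpha>)"
  then show "hcomp (Cat_on \<X>) \<beta> \<alpha> \<in> Cell (Cat_on \<X>) \<and>
     Dom (vert (Cat_on \<X>)) (hcomp (Cat_on \<X>) \<beta> \<alpha>) = Comp (und (Cat_on \<X>)) (Dom (vert (Cat_on \<X>)) \<beta>) (Dom (vert (Cat_on \<X>)) \<alpha>) \<and>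
     Cod (vert (Cat_on \<X>)) (hcomp (Cat_on \<X>) \<beta> \<alpha>) = Comp (und (Cat_on \<X>)) (Cod (vert (Cat_on \<X>)) \<beta>) (Cod (vert (Cat_on \<X>)) \<alpha>)"
    using X is_nattr_sel[of \<alpha>] is_nattr_sel[of \<beta>] by (auto intro!: hcomp_nattr_is_nattr)
next
  fix \<alpha> assume "\<alpha> \<in> Cell (Cat_on \<X>)"
  then have a: "is_nattr \<alpha>" "fdom (ndom \<alpha>) \<in> \<X>" "fcod (ndom \<alpha>) \<in> \<X>" by auto
  note s = is_nattr_sel[OF a(1)] is_nattr_cmp[OF a(1)]
  have c: "category (fdom (ndom \<alpha>))" "category (fcod (ndom \<alpha>))" using a X by auto
  have i: "comp_func (ndom \<alpha>) (id_func (fdom (ndom \<alpha>))) = ndom \<alpha>" "comp_func (id_func (fcod (ndom \<alpha>))) (ndom \<alpha>) = ndom \<alpha>"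
    "comp_func (ncod \<alpha>) (id_func (fdom (ndom \<alpha>))) = ncod \<alpha>" "comp_func (id_func (fcod (ndom \<alpha>))) (ncod \<alpha>) = ncod \<alpha>"
    using comp_func_id[OF c, of "ndom \<alpha>"] comp_func_id[OF c, of "ncod \<alpha>"] s(1-4) by (auto simp: functors_def)
  have l: "fob (ncod \<alpha>) x \<in> Obj (fcod (ndom \<alpha>))" if "x \<in> Obj (fdom (ndom \<alpha>))" for x
    using is_functorD(1)[OF s(2)] that s by auto
  show "hcomp (Cat_on \<X>) \<alpha> (Ide (vert (Cat_on \<X>)) (Ide (und (Cat_on \<X>)) (Dom (und (Cat_on \<X>)) (Dom (vert (Cat_on \<X>)) \<alpha>)))) = \<alpha> \<and>
     hcomp (Cat_on \<X>) (Ide (vert (Cat_on \<X>)) (Ide (und (Cat_on \<X>)) (Cod (und (Cat_on \<X>)) (Dom (vert (Cat_on \<X>)) \<alpha>)))) \<alpha> = \<alpha>"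
    by (auto intro!: nattr_eqI' hcomp_nattr_is_nattr id_nattr_is_nattr simp: a i c s l)
next
  fix \<alpha> \<beta> \<gamma>
  assume "\<alpha> \<in> Cell (Cat_on \<X>)" "\<beta> \<in> Cell (Cat_on \<X>)" "\<gamma> \<in> Cell (Cat_on \<X>)"
    and m: "Dom (und (Cat_on \<X>)) (Dom (vert (Cat_on \<X>)) \<beta>) = Cod (und (Cat_on \<X>)) (Dom (vert (Cat_on \<X>)) \<alpha>)"
    "Dom (und (Cat_on \<X>)) (Dom (vert (Cat_on \<X>)) \<gamma>) = Cod (und (Cat_on \<X>)) (Dom (vert (Cat_on \<X>)) \<beta>)"
  then have a: "is_nattr \<alpha>" "fdom (ndom \<alpha>) \<in> \<X>" "fcod (ndom \<alpha>) \<in> \<X>" "is_nattr \<beta>" "fcod (ndom \<beta>) \<in> \<X>"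
     "is_nattr \<gamma>" "fcod (ndom \<gamma>) \<in> \<X>"by auto
  have d: "fdom (ndom \<beta>) = fcod (ndom \<alpha>)" "fdom (ndom \<gamma>) = fcod (ndom \<beta>)" using m by simp_all
  have c: "category (fdom (ndom \<alpha>))" "category (fcod (ndom \<alpha>))" "category (fcod (ndom \<beta>))" "category (fcod (ndom \<gamma>))"
    using a X by auto
  note s = is_nattr_sel[OF a(1)] is_nattr_cmp[OF a(1)] is_nattr_sel[OF a(4)] is_nattr_cmp[OF a(4)] is_nattr_sel[OF a(6)] is_nattr_cmp[OF a(6)]
  have i: "comp_func (comp_func (ndom \<gamma>) (ndom \<beta>)) (ndom \<alpha>) = comp_func (ndom \<gamma>) (comp_func (ndom \<beta>) (ndom \<alpha>))"
    "comp_func (comp_func (ncod \<gamma>) (ncod \<beta>)) (ncod \<alpha>) = comp_func (ncod \<gamma>) (comp_func (ncod \<beta>) (ncod \<alpha>))"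
    by (rule comp_func_assoc; simp add: functors_def c s d)+
  have k: "ncmp \<alpha> x \<in> Arr (fdom (ndom \<beta>))" "ncmp \<alpha> x \<in> Arr (fdom (ncod \<beta>))" if "x \<in> Obj (fdom (ndom \<alpha>))" for x
    using s that d by auto
  have l: "fob (ncod \<alpha>) x \<in> Obj (fcod (ndom \<alpha>))" "fob (ndom \<alpha>) x \<in> Obj (fcod (ndom \<alpha>))" if "x \<in> Obj (fdom (ndom \<alpha>))" for x
    using is_functorD(1)[OF s(2)] is_functorD(1)[OF s(1)] that s by auto
  have fb: "ndom \<beta> \<in> functors (fcod (ndom \<alpha>)) (fcod (ndom \<beta>))" "ncod \<beta> \<in> functors (fcod (ndom \<alpha>)) (fcod (ndom \<beta>))"
    and fc: "ndom \<gamma> \<in> functors (fcod (ndom \<beta>)) (fcod (ndom \<gamma>))" "ncod \<gamma> \<in> functors (fcod (ndom \<beta>)) (fcod (ndom \<gamma>))"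
    by (simp_all add: functors_def s d)
  note fn = functorsD'[OF fb(1)] functorsD'[OF fb(2)] functorsD'[OF fc(1)] functorsD'[OF fc(2)]
  show "hcomp (Cat_on \<X>) \<gamma> (hcomp (Cat_on \<X>) \<beta> \<alpha>) = hcomp (Cat_on \<X>) (hcomp (Cat_on \<X>) \<gamma> \<beta>) \<alpha>"
    by (auto intro!: nattr_eqI' hcomp_nattr_is_nattr simp: a i c s d k l fn category_assoc)
next
  fix f g assume "f \<in> Mor (Cat_on \<X>)" "g \<in> Mor (Cat_on \<X>)" "Dom (und (Cat_on \<X>)) g = Cod (und (Cat_on \<X>)) f"
  then have f: "is_functor f" "fdom f \<in> \<X>" "fcod f \<in> \<X>" "is_functor g" "fdom g = fcod f" "fcod g \<in> \<X>" by auto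
  have c: "category (fdom f)" "category (fcod f)" "category (fcod g)" using f X by auto
  have "fob f x \<in> Obj (fdom g)" "far g (Ide (fcod f) (fob f x)) = Ide (fcod g) (fob g (fob f x))" if "x \<in> Obj (fdom f)" for x
    using that f is_functorD(1)[OF f(1)] is_functorD(5)[OF f(4)] by auto
  then show "hcomp (Cat_on \<X>) (Ide (vert (Cat_on \<X>)) g) (Ide (vert (Cat_on \<X>)) f) = Ide (vert (Cat_on \<X>)) (Comp (und (Cat_on \<X>)) g f)"
    using f is_functorD(1)[OF f(4)] by (auto intro!: nattr_eqI' hcomp_nattr_is_nattr id_nattr_is_nattr simp: c)
next
  fix \<alpha> \<alpha>' \<beta> \<beta>'
  assume "\<alpha> \<in> Cell (Cat_on \<X>)" "\<alpha>' \<in> Cell (Cat_on \<X>)" "\<beta> \<in> Cell (Cat_on \<X>)" "\<beta>' \<in> Cell (Cat_on \<X>)"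
    "Dom (vert (Cat_on \<X>)) \<alpha>' = Cod (vert (Cat_on \<X>)) \<alpha>" "Dom (vert (Cat_on \<X>)) \<beta>' = Cod (vert (Cat_on \<X>)) \<beta>"
    "Dom (und (Cat_on \<X>)) (Dom (vert (Cat_on \<X>)) \<beta>) = Cod (und (Cat_on \<X>)) (Dom (vert (Cat_on \<X>)) \<alpha>)"
  then have a: "is_nattr \<alpha>" "is_nattr \<alpha>'" "is_nattr \<beta>" "is_nattr \<beta>'" "fdom (ndom \<alpha>) \<in> \<X>" "fcod (ndom \<alpha>) \<in> \<X>" "fcod (ndom \<beta>) \<in> \<X>"
    and d: "ndom \<alpha>' = ncod \<alpha>" "ndom \<beta>' = ncod \<beta>" "fdom (ndom \<beta>) = fcod (ndom \<alpha>)"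
    by auto
  define A B C where ABC: "A = fdom (ndom \<alpha>)" "B = fcod (ndom \<alpha>)" "C = fcod (ndom \<beta>)"
  have c: "category A" "category B" "category C" using a X ABC by auto
  have n: "ndom \<alpha> \<in> functors A B" "ncod \<alpha> \<in> functors A B" "ncod \<alpha>' \<in> functors A B"
    "ndom \<beta> \<in> functors B C" "ncod \<beta> \<in> functors B C" "ncod \<beta>' \<in> functors B C"
    using a d is_nattr_sel[of \<alpha>] is_nattr_sel[of \<alpha>'] is_nattr_sel[of \<beta>] is_nattr_sel[of \<beta>'] ABC
    by (auto simp: functors_def)
  note s = is_nattrD[OF a(1) n(1)] is_nattrD[OF a(2), unfolded d, OF n(2)] is_nattrD[OF a(3) n(4)] is_nattrD[OF a(4), unfolded d, OF n(5)]
    functorsD[OF n(1)] functorsD[OF n(2)] functorsD[OF n(3)] functorsD[OF n(4)] functorsD[OF n(5)] functorsD[OF n(6)]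
    functorsD'[OF n(1)] functorsD'[OF n(2)] functorsD'[OF n(3)] functorsD'[OF n(4)] functorsD'[OF n(5)] functorsD'[OF n(6)]
  have key: "Comp C (Comp C (ncmp \<beta>' (fob (ncod \<alpha>') x)) (ncmp \<beta> (fob (ncod \<alpha>') x))) (far (ndom \<beta>) (Comp B (ncmp \<alpha>' x) (ncmp \<alpha> x))) =
     Comp C (Comp C (ncmp \<beta>' (fob (ncod \<alpha>') x)) (far (ncod \<beta>) (ncmp \<alpha>' x))) (Comp C (ncmp \<beta> (fob (ncod \<alpha>) x)) (far (ndom \<beta>) (ncmp \<alpha> x)))"
    if x: "x \<in> Obj A" for x
  proof -
    \<comment> \<open>Interchange of natural transformations comes down to this square: naturality
      of \<open>\<beta>\<close> at a component of \<open>\<alpha>'\<close>.\<close>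
    have nat: "Comp C (ncmp \<beta> (fob (ncod \<alpha>') x)) (far (ndom \<beta>) (ncmp \<alpha>' x)) = Comp C (far (ncod \<beta>) (ncmp \<alpha>' x)) (ncmp \<beta> (fob (ncod \<alpha>) x))"
      using is_nattr_natural[OF a(3) n(4), of "ncmp \<alpha>' x"] x by (simp add: s)
    have "Comp C (Comp C (ncmp \<beta>' (fob (ncod \<alpha>') x)) (ncmp \<beta> (fob (ncod \<alpha>') x))) (far (ndom \<beta>) (Comp B (ncmp \<alpha>' x) (ncmp \<alpha> x))) =
      Comp C (ncmp \<beta>' (fob (ncod \<alpha>') x)) (Comp C (Comp C (ncmp \<beta> (fob (ncod \<alpha>') x)) (far (ndom \<beta>) (ncmp \<alpha>' x))) (far (ndom \<beta>) (ncmp \<alpha> x)))"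
      using x by (simp add: s c category_assoc[OF c(3)])
    also have "\<dots> = Comp C (Comp C (ncmp \<beta>' (fob (ncod \<alpha>') x)) (far (ncod \<beta>) (ncmp \<alpha>' x))) (Comp C (ncmp \<beta> (fob (ncod \<alpha>) x)) (far (ndom \<beta>) (ncmp \<alpha> x)))"
      unfolding nat using x by (simp add: s c category_assoc[OF c(3)])
    finally show ?thesis .
  qed
  show "hcomp (Cat_on \<X>) (Comp (vert (Cat_on \<X>)) \<beta>' \<beta>) (Comp (vert (Cat_on \<X>)) \<alpha>' \<alpha>) =
     Comp (vert (Cat_on \<X>)) (hcomp (Cat_on \<X>) \<beta>' \<alpha>') (hcomp (Cat_on \<X>) \<beta> \<alpha>)"
    using key by (auto intro!: nattr_eqI' hcomp_nattr_is_nattr vcomp_nattr_is_nattr simp: a d s c)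
qed (auto simp: is_nattr_sel)

section \<open>Hom-categories and the comparison functor of a power\<close>

lemma hom_cat_sel [simp]:
  "Obj (hom_cat K X Y) = hom (und K) X Y"
  "Dom (hom_cat K X Y) = Dom (vert K)" "Cod (hom_cat K X Y) = Cod (vert K)"
  "Ide (hom_cat K X Y) = Ide (vert K)" "Comp (hom_cat K X Y) = Comp (vert K)"
  by (simp_all add: hom_cat_def)

lemma hom_cat_Arr [simp]:
  assumes "two_category K"
  shows "\<alpha> \<in> Arr (hom_cat K X Y) \<longleftrightarrow>
    \<alpha> \<in> Cell K \<and> Dom (und K) (Dom (vert K) \<alpha>) = X \<and> Cod (und K) (Dom (vert K) \<alpha>) = Y"
  using assms by (auto simp: hom_cat_def hom_iff)

lemma category_hom_cat [simp]:
  assumes K: "two_category K"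
  shows "category (hom_cat K X Y)"
proof -
  have Cv: "category (vert K)" using K by simp
  show ?thesis
    unfolding category_def using K by (auto simp: hom_iff category_assoc[OF Cv])
qed

lemma hom_cat_functorD:
  assumes K: "two_category K" and F: "F \<in> functors X (hom_cat K Y Z)"
  shows "x \<in> Obj X \<Longrightarrow> fob F x \<in> Mor K" "x \<in> Obj X \<Longrightarrow> Dom (und K) (fob F x) = Y"
    "x \<in> Obj X \<Longrightarrow> Cod (und K) (fob F x) = Z"
    "a \<in> Arr X \<Longrightarrow> far F a \<in> Cell K" "a \<in> Arr X \<Longrightarrow> Dom (vert K) (far F a) = fob F (Dom X a)"
    "a \<in> Arr X \<Longrightarrow> Cod (vert K) (far F a) = fob F (Cod X a)"
    "x \<in> Obj X \<Longrightarrow> far F (Ide X x) = Ide (vert K) (fob F x)"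
    "a \<in> Arr X \<Longrightarrow> b \<in> Arr X \<Longrightarrow> Dom X b = Cod X a \<Longrightarrow> far F (Comp X b a) = Comp (vert K) (far F b) (far F a)"
  using functorsD'[OF F] K by (auto simp: hom_iff)

lemma hom_cat_functorI:
  assumes K: "two_category K" and X: "category X" and "fdom F = X" "fcod F = hom_cat K Y Z"
    "\<And>x. x \<in> Obj X \<Longrightarrow> fob F x \<in> Mor K" "\<And>x. x \<in> Obj X \<Longrightarrow> Dom (und K) (fob F x) = Y"
    "\<And>x. x \<in> Obj X \<Longrightarrow> Cod (und K) (fob F x) = Z"
    "\<And>x. x \<notin> Obj X \<Longrightarrow> fob F x = undefined" "\<And>a. a \<notin> Arr X \<Longrightarrow> far F a = undefined"
    "\<And>a. a \<in> Arr X \<Longrightarrow> far F a \<in> Cell K" "\<And>a. a \<in> Arr X \<Longrightarrow> Dom (vert K) (far F a) = fob F (Dom X a)"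
    "\<And>a. a \<in> Arr X \<Longrightarrow> Cod (vert K) (far F a) = fob F (Cod X a)"
    "\<And>x. x \<in> Obj X \<Longrightarrow> far F (Ide X x) = Ide (vert K) (fob F x)"
    "\<And>a b. a \<in> Arr X \<Longrightarrow> b \<in> Arr X \<Longrightarrow> Dom X b = Cod X a \<Longrightarrow> far F (Comp X b a) = Comp (vert K) (far F b) (far F a)"
  shows "F \<in> functors X (hom_cat K Y Z)"
  by (rule functorsI) (use assms in \<open>auto simp: hom_iff\<close>)

text \<open>The local function \<open>H\<close> of \<open>power_comparison\<close>, given a name of
  its own, with whiskering unfolded to \<open>hcomp\<close>.\<close>

definition precompose :: "('o, 'm, 'c) two_cat \<Rightarrow> ('u, 'v) cat \<Rightarrow> ('u, 'v, 'm, 'c) func \<Rightarrow> 'o \<Rightarrow> 'o \<Rightarrow> 'm \<Rightarrow>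
    ('u, 'v, 'm, 'c) func" where
  "precompose K X \<gamma> Y A f = \<lparr>fdom = X, fcod = hom_cat K Y A,
     fob = (\<lambda>x\<in>Obj X. Comp (und K) (fob \<gamma> x) f), far = (\<lambda>a\<in>Arr X. hcomp K (far \<gamma> a) (Ide (vert K) f))\<rparr>"

lemma precompose_sel [simp]:
  "fdom (precompose K X \<gamma> Y A f) = X" "fcod (precompose K X \<gamma> Y A f) = hom_cat K Y A"
  "x \<in> Obj X \<Longrightarrow> fob (precompose K X \<gamma> Y A f) x = Comp (und K) (fob \<gamma> x) f"
  "a \<in> Arr X \<Longrightarrow> far (precompose K X \<gamma> Y A f) a = hcomp K (far \<gamma> a) (Ide (vert K) f)"
  by (simp_all add: precompose_def)

lemma precompose_functor:
  assumes K: "two_category K" and X: "category X" and \<gamma>: "\<gamma> \<in> functors X (hom_cat K P A)"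
    and f: "f \<in> Mor K" "Cod (und K) f = P"
  shows "precompose K X \<gamma> (Dom (und K) f) A f \<in> functors X (hom_cat K (Dom (und K) f) A)"
proof (rule hom_cat_functorI[OF K X])
  note g = hom_cat_functorD[OF K \<gamma>]
  fix a b assume ab: "a \<in> Arr X" "b \<in> Arr X" "Dom X b = Cod X a"
  have "hcomp K (Comp (vert K) (far \<gamma> b) (far \<gamma> a)) (Comp (vert K) (Ide (vert K) f) (Ide (vert K) f)) =
      Comp (vert K) (hcomp K (far \<gamma> b) (Ide (vert K) f)) (hcomp K (far \<gamma> a) (Ide (vert K) f))"
    by (rule interchange) (use ab in \<open>simp_all add: K f X g\<close>)
  then show "far (precompose K X \<gamma> (Dom (und K) f) A f) (Comp X b a) =
     Comp (vert K) (far (precompose K X \<gamma> (Dom (und K) f) A f) b) (far (precompose K X \<gamma> (Dom (und K) f) A f) a)"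
    using ab by (simp add: K f X g)
qed (simp_all add: K f X hom_cat_functorD[OF K \<gamma>] precompose_def)

lemma power_comparison_sel:
  "fdom (power_comparison K X A P \<gamma> Y) = hom_cat K Y P"
  "fcod (power_comparison K X A P \<gamma> Y) = func_cat X (hom_cat K Y A)"
  "fob (power_comparison K X A P \<gamma> Y) = (\<lambda>f\<in>hom (und K) Y P. precompose K X \<gamma> Y A f)"
  "far (power_comparison K X A P \<gamma> Y) = (\<lambda>\<alpha>\<in>Arr (hom_cat K Y P).
     \<lparr>ndom = precompose K X \<gamma> Y A (Dom (vert K) \<alpha>), ncod = precompose K X \<gamma> Y A (Cod (vert K) \<alpha>),
      ncmp = (\<lambda>x\<in>Obj X. hcomp K (Ide (vert K) (fob \<gamma> x)) \<alpha>)\<rparr>)"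
  by (simp_all add: power_comparison_def Let_def precompose_def rwhisker_def lwhisker_def)

lemma power_comparison_functor:
  assumes K: "two_category K" and X: "category X" and \<gamma>: "\<gamma> \<in> functors X (hom_cat K P A)"
  shows "power_comparison K X A P \<gamma> Y \<in> functors (hom_cat K Y P) (func_cat X (hom_cat K Y A))"
proof (rule functorsI)
  note g = hom_cat_functorD[OF K \<gamma>]
  have Cu: "category (und K)" and Cv: "category (vert K)" using K by simp_all
  let ?c = "Comp (vert K)" and ?h = "hcomp K" and ?I = "Ide (vert K)"
  have H: "precompose K X \<gamma> Y A f \<in> functors X (hom_cat K Y A)" if "f \<in> hom (und K) Y P" for f
    using that precompose_functor[OF K X \<gamma>, of f] by (auto simp: hom_iff)
  have HD: "precompose K X \<gamma> Y A (Dom (vert K) \<alpha>) \<in> functors X (hom_cat K Y A)"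
    "precompose K X \<gamma> Y A (Cod (vert K) \<alpha>) \<in> functors X (hom_cat K Y A)" if "\<alpha> \<in> Arr (hom_cat K Y P)" for \<alpha>
    using that H[of "Dom (vert K) \<alpha>"] H[of "Cod (vert K) \<alpha>"] K by (auto simp: hom_iff)
  have N: "is_nattr (far (power_comparison K X A P \<gamma> Y) \<alpha>)" if \<alpha>: "\<alpha> \<in> Arr (hom_cat K Y P)" for \<alpha>
  proof (rule is_nattrI[of _ X "hom_cat K Y A"])
    have \<alpha>': "\<alpha> \<in> Cell K" "Dom (und K) (Dom (vert K) \<alpha>) = Y" "Cod (und K) (Dom (vert K) \<alpha>) = P"
      using \<alpha> K by auto
    fix a assume a: "a \<in> Arr X"
    let ?f = "?I (Dom (vert K) \<alpha>)" and ?g = "?I (Cod (vert K) \<alpha>)" and ?y = "?I (fob \<gamma> (Cod X a))" and ?x = "?I (fob \<gamma> (Dom X a))"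
    \<comment> \<open>Both sides of the naturality square equal the horizontal composite of
      \<open>far \<gamma> a\<close> with \<open>\<alpha>\<close>, because identities may be absorbed
      before or after.\<close>
    have "?h (?c ?y (far \<gamma> a)) (?c \<alpha> ?f) = ?c (?h ?y \<alpha>) (?h (far \<gamma> a) ?f)"
      by (rule interchange) (use a \<alpha>' in \<open>simp_all add: K X g\<close>)
    moreover have "?h (?c (far \<gamma> a) ?x) (?c ?g \<alpha>) = ?c (?h (far \<gamma> a) ?g) (?h ?x \<alpha>)"
      by (rule interchange) (use a \<alpha>' in \<open>simp_all add: K X g\<close>)
    moreover have "?c ?y (far \<gamma> a) = far \<gamma> a" "?c (far \<gamma> a) ?x = far \<gamma> a" "?c \<alpha> ?f = \<alpha>" "?c ?g \<alpha> = \<alpha>"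
      using a \<alpha>' by (simp_all add: K X g)
    ultimately show "Comp (hom_cat K Y A) (ncmp (far (power_comparison K X A P \<gamma> Y) \<alpha>) (Cod X a))
        (far (ndom (far (power_comparison K X A P \<gamma> Y) \<alpha>)) a) =
       Comp (hom_cat K Y A) (far (ncod (far (power_comparison K X A P \<gamma> Y) \<alpha>)) a)
        (ncmp (far (power_comparison K X A P \<gamma> Y) \<alpha>) (Dom X a))"
      using a \<alpha> X by (simp add: power_comparison_sel)
  qed (use \<alpha> HD[OF \<alpha>] in \<open>simp_all add: power_comparison_sel K X g\<close>)
  show "f \<in> Arr (hom_cat K Y P) \<Longrightarrow> far (power_comparison K X A P \<gamma> Y) f \<in> Arr (func_cat X (hom_cat K Y A))" for f
    using N[of f] HD[of f] by (simp add: func_cat_def power_comparison_sel)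
  show "x \<in> Obj (hom_cat K Y P) \<Longrightarrow> far (power_comparison K X A P \<gamma> Y) (Ide (hom_cat K Y P) x) =
      Ide (func_cat X (hom_cat K Y A)) (fob (power_comparison K X A P \<gamma> Y) x)" for x
    by (auto simp: power_comparison_sel func_cat_def id_nattr_def hom_iff K g intro!: ext)
  show "far (power_comparison K X A P \<gamma> Y) (Comp (hom_cat K Y P) \<beta> \<alpha>) =
      Comp (func_cat X (hom_cat K Y A)) (far (power_comparison K X A P \<gamma> Y) \<beta>) (far (power_comparison K X A P \<gamma> Y) \<alpha>)"
    if ab: "\<alpha> \<in> Arr (hom_cat K Y P)" "\<beta> \<in> Arr (hom_cat K Y P)" "Dom (hom_cat K Y P) \<beta> = Cod (hom_cat K Y P) \<alpha>" for \<alpha> \<beta>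
  proof -
    have ab': "\<alpha> \<in> Cell K" "Dom (und K) (Dom (vert K) \<alpha>) = Y" "Cod (und K) (Dom (vert K) \<alpha>) = P"
      "\<beta> \<in> Cell K" "Dom (vert K) \<beta> = Cod (vert K) \<alpha>"
      using ab K by auto
    have "?h (?I (fob \<gamma> x)) (?c \<beta> \<alpha>) = ?c (?h (?I (fob \<gamma> x)) \<beta>) (?h (?I (fob \<gamma> x)) \<alpha>)" if x: "x \<in> Obj X" for x
    proof -
      have "?h (?c (?I (fob \<gamma> x)) (?I (fob \<gamma> x))) (?c \<beta> \<alpha>) = ?c (?h (?I (fob \<gamma> x)) \<beta>) (?h (?I (fob \<gamma> x)) \<alpha>)"
        by (rule interchange) (use x ab' in \<open>simp_all add: K X g\<close>)
      then show ?thesis using x by (simp add: K g)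
    qed
    then show ?thesis
      using ab' K Cv by (auto simp: power_comparison_sel func_cat_def vcomp_nattr_def intro!: ext)
  qed
qed (use precompose_functor[OF K X \<gamma>] K in \<open>auto simp: power_comparison_sel func_cat_def hom_iff\<close>)

lemma is_iso_func_bij:
  assumes F: "F \<in> functors A B" and iso: "is_iso_func F"
  shows "bij_betw (fob F) (Obj A) (Obj B)" "bij_betw (far F) (Arr A) (Arr B)"
proof -
  obtain G where G: "G \<in> functors B A" "comp_func G F = id_func A" "comp_func F G = id_func B"
    using iso functorsD[OF F] unfolding is_iso_func_def by auto
  have 1: "fob G (fob F x) = x" if "x \<in> Obj A" for x
    using that comp_func_sel(3)[of x F G] G(2) functorsD(2)[OF F] by (metis id_func_sel(3))
  have 2: "fob F (fob G x) = x" if "x \<in> Obj B" for x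
    using that comp_func_sel(3)[of x G F] G(3) functorsD(2)[OF G(1)] by (metis id_func_sel(3))
  have 3: "far G (far F x) = x" if "x \<in> Arr A" for x
    using that comp_func_sel(4)[of x F G] G(2) functorsD(2)[OF F] by (metis id_func_sel(4))
  have 4: "far F (far G x) = x" if "x \<in> Arr B" for x
    using that comp_func_sel(4)[of x G F] G(3) functorsD(2)[OF G(1)] by (metis id_func_sel(4))
  show "bij_betw (fob F) (Obj A) (Obj B)" "bij_betw (far F) (Arr A) (Arr B)"
    by (rule bij_betw_byWitness[of _ "fob G"] bij_betw_byWitness[of _ "far G"];
        use functorsD'(1,2)[OF F] functorsD'(1,2)[OF G(1)] 1 2 3 4 in blast)+
qed

text \<open>A functor that is bijective on objects and on arrows reflects sources, targets,
  identities and composites, so the inverse functions form a functor by themselves.\<close>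

lemma is_iso_funcI:
  assumes A: "category A" and F: "F \<in> functors A B"
    and ob: "bij_betw (fob F) (Obj A) (Obj B)" and ar: "bij_betw (far F) (Arr A) (Arr B)"
    and B: "category B"
  shows "is_iso_func F"
proof -
  define G where "G = \<lparr>fdom = B, fcod = A, fob = (\<lambda>x\<in>Obj B. inv_into (Obj A) (fob F) x),
     far = (\<lambda>f\<in>Arr B. inv_into (Arr A) (far F) f)\<rparr>"
  note f = functorsD'[OF F]
  have g1: "x \<in> Obj B \<Longrightarrow> fob G x \<in> Obj A \<and> fob F (fob G x) = x" for x
    using ob by (simp add: G_def bij_betw_def f_inv_into_f inv_into_into)
  have g2: "h \<in> Arr B \<Longrightarrow> far G h \<in> Arr A \<and> far F (far G h) = h" for h
    using ar by (simp add: G_def bij_betw_def f_inv_into_f inv_into_into)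
  have g3: "x \<in> Obj A \<Longrightarrow> fob G (fob F x) = x" for x
    using ob f by (simp add: G_def bij_betw_def)
  have g4: "h \<in> Arr A \<Longrightarrow> far G (far F h) = h" for h
    using ar f by (simp add: G_def bij_betw_def)
  have Gf: "G \<in> functors B A"
  proof (rule functorsI)
    show "h \<in> Arr B \<Longrightarrow> Dom A (far G h) = fob G (Dom B h)" for h
      using g2[of h] g3[of "Dom A (far G h)"] f(3)[of "far G h"] A by auto
    show "h \<in> Arr B \<Longrightarrow> Cod A (far G h) = fob G (Cod B h)" for h
      using g2[of h] g3[of "Cod A (far G h)"] f(4)[of "far G h"] A by auto
    show "x \<in> Obj B \<Longrightarrow> far G (Ide B x) = Ide A (fob G x)" for x
      using g1[of x] g4[of "Ide A (fob G x)"] f(5)[of "fob G x"] A by auto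
    show "far G (Comp B k h) = Comp A (far G k) (far G h)"
      if "h \<in> Arr B" "k \<in> Arr B" "Dom B k = Cod B h" for h k
    proof -
      have "Dom A (far G k) = Cod A (far G h)"
        using that g2[of h] g2[of k] f(3)[of "far G k"] f(4)[of "far G h"] g3 A by (metis categoryD(1,2))
      then show ?thesis
        using that g2[of h] g2[of k] g4[of "Comp A (far G k) (far G h)"] f(6)[of "far G h" "far G k"] A by auto
    qed
  qed (use g1 g2 in \<open>auto simp: G_def\<close>)
  have "comp_func G F = id_func A"
    by (rule functors_eqI[OF comp_functors[OF A F Gf] id_functors[OF A]]) (simp_all add: functorsD[OF F] g3 g4)
  moreover have "comp_func F G = id_func B"
    by (rule functors_eqI[OF comp_functors[OF B Gf F] id_functors[OF B]]) (simp_all add: functorsD[OF Gf] g1 g2)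
  ultimately show ?thesis
    unfolding is_iso_func_def using Gf functorsD[OF F] by auto
qed

lemma category_func_cat:
  assumes A: "category A" and B: "category B"
  shows "category (func_cat A B)"
  unfolding category_def func_cat_def
proof (simp add: functorsD, intro conjI ballI allI impI; (elim conjE)?)
  fix f assume f: "is_nattr f" "ndom f \<in> functors A B" "ncod f \<in> functors A B"
  have v: "is_nattr (vcomp_nattr f (id_nattr (ndom f)))" "is_nattr (vcomp_nattr (id_nattr (ncod f)) f)"
    by (rule vcomp_nattr_nattr[OF A B]; simp add: f id_nattr_nattr[OF A B])+
  note s = functorsD[OF f(2)] functorsD[OF f(3)] is_nattrD[OF f(1,2)]
  show "vcomp_nattr f (id_nattr (ndom f)) = f" "vcomp_nattr (id_nattr (ncod f)) f = f"
    by (rule nattr_eqI[of _ _ A B]; simp add: f v s A B)+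
next
  fix f g h assume f: "is_nattr f" "ndom f \<in> functors A B" "ncod f \<in> functors A B"
    and g: "is_nattr g" "ndom g \<in> functors A B" "ncod g \<in> functors A B"
    and h: "is_nattr h" "ndom h \<in> functors A B" "ncod h \<in> functors A B"
    and m: "ndom g = ncod f" "ndom h = ncod g"
  have v: "is_nattr (vcomp_nattr h (vcomp_nattr g f))" "is_nattr (vcomp_nattr (vcomp_nattr h g) f)"
    using f g h m by (auto intro!: vcomp_nattr_nattr[OF A B])
  note s = functorsD[OF f(2)] functorsD[OF g(2)] functorsD[OF f(3)] functorsD[OF g(3)] is_nattrD[OF f(1,2)] is_nattrD[OF g(1,2)] is_nattrD[OF h(1,2)]
  show "vcomp_nattr h (vcomp_nattr g f) = vcomp_nattr (vcomp_nattr h g) f"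
    by (rule nattr_eqI[of _ _ A B]; simp add: f v s m A B category_assoc[OF B])
qed (auto intro!: vcomp_nattr_nattr[OF A B] id_nattr_nattr[OF A B])

section \<open>Powers through existence and uniqueness of 1-cells and 2-cells\<close>

context
  fixes K :: "('o, 'm, 'c) two_cat" and X :: "('u, 'v) cat"
    and A P :: 'o and \<gamma> :: "('u, 'v, 'm, 'c) func"
  assumes K: "two_category K" and X: "category X"
begin

lemma is_powerD:
  assumes "is_power K X A P \<gamma>"
  shows "A \<in> Ob K" "P \<in> Ob K" "\<gamma> \<in> functors X (hom_cat K P A)"
  using assms by (simp_all add: is_power_def)

text \<open>Injectivity of the comparison functor on objects. Its values are functors on
  \<open>X\<close>, so equality has to be tested on the arrows of \<open>X\<close> as well, where it
  becomes an equation of whiskered cells.\<close>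

lemma is_power_eq:
  assumes p: "is_power K X A P \<gamma>" and f: "f \<in> Mor K" "Cod (und K) f = P" and g: "g \<in> Mor K" "Cod (und K) g = P"
    and d: "Dom (und K) f = Dom (und K) g"
    and x: "\<And>x. x \<in> Obj X \<Longrightarrow> Comp (und K) (fob \<gamma> x) f = Comp (und K) (fob \<gamma> x) g"
    and a: "\<And>a. a \<in> Arr X \<Longrightarrow> hcomp K (far \<gamma> a) (Ide (vert K) f) = hcomp K (far \<gamma> a) (Ide (vert K) g)"
  shows "f = g"
proof -
  let ?Y = "Dom (und K) f"
  note \<gamma> = is_powerD(3)[OF p]
  have Y: "?Y \<in> Ob K" using f K by simp
  have i: "inj_on (fob (power_comparison K X A P \<gamma> ?Y)) (hom (und K) ?Y P)"
    using is_iso_func_bij(1)[OF power_comparison_functor[OF K X \<gamma>, of ?Y]] p Y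
    unfolding is_power_def by (auto simp: bij_betw_def)
  have "precompose K X \<gamma> ?Y A f = precompose K X \<gamma> ?Y A g"
    by (rule functors_eqI[OF precompose_functor[OF K X \<gamma> f] precompose_functor[OF K X \<gamma> g, folded d]])
      (simp_all add: x a)
  then show ?thesis
    using inj_onD[OF i, of f g] f g d by (simp add: power_comparison_sel hom_iff)
qed

text \<open>Surjectivity of the comparison functor on objects, at an arbitrary test object.\<close>

lemma is_power_ex:
  assumes p: "is_power K X A P \<gamma>" and Y: "Y \<in> Ob K" and F: "F \<in> functors X (hom_cat K Y A)"
  shows "\<exists>f. f \<in> Mor K \<and> Dom (und K) f = Y \<and> Cod (und K) f = P \<and>
     (\<forall>x\<in>Obj X. Comp (und K) (fob \<gamma> x) f = fob F x) \<and> (\<forall>a\<in>Arr X. hcomp K (far \<gamma> a) (Ide (vert K) f) = far F a)"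
proof -
  note \<gamma> = is_powerD(3)[OF p]
  have "fob (power_comparison K X A P \<gamma> Y) ` hom (und K) Y P = functors X (hom_cat K Y A)"
    using is_iso_func_bij(1)[OF power_comparison_functor[OF K X \<gamma>, of Y]] p Y
    unfolding is_power_def by (auto simp: bij_betw_def func_cat_def)
  then obtain f where f: "f \<in> hom (und K) Y P" "precompose K X \<gamma> Y A f = F"
    using F unfolding power_comparison_sel by (metis (no_types, lifting) imageE restrict_apply')
  then show ?thesis
    using precompose_sel(3,4)[of _ X K \<gamma> Y A f] by (auto simp: hom_iff)
qed

text \<open>Injectivity of the comparison functor on arrows, for cells already known to be
  parallel.\<close>

lemma is_power_cell_eq:
  assumes p: "is_power K X A P \<gamma>" and \<alpha>: "\<alpha> \<in> Cell K" "Cod (und K) (Dom (vert K) \<alpha>) = P"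
    and \<beta>: "\<beta> \<in> Cell K" "Dom (vert K) \<beta> = Dom (vert K) \<alpha>" "Cod (vert K) \<beta> = Cod (vert K) \<alpha>"
    and x: "\<And>x. x \<in> Obj X \<Longrightarrow> hcomp K (Ide (vert K) (fob \<gamma> x)) \<alpha> = hcomp K (Ide (vert K) (fob \<gamma> x)) \<beta>"
  shows "\<alpha> = \<beta>"
proof -
  let ?Y = "Dom (und K) (Dom (vert K) \<alpha>)"
  note \<gamma> = is_powerD(3)[OF p]
  have Y: "?Y \<in> Ob K" using \<alpha> K by simp
  have i: "inj_on (far (power_comparison K X A P \<gamma> ?Y)) (Arr (hom_cat K ?Y P))"
    using is_iso_func_bij(2)[OF power_comparison_functor[OF K X \<gamma>, of ?Y]] p Y
    unfolding is_power_def by (auto simp: bij_betw_def)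
  show ?thesis
    by (rule inj_onD[OF i]) (use \<alpha> \<beta> x K in \<open>auto simp: power_comparison_sel intro!: ext\<close>)
qed

text \<open>The family \<open>\<sigma>\<close> is a natural transformation between the two composite
  functors, so it has a preimage under the comparison functor.\<close>

lemma is_power_cell_ex:
  assumes p: "is_power K X A P \<gamma>" and f: "f \<in> Mor K" "Cod (und K) f = P" and g: "g \<in> Mor K" "Cod (und K) g = P"
    and d: "Dom (und K) f = Dom (und K) g"
    and x: "\<And>x. x \<in> Obj X \<Longrightarrow> \<sigma> x \<in> Cell K" "\<And>x. x \<in> Obj X \<Longrightarrow> Dom (vert K) (\<sigma> x) = Comp (und K) (fob \<gamma> x) f"
      "\<And>x. x \<in> Obj X \<Longrightarrow> Cod (vert K) (\<sigma> x) = Comp (und K) (fob \<gamma> x) g"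
    and a: "\<And>a. a \<in> Arr X \<Longrightarrow> Comp (vert K) (\<sigma> (Cod X a)) (hcomp K (far \<gamma> a) (Ide (vert K) f)) =
      Comp (vert K) (hcomp K (far \<gamma> a) (Ide (vert K) g)) (\<sigma> (Dom X a))"
  shows "\<exists>\<alpha>. \<alpha> \<in> Cell K \<and> Dom (vert K) \<alpha> = f \<and> Cod (vert K) \<alpha> = g \<and>
     (\<forall>x\<in>Obj X. hcomp K (Ide (vert K) (fob \<gamma> x)) \<alpha> = \<sigma> x)"
proof -
  let ?Y = "Dom (und K) f"
  note \<gamma> = is_powerD(3)[OF p]
  note gf = hom_cat_functorD[OF K \<gamma>]
  have Y: "?Y \<in> Ob K" using f K by simp
  let ?n = "\<lparr>ndom = precompose K X \<gamma> ?Y A f, ncod = precompose K X \<gamma> ?Y A g, ncmp = restrict \<sigma> (Obj X)\<rparr>"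
  have P: "precompose K X \<gamma> ?Y A f \<in> functors X (hom_cat K ?Y A)" "precompose K X \<gamma> ?Y A g \<in> functors X (hom_cat K ?Y A)"
    using precompose_functor[OF K X \<gamma> f] precompose_functor[OF K X \<gamma> g] d by simp_all
  have "is_nattr ?n"
  proof (rule is_nattrI[of _ X "hom_cat K ?Y A"])
    show "ncmp ?n x \<in> Arr (hom_cat K ?Y A)" if "x \<in> Obj X" for x
      using x[OF that] that f(2) by (simp add: K gf f(1))
    show "Dom (hom_cat K ?Y A) (ncmp ?n x) = fob (ndom ?n) x" "Cod (hom_cat K ?Y A) (ncmp ?n x) = fob (ncod ?n) x"
      if "x \<in> Obj X" for x
      using x[OF that] that by simp_all
    show "Comp (hom_cat K ?Y A) (ncmp ?n (Cod X a)) (far (ndom ?n) a) =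
        Comp (hom_cat K ?Y A) (far (ncod ?n) a) (ncmp ?n (Dom X a))" if "a \<in> Arr X" for a
      using a[OF that] that X by simp
  qed (use P in simp_all)
  then have "?n \<in> Arr (func_cat X (hom_cat K ?Y A))"
    using P by (simp add: func_cat_def)
  moreover have b: "bij_betw (far (power_comparison K X A P \<gamma> ?Y)) (Arr (hom_cat K ?Y P)) (Arr (func_cat X (hom_cat K ?Y A)))"
    using is_iso_func_bij(2)[OF power_comparison_functor[OF K X \<gamma>, of ?Y]] p Y
    unfolding is_power_def by auto
  ultimately have "?n \<in> far (power_comparison K X A P \<gamma> ?Y) ` Arr (hom_cat K ?Y P)"
    by (simp only: bij_betw_imp_surj_on)
  then obtain \<alpha> where \<alpha>: "\<alpha> \<in> Arr (hom_cat K ?Y P)" "far (power_comparison K X A P \<gamma> ?Y) \<alpha> = ?n"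
    by (elim imageE) (rule that, assumption, rule sym, assumption)
  have \<alpha>': "\<alpha> \<in> Cell K" "Dom (und K) (Dom (vert K) \<alpha>) = ?Y" "Cod (und K) (Dom (vert K) \<alpha>) = P"
    using \<alpha> K by auto
  have e: "precompose K X \<gamma> ?Y A (Dom (vert K) \<alpha>) = precompose K X \<gamma> ?Y A f"
    "precompose K X \<gamma> ?Y A (Cod (vert K) \<alpha>) = precompose K X \<gamma> ?Y A g"
    "(\<lambda>x\<in>Obj X. hcomp K (Ide (vert K) (fob \<gamma> x)) \<alpha>) = restrict \<sigma> (Obj X)"
    using \<alpha> by (simp_all add: power_comparison_sel)
  \<comment> \<open>So far the preimage \<open>\<alpha>\<close> only has a source and target with
    the right composites with the cone; injectivity on objects pins both down.\<close>
  have "Dom (vert K) \<alpha> = f"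
    by (rule is_power_eq[OF p]) (use \<alpha>' f K e(1) precompose_sel(3,4)[of _ X K \<gamma> ?Y A f] precompose_sel(3,4)[of _ X K \<gamma> ?Y A "Dom (vert K) \<alpha>"] in simp_all)
  moreover have "Cod (vert K) \<alpha> = g"
    by (rule is_power_eq[OF p]) (use \<alpha>' g d K e(2) precompose_sel(3,4)[of _ X K \<gamma> ?Y A g] precompose_sel(3,4)[of _ X K \<gamma> ?Y A "Cod (vert K) \<alpha>"] in simp_all)
  moreover have "\<forall>x\<in>Obj X. hcomp K (Ide (vert K) (fob \<gamma> x)) \<alpha> = \<sigma> x"
    using e(3) by (metis restrict_apply')
  ultimately show ?thesis using \<alpha>' by blast
qed

text \<open>The four properties amount to bijectivity of the comparison functor on objects and on
  arrows, for each test object. In this form powers can be constructed and transported without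
  handling functor categories.\<close>

lemma is_powerI:
  assumes A: "A \<in> Ob K" and P: "P \<in> Ob K" and \<gamma>: "\<gamma> \<in> functors X (hom_cat K P A)"
    and eq: "\<And>f g. f \<in> Mor K \<Longrightarrow> Cod (und K) f = P \<Longrightarrow> g \<in> Mor K \<Longrightarrow> Cod (und K) g = P \<Longrightarrow>
      Dom (und K) f = Dom (und K) g \<Longrightarrow>
      (\<And>x. x \<in> Obj X \<Longrightarrow> Comp (und K) (fob \<gamma> x) f = Comp (und K) (fob \<gamma> x) g) \<Longrightarrow>
      (\<And>a. a \<in> Arr X \<Longrightarrow> hcomp K (far \<gamma> a) (Ide (vert K) f) = hcomp K (far \<gamma> a) (Ide (vert K) g)) \<Longrightarrow> f = g"
    and ex: "\<And>Y F. Y \<in> Ob K \<Longrightarrow> F \<in> functors X (hom_cat K Y A) \<Longrightarrow>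
      \<exists>f. f \<in> Mor K \<and> Dom (und K) f = Y \<and> Cod (und K) f = P \<and>
       (\<forall>x\<in>Obj X. Comp (und K) (fob \<gamma> x) f = fob F x) \<and> (\<forall>a\<in>Arr X. hcomp K (far \<gamma> a) (Ide (vert K) f) = far F a)"
    and cell_eq: "\<And>\<alpha> \<beta>. \<alpha> \<in> Cell K \<Longrightarrow> Cod (und K) (Dom (vert K) \<alpha>) = P \<Longrightarrow> \<beta> \<in> Cell K \<Longrightarrow>
      Dom (vert K) \<beta> = Dom (vert K) \<alpha> \<Longrightarrow> Cod (vert K) \<beta> = Cod (vert K) \<alpha> \<Longrightarrow>
      (\<And>x. x \<in> Obj X \<Longrightarrow> hcomp K (Ide (vert K) (fob \<gamma> x)) \<alpha> = hcomp K (Ide (vert K) (fob \<gamma> x)) \<beta>) \<Longrightarrow> \<alpha> = \<beta>"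
    and cell_ex: "\<And>f g \<sigma>. f \<in> Mor K \<Longrightarrow> Cod (und K) f = P \<Longrightarrow> g \<in> Mor K \<Longrightarrow> Cod (und K) g = P \<Longrightarrow>
      Dom (und K) f = Dom (und K) g \<Longrightarrow> (\<And>x. x \<in> Obj X \<Longrightarrow> \<sigma> x \<in> Cell K) \<Longrightarrow>
      (\<And>x. x \<in> Obj X \<Longrightarrow> Dom (vert K) (\<sigma> x) = Comp (und K) (fob \<gamma> x) f) \<Longrightarrow>
      (\<And>x. x \<in> Obj X \<Longrightarrow> Cod (vert K) (\<sigma> x) = Comp (und K) (fob \<gamma> x) g) \<Longrightarrow>
      (\<And>a. a \<in> Arr X \<Longrightarrow> Comp (vert K) (\<sigma> (Cod X a)) (hcomp K (far \<gamma> a) (Ide (vert K) f)) =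
         Comp (vert K) (hcomp K (far \<gamma> a) (Ide (vert K) g)) (\<sigma> (Dom X a))) \<Longrightarrow>
      \<exists>\<alpha>. \<alpha> \<in> Cell K \<and> Dom (vert K) \<alpha> = f \<and> Cod (vert K) \<alpha> = g \<and>
       (\<forall>x\<in>Obj X. hcomp K (Ide (vert K) (fob \<gamma> x)) \<alpha> = \<sigma> x)"
  shows "is_power K X A P \<gamma>"
  unfolding is_power_def
proof (intro conjI ballI A P \<gamma>)
  fix Y assume Y: "Y \<in> Ob K"
  note F = power_comparison_functor[OF K X \<gamma>, of Y]
  have C: "category (hom_cat K Y A)" using K by simp
  have precomp_eq: "f = g" if "f \<in> hom (und K) Y P" "g \<in> hom (und K) Y P" "precompose K X \<gamma> Y A f = precompose K X \<gamma> Y A g" for f g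
    by (rule eq) (use that precompose_sel(3,4)[of _ X K \<gamma> Y A f] precompose_sel(3,4)[of _ X K \<gamma> Y A g] in \<open>simp_all add: hom_iff\<close>)
  show "is_iso_func (power_comparison K X A P \<gamma> Y)"
  proof (rule is_iso_funcI[OF category_hom_cat[OF K] F _ _ category_func_cat[OF X C]])
    have "inj_on (fob (power_comparison K X A P \<gamma> Y)) (hom (und K) Y P)"
      by (rule inj_onI) (use precomp_eq in \<open>simp add: power_comparison_sel\<close>)
    moreover have "F \<in> fob (power_comparison K X A P \<gamma> Y) ` hom (und K) Y P" if F: "F \<in> functors X (hom_cat K Y A)" for F
    proof -
      obtain f where f: "f \<in> Mor K" "Dom (und K) f = Y" "Cod (und K) f = P"
        "\<And>x. x \<in> Obj X \<Longrightarrow> Comp (und K) (fob \<gamma> x) f = fob F x"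
        "\<And>a. a \<in> Arr X \<Longrightarrow> hcomp K (far \<gamma> a) (Ide (vert K) f) = far F a"
        using ex[OF Y F] by blast
      have "precompose K X \<gamma> Y A f = F"
        by (rule functors_eqI[OF _ F]) (use precompose_functor[OF K X \<gamma> f(1,3)] f in auto)
      then show ?thesis using f by (auto simp: power_comparison_sel hom_iff intro!: image_eqI[of _ _ f])
    qed
    ultimately show "bij_betw (fob (power_comparison K X A P \<gamma> Y)) (Obj (hom_cat K Y P)) (Obj (func_cat X (hom_cat K Y A)))"
      using functorsD'(1)[OF F] unfolding bij_betw_def by (auto simp: func_cat_def)
  next
    have D: "Dom (vert K) \<alpha> \<in> hom (und K) Y P" "Cod (vert K) \<alpha> \<in> hom (und K) Y P" if "\<alpha> \<in> Arr (hom_cat K Y P)" for \<alpha>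
      using that K by (auto simp: hom_iff)
    have "inj_on (far (power_comparison K X A P \<gamma> Y)) (Arr (hom_cat K Y P))"
    proof (rule inj_onI)
      fix \<alpha> \<beta> assume ab: "\<alpha> \<in> Arr (hom_cat K Y P)" "\<beta> \<in> Arr (hom_cat K Y P)"
        "far (power_comparison K X A P \<gamma> Y) \<alpha> = far (power_comparison K X A P \<gamma> Y) \<beta>"
      then have e: "precompose K X \<gamma> Y A (Dom (vert K) \<alpha>) = precompose K X \<gamma> Y A (Dom (vert K) \<beta>)"
        "precompose K X \<gamma> Y A (Cod (vert K) \<alpha>) = precompose K X \<gamma> Y A (Cod (vert K) \<beta>)"
        "(\<lambda>x\<in>Obj X. hcomp K (Ide (vert K) (fob \<gamma> x)) \<alpha>) = (\<lambda>x\<in>Obj X. hcomp K (Ide (vert K) (fob \<gamma> x)) \<beta>)"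
        by (simp_all add: power_comparison_sel)
      have "Dom (vert K) \<beta> = Dom (vert K) \<alpha>" "Cod (vert K) \<beta> = Cod (vert K) \<alpha>"
        using precomp_eq[OF D(1)[OF ab(1)] D(1)[OF ab(2)] e(1)] precomp_eq[OF D(2)[OF ab(1)] D(2)[OF ab(2)] e(2)] by simp_all
      moreover have "hcomp K (Ide (vert K) (fob \<gamma> x)) \<alpha> = hcomp K (Ide (vert K) (fob \<gamma> x)) \<beta>" if "x \<in> Obj X" for x
        using fun_cong[OF e(3), of x] that by simp
      moreover have "\<alpha> \<in> Cell K" "Cod (und K) (Dom (vert K) \<alpha>) = P" "\<beta> \<in> Cell K"
        using ab(1,2) by (simp_all add: hom_cat_Arr[OF K])
      ultimately show "\<alpha> = \<beta>" by - (rule cell_eq)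
    qed
    moreover have "n \<in> far (power_comparison K X A P \<gamma> Y) ` Arr (hom_cat K Y P)" if n: "n \<in> Arr (func_cat X (hom_cat K Y A))" for n
    proof -
      have n': "is_nattr n" "ndom n \<in> functors X (hom_cat K Y A)" "ncod n \<in> functors X (hom_cat K Y A)"
        using n by (auto simp: func_cat_def)
      \<comment> \<open>A preimage of a natural transformation needs a source and a target before a
        cell between them can be asked for; they are the 1-cells induced by the two functors
        \<open>ndom n\<close> and \<open>ncod n\<close>.\<close>
      obtain f where f: "f \<in> Mor K" "Dom (und K) f = Y" "Cod (und K) f = P"
        "\<And>x. x \<in> Obj X \<Longrightarrow> Comp (und K) (fob \<gamma> x) f = fob (ndom n) x"
        "\<And>a. a \<in> Arr X \<Longrightarrow> hcomp K (far \<gamma> a) (Ide (vert K) f) = far (ndom n) a"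
        using ex[OF Y n'(2)] by blast
      obtain g where g: "g \<in> Mor K" "Dom (und K) g = Y" "Cod (und K) g = P"
        "\<And>x. x \<in> Obj X \<Longrightarrow> Comp (und K) (fob \<gamma> x) g = fob (ncod n) x"
        "\<And>a. a \<in> Arr X \<Longrightarrow> hcomp K (far \<gamma> a) (Ide (vert K) g) = far (ncod n) a"
        using ex[OF Y n'(3)] by blast
      have pf: "precompose K X \<gamma> Y A f = ndom n"
        by (rule functors_eqI[OF _ n'(2)]) (use precompose_functor[OF K X \<gamma> f(1,3)] f in auto)
      have pg: "precompose K X \<gamma> Y A g = ncod n"
        by (rule functors_eqI[OF _ n'(3)]) (use precompose_functor[OF K X \<gamma> g(1,3)] g in auto)
      have "\<exists>\<alpha>. \<alpha> \<in> Cell K \<and> Dom (vert K) \<alpha> = f \<and> Cod (vert K) \<alpha> = g \<and>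
         (\<forall>x\<in>Obj X. hcomp K (Ide (vert K) (fob \<gamma> x)) \<alpha> = ncmp n x)"
      proof (rule cell_ex)
        show "\<And>x. x \<in> Obj X \<Longrightarrow> ncmp n x \<in> Cell K" "\<And>x. x \<in> Obj X \<Longrightarrow> Dom (vert K) (ncmp n x) = Comp (und K) (fob \<gamma> x) f"
          "\<And>x. x \<in> Obj X \<Longrightarrow> Cod (vert K) (ncmp n x) = Comp (und K) (fob \<gamma> x) g"
          using is_nattrD[OF n'(1,2)] f g K by auto
        show "Comp (vert K) (ncmp n (Cod X a)) (hcomp K (far \<gamma> a) (Ide (vert K) f)) =
            Comp (vert K) (hcomp K (far \<gamma> a) (Ide (vert K) g)) (ncmp n (Dom X a))" if "a \<in> Arr X" for a
          using is_nattr_natural[OF n'(1,2) that] f g that by simp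
      qed (use f g in simp_all)
      then obtain \<alpha> where \<alpha>: "\<alpha> \<in> Cell K" "Dom (vert K) \<alpha> = f" "Cod (vert K) \<alpha> = g"
        "\<And>x. x \<in> Obj X \<Longrightarrow> hcomp K (Ide (vert K) (fob \<gamma> x)) \<alpha> = ncmp n x" by blast
      have m: "\<alpha> \<in> Arr (hom_cat K Y P)" using \<alpha> f g K by simp
      have "far (power_comparison K X A P \<gamma> Y) \<alpha> = n"
        using m \<alpha> pf pg is_nattr_undef[OF n'(1,2)]
        by (auto simp: power_comparison_sel intro!: nattr.equality ext)
      then show ?thesis using m by blast
    qed
    ultimately show "bij_betw (far (power_comparison K X A P \<gamma> Y)) (Arr (hom_cat K Y P)) (Arr (func_cat X (hom_cat K Y A)))"
      using functorsD'(2)[OF F] unfolding bij_betw_def by auto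
  qed
qed

end

section \<open>Transport and preservation of powers\<close>

lemma hom_action_functor:
  assumes K: "two_category K" and L: "two_category L" and F: "two_functor K L F"
  shows "hom_action K L F X Y \<in> functors (hom_cat K X Y) (hom_cat L (F0 F X) (F0 F Y))"
  by (rule functorsI) (auto simp: hom_action_def hom_iff K L two_functorD[OF F])

lemma hom_action_cone:
  assumes K: "two_category K" and L: "two_category L" and F: "two_functor K L F"
    and X: "category X" and \<gamma>: "\<gamma> \<in> functors X (hom_cat K P A)"
  shows "comp_func (hom_action K L F P A) \<gamma> \<in> functors X (hom_cat L (F0 F P) (F0 F A))"
    "x \<in> Obj X \<Longrightarrow> fob (comp_func (hom_action K L F P A) \<gamma>) x = F1 F (fob \<gamma> x)"
    "a \<in> Arr X \<Longrightarrow> far (comp_func (hom_action K L F P A) \<gamma>) a = F2 F (far \<gamma> a)"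
  using comp_functors[OF X \<gamma> hom_action_functor[OF K L F]] functorsD[OF \<gamma>] functorsD'(1,2)[OF \<gamma>]
  by (simp_all add: hom_action_def hom_cat_def)

text \<open>Each cone induces a 1-cell into the other power. The two composites are compatible with
  the projections, hence identities by the uniqueness property.\<close>

lemma powers_iso:
  assumes K: "two_category K" and X: "category X"
    and p: "is_power K X A P \<gamma>" and q: "is_power K X A Q \<kappa>"
  obtains i j where "i \<in> Mor K" "Dom (und K) i = P" "Cod (und K) i = Q"
    "j \<in> Mor K" "Dom (und K) j = Q" "Cod (und K) j = P"
    "Comp (und K) j i = Ide (und K) P" "Comp (und K) i j = Ide (und K) Q"
    "\<And>x. x \<in> Obj X \<Longrightarrow> Comp (und K) (fob \<kappa> x) i = fob \<gamma> x"
    "\<And>a. a \<in> Arr X \<Longrightarrow> hcomp K (far \<kappa> a) (Ide (vert K) i) = far \<gamma> a"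
proof -
  note pd = is_powerD[OF K X p] and qd = is_powerD[OF K X q]
  note pf = hom_cat_functorD[OF K pd(3)] and qf = hom_cat_functorD[OF K qd(3)]
  have Cu: "category (und K)" and Cv: "category (vert K)" using K by simp_all
  obtain i where i: "i \<in> Mor K" "Dom (und K) i = P" "Cod (und K) i = Q"
    "\<And>x. x \<in> Obj X \<Longrightarrow> Comp (und K) (fob \<kappa> x) i = fob \<gamma> x"
    "\<And>a. a \<in> Arr X \<Longrightarrow> hcomp K (far \<kappa> a) (Ide (vert K) i) = far \<gamma> a"
    using is_power_ex[OF K X q pd(2,3)] by blast
  obtain j where j: "j \<in> Mor K" "Dom (und K) j = Q" "Cod (und K) j = P"
    "\<And>x. x \<in> Obj X \<Longrightarrow> Comp (und K) (fob \<gamma> x) j = fob \<kappa> x"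
    "\<And>a. a \<in> Arr X \<Longrightarrow> hcomp K (far \<gamma> a) (Ide (vert K) j) = far \<kappa> a"
    using is_power_ex[OF K X p qd(2,3)] by blast
  have ji: "Comp (und K) j i = Ide (und K) P"
  proof (rule is_power_eq[OF K X p])
    show "Comp (und K) (fob \<gamma> x) (Comp (und K) j i) = Comp (und K) (fob \<gamma> x) (Ide (und K) P)" if x: "x \<in> Obj X" for x
      using category_assoc[OF Cu i(1) j(1) pf(1)[OF x]] x by (simp add: i j pf K)
    show "hcomp K (far \<gamma> a) (Ide (vert K) (Comp (und K) j i)) = hcomp K (far \<gamma> a) (Ide (vert K) (Ide (und K) P))"
      if a: "a \<in> Arr X" for a
      using hcomp_assoc[OF K, of "Ide (vert K) i" "Ide (vert K) j" "far \<gamma> a"] a by (simp add: i j pf K X)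
  qed (simp_all add: i j K pd)
  have ij: "Comp (und K) i j = Ide (und K) Q"
  proof (rule is_power_eq[OF K X q])
    show "Comp (und K) (fob \<kappa> x) (Comp (und K) i j) = Comp (und K) (fob \<kappa> x) (Ide (und K) Q)" if x: "x \<in> Obj X" for x
      using category_assoc[OF Cu j(1) i(1) qf(1)[OF x]] x by (simp add: i j qf K)
    show "hcomp K (far \<kappa> a) (Ide (vert K) (Comp (und K) i j)) = hcomp K (far \<kappa> a) (Ide (vert K) (Ide (und K) Q))"
      if a: "a \<in> Arr X" for a
      using hcomp_assoc[OF K, of "Ide (vert K) j" "Ide (vert K) i" "far \<kappa> a"] a by (simp add: i j qf K X)
  qed (simp_all add: i j K qd)
  show thesis using that i j ji ij by blast
qed

text \<open>Each question about 1-cells or 2-cells into \<open>P\<close> is sent along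
  \<open>i\<close> to \<open>Q\<close>, answered there, and the answer is brought back along
  \<open>j\<close>.\<close>

lemma power_iso_invariant:
  assumes K: "two_category K" and X: "category X" and q: "is_power K X A Q \<kappa>"
    and i: "i \<in> Mor K" "Dom (und K) i = P" "Cod (und K) i = Q"
    and j: "j \<in> Mor K" "Dom (und K) j = Q" "Cod (und K) j = P"
    and ji: "Comp (und K) j i = Ide (und K) P" and ij: "Comp (und K) i j = Ide (und K) Q"
    and \<gamma>: "\<gamma> \<in> functors X (hom_cat K P A)"
    and x: "\<And>x. x \<in> Obj X \<Longrightarrow> fob \<gamma> x = Comp (und K) (fob \<kappa> x) i"
    and a: "\<And>a. a \<in> Arr X \<Longrightarrow> far \<gamma> a = hcomp K (far \<kappa> a) (Ide (vert K) i)"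
  shows "is_power K X A P \<gamma>"
proof -
  note qd = is_powerD[OF K X q]
  note qf = hom_cat_functorD[OF K qd(3)]
  have Cu: "category (und K)" and Cv: "category (vert K)" using K by simp_all
  let ?c = "Comp (und K)" and ?h = "hcomp K" and ?I = "Ide (vert K)"
  have P: "P \<in> Ob K" using i K by auto
  have gx: "?c (fob \<gamma> x) f = ?c (fob \<kappa> x) (?c i f)" if "x \<in> Obj X" "f \<in> Mor K" "Cod (und K) f = P" for x f
    using that x category_assoc[OF Cu that(2) i(1) qf(1)[OF that(1)]] by (simp add: i qf)
  have ga: "?h (far \<gamma> a) (?I f) = ?h (far \<kappa> a) (?I (?c i f))" if "a \<in> Arr X" "f \<in> Mor K" "Cod (und K) f = P" for a f
    using that a hcomp_assoc[OF K, of "?I f" "?I i" "far \<kappa> a"] by (simp add: i qf K X)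
  have gc: "?h (?I (fob \<gamma> x)) \<alpha> = ?h (?I (fob \<kappa> x)) (?h (?I i) \<alpha>)" if "x \<in> Obj X" "\<alpha> \<in> Cell K" "Cod (und K) (Dom (vert K) \<alpha>) = P" for x \<alpha>
  proof -
    have "?I (fob \<gamma> x) = ?h (?I (fob \<kappa> x)) (?I i)" using that by (simp add: x i qf K)
    then show ?thesis using that hcomp_assoc[OF K, of \<alpha> "?I i" "?I (fob \<kappa> x)"] by (simp add: i qf K)
  qed
  have ic: "f = g" if "?c i f = ?c i g" "f \<in> Mor K" "Cod (und K) f = P" "g \<in> Mor K" "Cod (und K) g = P" for f g
  proof -
    have "?c j (?c i f) = f" "?c j (?c i g) = g"
      using category_assoc[OF Cu that(2) i(1) j(1)] category_assoc[OF Cu that(4) i(1) j(1)] that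
      by (simp_all add: i j ji Cu)
    then show ?thesis using that(1) by metis
  qed
  show ?thesis
  proof (rule is_powerI[OF K X qd(1) P \<gamma>])
    fix f g assume fg: "f \<in> Mor K" "Cod (und K) f = P" "g \<in> Mor K" "Cod (und K) g = P" "Dom (und K) f = Dom (und K) g"
      and e: "\<And>x. x \<in> Obj X \<Longrightarrow> ?c (fob \<gamma> x) f = ?c (fob \<gamma> x) g"
        "\<And>a. a \<in> Arr X \<Longrightarrow> ?h (far \<gamma> a) (?I f) = ?h (far \<gamma> a) (?I g)"
    have "?c i f = ?c i g"
      by (rule is_power_eq[OF K X q]) (use e gx ga fg in \<open>simp_all add: i Cu\<close>)
    then show "f = g" using ic fg by blast
  next
    fix Y F assume "Y \<in> Ob K" "F \<in> functors X (hom_cat K Y A)"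
    then obtain f where f: "f \<in> Mor K" "Dom (und K) f = Y" "Cod (und K) f = Q"
      "\<And>x. x \<in> Obj X \<Longrightarrow> ?c (fob \<kappa> x) f = fob F x" "\<And>a. a \<in> Arr X \<Longrightarrow> ?h (far \<kappa> a) (?I f) = far F a"
      using is_power_ex[OF K X q] by blast
    have "?c i (?c j f) = f"
      using category_assoc[OF Cu f(1) j(1) i(1)] by (simp add: f i j ij Cu)
    then show "\<exists>f. f \<in> Mor K \<and> Dom (und K) f = Y \<and> Cod (und K) f = P \<and>
        (\<forall>x\<in>Obj X. ?c (fob \<gamma> x) f = fob F x) \<and> (\<forall>a\<in>Arr X. ?h (far \<gamma> a) (?I f) = far F a)"
      by (intro exI[of _ "?c j f"]) (simp add: gx ga f j Cu)
  next
    fix \<alpha> \<beta> assume ab: "\<alpha> \<in> Cell K" "Cod (und K) (Dom (vert K) \<alpha>) = P" "\<beta> \<in> Cell K"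
      "Dom (vert K) \<beta> = Dom (vert K) \<alpha>" "Cod (vert K) \<beta> = Cod (vert K) \<alpha>"
      and e: "\<And>x. x \<in> Obj X \<Longrightarrow> ?h (?I (fob \<gamma> x)) \<alpha> = ?h (?I (fob \<gamma> x)) \<beta>"
    have "?h (?I i) \<alpha> = ?h (?I i) \<beta>"
      by (rule is_power_cell_eq[OF K X q]) (use e gc ab in \<open>simp_all add: i K Cu\<close>)
    moreover have "?h (?I j) (?h (?I i) \<alpha>) = \<alpha>" "?h (?I j) (?h (?I i) \<beta>) = \<beta>"
      using hcomp_assoc[OF K, of \<alpha> "?I i" "?I j"] hcomp_assoc[OF K, of \<beta> "?I i" "?I j"] ab
      by (simp_all add: i j ji K)
    ultimately show "\<alpha> = \<beta>" by metis
  next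
    fix f g \<sigma> assume fg: "f \<in> Mor K" "Cod (und K) f = P" "g \<in> Mor K" "Cod (und K) g = P" "Dom (und K) f = Dom (und K) g"
      and s: "\<And>x. x \<in> Obj X \<Longrightarrow> \<sigma> x \<in> Cell K" "\<And>x. x \<in> Obj X \<Longrightarrow> Dom (vert K) (\<sigma> x) = ?c (fob \<gamma> x) f"
        "\<And>x. x \<in> Obj X \<Longrightarrow> Cod (vert K) (\<sigma> x) = ?c (fob \<gamma> x) g"
        "\<And>a. a \<in> Arr X \<Longrightarrow> Comp (vert K) (\<sigma> (Cod X a)) (?h (far \<gamma> a) (?I f)) =
           Comp (vert K) (?h (far \<gamma> a) (?I g)) (\<sigma> (Dom X a))"
    have "\<exists>\<alpha>. \<alpha> \<in> Cell K \<and> Dom (vert K) \<alpha> = ?c i f \<and> Cod (vert K) \<alpha> = ?c i g \<and>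
        (\<forall>x\<in>Obj X. ?h (?I (fob \<kappa> x)) \<alpha> = \<sigma> x)"
      by (rule is_power_cell_ex[OF K X q]) (use s gx ga fg in \<open>simp_all add: i K Cu\<close>)
    then obtain \<alpha> where \<alpha>: "\<alpha> \<in> Cell K" "Dom (vert K) \<alpha> = ?c i f" "Cod (vert K) \<alpha> = ?c i g"
        "\<And>x. x \<in> Obj X \<Longrightarrow> ?h (?I (fob \<kappa> x)) \<alpha> = \<sigma> x" by blast
    have jif: "?c j (?c i f) = f" "?c j (?c i g) = g"
      using category_assoc[OF Cu fg(1) i(1) j(1)] category_assoc[OF Cu fg(3) i(1) j(1)] fg
      by (simp_all add: i j ji Cu)
    have ija: "?h (?I i) (?h (?I j) \<alpha>) = \<alpha>"
      using hcomp_assoc[OF K \<alpha>(1), of "?I j" "?I i"] fg by (simp add: i j ij K \<alpha> Cu)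
    have "?h (?I j) \<alpha> \<in> Cell K \<and> Dom (vert K) (?h (?I j) \<alpha>) = f \<and> Cod (vert K) (?h (?I j) \<alpha>) = g"
      using fg by (simp add: i j K \<alpha> Cu jif)
    moreover have "\<forall>x\<in>Obj X. ?h (?I (fob \<gamma> x)) (?h (?I j) \<alpha>) = \<sigma> x"
      using fg by (simp add: gc ija \<alpha> j i K Cu)
    ultimately show "\<exists>\<alpha>. \<alpha> \<in> Cell K \<and> Dom (vert K) \<alpha> = f \<and> Cod (vert K) \<alpha> = g \<and>
        (\<forall>x\<in>Obj X. ?h (?I (fob \<gamma> x)) \<alpha> = \<sigma> x)" by blast
  qed
qed

text \<open>Two powers of \<open>A\<close> by \<open>X\<close> are related by an isomorphism
  compatible with the projections, and \<open>F\<close> carries it to such an isomorphism.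
  Preservation of an arbitrary power can therefore be tested on one that is constructed for the
  purpose.\<close>

lemma preserves_power_cong:
  assumes K: "two_category K" and L: "two_category L" and F: "two_functor K L F" and X: "category X"
    and p: "is_power K X A P \<gamma>" and q: "is_power K X A Q \<kappa>"
    and Fq: "is_power L X (F0 F A) (F0 F Q) (comp_func (hom_action K L F Q A) \<kappa>)"
  shows "is_power L X (F0 F A) (F0 F P) (comp_func (hom_action K L F P A) \<gamma>)"
proof -
  note pd = is_powerD[OF K X p] and qd = is_powerD[OF K X q]
  note pf = hom_cat_functorD[OF K pd(3)] and qf = hom_cat_functorD[OF K qd(3)]
  note f = two_functorD[OF F] and hp = hom_action_cone[OF K L F X pd(3)] and hq = hom_action_cone[OF K L F X qd(3)]
  obtain i j where ij: "i \<in> Mor K" "Dom (und K) i = P" "Cod (und K) i = Q"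
    "j \<in> Mor K" "Dom (und K) j = Q" "Cod (und K) j = P"
    "Comp (und K) j i = Ide (und K) P" "Comp (und K) i j = Ide (und K) Q"
    and x: "\<And>x. x \<in> Obj X \<Longrightarrow> Comp (und K) (fob \<kappa> x) i = fob \<gamma> x"
    and a: "\<And>a. a \<in> Arr X \<Longrightarrow> hcomp K (far \<kappa> a) (Ide (vert K) i) = far \<gamma> a"
    by (rule powers_iso[OF K X p q]) blast
  have e: "Comp (und L) (F1 F j) (F1 F i) = Ide (und L) (F0 F P)" "Comp (und L) (F1 F i) (F1 F j) = Ide (und L) (F0 F Q)"
    using f(6)[of i j] f(6)[of j i] ij pd qd f(5) by simp_all
  show ?thesis
  proof (rule power_iso_invariant[OF L X Fq _ _ _ _ _ _ e hp(1)])
    show "fob (comp_func (hom_action K L F P A) \<gamma>) x = Comp (und L) (fob (comp_func (hom_action K L F Q A) \<kappa>) x) (F1 F i)"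
      if "x \<in> Obj X" for x
      using f(6)[of i "fob \<kappa> x"] that by (simp add: hp hq ij qf x)
    show "far (comp_func (hom_action K L F P A) \<gamma>) a = hcomp L (far (comp_func (hom_action K L F Q A) \<kappa>) a) (Ide (vert L) (F1 F i))"
      if "a \<in> Arr X" for a
      using f(12)[of "Ide (vert K) i" "far \<kappa> a"] f(10)[of i] that by (simp add: hp hq ij qf a K X)
  qed (simp_all add: ij f)
qed

text \<open>A product of categories presented by two coordinate bijections instead of by pairs: in
  its use below the product lives over the same type as its factors and is replaced by an isomorphic
  member of \<open>FP\<close>, and this notion survives both.\<close>

definition product_of :: "('o, 'a) cat \<Rightarrow> ('p, 'b) cat \<Rightarrow> ('q, 'c) cat \<Rightarrow> ('o \<Rightarrow> 'p \<Rightarrow> 'q) \<Rightarrow> ('a \<Rightarrow> 'b \<Rightarrow> 'c) \<Rightarrow> bool" where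
  "product_of X A Q k0 k1 \<longleftrightarrow>
     bij_betw (\<lambda>(x, a). k0 x a) (Obj X \<times> Obj A) (Obj Q) \<and>
     bij_betw (\<lambda>(u, v). k1 u v) (Arr X \<times> Arr A) (Arr Q) \<and>
     (\<forall>u\<in>Arr X. \<forall>v\<in>Arr A. Dom Q (k1 u v) = k0 (Dom X u) (Dom A v) \<and> Cod Q (k1 u v) = k0 (Cod X u) (Cod A v)) \<and>
     (\<forall>x\<in>Obj X. \<forall>a\<in>Obj A. Ide Q (k0 x a) = k1 (Ide X x) (Ide A a)) \<and>
     (\<forall>u\<in>Arr X. \<forall>u'\<in>Arr X. \<forall>v\<in>Arr A. \<forall>v'\<in>Arr A. Dom X u' = Cod X u \<longrightarrow> Dom A v' = Cod A v \<longrightarrow>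
        Comp Q (k1 u' v') (k1 u v) = k1 (Comp X u' u) (Comp A v' v))"

lemma product_ofD:
  assumes "product_of X A Q k0 k1"
  shows "x \<in> Obj X \<Longrightarrow> a \<in> Obj A \<Longrightarrow> k0 x a \<in> Obj Q"
    "u \<in> Arr X \<Longrightarrow> v \<in> Arr A \<Longrightarrow> k1 u v \<in> Arr Q"
    "u \<in> Arr X \<Longrightarrow> v \<in> Arr A \<Longrightarrow> Dom Q (k1 u v) = k0 (Dom X u) (Dom A v)"
    "u \<in> Arr X \<Longrightarrow> v \<in> Arr A \<Longrightarrow> Cod Q (k1 u v) = k0 (Cod X u) (Cod A v)"
    "x \<in> Obj X \<Longrightarrow> a \<in> Obj A \<Longrightarrow> Ide Q (k0 x a) = k1 (Ide X x) (Ide A a)"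
    "u \<in> Arr X \<Longrightarrow> u' \<in> Arr X \<Longrightarrow> v \<in> Arr A \<Longrightarrow> v' \<in> Arr A \<Longrightarrow> Dom X u' = Cod X u \<Longrightarrow> Dom A v' = Cod A v \<Longrightarrow>
        Comp Q (k1 u' v') (k1 u v) = k1 (Comp X u' u) (Comp A v' v)"
    "\<And>q. q \<in> Obj Q \<Longrightarrow> \<exists>x\<in>Obj X. \<exists>a\<in>Obj A. q = k0 x a"
    "\<And>q. q \<in> Arr Q \<Longrightarrow> \<exists>u\<in>Arr X. \<exists>v\<in>Arr A. q = k1 u v"
    "\<And>x a x' a'. x \<in> Obj X \<Longrightarrow> a \<in> Obj A \<Longrightarrow> x' \<in> Obj X \<Longrightarrow> a' \<in> Obj A \<Longrightarrow> k0 x a = k0 x' a' \<longleftrightarrow> x = x' \<and> a = a'"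
    "\<And>x a x' a'. x \<in> Arr X \<Longrightarrow> a \<in> Arr A \<Longrightarrow> x' \<in> Arr X \<Longrightarrow> a' \<in> Arr A \<Longrightarrow> k1 x a = k1 x' a' \<longleftrightarrow> x = x' \<and> a = a'"
proof -
  have s: "Obj Q = (\<lambda>(x, a). k0 x a) ` (Obj X \<times> Obj A)" "Arr Q = (\<lambda>(u, v). k1 u v) ` (Arr X \<times> Arr A)"
    using assms by (simp_all add: product_of_def bij_betw_def)
  show "\<And>q. q \<in> Obj Q \<Longrightarrow> \<exists>x\<in>Obj X. \<exists>a\<in>Obj A. q = k0 x a"
    "\<And>q. q \<in> Arr Q \<Longrightarrow> \<exists>u\<in>Arr X. \<exists>v\<in>Arr A. q = k1 u v"
    unfolding s by auto
  show "x \<in> Obj X \<Longrightarrow> a \<in> Obj A \<Longrightarrow> k0 x a \<in> Obj Q" "u \<in> Arr X \<Longrightarrow> v \<in> Arr A \<Longrightarrow> k1 u v \<in> Arr Q"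
    unfolding s by auto
qed (use assms in \<open>auto simp: product_of_def bij_betw_def inj_on_def\<close>)

text \<open>Values are prescribed on the coordinates of an element of the product, which the
  inverses of the two bijections recover.\<close>

lemma product_functions:
  assumes "product_of X A Q k0 k1"
  obtains f0 f1 where "\<And>x a. x \<in> Obj X \<Longrightarrow> a \<in> Obj A \<Longrightarrow> f0 (k0 x a) = h0 x a"
    "\<And>u v. u \<in> Arr X \<Longrightarrow> v \<in> Arr A \<Longrightarrow> f1 (k1 u v) = h1 u v"
proof -
  have i: "inj_on (\<lambda>(x, a). k0 x a) (Obj X \<times> Obj A)" "inj_on (\<lambda>(u, v). k1 u v) (Arr X \<times> Arr A)"
    using assms by (auto simp: product_of_def bij_betw_def)
  show thesis
  proof (rule that)
    show "case_prod h0 (inv_into (Obj X \<times> Obj A) (\<lambda>(x, a). k0 x a) (k0 x a)) = h0 x a" if "x \<in> Obj X" "a \<in> Obj A" for x a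
      using inv_into_f_f[OF i(1), of "(x, a)"] that by simp
    show "case_prod h1 (inv_into (Arr X \<times> Arr A) (\<lambda>(x, a). k1 x a) (k1 x a)) = h1 x a" if "x \<in> Arr X" "a \<in> Arr A" for x a
      using inv_into_f_f[OF i(2), of "(x, a)"] that by simp
  qed
qed

text \<open>Each element of the product has unique coordinates, so a pair of two-variable functions
  that respects both structures descends to a functor on \<open>Q\<close>.\<close>

lemma product_functor_ex:
  assumes Q: "product_of X A Q k0 k1" and X: "category X" and A: "category A"
    and h: "\<And>x a. x \<in> Obj X \<Longrightarrow> a \<in> Obj A \<Longrightarrow> h0 x a \<in> Obj B"
      "\<And>u v. u \<in> Arr X \<Longrightarrow> v \<in> Arr A \<Longrightarrow> h1 u v \<in> Arr B"
      "\<And>u v. u \<in> Arr X \<Longrightarrow> v \<in> Arr A \<Longrightarrow> Dom B (h1 u v) = h0 (Dom X u) (Dom A v)"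
      "\<And>u v. u \<in> Arr X \<Longrightarrow> v \<in> Arr A \<Longrightarrow> Cod B (h1 u v) = h0 (Cod X u) (Cod A v)"
      "\<And>x a. x \<in> Obj X \<Longrightarrow> a \<in> Obj A \<Longrightarrow> h1 (Ide X x) (Ide A a) = Ide B (h0 x a)"
      "\<And>u v u' v'. u \<in> Arr X \<Longrightarrow> v \<in> Arr A \<Longrightarrow> u' \<in> Arr X \<Longrightarrow> v' \<in> Arr A \<Longrightarrow> Dom X u' = Cod X u \<Longrightarrow> Dom A v' = Cod A v \<Longrightarrow>
         h1 (Comp X u' u) (Comp A v' v) = Comp B (h1 u' v') (h1 u v)"
  shows "\<exists>F\<in>functors Q B. (\<forall>x\<in>Obj X. \<forall>a\<in>Obj A. fob F (k0 x a) = h0 x a) \<and>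
     (\<forall>u\<in>Arr X. \<forall>v\<in>Arr A. far F (k1 u v) = h1 u v)"
proof -
  note q = product_ofD[OF Q]
  obtain f0 f1 where f: "\<And>x a. x \<in> Obj X \<Longrightarrow> a \<in> Obj A \<Longrightarrow> f0 (k0 x a) = h0 x a"
    "\<And>u v. u \<in> Arr X \<Longrightarrow> v \<in> Arr A \<Longrightarrow> f1 (k1 u v) = h1 u v"
    by (rule product_functions[OF Q, where ?h0.0=h0 and ?h1.0=h1]) blast
  define F where "F = \<lparr>fdom = Q, fcod = B, fob = restrict f0 (Obj Q), far = restrict f1 (Arr Q)\<rparr>"
  have F: "fob F (k0 x a) = h0 x a" if "x \<in> Obj X" "a \<in> Obj A" for x a using that f q(1) by (simp add: F_def)
  have F': "far F (k1 x a) = h1 x a" if "x \<in> Arr X" "a \<in> Arr A" for x a using that f q(2) by (simp add: F_def)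
  have "F \<in> functors Q B"
  proof (rule functorsI)
    fix r s assume rs: "r \<in> Arr Q" "s \<in> Arr Q" "Dom Q s = Cod Q r"
    obtain u v where u: "u \<in> Arr X" "v \<in> Arr A" "r = k1 u v" using q(8)[OF rs(1)] by blast
    obtain u' v' where u': "u' \<in> Arr X" "v' \<in> Arr A" "s = k1 u' v'" using q(8)[OF rs(2)] by blast
    have d: "Dom X u' = Cod X u \<and> Dom A v' = Cod A v"
      using rs(3) u u' q(3)[OF u'(1,2)] q(4)[OF u(1,2)] q(9) X A by simp
    then show "far F (Comp Q s r) = Comp B (far F s) (far F r)"
      using u u' q(6)[OF u(1) u'(1) u(2) u'(2)] F' h(6)[OF u(1,2) u'(1,2)] X A by simp
  next
    fix r assume r: "r \<in> Arr Q"
    then obtain u v where u: "u \<in> Arr X" "v \<in> Arr A" "r = k1 u v" using q(8) by blast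
    then show "far F r \<in> Arr B" "Dom B (far F r) = fob F (Dom Q r)" "Cod B (far F r) = fob F (Cod Q r)"
      using F F' h X A q(3,4) by simp_all
  next
    fix r assume r: "r \<in> Obj Q"
    then obtain x a where u: "x \<in> Obj X" "a \<in> Obj A" "r = k0 x a" using q(7) by blast
    then show "fob F r \<in> Obj B" "far F (Ide Q r) = Ide B (fob F r)"
      using F F' h X A q(5) by simp_all
  qed (simp_all add: F_def)
  then show ?thesis using F F' by blast
qed

text \<open>If \<open>\<alpha>\<close> exhibits \<open>P = I\<^sup>A\<close> and \<open>\<rho>\<close> exhibits \<open>R = I\<^sup>Q\<close> with \<open>Q = X \<times> A\<close>, then \<open>\<kappa>\<close> exhibits \<open>R = P\<^sup>X\<close>.\<close>

lemma power_of_power: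
  assumes K: "two_category K" and X: "category X" and A: "category A" and Q: "category Q"
    and pr: "product_of X A Q k0 k1"
    and a: "is_power K A I P \<alpha>" and r: "is_power K Q I R \<rho>"
    and \<kappa>: "\<kappa> \<in> functors X (hom_cat K R P)"
    and e0: "\<And>x a. x \<in> Obj X \<Longrightarrow> a \<in> Obj A \<Longrightarrow> Comp (und K) (fob \<alpha> a) (fob \<kappa> x) = fob \<rho> (k0 x a)"
    and e1: "\<And>u v. u \<in> Arr X \<Longrightarrow> v \<in> Arr A \<Longrightarrow> hcomp K (far \<alpha> v) (far \<kappa> u) = far \<rho> (k1 u v)"
  shows "is_power K X P R \<kappa>"
proof -
  note ad = is_powerD[OF K A a] and rd = is_powerD[OF K Q r]
  note af = hom_cat_functorD[OF K ad(3)] and rf = hom_cat_functorD[OF K rd(3)] and kf = hom_cat_functorD[OF K \<kappa>]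
  note q = product_ofD[OF pr]
  have Cu: "category (und K)" and Cv: "category (vert K)" using K by simp_all
  let ?c = "Comp (und K)" and ?h = "hcomp K" and ?I = "Ide (vert K)" and ?v = "Comp (vert K)"
  have c0: "?c (fob \<rho> (k0 x a)) f = ?c (fob \<alpha> a) (?c (fob \<kappa> x) f)"
    if "x \<in> Obj X" "a \<in> Obj A" "f \<in> Mor K" "Cod (und K) f = R" for x a f
    using category_assoc[OF Cu that(3) kf(1)[OF that(1)] af(1)[OF that(2)]] that by (simp add: e0 kf af)
  have c1: "?h (far \<rho> (k1 u v)) (?I f) = ?h (far \<alpha> v) (?h (far \<kappa> u) (?I f))"
    if "u \<in> Arr X" "v \<in> Arr A" "f \<in> Mor K" "Cod (und K) f = R" for u v f
    using hcomp_assoc[OF K, of "?I f" "far \<kappa> u" "far \<alpha> v"] that by (simp add: e1 kf af K X A)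
  have c2: "?h (?I (fob \<rho> (k0 x a))) \<beta> = ?h (?I (fob \<alpha> a)) (?h (?I (fob \<kappa> x)) \<beta>)"
    if "x \<in> Obj X" "a \<in> Obj A" "\<beta> \<in> Cell K" "Cod (und K) (Dom (vert K) \<beta>) = R" for x a \<beta>
  proof -
    have "?I (fob \<rho> (k0 x a)) = ?h (?I (fob \<alpha> a)) (?I (fob \<kappa> x))"
      using that by (simp add: e0[symmetric] kf af K)
    then show ?thesis using hcomp_assoc[OF K that(3), of "?I (fob \<kappa> x)" "?I (fob \<alpha> a)"] that by (simp add: kf af K)
  qed
  have idA: "?h (?I (fob \<alpha> a)) \<theta> = ?h (far \<alpha> (Ide A a)) \<theta>" if "a \<in> Obj A" for a \<theta>
    using that by (simp add: af)
  show ?thesis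
  proof (rule is_powerI[OF K X ad(2) rd(2) \<kappa>])
    fix f g assume fg: "f \<in> Mor K" "Cod (und K) f = R" "g \<in> Mor K" "Cod (und K) g = R" "Dom (und K) f = Dom (und K) g"
      and e: "\<And>x. x \<in> Obj X \<Longrightarrow> ?c (fob \<kappa> x) f = ?c (fob \<kappa> x) g"
        "\<And>a. a \<in> Arr X \<Longrightarrow> ?h (far \<kappa> a) (?I f) = ?h (far \<kappa> a) (?I g)"
    show "f = g"
    proof (rule is_power_eq[OF K Q r fg])
      fix z assume "z \<in> Obj Q"
      then obtain x a where "x \<in> Obj X" "a \<in> Obj A" "z = k0 x a" using q(7) by blast
      then show "?c (fob \<rho> z) f = ?c (fob \<rho> z) g" using c0 fg e(1) by simp
    next
      fix z assume "z \<in> Arr Q"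
      then obtain u v where "u \<in> Arr X" "v \<in> Arr A" "z = k1 u v" using q(8) by blast
      then show "?h (far \<rho> z) (?I f) = ?h (far \<rho> z) (?I g)" using c1 fg e(2) by simp
    qed
  next
    fix Y F assume Y: "Y \<in> Ob K" and F: "F \<in> functors X (hom_cat K Y P)"
    note ff = hom_cat_functorD[OF K F]
    \<comment> \<open>Uncurrying: \<open>P\<close> classifies cones on \<open>I\<close> indexed by
      \<open>A\<close>, so a cone on \<open>P\<close> indexed by \<open>X\<close> amounts to a cone
      on \<open>I\<close> indexed by the product.\<close>
    have "\<exists>G\<in>functors Q (hom_cat K Y I). (\<forall>x\<in>Obj X. \<forall>a\<in>Obj A. fob G (k0 x a) = ?c (fob \<alpha> a) (fob F x)) \<and>
       (\<forall>u\<in>Arr X. \<forall>v\<in>Arr A. far G (k1 u v) = ?h (far \<alpha> v) (far F u))"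
    proof (rule product_functor_ex[OF pr X A])
      fix u v u' v' assume uv: "u \<in> Arr X" "v \<in> Arr A" "u' \<in> Arr X" "v' \<in> Arr A" "Dom X u' = Cod X u" "Dom A v' = Cod A v"
      have "?h (?v (far \<alpha> v') (far \<alpha> v)) (?v (far F u') (far F u)) = ?v (?h (far \<alpha> v') (far F u')) (?h (far \<alpha> v) (far F u))"
        by (rule interchange) (use uv in \<open>simp_all add: K X A af ff\<close>)
      then show "?h (far \<alpha> (Comp A v' v)) (far F (Comp X u' u)) =
          Comp (hom_cat K Y I) (?h (far \<alpha> v') (far F u')) (?h (far \<alpha> v) (far F u))"
        using uv by (simp add: af ff)
    qed (simp_all add: hom_iff K X A af ff)
    then obtain G where G: "G \<in> functors Q (hom_cat K Y I)"
      "\<And>x a. x \<in> Obj X \<Longrightarrow> a \<in> Obj A \<Longrightarrow> fob G (k0 x a) = ?c (fob \<alpha> a) (fob F x)"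
      "\<And>u v. u \<in> Arr X \<Longrightarrow> v \<in> Arr A \<Longrightarrow> far G (k1 u v) = ?h (far \<alpha> v) (far F u)"
      by blast
    obtain f where f: "f \<in> Mor K" "Dom (und K) f = Y" "Cod (und K) f = R"
      "\<And>x. x \<in> Obj Q \<Longrightarrow> ?c (fob \<rho> x) f = fob G x" "\<And>a. a \<in> Arr Q \<Longrightarrow> ?h (far \<rho> a) (?I f) = far G a"
      using is_power_ex[OF K Q r Y G(1)] by blast
    have fa: "?h (far \<alpha> v) (?h (far \<kappa> u) (?I f)) = ?h (far \<alpha> v) (far F u)" if "u \<in> Arr X" "v \<in> Arr A" for u v
      using c1[OF that f(1,3)] f(5)[OF q(2)[OF that]] G(3)[OF that] by simp
    have 1: "?c (fob \<kappa> x) f = fob F x" if x: "x \<in> Obj X" for x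
    proof (rule is_power_eq[OF K A a])
      fix a assume a': "a \<in> Obj A"
      show "?c (fob \<alpha> a) (?c (fob \<kappa> x) f) = ?c (fob \<alpha> a) (fob F x)"
        using c0[OF x a' f(1,3)] f(4)[OF q(1)[OF x a']] G(2)[OF x a'] by simp
    next
      fix v assume v: "v \<in> Arr A"
      \<comment> \<open>Both functors send \<open>Ide X x\<close> to an identity cell, so
        \<open>fa\<close> at this arrow is the required equation of whiskered cells.\<close>
      show "?h (far \<alpha> v) (?I (?c (fob \<kappa> x) f)) = ?h (far \<alpha> v) (?I (fob F x))"
        using fa[OF _ v, of "Ide X x"] x by (simp add: kf ff f K X)
    qed (use x in \<open>simp_all add: kf ff f Cu\<close>)
    have 2: "?h (far \<kappa> u) (?I f) = far F u" if u: "u \<in> Arr X" for u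
    proof (rule is_power_cell_eq[OF K A a])
      fix a assume "a \<in> Obj A"
      then show "?h (?I (fob \<alpha> a)) (?h (far \<kappa> u) (?I f)) = ?h (?I (fob \<alpha> a)) (far F u)"
        using fa[OF u, of "Ide A a"] A by (simp add: af)
    qed (use u 1 in \<open>simp_all add: kf ff f K X Cu\<close>)
    show "\<exists>f. f \<in> Mor K \<and> Dom (und K) f = Y \<and> Cod (und K) f = R \<and>
        (\<forall>x\<in>Obj X. ?c (fob \<kappa> x) f = fob F x) \<and> (\<forall>a\<in>Arr X. ?h (far \<kappa> a) (?I f) = far F a)"
      using f 1 2 by blast
  next
    fix \<beta> \<theta> assume ab: "\<beta> \<in> Cell K" "Cod (und K) (Dom (vert K) \<beta>) = R" "\<theta> \<in> Cell K"
      "Dom (vert K) \<theta> = Dom (vert K) \<beta>" "Cod (vert K) \<theta> = Cod (vert K) \<beta>"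
      and e: "\<And>x. x \<in> Obj X \<Longrightarrow> ?h (?I (fob \<kappa> x)) \<beta> = ?h (?I (fob \<kappa> x)) \<theta>"
    show "\<beta> = \<theta>"
    proof (rule is_power_cell_eq[OF K Q r ab])
      fix z assume "z \<in> Obj Q"
      then obtain x a where "x \<in> Obj X" "a \<in> Obj A" "z = k0 x a" using q(7) by blast
      then show "?h (?I (fob \<rho> z)) \<beta> = ?h (?I (fob \<rho> z)) \<theta>" using c2 ab e by simp
    qed
  next
    fix f g \<sigma> assume fg: "f \<in> Mor K" "Cod (und K) f = R" "g \<in> Mor K" "Cod (und K) g = R" "Dom (und K) f = Dom (und K) g"
      and s: "\<And>x. x \<in> Obj X \<Longrightarrow> \<sigma> x \<in> Cell K" "\<And>x. x \<in> Obj X \<Longrightarrow> Dom (vert K) (\<sigma> x) = ?c (fob \<kappa> x) f"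
        "\<And>x. x \<in> Obj X \<Longrightarrow> Cod (vert K) (\<sigma> x) = ?c (fob \<kappa> x) g"
        "\<And>a. a \<in> Arr X \<Longrightarrow> ?v (\<sigma> (Cod X a)) (?h (far \<kappa> a) (?I f)) = ?v (?h (far \<kappa> a) (?I g)) (\<sigma> (Dom X a))"
    \<comment> \<open>At \<open>k0 x a\<close> the family is \<open>\<sigma> x\<close> followed by
      the projection at \<open>a\<close>. Its naturality at \<open>k1 u v\<close> is the given
      square for \<open>u\<close>, composed horizontally with \<open>far \<alpha> v\<close>.\<close>
    obtain \<tau> where \<tau>: "\<And>x a. x \<in> Obj X \<Longrightarrow> a \<in> Obj A \<Longrightarrow> \<tau> (k0 x a) = ?h (?I (fob \<alpha> a)) (\<sigma> x)"
      by (rule product_functions[OF pr, where ?h0.0="\<lambda>x a. ?h (?I (fob \<alpha> a)) (\<sigma> x)" and ?h1.0="\<lambda>_ _. undefined"]) blast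
    have "\<exists>\<beta>. \<beta> \<in> Cell K \<and> Dom (vert K) \<beta> = f \<and> Cod (vert K) \<beta> = g \<and> (\<forall>z\<in>Obj Q. ?h (?I (fob \<rho> z)) \<beta> = \<tau> z)"
    proof (rule is_power_cell_ex[OF K Q r fg])
      fix z assume "z \<in> Obj Q"
      then obtain x a where z: "x \<in> Obj X" "a \<in> Obj A" "z = k0 x a" using q(7) by blast
      then show "\<tau> z \<in> Cell K" "Dom (vert K) (\<tau> z) = ?c (fob \<rho> z) f" "Cod (vert K) (\<tau> z) = ?c (fob \<rho> z) g"
        using fg by (simp_all add: \<tau> s c0 K kf af Cu)
    next
      fix z assume "z \<in> Arr Q"
      then obtain u v where z: "u \<in> Arr X" "v \<in> Arr A" "z = k1 u v" using q(8) by blast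
      let ?y = "?I (fob \<alpha> (Cod A v))" and ?x = "?I (fob \<alpha> (Dom A v))"
      have "?h (?v ?y (far \<alpha> v)) (?v (\<sigma> (Cod X u)) (?h (far \<kappa> u) (?I f))) =
          ?v (?h ?y (\<sigma> (Cod X u))) (?h (far \<alpha> v) (?h (far \<kappa> u) (?I f)))"
        by (rule interchange) (use z fg(1-4) in \<open>simp_all add: s K X A kf af Cu\<close>)
      moreover have "?h (?v (far \<alpha> v) ?x) (?v (?h (far \<kappa> u) (?I g)) (\<sigma> (Dom X u))) =
          ?v (?h (far \<alpha> v) (?h (far \<kappa> u) (?I g))) (?h ?x (\<sigma> (Dom X u)))"
        by (rule interchange) (use z fg in \<open>simp_all add: s K X A kf af Cu\<close>)
      moreover have "?v ?y (far \<alpha> v) = far \<alpha> v" "?v (far \<alpha> v) ?x = far \<alpha> v"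
        using z by (simp_all add: K A af)
      ultimately have "?v (?h ?y (\<sigma> (Cod X u))) (?h (far \<alpha> v) (?h (far \<kappa> u) (?I f))) =
          ?v (?h (far \<alpha> v) (?h (far \<kappa> u) (?I g))) (?h ?x (\<sigma> (Dom X u)))"
        using s(4)[OF z(1)] by simp
      then show "?v (\<tau> (Cod Q z)) (?h (far \<rho> z) (?I f)) = ?v (?h (far \<rho> z) (?I g)) (\<tau> (Dom Q z))"
        using z fg c1 X A by (simp add: q(3,4) \<tau>)
    qed
    then obtain \<beta> where \<beta>: "\<beta> \<in> Cell K" "Dom (vert K) \<beta> = f" "Cod (vert K) \<beta> = g"
      "\<And>z. z \<in> Obj Q \<Longrightarrow> ?h (?I (fob \<rho> z)) \<beta> = \<tau> z" by blast
    have "?h (?I (fob \<kappa> x)) \<beta> = \<sigma> x" if x: "x \<in> Obj X" for x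
    proof (rule is_power_cell_eq[OF K A a])
      fix a assume a': "a \<in> Obj A"
      show "?h (?I (fob \<alpha> a)) (?h (?I (fob \<kappa> x)) \<beta>) = ?h (?I (fob \<alpha> a)) (\<sigma> x)"
        using c2[OF x a' \<beta>(1)] \<beta>(4)[OF q(1)[OF x a']] \<tau>[OF x a'] \<beta>(2) fg by simp
    qed (use x fg in \<open>simp_all add: \<beta> s kf K Cu\<close>)
    then show "\<exists>\<beta>. \<beta> \<in> Cell K \<and> Dom (vert K) \<beta> = f \<and> Cod (vert K) \<beta> = g \<and> (\<forall>x\<in>Obj X. ?h (?I (fob \<kappa> x)) \<beta> = \<sigma> x)"
      using \<beta> by blast
  qed
qed

section \<open>Filtered colimits of categories\<close>

text \<open>An infinite set is equinumerous with its square. Every coding that keeps a constructed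
  category over \<open>'u\<close> rests on this injection.\<close>

lemma ex_inj_pair: "\<exists>e :: 'u::infinite \<times> 'u \<Rightarrow> 'u. inj e"
proof -
  obtain f :: "'u \<times> 'u \<Rightarrow> 'u" where "bij_betw f (UNIV \<times> UNIV) UNIV"
    using card_of_Times_same_infinite[OF infinite_UNIV] unfolding card_of_ordIso[symmetric] by blast
  then show ?thesis by (auto simp: bij_betw_def)
qed

locale filtered_diagram =
  fixes J :: "('u::infinite, 'u) cat" and D :: "('u, 'u, ('u, 'u) cat, ('u, 'u, 'u, 'u) func) func"
  assumes filt: "filtered J" and D: "is_functor D" "fdom D = J" "fcod D = und CAT"
begin

lemma J [simp]: "category J"
  using filt by (simp add: filtered_def)

lemma D_cat [simp]: "j \<in> Obj J \<Longrightarrow> category (fob D j)"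
  using is_functorD(1)[OF D(1)] D(2,3) by (simp add: CAT_def)

lemma D_functors: "p \<in> Arr J \<Longrightarrow> far D p \<in> functors (fob D (Dom J p)) (fob D (Cod J p))"
  using is_functorD(2-4)[OF D(1)] D(2,3) by (simp add: CAT_def functors_def)

definition act :: "'u \<Rightarrow> 'u \<Rightarrow> 'u" where "act p a = far (far D p) a"

lemma D_comp:
  assumes "p \<in> Arr J" "q \<in> Arr J" "Dom J q = Cod J p"
  shows "far D (Comp J q p) = comp_func (far D q) (far D p)"
  using is_functorD(6)[OF D(1)] D(2,3) assms by (simp add: CAT_def)

lemma act_comp:
  assumes "p \<in> Arr J" "q \<in> Arr J" "Dom J q = Cod J p" "a \<in> Arr (fob D (Dom J p))"
  shows "act (Comp J q p) a = act q (act p a)"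
  using D_comp[OF assms(1-3)] assms(4) functorsD[OF D_functors[OF assms(1)]] by (simp add: act_def)

lemma act_id: "j \<in> Obj J \<Longrightarrow> a \<in> Arr (fob D j) \<Longrightarrow> act (Ide J j) a = a"
  using is_functorD(5)[OF D(1), of j] D(2,3) by (simp add: CAT_def act_def)

lemma act [simp]:
  assumes "p \<in> Arr J" "i = Dom J p" "a \<in> Arr (fob D i)"
  shows "act p a \<in> Arr (fob D (Cod J p))"
    "Dom (fob D (Cod J p)) (act p a) = fob (far D p) (Dom (fob D i) a)"
    "Cod (fob D (Cod J p)) (act p a) = fob (far D p) (Cod (fob D i) a)"
  using functorsD'[OF D_functors[OF assms(1)]] assms(2,3) by (simp_all add: act_def)

lemma act_Ide:
  assumes "p \<in> Arr J" "x \<in> Obj (fob D (Dom J p))"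
  shows "act p (Ide (fob D (Dom J p)) x) = Ide (fob D (Cod J p)) (fob (far D p) x)"
  using functorsD'(5)[OF D_functors[OF assms(1)]] assms(2) by (simp add: act_def)

lemma D_ob [simp]:
  assumes "p \<in> Arr J" "x \<in> Obj (fob D (Dom J p))"
  shows "fob (far D p) x \<in> Obj (fob D (Cod J p))"
  using functorsD'(1)[OF D_functors[OF assms(1)]] assms(2) by simp

lemma act_Comp:
  assumes "p \<in> Arr J" "a \<in> Arr (fob D (Dom J p))" "b \<in> Arr (fob D (Dom J p))"
    "Dom (fob D (Dom J p)) b = Cod (fob D (Dom J p)) a"
  shows "act p (Comp (fob D (Dom J p)) b a) = Comp (fob D (Cod J p)) (act p b) (act p a)"
  using functorsD'(6)[OF D_functors[OF assms(1)]] assms(2-4) by (simp add: act_def)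

lemma upper_bound:
  assumes "i \<in> Obj J" "j \<in> Obj J"
  obtains p q where "p \<in> Arr J" "q \<in> Arr J" "Dom J p = i" "Dom J q = j" "Cod J q = Cod J p"
proof -
  obtain k where "k \<in> Obj J" "hom J i k \<noteq> {}" "hom J j k \<noteq> {}"
    using filt assms unfolding filtered_def by blast
  then obtain p q where "p \<in> hom J i k" "q \<in> hom J j k" by blast
  then show thesis using that[of p q] by (simp add: hom_iff)
qed

lemma coequalize:
  assumes "p \<in> Arr J" "q \<in> Arr J" "Dom J p = Dom J q" "Cod J p = Cod J q"
  obtains r where "r \<in> Arr J" "Dom J r = Cod J p" "Comp J r p = Comp J r q"
proof -
  have "\<forall>i\<in>Obj J. \<forall>j\<in>Obj J. \<forall>f\<in>hom J i j. \<forall>g\<in>hom J i j. \<exists>k\<in>Obj J. \<exists>h\<in>hom J j k. Comp J h f = Comp J h g"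
    using filt unfolding filtered_def by blast
  then obtain k h where "h \<in> hom J (Cod J p) k" "Comp J h p = Comp J h q"
    using assms by (metis J categoryD(1,2) hom_iff)
  then show thesis using that by (auto simp: hom_iff)
qed

text \<open>An upper bound of the two vertices yields two parallel maps out of each foot.
  Coequalizing at the first foot, and then once more at the second, makes both pairs agree; the
  second step does not disturb the first.\<close>

lemma merge_cospans:
  assumes p: "p \<in> Arr J" "q \<in> Arr J" "Cod J q = Cod J p"
    and p': "p' \<in> Arr J" "q' \<in> Arr J" "Cod J q' = Cod J p'" "Dom J p' = Dom J p" "Dom J q' = Dom J q"
  obtains s t where "s \<in> Arr J" "t \<in> Arr J" "Dom J s = Cod J p" "Dom J t = Cod J p'" "Cod J t = Cod J s"
    "Comp J s p = Comp J t p'" "Comp J s q = Comp J t q'"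
proof -
  obtain s0 t0 where s0: "s0 \<in> Arr J" "t0 \<in> Arr J" "Dom J s0 = Cod J p" "Dom J t0 = Cod J p'" "Cod J t0 = Cod J s0"
    using upper_bound[of "Cod J p" "Cod J p'"] p(1) p'(1) by (metis J categoryD(2))
  obtain r where r: "r \<in> Arr J" "Dom J r = Cod J s0" "Comp J r (Comp J s0 p) = Comp J r (Comp J t0 p')"
    using coequalize[of "Comp J s0 p" "Comp J t0 p'"] s0 p p' by auto
  obtain r' where r': "r' \<in> Arr J" "Dom J r' = Cod J r"
      "Comp J r' (Comp J (Comp J r s0) q) = Comp J r' (Comp J (Comp J r t0) q')"
    using coequalize[of "Comp J (Comp J r s0) q" "Comp J (Comp J r t0) q'"] s0 p p' r by auto
  show thesis
  proof (rule that[of "Comp J r' (Comp J r s0)" "Comp J r' (Comp J r t0)"])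
    show "Comp J (Comp J r' (Comp J r s0)) p = Comp J (Comp J r' (Comp J r t0)) p'"
      using s0 r r' p p' by (simp add: category_assoc[OF J])
    show "Comp J (Comp J r' (Comp J r s0)) q = Comp J (Comp J r' (Comp J r t0)) q'"
      using s0 r r' p p' by (simp add: category_assoc[OF J])
  qed (use s0 r r' in simp_all)
qed

section \<open>Germs of arrows and the concrete filtered colimit\<close>

definition germs :: "('u \<times> 'u) set" where
  "germs = {(j, a). j \<in> Obj J \<and> a \<in> Arr (fob D j)}"

definition eqv :: "'u \<times> 'u \<Rightarrow> 'u \<times> 'u \<Rightarrow> bool" where
  "eqv s t \<longleftrightarrow> (\<exists>p\<in>Arr J. \<exists>q\<in>Arr J. Dom J p = fst s \<and> Dom J q = fst t \<and> Cod J q = Cod J p \<and>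
     act p (snd s) = act q (snd t))"

lemma eqvI:
  assumes "p \<in> Arr J" "q \<in> Arr J" "Dom J p = i" "Dom J q = j" "Cod J q = Cod J p" "act p a = act q b"
  shows "eqv (i, a) (j, b)"
  using assms unfolding eqv_def by auto

lemma eqvE:
  assumes "eqv (i, a) (j, b)"
  obtains p q where "p \<in> Arr J" "q \<in> Arr J" "Dom J p = i" "Dom J q = j" "Cod J q = Cod J p" "act p a = act q b"
  using assms unfolding eqv_def by auto

lemma eqv_refl: "s \<in> germs \<Longrightarrow> eqv s s"
  by (cases s) (auto simp: germs_def intro!: eqvI[of "Ide J (fst s)" "Ide J (fst s)"])

lemma eqv_sym: "eqv s t \<Longrightarrow> eqv t s"
  unfolding eqv_def by metis

lemma eqv_trans:
  assumes st: "eqv s t" and tu: "eqv t u" and g: "s \<in> germs" "t \<in> germs" "u \<in> germs"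
  shows "eqv s u"
proof -
  obtain i a j b k c where s: "s = (i, a)" and t: "t = (j, b)" and u: "u = (k, c)"
    by (cases s, cases t, cases u)
  note g' = g[unfolded s t u germs_def]
  obtain p q where p: "p \<in> Arr J" "q \<in> Arr J" "Dom J p = i" "Dom J q = j" "Cod J q = Cod J p" "act p a = act q b"
    using st unfolding s t by (rule eqvE)
  obtain p' q' where p': "p' \<in> Arr J" "q' \<in> Arr J" "Dom J p' = j" "Dom J q' = k" "Cod J q' = Cod J p'" "act p' b = act q' c"
    using tu unfolding t u by (rule eqvE)
  \<comment> \<open>Only the two maps out of the middle index \<open>j\<close> have to be
    amalgamated, hence cospans with repeated legs.\<close>
  obtain m n where m: "m \<in> Arr J" "n \<in> Arr J" "Dom J m = Cod J q" "Dom J n = Cod J p'" "Cod J n = Cod J m"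
    "Comp J m q = Comp J n p'"
    using merge_cospans[of q q p' p'] p p' by metis
  have "act (Comp J m p) a = act (Comp J n q') c"
    using act_comp[of p m a] act_comp[of q m b] act_comp[of p' n b] act_comp[of q' n c] p p' m g' by auto
  then show ?thesis
    unfolding s u using p p' m by (intro eqvI[of "Comp J m p" "Comp J n q'"]) simp_all
qed

lemma eqv_act:
  assumes "p \<in> Arr J" "a \<in> Arr (fob D (Dom J p))"
  shows "eqv (Dom J p, a) (Cod J p, act p a)"
  by (rule eqvI[of p "Ide J (Cod J p)"]) (use assms in \<open>simp_all add: act_id\<close>)

text \<open>Transition functors commute with taking the identity on the domain, so the maps that
  witness the equivalence of the arrows also witness that of the identities.\<close>

lemma eqv_Dom:
  assumes "eqv (i, a) (j, b)" "(i, a) \<in> germs" "(j, b) \<in> germs"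
  shows "eqv (i, Ide (fob D i) (Dom (fob D i) a)) (j, Ide (fob D j) (Dom (fob D j) b))"
proof -
  obtain p q where p: "p \<in> Arr J" "q \<in> Arr J" "Dom J p = i" "Dom J q = j" "Cod J q = Cod J p" "act p a = act q b"
    using assms(1) by (rule eqvE)
  have "fob (far D p) (Dom (fob D i) a) = fob (far D q) (Dom (fob D j) b)"
    using act(2)[of p i a] act(2)[of q j b] p assms(2,3) by (simp add: germs_def)
  then show ?thesis
    using p assms(2,3) act_Ide[of p "Dom (fob D i) a"] act_Ide[of q "Dom (fob D j) b"]
    by (intro eqvI[of p q]) (simp_all add: germs_def)
qed

lemma eqv_Cod:
  assumes "eqv (i, a) (j, b)" "(i, a) \<in> germs" "(j, b) \<in> germs"
  shows "eqv (i, Ide (fob D i) (Cod (fob D i) a)) (j, Ide (fob D j) (Cod (fob D j) b))"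
proof -
  obtain p q where p: "p \<in> Arr J" "q \<in> Arr J" "Dom J p = i" "Dom J q = j" "Cod J q = Cod J p" "act p a = act q b"
    using assms(1) by (rule eqvE)
  have "fob (far D p) (Cod (fob D i) a) = fob (far D q) (Cod (fob D j) b)"
    using act(3)[of p i a] act(3)[of q j b] p assms(2,3) by (simp add: germs_def)
  then show ?thesis
    using p assms(2,3) act_Ide[of p "Cod (fob D i) a"] act_Ide[of q "Cod (fob D j) b"]
    by (intro eqvI[of p q]) (simp_all add: germs_def)
qed

text \<open>The witnesses of the two equivalences are cospans with the same feet. Merging them gives
  a single stage at which both pairs of arrows agree, and there the composites agree too.\<close>

lemma eqv_Comp:
  assumes k: "k \<in> Obj J" "a \<in> Arr (fob D k)" "b \<in> Arr (fob D k)" "Dom (fob D k) b = Cod (fob D k) a"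
    and k': "k' \<in> Obj J" "a' \<in> Arr (fob D k')" "b' \<in> Arr (fob D k')" "Dom (fob D k') b' = Cod (fob D k') a'"
    and e: "eqv (k, a) (k', a')" "eqv (k, b) (k', b')"
  shows "eqv (k, Comp (fob D k) b a) (k', Comp (fob D k') b' a')"
proof -
  obtain s t where s: "s \<in> Arr J" "t \<in> Arr J" "Dom J s = k" "Dom J t = k'" "Cod J t = Cod J s" "act s a = act t a'"
    using e(1) by (rule eqvE)
  obtain s' t' where s': "s' \<in> Arr J" "t' \<in> Arr J" "Dom J s' = k" "Dom J t' = k'" "Cod J t' = Cod J s'" "act s' b = act t' b'"
    using e(2) by (rule eqvE)
  obtain m n where m: "m \<in> Arr J" "n \<in> Arr J" "Dom J m = Cod J s" "Dom J n = Cod J s'" "Cod J n = Cod J m"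
    "Comp J m s = Comp J n s'" "Comp J m t = Comp J n t'"
    using merge_cospans[of s t s' t'] s s' by metis
  have 1: "act (Comp J m s) a = act (Comp J m t) a'"
    using act_comp[of s m a] act_comp[of t m a'] s m k k' by simp
  have 2: "act (Comp J m s) b = act (Comp J m t) b'"
    unfolding m(6,7) using act_comp[of s' n b] act_comp[of t' n b'] s' m k k' by simp
  define P Q where "P = Comp J m s" and "Q = Comp J m t"
  have PQ: "P \<in> Arr J" "Q \<in> Arr J" "Dom J P = k" "Dom J Q = k'" "Cod J Q = Cod J P"
    using s m(1-5) by (simp_all add: P_def Q_def)
  show ?thesis
    using 1 2 PQ k k' act_Comp[of P a b] act_Comp[of Q a' b']
    unfolding P_def[symmetric] Q_def[symmetric] by (intro eqvI[of P Q]) simp_all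
qed

text \<open>Equivalence of the two identity germs means that the endpoints coincide at some stage,
  where the two arrows have become composable.\<close>

lemma composable_lift:
  assumes "(i, a) \<in> germs" "(j, b) \<in> germs"
    "eqv (i, Ide (fob D i) (Cod (fob D i) a)) (j, Ide (fob D j) (Dom (fob D j) b))"
  obtains p q where "p \<in> Arr J" "q \<in> Arr J" "Dom J p = i" "Dom J q = j" "Cod J q = Cod J p"
    "Dom (fob D (Cod J p)) (act q b) = Cod (fob D (Cod J p)) (act p a)"
proof -
  obtain p q where p: "p \<in> Arr J" "q \<in> Arr J" "Dom J p = i" "Dom J q = j" "Cod J q = Cod J p"
    "act p (Ide (fob D i) (Cod (fob D i) a)) = act q (Ide (fob D j) (Dom (fob D j) b))"
    using assms(3) by (rule eqvE)
  have "fob (far D p) (Cod (fob D i) a) \<in> Obj (fob D (Cod J p))" "fob (far D q) (Dom (fob D j) b) \<in> Obj (fob D (Cod J p))"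
    using p assms D_ob[of p "Cod (fob D i) a"] D_ob[of q "Dom (fob D j) b"] by (simp_all add: germs_def)
  moreover have "Ide (fob D (Cod J p)) (fob (far D p) (Cod (fob D i) a)) = Ide (fob D (Cod J p)) (fob (far D q) (Dom (fob D j) b))"
    using p assms(1,2) act_Ide[of p "Cod (fob D i) a"] act_Ide[of q "Dom (fob D j) b"] by (simp add: germs_def)
  ultimately have "fob (far D p) (Cod (fob D i) a) = fob (far D q) (Dom (fob D j) b)"
    using p(1) by (metis D_cat J categoryD(2,4))
  then show thesis
    using that[of p q] p act(2)[of q j b] act(3)[of p i a] assms(1,2) by (simp add: germs_def)
qed

text \<open>A member chosen from each class is coded by an injection into \<open>'u\<close>;
  equivalent germs define the same predicate under \<open>SOME\<close> and so receive the same
  choice. This replaces the quotient set by a subset of \<open>'u\<close>.\<close>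

lemma ex_rep: "\<exists>r :: 'u \<times> 'u \<Rightarrow> 'u. \<forall>s\<in>germs. \<forall>t\<in>germs. r s = r t \<longleftrightarrow> eqv s t"
proof -
  obtain e :: "'u \<times> 'u \<Rightarrow> 'u" where e: "inj e" using ex_inj_pair by blast
  define c where "c s = (SOME t. t \<in> germs \<and> eqv s t)" for s
  have c: "c s \<in> germs \<and> eqv s (c s)" if "s \<in> germs" for s
    unfolding c_def by (rule someI[of _ s]) (use that eqv_refl in blast)
  have "c s = c t \<longleftrightarrow> eqv s t" if "s \<in> germs" "t \<in> germs" for s t
  proof
    assume "c s = c t"
    then show "eqv s t" using c[OF that(1)] c[OF that(2)] that eqv_trans eqv_sym by metis
  next
    assume "eqv s t"
    then have "(u \<in> germs \<and> eqv s u) = (u \<in> germs \<and> eqv t u)" for u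
      using that eqv_trans eqv_sym by metis
    then show "c s = c t" unfolding c_def by simp
  qed
  then show ?thesis
    using e by (intro exI[of _ "\<lambda>s. e (c s)"]) (simp add: inj_eq)
qed

definition rep :: "'u \<times> 'u \<Rightarrow> 'u" where
  "rep = (SOME r. \<forall>s\<in>germs. \<forall>t\<in>germs. r s = r t \<longleftrightarrow> eqv s t)"

lemma rep_eq: "s \<in> germs \<Longrightarrow> t \<in> germs \<Longrightarrow> rep s = rep t \<longleftrightarrow> eqv s t"
  using someI_ex[OF ex_rep] unfolding rep_def by blast

definition unrep :: "'u \<Rightarrow> 'u \<times> 'u" where
  "unrep e = (SOME s. s \<in> germs \<and> rep s = e)"

lemma unrep: "s \<in> germs \<Longrightarrow> unrep (rep s) \<in> germs \<and> eqv (unrep (rep s)) s"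
proof -
  assume s: "s \<in> germs"
  have "unrep (rep s) \<in> germs \<and> rep (unrep (rep s)) = rep s"
    unfolding unrep_def by (rule someI[of _ s]) (use s in blast)
  then show ?thesis using s rep_eq by blast
qed

text \<open>Objects are the classes of identity germs. This makes \<open>Ide\<close> the identity
  function and leaves a single quotient to form, that of the arrows; a composite is formed at any
  stage where both classes have composable representatives.\<close>

definition colim :: "('u, 'u) cat" where
  "colim = \<lparr>Obj = {rep (j, Ide (fob D j) x) | j x. j \<in> Obj J \<and> x \<in> Obj (fob D j)}, Arr = rep ` germs,
     Dom = (\<lambda>e. let (j, a) = unrep e in rep (j, Ide (fob D j) (Dom (fob D j) a))),
     Cod = (\<lambda>e. let (j, a) = unrep e in rep (j, Ide (fob D j) (Cod (fob D j) a))),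
     Ide = (\<lambda>e. e),
     Comp = (\<lambda>g f. SOME e. \<exists>k a b. k \<in> Obj J \<and> a \<in> Arr (fob D k) \<and> b \<in> Arr (fob D k) \<and>
        Dom (fob D k) b = Cod (fob D k) a \<and> rep (k, a) = f \<and> rep (k, b) = g \<and> e = rep (k, Comp (fob D k) b a))\<rparr>"

lemma germ_iff [simp]: "(j, a) \<in> germs \<longleftrightarrow> j \<in> Obj J \<and> a \<in> Arr (fob D j)"
  by (simp add: germs_def)

lemma colim_sel:
  "Obj colim = {rep (j, Ide (fob D j) x) | j x. j \<in> Obj J \<and> x \<in> Obj (fob D j)}" "Arr colim = rep ` germs"
  "Ide colim e = e"
  by (simp_all add: colim_def)

lemma colim_Dom:
  assumes "j \<in> Obj J" "a \<in> Arr (fob D j)"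
  shows "Dom colim (rep (j, a)) = rep (j, Ide (fob D j) (Dom (fob D j) a))"
    "Cod colim (rep (j, a)) = rep (j, Ide (fob D j) (Cod (fob D j) a))"
proof -
  obtain i b where u: "unrep (rep (j, a)) = (i, b)" by (cases "unrep (rep (j, a))")
  then have e: "(i, b) \<in> germs" "eqv (i, b) (j, a)" using unrep[of "(j, a)"] assms by auto
  show "Dom colim (rep (j, a)) = rep (j, Ide (fob D j) (Dom (fob D j) a))"
    using eqv_Dom[OF e(2)] e(1) assms by (simp add: colim_def u rep_eq)
  show "Cod colim (rep (j, a)) = rep (j, Ide (fob D j) (Cod (fob D j) a))"
    using eqv_Cod[OF e(2)] e(1) assms by (simp add: colim_def u rep_eq)
qed

text \<open>By \<open>eqv_Comp\<close>, all representations of the two classes at a common stage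
  give the same composite, so the choice made in \<open>colim\<close> is forced.\<close>

lemma colim_Comp:
  assumes k: "k \<in> Obj J" "a \<in> Arr (fob D k)" "b \<in> Arr (fob D k)" "Dom (fob D k) b = Cod (fob D k) a"
  shows "Comp colim (rep (k, b)) (rep (k, a)) = rep (k, Comp (fob D k) b a)"
proof -
  have "(SOME e. \<exists>k' a' b'. k' \<in> Obj J \<and> a' \<in> Arr (fob D k') \<and> b' \<in> Arr (fob D k') \<and>
        Dom (fob D k') b' = Cod (fob D k') a' \<and> rep (k', a') = rep (k, a) \<and> rep (k', b') = rep (k, b) \<and>
        e = rep (k', Comp (fob D k') b' a')) = rep (k, Comp (fob D k) b a)"
  proof (rule some_equality)
    fix e assume "\<exists>k' a' b'. k' \<in> Obj J \<and> a' \<in> Arr (fob D k') \<and> b' \<in> Arr (fob D k') \<and>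
        Dom (fob D k') b' = Cod (fob D k') a' \<and> rep (k', a') = rep (k, a) \<and> rep (k', b') = rep (k, b) \<and>
        e = rep (k', Comp (fob D k') b' a')"
    then obtain k' a' b' where k': "k' \<in> Obj J" "a' \<in> Arr (fob D k')" "b' \<in> Arr (fob D k')"
        "Dom (fob D k') b' = Cod (fob D k') a'" "rep (k', a') = rep (k, a)" "rep (k', b') = rep (k, b)"
        "e = rep (k', Comp (fob D k') b' a')" by blast
    then show "e = rep (k, Comp (fob D k) b a)"
      using k eqv_Comp[OF k'(1-4) k] by (simp add: rep_eq)
  qed (use k in blast)
  then show ?thesis by (simp add: colim_def)
qed

lemma colim_composable:
  assumes "f \<in> Arr colim" "g \<in> Arr colim" "Dom colim g = Cod colim f"
  obtains k a b where "k \<in> Obj J" "a \<in> Arr (fob D k)" "b \<in> Arr (fob D k)"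
    "Dom (fob D k) b = Cod (fob D k) a" "f = rep (k, a)" "g = rep (k, b)"
proof -
  obtain i a where f: "f = rep (i, a)" "i \<in> Obj J" "a \<in> Arr (fob D i)" using assms(1) by (auto simp: colim_sel)
  obtain j b where g: "g = rep (j, b)" "j \<in> Obj J" "b \<in> Arr (fob D j)" using assms(2) by (auto simp: colim_sel)
  have "eqv (i, Ide (fob D i) (Cod (fob D i) a)) (j, Ide (fob D j) (Dom (fob D j) b))"
    using assms(3) f g by (simp add: colim_Dom rep_eq eqv_sym)
  then obtain p q where p: "p \<in> Arr J" "q \<in> Arr J" "Dom J p = i" "Dom J q = j" "Cod J q = Cod J p"
    "Dom (fob D (Cod J p)) (act q b) = Cod (fob D (Cod J p)) (act p a)"
    using composable_lift[of i a j b] f g by auto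
  have "f = rep (Cod J p, act p a)" "g = rep (Cod J p, act q b)"
    using eqv_act[of p a] eqv_act[of q b] act(1)[of q j b] p f g by (simp_all add: rep_eq)
  then show thesis using that[of "Cod J p" "act p a" "act q b"] p f g act(1)[of q j b] by simp
qed

lemma category_colim: "category colim"
  unfolding category_def
proof (intro conjI ballI impI)
  fix f assume "f \<in> Arr colim"
  then obtain j a where f: "f = rep (j, a)" "j \<in> Obj J" "a \<in> Arr (fob D j)" by (auto simp: colim_sel)
  show "Dom colim f \<in> Obj colim" "Cod colim f \<in> Obj colim"
    using f D_cat[OF f(2)] unfolding f(1) colim_Dom[OF f(2,3)] colim_sel(1)
    by (blast intro: categoryD(1,2))+
  show "Comp colim f (Ide colim (Dom colim f)) = f" "Comp colim (Ide colim (Cod colim f)) f = f"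
    using f by (simp_all add: colim_Dom colim_sel colim_Comp)
next
  fix x assume "x \<in> Obj colim"
  then obtain j y where x: "x = rep (j, Ide (fob D j) y)" "j \<in> Obj J" "y \<in> Obj (fob D j)" by (auto simp: colim_sel)
  then show "Ide colim x \<in> Arr colim" "Dom colim (Ide colim x) = x" "Cod colim (Ide colim x) = x"
    by (auto simp: colim_sel colim_Dom)
next
  fix f g assume fg: "f \<in> Arr colim" "g \<in> Arr colim" "Dom colim g = Cod colim f"
  obtain k a b where k: "k \<in> Obj J" "a \<in> Arr (fob D k)" "b \<in> Arr (fob D k)"
    "Dom (fob D k) b = Cod (fob D k) a" "f = rep (k, a)" "g = rep (k, b)"
    by (rule colim_composable[OF fg])
  then show "Comp colim g f \<in> Arr colim" "Dom colim (Comp colim g f) = Dom colim f" "Cod colim (Comp colim g f) = Cod colim g"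
    by (simp_all add: colim_Comp colim_Dom) (simp add: colim_sel)
next
  fix f g h assume fgh: "f \<in> Arr colim" "g \<in> Arr colim" "h \<in> Arr colim" "Dom colim g = Cod colim f" "Dom colim h = Cod colim g"
  obtain k a b where k: "k \<in> Obj J" "a \<in> Arr (fob D k)" "b \<in> Arr (fob D k)"
    "Dom (fob D k) b = Cod (fob D k) a" "f = rep (k, a)" "g = rep (k, b)"
    by (rule colim_composable[OF fgh(1,2,4)])
  obtain l c where l: "h = rep (l, c)" "l \<in> Obj J" "c \<in> Arr (fob D l)" using fgh(3) by (auto simp: colim_sel)
  \<comment> \<open>A stage common to \<open>f\<close> and \<open>g\<close> is at hand. The third
    arrow is matched with \<open>g\<close> at a later stage, to which all three are transported;
    there associativity holds.\<close>
  have "eqv (k, Ide (fob D k) (Cod (fob D k) b)) (l, Ide (fob D l) (Dom (fob D l) c))"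
    using fgh(5) k l by (simp add: colim_Dom rep_eq eqv_sym)
  then obtain p q where p: "p \<in> Arr J" "q \<in> Arr J" "Dom J p = k" "Dom J q = l" "Cod J q = Cod J p"
    "Dom (fob D (Cod J p)) (act q c) = Cod (fob D (Cod J p)) (act p b)"
    using composable_lift[of k b l c] k l by auto
  have q: "act q c \<in> Arr (fob D (Cod J p))" using act(1)[of q l c] p l by simp
  have m: "f = rep (Cod J p, act p a)" "g = rep (Cod J p, act p b)" "h = rep (Cod J p, act q c)"
    using eqv_act[of p a] eqv_act[of p b] eqv_act[of q c] q p k l by (simp_all add: rep_eq)
  have d: "Dom (fob D (Cod J p)) (act p b) = Cod (fob D (Cod J p)) (act p a)"
    using act(2)[of p k b] act(3)[of p k a] p k by simp
  show "Comp colim h (Comp colim g f) = Comp colim (Comp colim h g) f"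
    unfolding m using p q d k act(1)[of p k a] act(1)[of p k b]
    by (simp add: colim_Comp category_assoc[OF D_cat])
qed

section \<open>Comparison of a colimit cocone with the concrete colimit\<close>

definition inj_colim :: "'u \<Rightarrow> ('u, 'u, 'u, 'u) func" where
  "inj_colim j = \<lparr>fdom = fob D j, fcod = colim, fob = (\<lambda>x\<in>Obj (fob D j). rep (j, Ide (fob D j) x)),
     far = (\<lambda>a\<in>Arr (fob D j). rep (j, a))\<rparr>"

lemma inj_colim_functors: "j \<in> Obj J \<Longrightarrow> inj_colim j \<in> functors (fob D j) colim"
  by (rule functorsI) (auto simp: inj_colim_def colim_Dom colim_Comp colim_sel)

lemma cocone_iff:
  "cocone D L \<gamma> \<longleftrightarrow> category L \<and> (\<forall>j\<in>Obj J. \<gamma> j \<in> functors (fob D j) L) \<and>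
     (\<forall>k\<in>Arr J. comp_func (\<gamma> (Cod J k)) (far D k) = \<gamma> (Dom J k))"
  unfolding cocone_def D CAT_def by (auto simp: hom_iff functors_def)

lemma inj_colim_cocone: "cocone D colim inj_colim"
  unfolding cocone_iff
proof (intro conjI ballI category_colim)
  fix p assume p: "p \<in> Arr J"
  have o: "Dom J p \<in> Obj J" "Cod J p \<in> Obj J" using p by simp_all
  show "comp_func (inj_colim (Cod J p)) (far D p) = inj_colim (Dom J p)"
  proof (rule functors_eqI_arr[OF D_cat[OF o(1)] category_colim])
    show "comp_func (inj_colim (Cod J p)) (far D p) \<in> functors (fob D (Dom J p)) colim"
      by (rule comp_functors[OF D_cat[OF o(1)] D_functors[OF p] inj_colim_functors[OF o(2)]])
    show "inj_colim (Dom J p) \<in> functors (fob D (Dom J p)) colim" by (rule inj_colim_functors[OF o(1)])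
    fix a assume a: "a \<in> Arr (fob D (Dom J p))"
    then show "far (comp_func (inj_colim (Cod J p)) (far D p)) a = far (inj_colim (Dom J p)) a"
      using eqv_act[OF p a] functorsD[OF D_functors[OF p]] act(1)[OF p refl a] p
      by (simp add: inj_colim_def act_def[symmetric] rep_eq eqv_sym)
  qed
qed (rule inj_colim_functors)

lemma colimit_cocone_cocone: "colimit_cocone D L \<gamma> \<Longrightarrow> cocone D L \<gamma>"
  by (simp add: colimit_cocone_def)

lemma colimit_cocone_ex1:
  assumes "colimit_cocone D L \<gamma>" "cocone D B \<mu>"
  shows "\<exists>!h. h \<in> functors L B \<and> (\<forall>j\<in>Obj J. comp_func h (\<gamma> j) = \<mu> j)"
proof -
  have "category L" "category B" using assms by (auto simp: colimit_cocone_def cocone_iff)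
  then have hh: "hom (und CAT) L B = functors L B"
    by (auto simp: hom_iff CAT_def functors_def)
  have cc: "Comp (und CAT) = (comp_func :: ('u, 'u, 'u, 'u) func \<Rightarrow> _)" by (simp add: CAT_def)
  have "\<exists>!h. h \<in> hom (fcod D) L B \<and> (\<forall>j\<in>Obj (fdom D). Comp (fcod D) h (\<gamma> j) = \<mu> j)"
    using assms(1)[unfolded colimit_cocone_def] assms(2) by simp
  then show ?thesis unfolding D hh cc .
qed

lemma cocone_act:
  assumes "cocone D L \<gamma>" "p \<in> Arr J" "a \<in> Arr (fob D (Dom J p))"
  shows "far (\<gamma> (Cod J p)) (act p a) = far (\<gamma> (Dom J p)) a"
proof -
  have "comp_func (\<gamma> (Cod J p)) (far D p) = \<gamma> (Dom J p)" using assms(1,2) by (simp add: cocone_iff)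
  then show ?thesis using assms(3) functorsD[OF D_functors[OF assms(2)]] comp_func_sel(4)[of a "far D p" "\<gamma> (Cod J p)"]
    by (simp add: act_def)
qed

lemma cocone_eqv:
  assumes "cocone D L \<gamma>" "eqv (i, a) (j, b)" "(i, a) \<in> germs" "(j, b) \<in> germs"
  shows "far (\<gamma> i) a = far (\<gamma> j) b"
proof -
  obtain p q where p: "p \<in> Arr J" "q \<in> Arr J" "Dom J p = i" "Dom J q = j" "Cod J q = Cod J p" "act p a = act q b"
    using assms(2) by (rule eqvE)
  then show ?thesis using cocone_act[OF assms(1) p(1), of a] cocone_act[OF assms(1) p(2), of b] assms(3,4) by simp
qed

text \<open>The colimit maps to the concrete cocone, in which equality of classes is
  \<open>eqv\<close>. Arrows identified in \<open>L\<close> are therefore already identified at some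
  stage.\<close>

lemma colimit_eqv:
  assumes c: "colimit_cocone D L \<gamma>" and "i \<in> Obj J" "a \<in> Arr (fob D i)" "j \<in> Obj J" "b \<in> Arr (fob D j)"
    and e: "far (\<gamma> i) a = far (\<gamma> j) b"
  shows "eqv (i, a) (j, b)"
proof -
  obtain h where h: "h \<in> functors L colim" "\<And>j. j \<in> Obj J \<Longrightarrow> comp_func h (\<gamma> j) = inj_colim j"
    using colimit_cocone_ex1[OF c inj_colim_cocone] by blast
  have g: "\<gamma> i \<in> functors (fob D i) L" "\<gamma> j \<in> functors (fob D j) L"
    using colimit_cocone_cocone[OF c] assms by (simp_all add: cocone_iff)
  have "far h (far (\<gamma> i) a) = rep (i, a)"
    using h(2)[OF assms(2)] comp_func_sel(4)[of a "\<gamma> i" h] functorsD[OF g(1)] assms(3) by (simp add: inj_colim_def)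
  moreover have "far h (far (\<gamma> j) b) = rep (j, b)"
    using h(2)[OF assms(4)] comp_func_sel(4)[of b "\<gamma> j" h] functorsD[OF g(2)] assms(5) by (simp add: inj_colim_def)
  ultimately have "rep (i, a) = rep (j, b)" using e by simp
  then show ?thesis using assms(2-5) by (simp add: rep_eq)
qed

text \<open>A functor from the concrete colimit back to \<open>L\<close> is built from
  representatives. Its composite with the comparison functor fixes the cocone, so by uniqueness it
  is the identity, and each arrow of \<open>L\<close> is the image of an arrow at some
  stage.\<close>

lemma colimit_surj:
  assumes c: "colimit_cocone D L \<gamma>" and f: "f \<in> Arr L"
  obtains j a where "j \<in> Obj J" "a \<in> Arr (fob D j)" "far (\<gamma> j) a = f"
proof -
  note cc = colimit_cocone_cocone[OF c]
  have L: "category L" and g: "\<And>j. j \<in> Obj J \<Longrightarrow> \<gamma> j \<in> functors (fob D j) L"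
    using cc by (simp_all add: cocone_iff)
  obtain h where h: "h \<in> functors L colim" "\<And>j. j \<in> Obj J \<Longrightarrow> comp_func h (\<gamma> j) = inj_colim j"
    using colimit_cocone_ex1[OF c inj_colim_cocone] by blast
  \<comment> \<open>The cocone is applied to the representative chosen by \<open>unrep\<close>;
    independence of this choice is \<open>cocone_eqv\<close>. On objects, which are classes of
    identities, the domain of the resulting arrow is taken.\<close>
  define G where "G = \<lparr>fdom = colim, fcod = L, fob = (\<lambda>e\<in>Obj colim. Dom L (far (\<gamma> (fst (unrep e))) (snd (unrep e)))),
     far = (\<lambda>e\<in>Arr colim. far (\<gamma> (fst (unrep e))) (snd (unrep e)))\<rparr>"
  have u: "far (\<gamma> (fst (unrep (rep (j, a))))) (snd (unrep (rep (j, a)))) = far (\<gamma> j) a"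
    if "j \<in> Obj J" "a \<in> Arr (fob D j)" for j a
    using cocone_eqv[OF cc, of "fst (unrep (rep (j, a)))" "snd (unrep (rep (j, a)))" j a] unrep[of "(j, a)"] that by simp
  have G1: "far G (rep (j, a)) = far (\<gamma> j) a" if "j \<in> Obj J" "a \<in> Arr (fob D j)" for j a
    using that by (auto simp: G_def u colim_sel)
  have G0: "fob G (rep (j, Ide (fob D j) x)) = fob (\<gamma> j) x" if jx: "j \<in> Obj J" "x \<in> Obj (fob D j)" for j x
  proof -
    have "rep (j, Ide (fob D j) x) \<in> Obj colim" using jx by (auto simp: colim_sel)
    then show ?thesis
      using jx functorsD'(1,5)[OF g[OF jx(1)]] L by (simp add: G_def u)
  qed
  have G: "G \<in> functors colim L"
  proof (rule functorsI)
    fix e assume "e \<in> Obj colim"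
    then obtain j y where x: "e = rep (j, Ide (fob D j) y)" "j \<in> Obj J" "y \<in> Obj (fob D j)" by (auto simp: colim_sel)
    then show "fob G e \<in> Obj L" "far G (Ide colim e) = Ide L (fob G e)"
      using functorsD'[OF g[OF x(2)]] by (simp_all add: G0 G1 colim_sel)
  next
    fix e assume "e \<in> Arr colim"
    then obtain j a where x: "e = rep (j, a)" "j \<in> Obj J" "a \<in> Arr (fob D j)" by (auto simp: colim_sel)
    then show "far G e \<in> Arr L" "Dom L (far G e) = fob G (Dom colim e)" "Cod L (far G e) = fob G (Cod colim e)"
      using functorsD'[OF g[OF x(2)]] by (simp_all add: G0 G1 colim_Dom)
  next
    fix e e' assume e: "e \<in> Arr colim" "e' \<in> Arr colim" "Dom colim e' = Cod colim e"
    obtain k a b where k: "k \<in> Obj J" "a \<in> Arr (fob D k)" "b \<in> Arr (fob D k)"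
      "Dom (fob D k) b = Cod (fob D k) a" "e = rep (k, a)" "e' = rep (k, b)"
      by (rule colim_composable[OF e])
    then show "far G (Comp colim e' e) = Comp L (far G e') (far G e)"
      using functorsD'[OF g[OF k(1)]] by (simp add: colim_Comp G1)
  qed (simp_all add: G_def)
  have Gh: "comp_func G h \<in> functors L L" by (rule comp_functors[OF L h(1) G])
  have "comp_func (comp_func G h) (\<gamma> j) = \<gamma> j" if j: "j \<in> Obj J" for j
  proof -
    have "comp_func (comp_func G h) (\<gamma> j) = comp_func G (inj_colim j)"
      using comp_func_assoc[OF D_cat[OF j] g[OF j] h(1) G] h(2)[OF j] by simp
    also have "\<dots> = \<gamma> j"
      by (rule functors_eqI_arr[OF D_cat[OF j] L comp_functors[OF D_cat[OF j] inj_colim_functors[OF j] G] g[OF j]])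
        (use j in \<open>simp add: inj_colim_def G1\<close>)
    finally show ?thesis .
  qed
  moreover have "comp_func (id_func L) (\<gamma> j) = \<gamma> j" if j: "j \<in> Obj J" for j
    by (rule comp_func_id(2)[OF D_cat[OF j] L g[OF j]])
  ultimately have "comp_func G h = id_func L"
    using colimit_cocone_ex1[OF c cc] Gh id_functors[OF L] by blast
  then have f': "f = far G (far h f)"
    using comp_func_sel(4)[of f h G] functorsD[OF h(1)] f by simp
  have "far h f \<in> Arr colim" using functorsD'(2)[OF h(1) f] .
  then obtain j a where "far h f = rep (j, a)" "j \<in> Obj J" "a \<in> Arr (fob D j)" by (auto simp: colim_sel)
  then show thesis using that[of j a] f' G1 by simp
qed

end

section \<open>Preservation of filtered colimits by hom-functors\<close>

lemma SET_hom: "h \<in> hom SET A B \<longleftrightarrow> (\<exists>m\<in>A \<rightarrow>\<^sub>E B. h = (A, m, B))"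
  by (auto simp: hom_iff SET_def)

lemma SET_Obj: "A \<in> Obj SET"
  by (simp add: SET_def)

lemma SET_Comp: "Comp SET (B', g, C) (A, f, B) = (A, \<lambda>x\<in>A. g (f x), C)"
  by (simp add: SET_def)

context filtered_diagram
begin

text \<open>Induction on the set of pairs: the map that serves the earlier pairs and the one that
  serves the new pair are amalgamated over \<open>j\<close>, and equations persist under later
  transition maps.\<close>

lemma equalize_finite:
  assumes "finite R" "j \<in> Obj J"
    and "\<And>a b. (a, b) \<in> R \<Longrightarrow> a \<in> Arr (fob D j) \<and> b \<in> Arr (fob D j) \<and> eqv (j, a) (j, b)"
  shows "\<exists>r\<in>Arr J. Dom J r = j \<and> (\<forall>(a, b)\<in>R. act r a = act r b)"
  using assms(1,3)
proof (induction R rule: finite_induct)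
  case empty
  then show ?case using assms(2) by (intro bexI[of _ "Ide J j"]) auto
next
  case (insert x R)
  obtain a b where x: "x = (a, b)" by (cases x)
  obtain r where r: "r \<in> Arr J" "Dom J r = j" "\<forall>(a, b)\<in>R. act r a = act r b"
    using insert.IH insert.prems by blast
  have ab: "a \<in> Arr (fob D j)" "b \<in> Arr (fob D j)" "eqv (j, a) (j, b)"
    using insert.prems[of a b] x by auto
  obtain p q where p: "p \<in> Arr J" "q \<in> Arr J" "Dom J p = j" "Dom J q = j" "Cod J q = Cod J p" "act p a = act q b"
    using ab(3) by (rule eqvE)
  \<comment> \<open>The equivalence supplies two different maps out of \<open>j\<close>. After
    coequalizing them, a single map identifies \<open>a\<close> with \<open>b\<close>.\<close>
  obtain s where s: "s \<in> Arr J" "Dom J s = Cod J p" "Comp J s p = Comp J s q"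
    using coequalize[of p q] p by metis
  obtain m n where m: "m \<in> Arr J" "n \<in> Arr J" "Dom J m = Cod J r" "Dom J n = Cod J s" "Cod J n = Cod J m"
    "Comp J m r = Comp J n (Comp J s p)"
  proof -
    have sp: "Comp J s p \<in> Arr J" "Dom J (Comp J s p) = Dom J r" "Cod J (Comp J s p) = Cod J s"
      using r(1,2) s(1,2) p by simp_all
    show thesis
      by (rule merge_cospans[OF r(1) r(1) refl sp(1) sp(1) refl sp(2) sp(2)]) (use that sp(3) in simp)
  qed
  have "act (Comp J s p) a = act (Comp J s p) b"
    using act_comp[of p s a] act_comp[of q s b] p s ab by simp
  then have "act (Comp J n (Comp J s p)) a = act (Comp J n (Comp J s p)) b"
    using act_comp[of "Comp J s p" n a] act_comp[of "Comp J s p" n b] m p s ab by simp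
  then have 1: "act (Comp J m r) a = act (Comp J m r) b"
    using m(6) by simp
  have 2: "act (Comp J m r) a' = act (Comp J m r) b'" if "(a', b') \<in> R" for a' b'
    using that insert.prems[of a' b'] r act_comp[of r m a'] act_comp[of r m b'] m by auto
  show ?case
    by (rule bexI[of _ "Comp J m r"]) (use 1 2 x r m(1-5) in auto)
qed

lemma upper_bound_finite:
  assumes "finite N" "\<And>n. n \<in> N \<Longrightarrow> f n \<in> Obj J"
  shows "\<exists>m\<in>Obj J. \<forall>n\<in>N. \<exists>p\<in>Arr J. Dom J p = f n \<and> Cod J p = m"
  using assms
proof (induction N rule: finite_induct)
  case empty
  then show ?case using filt unfolding filtered_def by blast
next
  case (insert x N)
  then obtain m where m: "m \<in> Obj J" "\<forall>n\<in>N. \<exists>p\<in>Arr J. Dom J p = f n \<and> Cod J p = m" by blast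
  obtain p q where p: "p \<in> Arr J" "q \<in> Arr J" "Dom J p = m" "Dom J q = f x" "Cod J q = Cod J p"
    using upper_bound[of m "f x"] m insert.prems by blast
  have "\<exists>p'\<in>Arr J. Dom J p' = f n \<and> Cod J p' = Cod J p" if n: "n \<in> N" for n
  proof -
    obtain p' where "p' \<in> Arr J" "Dom J p' = f n" "Cod J p' = m" using m n by blast
    then show ?thesis using p by (intro bexI[of _ "Comp J p p'"]) auto
  qed
  then show ?case using p by (intro bexI[of _ "Cod J p"]) auto
qed

lemma hom_CAT: "category X \<Longrightarrow> category Y \<Longrightarrow> hom (und CAT) X Y = functors X Y"
  by (auto simp: hom_iff CAT_def functors_def)

lemma hom_func_CAT:
  assumes X: "category X"
  shows "category L \<Longrightarrow> fob (hom_func (und CAT) X) L = functors X L"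
    "g \<in> functors A B \<Longrightarrow> category A \<Longrightarrow> category B \<Longrightarrow>
       far (hom_func (und CAT) X) g = (functors X A, \<lambda>f\<in>functors X A. comp_func g f, functors X B)"
proof -
  show "category L \<Longrightarrow> fob (hom_func (und CAT) X) L = functors X L"
    using hom_CAT[OF X] by (simp add: hom_func_def) (simp add: CAT_def)
  assume g: "g \<in> functors A B" "category A" "category B"
  then have "g \<in> Mor CAT" "Dom (und CAT) g = A" "Cod (und CAT) g = B" "Comp (und CAT) g = comp_func g"
    by (simp_all add: CAT_def functorsD)
  then show "far (hom_func (und CAT) X) g = (functors X A, \<lambda>f\<in>functors X A. comp_func g f, functors X B)"
    using hom_CAT[OF X] g by (simp add: hom_func_def)
qed

lemma hom_diagram:
  assumes X: "category X"
  shows "fdom (comp_func (hom_func (und CAT) X) D) = J" "fcod (comp_func (hom_func (und CAT) X) D) = SET"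
    "j \<in> Obj J \<Longrightarrow> fob (comp_func (hom_func (und CAT) X) D) j = functors X (fob D j)"
    "p \<in> Arr J \<Longrightarrow> far (comp_func (hom_func (und CAT) X) D) p =
       (functors X (fob D (Dom J p)), \<lambda>f\<in>functors X (fob D (Dom J p)). comp_func (far D p) f, functors X (fob D (Cod J p)))"
  using hom_func_CAT(1)[OF X] hom_func_CAT(2)[OF X D_functors] D
  by simp_all (simp add: hom_func_def)

lemma hom_cocone_iff:
  assumes X: "category X" and c: "cocone D L \<gamma>"
  shows "cocone (comp_func (hom_func (und CAT) X) D) B \<mu> \<longleftrightarrow>
     (\<forall>j\<in>Obj J. \<exists>m\<in>functors X (fob D j) \<rightarrow>\<^sub>E B. \<mu> j = (functors X (fob D j), m, B)) \<and>
     (\<forall>p\<in>Arr J. \<forall>f\<in>functors X (fob D (Dom J p)). fst (snd (\<mu> (Cod J p))) (comp_func (far D p) f) = fst (snd (\<mu> (Dom J p))) f)"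
    (is "?L \<longleftrightarrow> ?A \<and> ?B")
proof -
  have o: "p \<in> Arr J \<Longrightarrow> Dom J p \<in> Obj J" "p \<in> Arr J \<Longrightarrow> Cod J p \<in> Obj J" for p by simp_all
  have 1: "?L \<longleftrightarrow> ?A \<and> (\<forall>p\<in>Arr J. Comp SET (\<mu> (Cod J p)) (functors X (fob D (Dom J p)), \<lambda>f\<in>functors X (fob D (Dom J p)). comp_func (far D p) f, functors X (fob D (Cod J p))) = \<mu> (Dom J p))"
    unfolding cocone_def hom_diagram(1,2)[OF X] SET_hom by (simp add: hom_diagram(3,4)[OF X] SET_Obj)
  have "Comp SET (\<mu> (Cod J p)) (functors X (fob D (Dom J p)), \<lambda>f\<in>functors X (fob D (Dom J p)). comp_func (far D p) f, functors X (fob D (Cod J p))) = \<mu> (Dom J p) \<longleftrightarrow>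
     (\<forall>f\<in>functors X (fob D (Dom J p)). fst (snd (\<mu> (Cod J p))) (comp_func (far D p) f) = fst (snd (\<mu> (Dom J p))) f)"
    if A: ?A and p: "p \<in> Arr J" for p
  proof -
    obtain m where m: "m \<in> functors X (fob D (Dom J p)) \<rightarrow>\<^sub>E B" "\<mu> (Dom J p) = (functors X (fob D (Dom J p)), m, B)"
      using A o(1)[OF p] by blast
    obtain n where n: "n \<in> functors X (fob D (Cod J p)) \<rightarrow>\<^sub>E B" "\<mu> (Cod J p) = (functors X (fob D (Cod J p)), n, B)"
      using A o(2)[OF p] by blast
    have "(\<lambda>x\<in>functors X (fob D (Dom J p)). n (comp_func (far D p) x)) = m \<longleftrightarrow>
        (\<forall>f\<in>functors X (fob D (Dom J p)). n (comp_func (far D p) f) = m f)"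
      using m(1) by (auto simp: fun_eq_iff PiE_def extensional_def)
    moreover have "Comp SET (\<mu> (Cod J p)) (functors X (fob D (Dom J p)), \<lambda>f\<in>functors X (fob D (Dom J p)). comp_func (far D p) f, functors X (fob D (Cod J p))) =
        (functors X (fob D (Dom J p)), \<lambda>x\<in>functors X (fob D (Dom J p)). n (comp_func (far D p) x), B)"
      unfolding n(2) SET_Comp by (auto intro!: ext)
    ultimately show ?thesis unfolding m(2) n(2) by simp
  qed
  then show ?thesis unfolding 1 by blast
qed

text \<open>An arrow of \<open>SET\<close> is a triple whose outer components are determined by
  source and target, so unique existence of triples is unique existence of maps. This eliminates
  \<open>SET\<close> and leaves a statement about maps out of \<open>functors X L\<close>.\<close>

lemma hom_colimit_iff:
  assumes X: "category X" and c: "cocone D L \<gamma>"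
  shows "colimit_cocone (comp_func (hom_func (und CAT) X) D) (fob (hom_func (und CAT) X) L) (\<lambda>j. far (hom_func (und CAT) X) (\<gamma> j)) \<longleftrightarrow>
    (\<forall>(B :: ('u, 'u, 'u, 'u) func set) \<mu>. (\<forall>j\<in>Obj J. \<mu> j \<in> functors X (fob D j) \<rightarrow>\<^sub>E B) \<and>
        (\<forall>p\<in>Arr J. \<forall>f\<in>functors X (fob D (Dom J p)). \<mu> (Cod J p) (comp_func (far D p) f) = \<mu> (Dom J p) f) \<longrightarrow>
        (\<exists>!h. h \<in> functors X L \<rightarrow>\<^sub>E B \<and> (\<forall>j\<in>Obj J. \<forall>f\<in>functors X (fob D j). h (comp_func (\<gamma> j) f) = \<mu> j f)))"
    (is "?L \<longleftrightarrow> (\<forall>B \<mu>. ?P B \<mu> \<longrightarrow> (\<exists>!h. ?Q B \<mu> h))")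
proof -
  have L: "category L" and g: "\<And>j. j \<in> Obj J \<Longrightarrow> \<gamma> j \<in> functors (fob D j) L"
    and gp: "\<And>p. p \<in> Arr J \<Longrightarrow> comp_func (\<gamma> (Cod J p)) (far D p) = \<gamma> (Dom J p)"
    using c by (auto simp: cocone_iff)
  let ?D = "comp_func (hom_func (und CAT) X) D"
  have gj: "far (hom_func (und CAT) X) (\<gamma> j) = (functors X (fob D j), \<lambda>f\<in>functors X (fob D j). comp_func (\<gamma> j) f, functors X L)"
    if "j \<in> Obj J" for j
    using hom_func_CAT(2)[OF X g[OF that]] that L by simp
  have Lh: "fob (hom_func (und CAT) X) L = functors X L" by (rule hom_func_CAT(1)[OF X L])
  have c0: "cocone ?D (functors X L) (\<lambda>j. far (hom_func (und CAT) X) (\<gamma> j))"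
    unfolding hom_cocone_iff[OF X c]
  proof (intro conjI ballI)
    fix j assume j: "j \<in> Obj J"
    show "\<exists>m\<in>functors X (fob D j) \<rightarrow>\<^sub>E functors X L. far (hom_func (und CAT) X) (\<gamma> j) = (functors X (fob D j), m, functors X L)"
      using gj[OF j] comp_functors[OF X _ g[OF j]] by auto
  next
    fix p f assume p: "p \<in> Arr J" and f: "f \<in> functors X (fob D (Dom J p))"
    show "fst (snd (far (hom_func (und CAT) X) (\<gamma> (Cod J p)))) (comp_func (far D p) f) =
        fst (snd (far (hom_func (und CAT) X) (\<gamma> (Dom J p)))) f"
      using gj[of "Cod J p"] gj[of "Dom J p"] p f comp_functors[OF X f D_functors[OF p]] gp[OF p]
        comp_func_assoc[OF X f D_functors[OF p] g[of "Cod J p"]] by simp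
  qed
  have E: "(\<exists>!h. h \<in> hom SET (functors X L) B \<and> (\<forall>j\<in>Obj J. Comp SET h (far (hom_func (und CAT) X) (\<gamma> j)) = (functors X (fob D j), \<mu> j, B)))
     \<longleftrightarrow> (\<exists>!h. ?Q B \<mu> h)" if P: "?P B \<mu>" for B :: "('u, 'u, 'u, 'u) func set" and \<mu>
  proof -
    have i: "(functors X L, h, B) \<in> hom SET (functors X L) B \<and>
        (\<forall>j\<in>Obj J. Comp SET (functors X L, h, B) (far (hom_func (und CAT) X) (\<gamma> j)) = (functors X (fob D j), \<mu> j, B)) \<longleftrightarrow> ?Q B \<mu> h" for h
    proof -
      have "Comp SET (functors X L, h, B) (far (hom_func (und CAT) X) (\<gamma> j)) = (functors X (fob D j), \<mu> j, B) \<longleftrightarrow>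
          (\<forall>f\<in>functors X (fob D j). h (comp_func (\<gamma> j) f) = \<mu> j f)" if j: "j \<in> Obj J" for j
      proof -
        have "\<mu> j \<in> functors X (fob D j) \<rightarrow>\<^sub>E B" using P j by blast
        then have "(\<lambda>x\<in>functors X (fob D j). h (comp_func (\<gamma> j) x)) = \<mu> j \<longleftrightarrow>
            (\<forall>f\<in>functors X (fob D j). h (comp_func (\<gamma> j) f) = \<mu> j f)"
          by (auto simp: fun_eq_iff PiE_def extensional_def)
        moreover have "Comp SET (functors X L, h, B) (far (hom_func (und CAT) X) (\<gamma> j)) =
            (functors X (fob D j), \<lambda>x\<in>functors X (fob D j). h (comp_func (\<gamma> j) x), B)"
          unfolding gj[OF j] SET_Comp by (auto intro!: ext)
        ultimately show ?thesis by simp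
      qed
      then show ?thesis by (auto simp: SET_hom)
    qed
    have j: "h \<in> hom SET (functors X L) B \<Longrightarrow> \<exists>h'. h = (functors X L, h', B)" for h
      by (auto simp: SET_hom)
    show ?thesis
    proof
      assume "\<exists>!h. h \<in> hom SET (functors X L) B \<and> (\<forall>j\<in>Obj J. Comp SET h (far (hom_func (und CAT) X) (\<gamma> j)) = (functors X (fob D j), \<mu> j, B))"
      then obtain t where t: "t \<in> hom SET (functors X L) B" "\<forall>j\<in>Obj J. Comp SET t (far (hom_func (und CAT) X) (\<gamma> j)) = (functors X (fob D j), \<mu> j, B)"
        "\<And>t'. t' \<in> hom SET (functors X L) B \<and> (\<forall>j\<in>Obj J. Comp SET t' (far (hom_func (und CAT) X) (\<gamma> j)) = (functors X (fob D j), \<mu> j, B)) \<Longrightarrow> t' = t"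
        by blast
      obtain h where h: "t = (functors X L, h, B)" using j[OF t(1)] by blast
      show "\<exists>!h. ?Q B \<mu> h"
      proof (rule ex1I[of _ h])
        show "?Q B \<mu> h" using i[of h] t(1,2) h by blast
        fix k assume "?Q B \<mu> k"
        then have "(functors X L, k, B) = t" using i[of k] t(3) by blast
        then show "k = h" using h by simp
      qed
    next
      assume "\<exists>!h. ?Q B \<mu> h"
      then obtain h where h: "?Q B \<mu> h" "\<And>k. ?Q B \<mu> k \<Longrightarrow> k = h"
        by (elim ex1E) (erule that, erule allE, erule mp)
      define P where "P t \<longleftrightarrow> t \<in> hom SET (functors X L) B \<and>
         (\<forall>j\<in>Obj J. Comp SET t (far (hom_func (und CAT) X) (\<gamma> j)) = (functors X (fob D j), \<mu> j, B))" for t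
      have 1: "P (functors X L, h, B)"
        unfolding P_def by (rule iffD2[OF i h(1)])
      have 2: "t = (functors X L, h, B)" if Pt: "P t" for t
      proof -
        obtain k where k: "t = (functors X L, k, B)" using j Pt unfolding P_def by blast
        have "?Q B \<mu> k" using Pt unfolding P_def k by (rule iffD1[OF i])
        then show ?thesis using h(2) k by simp
      qed
      have "\<exists>!t. P t" using 1 2 by (rule ex1I)
      then show "\<exists>!h. h \<in> hom SET (functors X L) B \<and> (\<forall>j\<in>Obj J. Comp SET h (far (hom_func (und CAT) X) (\<gamma> j)) = (functors X (fob D j), \<mu> j, B))"
        unfolding P_def .
    qed
  qed
  show ?thesis
  proof
    assume l: ?L
    show "\<forall>B \<mu>. ?P B \<mu> \<longrightarrow> (\<exists>!h. ?Q B \<mu> h)"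
    proof (intro allI impI)
      fix B \<mu> assume P: "?P B \<mu>"
      have "cocone ?D B (\<lambda>j. (functors X (fob D j), \<mu> j, B))"
        unfolding hom_cocone_iff[OF X c] using P by auto
      moreover have "cocone ?D B (\<lambda>j. (functors X (fob D j), \<mu> j, B)) \<longrightarrow>
         (\<exists>!h. h \<in> hom SET (functors X L) B \<and>
            (\<forall>j\<in>Obj J. Comp SET h (far (hom_func (und CAT) X) (\<gamma> j)) = (functors X (fob D j), \<mu> j, B)))"
        by (rule l[unfolded colimit_cocone_def hom_diagram(1,2)[OF X] Lh, THEN conjunct2, THEN spec, THEN spec])
      ultimately show "\<exists>!h. ?Q B \<mu> h"
        using iffD1[OF E[OF P]] by simp
    qed
  next
    assume r: "\<forall>B \<mu>. ?P B \<mu> \<longrightarrow> (\<exists>!h. ?Q B \<mu> h)"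
    show ?L
      unfolding colimit_cocone_def hom_diagram[OF X] Lh
    proof (intro conjI c0 allI impI)
      fix B \<mu> assume \<mu>: "cocone ?D B \<mu>"
      have m: "\<mu> j = (functors X (fob D j), fst (snd (\<mu> j)), B)" "fst (snd (\<mu> j)) \<in> functors X (fob D j) \<rightarrow>\<^sub>E B" if j: "j \<in> Obj J" for j
      proof -
        obtain m where "m \<in> functors X (fob D j) \<rightarrow>\<^sub>E B" "\<mu> j = (functors X (fob D j), m, B)"
          by (rule bexE[OF bspec[OF conjunct1[OF iffD1[OF hom_cocone_iff[OF X c] \<mu>]] j]]) (rule that)
        then show "\<mu> j = (functors X (fob D j), fst (snd (\<mu> j)), B)" "fst (snd (\<mu> j)) \<in> functors X (fob D j) \<rightarrow>\<^sub>E B"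
          by simp_all
      qed
      have P: "?P B (\<lambda>j. fst (snd (\<mu> j)))"
        using \<mu> m(2) unfolding hom_cocone_iff[OF X c] by blast
      have "(\<forall>j\<in>Obj J. Comp SET h (far (hom_func (und CAT) X) (\<gamma> j)) = (functors X (fob D j), fst (snd (\<mu> j)), B)) \<longleftrightarrow>
         (\<forall>j\<in>Obj J. Comp SET h (far (hom_func (und CAT) X) (\<gamma> j)) = \<mu> j)" for h
        using m(1) by (intro ball_cong refl) simp
      then show "\<exists>!h. h \<in> hom SET (functors X L) B \<and> (\<forall>j\<in>Obj J. Comp SET h (far (hom_func (und CAT) X) (\<gamma> j)) = \<mu> j)"
        using E[OF P] r P by simp
    qed
  qed
qed

end

text \<open>\<open>generated\<close> adjoins the identities of all objects for free, so finiteness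
  of the set of objects is a separate requirement.\<close>

definition finitely_generated :: "('o, 'a) cat \<Rightarrow> bool" where
  "finitely_generated A \<longleftrightarrow> finite (Obj A) \<and> (\<exists>G. finite G \<and> G \<subseteq> Arr A \<and> Arr A \<subseteq> generated A G)"

text \<open>The surjectivity half of the statement that the hom-functor of \<open>X\<close>
  preserves filtered colimits. The injectivity half will follow from finite generation.\<close>

definition factors_through_stages :: "('u::infinite, 'u) cat \<Rightarrow> bool" where
  "factors_through_stages X \<longleftrightarrow> (\<forall>J D L (\<gamma> :: 'u \<Rightarrow> ('u, 'u, 'u, 'u) func).
     filtered_diagram J D \<longrightarrow> colimit_cocone D L \<gamma> \<longrightarrow>
     (\<forall>F\<in>functors X L. \<exists>j\<in>Obj J. \<exists>F'\<in>functors X (fob D j). comp_func (\<gamma> j) F' = F))"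

text \<open>Membership in \<open>Arr A\<close> is carried along, so that the composition case may
  assume that both factors are arrows.\<close>

lemma generated_induct:
  assumes A: "category A" and G: "G \<subseteq> Arr A" and f: "f \<in> generated A G"
    and "\<And>g. g \<in> G \<Longrightarrow> P g" "\<And>x. x \<in> Obj A \<Longrightarrow> P (Ide A x)"
    and "\<And>f g. f \<in> Arr A \<Longrightarrow> g \<in> Arr A \<Longrightarrow> Dom A g = Cod A f \<Longrightarrow> P f \<Longrightarrow> P g \<Longrightarrow> P (Comp A g f)"
  shows "f \<in> Arr A \<and> P f"
  using f by induction (use assms in auto)

lemma generated_agree:
  assumes A: "category A" and G: "G \<subseteq> Arr A" "Arr A \<subseteq> generated A G"
    and F: "F \<in> functors A B" and F': "F' \<in> functors A B" and B: "category B"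
    and e: "\<And>g. g \<in> G \<Longrightarrow> far F g = far F' g" "\<And>x. x \<in> Obj A \<Longrightarrow> fob F x = fob F' x"
  shows "F = F'"
proof (rule functors_eqI_arr[OF A B F F'])
  fix f assume "f \<in> Arr A"
  then have "f \<in> generated A G" using G by blast
  then have "f \<in> Arr A \<and> far F f = far F' f"
    by (rule generated_induct[OF A G(1)]) (use e functorsD'[OF F] functorsD'[OF F'] in auto)
  then show "far F f = far F' f" ..
qed

text \<open>If some \<open>F\<close> came from no stage, the constant map on
  \<open>functors X L\<close> and the same map altered at \<open>F\<close> alone would both extend
  one cocone, against the uniqueness in the colimit property.\<close>

lemma finitely_presentable_factors:
  fixes X :: "('u::infinite, 'u) cat"
  assumes "finitely_presentable X"
  shows "factors_through_stages X"
  unfolding factors_through_stages_def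
proof (intro allI impI ballI)
  fix J and D :: "('u, 'u, ('u, 'u) cat, ('u, 'u, 'u, 'u) func) func" and L \<gamma> F
  assume "filtered_diagram J D" and c: "colimit_cocone D L \<gamma>" and F: "F \<in> functors X L"
  interpret filtered_diagram J D by fact
  have X: "category X" using assms by (simp add: finitely_presentable_def)
  have sel: "filtered (fdom D)" "fcod D = und CAT" using filt D by auto
  obtain a b :: 'u where ab: "a \<noteq> b" using ex_new_if_finite[OF infinite_UNIV, of "{undefined :: 'u}"] by auto
  \<comment> \<open>The cocones in \<open>SET\<close> are tested on sets of functor records, so the
    two-element set needed here consists of two arbitrary records, kept apart by their object
    parts.\<close>
  define u v :: "('u, 'u, 'u, 'u) func" where "u = undefined\<lparr>fob := (\<lambda>_. a)\<rparr>" and "v = undefined\<lparr>fob := (\<lambda>_. b)\<rparr>"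
  have "fob u \<noteq> fob v" using ab by (simp add: u_def v_def fun_eq_iff)
  then have uv: "u \<noteq> v" by auto
  let ?Q = "\<lambda>h. h \<in> functors X L \<rightarrow>\<^sub>E {u, v} \<and> (\<forall>j\<in>Obj J. \<forall>f\<in>functors X (fob D j). h (comp_func (\<gamma> j) f) = (\<lambda>f\<in>functors X (fob D j). u) f)"
  have co: "cocone D L \<gamma>" by (rule colimit_cocone_cocone[OF c])
  have "colimit_cocone (comp_func (hom_func (und CAT) X) D) (fob (hom_func (und CAT) X) L) (\<lambda>j. far (hom_func (und CAT) X) (\<gamma> j))"
    using assms D(1) sel c unfolding finitely_presentable_def by blast
  then have all: "(\<forall>j\<in>Obj J. \<mu> j \<in> functors X (fob D j) \<rightarrow>\<^sub>E B) \<and>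
        (\<forall>p\<in>Arr J. \<forall>f\<in>functors X (fob D (Dom J p)). \<mu> (Cod J p) (comp_func (far D p) f) = \<mu> (Dom J p) f) \<longrightarrow>
        (\<exists>!h. h \<in> functors X L \<rightarrow>\<^sub>E B \<and> (\<forall>j\<in>Obj J. \<forall>f\<in>functors X (fob D j). h (comp_func (\<gamma> j) f) = \<mu> j f))"
      for B :: "('u, 'u, 'u, 'u) func set" and \<mu>
    by (rule iffD1[OF hom_colimit_iff[OF X co], THEN spec, THEN spec])
  have "\<exists>!h. ?Q h"
    by (rule all[rule_format, of "\<lambda>j. \<lambda>f\<in>functors X (fob D j). u" "{u, v}"])
      (use comp_functors[OF X _ D_functors] in auto)
  then have uniq: "?Q h \<Longrightarrow> ?Q k \<Longrightarrow> h = k" for h k by blast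
  show "\<exists>j\<in>Obj J. \<exists>F'\<in>functors X (fob D j). comp_func (\<gamma> j) F' = F"
  proof (rule ccontr)
    assume no: "\<not> (\<exists>j\<in>Obj J. \<exists>F'\<in>functors X (fob D j). comp_func (\<gamma> j) F' = F)"
    have g: "comp_func (\<gamma> j) f \<in> functors X L" if "j \<in> Obj J" "f \<in> functors X (fob D j)" for j f
      using comp_functors[OF X that(2)] co that(1) by (auto simp: cocone_iff)
    have "(\<lambda>f\<in>functors X L. u) = (\<lambda>f\<in>functors X L. if f = F then v else u)"
      by (rule uniq) (use no g in auto)
    then have "u = v" using F by (auto simp: fun_eq_iff restrict_def split: if_splits)
    then show False using uv by simp
  qed
qed

text \<open>Each functor into the colimit comes from a stage by hypothesis. Two functors with the
  same image agree at a later stage on a finite generating set, hence entirely, so a compatible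
  family of maps has a well-defined extension.\<close>

lemma finitely_presentableI:
  fixes X :: "('u::infinite, 'u) cat"
  assumes X: "category X" and fg: "finitely_generated X" and fs: "factors_through_stages X"
  shows "finitely_presentable X"
  unfolding finitely_presentable_def
proof (intro conjI X allI impI; elim conjE)
  fix D :: "('u, 'u, ('u, 'u) cat, ('u, 'u, 'u, 'u) func) func" and L \<gamma>
  assume D: "is_functor D" "filtered (fdom D)" "fcod D = und CAT" and c: "colimit_cocone D L \<gamma>"
  define J where "J = fdom D"
  interpret filtered_diagram J D
    by unfold_locales (use D J_def in simp_all)
  obtain G where G: "finite (Obj X)" "finite G" "G \<subseteq> Arr X" "Arr X \<subseteq> generated X G"
    using fg by (auto simp: finitely_generated_def)
  have co: "cocone D L \<gamma>" by (rule colimit_cocone_cocone[OF c])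
  have L: "category L" and g: "\<And>j. j \<in> Obj J \<Longrightarrow> \<gamma> j \<in> functors (fob D j) L"
    and gp: "\<And>p. p \<in> Arr J \<Longrightarrow> comp_func (\<gamma> (Cod J p)) (far D p) = \<gamma> (Dom J p)"
    using co by (auto simp: cocone_iff)
  have ex: "\<exists>j\<in>Obj J. \<exists>F'\<in>functors X (fob D j). comp_func (\<gamma> j) F' = F" if "F \<in> functors X L" for F
    using fs that c filtered_diagram_axioms unfolding factors_through_stages_def by blast
  \<comment> \<open>The injectivity half: equality in the colimit is reached at some stage. Finite
    generation enters here.\<close>
  have eventually: "\<exists>r\<in>Arr J. \<exists>s\<in>Arr J. Dom J r = i \<and> Dom J s = j \<and> Cod J s = Cod J r \<and>
      comp_func (far D r) F = comp_func (far D s) F'"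
    if i: "i \<in> Obj J" "j \<in> Obj J" and F: "F \<in> functors X (fob D i)" "F' \<in> functors X (fob D j)"
      and e: "comp_func (\<gamma> i) F = comp_func (\<gamma> j) F'" for i j F F'
  proof -
    obtain p q where p: "p \<in> Arr J" "q \<in> Arr J" "Dom J p = i" "Dom J q = j" "Cod J q = Cod J p"
      using upper_bound[OF i] by blast
    let ?k = "Cod J p"
    have k: "?k \<in> Obj J" using p by simp
    have P: "far D p \<in> functors (fob D i) (fob D ?k)" "far D q \<in> functors (fob D j) (fob D ?k)"
      using D_functors[OF p(1)] D_functors[OF p(2)] p by simp_all
    have PF: "comp_func (far D p) F \<in> functors X (fob D ?k)" "comp_func (far D q) F' \<in> functors X (fob D ?k)"
      using comp_functors[OF X F(1) P(1)] comp_functors[OF X F(2) P(2)] by simp_all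
    \<comment> \<open>The identities are included because an object need not be an endpoint of a
      generator, so that agreement on generators alone says nothing about it.\<close>
    let ?R = "(\<lambda>f. (far (comp_func (far D p) F) f, far (comp_func (far D q) F') f)) ` (G \<union> Ide X ` Obj X)"
    have GX: "G \<union> Ide X ` Obj X \<subseteq> Arr X" using G X by auto
    have "\<exists>r\<in>Arr J. Dom J r = ?k \<and> (\<forall>(a, b)\<in>?R. act r a = act r b)"
    proof (rule equalize_finite[OF _ k])
      show "finite ?R" using G by simp
      fix a b assume "(a, b) \<in> ?R"
      then obtain f where f: "f \<in> Arr X" "a = far (comp_func (far D p) F) f" "b = far (comp_func (far D q) F') f"
        using GX by blast
      have "far (\<gamma> ?k) a = far (comp_func (\<gamma> i) F) f" "far (\<gamma> ?k) b = far (comp_func (\<gamma> j) F') f"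
        using f cocone_act[OF co p(1), of "far F f"] cocone_act[OF co p(2), of "far F' f"] p
          functorsD[OF F(1)] functorsD[OF F(2)] functorsD'(2)[OF F(1)] functorsD'(2)[OF F(2)]
        by (simp_all add: act_def)
      then show "a \<in> Arr (fob D ?k) \<and> b \<in> Arr (fob D ?k) \<and> eqv (?k, a) (?k, b)"
        using functorsD'(2)[OF PF(1) f(1)] functorsD'(2)[OF PF(2) f(1)] f e colimit_eqv[OF c k _ k] by simp
    qed
    then obtain r where r: "r \<in> Arr J" "Dom J r = ?k" "\<And>f. f \<in> G \<union> Ide X ` Obj X \<Longrightarrow>
        act r (far (comp_func (far D p) F) f) = act r (far (comp_func (far D q) F') f)"
      by fast
    have R: "far D r \<in> functors (fob D ?k) (fob D (Cod J r))" using D_functors[OF r(1)] r(2) by simp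
    have Dr: "category (fob D (Cod J r))" "category (fob D i)" "category (fob D j)" "category (fob D ?k)" using r i k by simp_all
    have RF: "comp_func (far D r) (comp_func (far D p) F) \<in> functors X (fob D (Cod J r))"
      "comp_func (far D r) (comp_func (far D q) F') \<in> functors X (fob D (Cod J r))"
      using comp_functors[OF X PF(1) R] comp_functors[OF X PF(2) R] by simp_all
    have re: "far (comp_func (far D r) (comp_func (far D p) F)) f = far (comp_func (far D r) (comp_func (far D q) F')) f"
      if "f \<in> G \<union> Ide X ` Obj X" for f
    proof -
      have "f \<in> Arr X" using that GX by blast
      then show ?thesis using r(3)[OF that] functorsD(2)[OF F(1)] functorsD(2)[OF F(2)] by (simp add: act_def)
    qed
    have "comp_func (far D r) (comp_func (far D p) F) = comp_func (far D r) (comp_func (far D q) F')"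
    proof (rule generated_agree[OF X G(3,4) RF Dr(1)])
      fix x assume x: "x \<in> Obj X"
      have "Dom (fob D (Cod J r)) (far (comp_func (far D r) (comp_func (far D p) F)) (Ide X x)) =
            Dom (fob D (Cod J r)) (far (comp_func (far D r) (comp_func (far D q) F')) (Ide X x))"
        using re[of "Ide X x"] x by simp
      then show "fob (comp_func (far D r) (comp_func (far D p) F)) x = fob (comp_func (far D r) (comp_func (far D q) F')) x"
        using functorsD'(3)[OF RF(1), of "Ide X x"] functorsD'(3)[OF RF(2), of "Ide X x"] x X
        by (metis categoryD(3,4))
    qed (use re in blast)
    moreover have "comp_func (far D r) (comp_func (far D p) F) = comp_func (far D (Comp J r p)) F"
      using comp_func_assoc[OF X F(1) P(1) R] D_comp[of p r] p r by simp
    moreover have "comp_func (far D r) (comp_func (far D q) F') = comp_func (far D (Comp J r q)) F'"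
      using comp_func_assoc[OF X F(2) P(2) R] D_comp[of q r] p r by simp
    ultimately show ?thesis
      using p r by (intro bexI[of _ "Comp J r p"] bexI[of _ "Comp J r q"]) simp_all
  qed
  show "colimit_cocone (comp_func (hom_func (und CAT) X) D) (fob (hom_func (und CAT) X) L) (\<lambda>j. far (hom_func (und CAT) X) (\<gamma> j))"
    unfolding hom_colimit_iff[OF X co]
  proof (intro allI impI; elim conjE)
    fix B and \<mu> :: "'u \<Rightarrow> ('u, 'u, 'u, 'u) func \<Rightarrow> ('u, 'u, 'u, 'u) func"
    assume mB: "\<forall>j\<in>Obj J. \<mu> j \<in> functors X (fob D j) \<rightarrow>\<^sub>E B"
      and mp: "\<forall>p\<in>Arr J. \<forall>f\<in>functors X (fob D (Dom J p)). \<mu> (Cod J p) (comp_func (far D p) f) = \<mu> (Dom J p) f"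
    have wd: "\<mu> i F = \<mu> j F'"
      if i: "i \<in> Obj J" "j \<in> Obj J" and F: "F \<in> functors X (fob D i)" "F' \<in> functors X (fob D j)"
        and e: "comp_func (\<gamma> i) F = comp_func (\<gamma> j) F'" for i j F F'
    proof -
      obtain r s where "r \<in> Arr J" "s \<in> Arr J" "Dom J r = i" "Dom J s = j" "Cod J s = Cod J r"
        "comp_func (far D r) F = comp_func (far D s) F'"
        using eventually[OF i F e] by blast
      then show ?thesis using mp F by metis
    qed
    define c where "c F = (SOME t. fst t \<in> Obj J \<and> snd t \<in> functors X (fob D (fst t)) \<and> comp_func (\<gamma> (fst t)) (snd t) = F)" for F
    have c: "fst (c F) \<in> Obj J \<and> snd (c F) \<in> functors X (fob D (fst (c F))) \<and> comp_func (\<gamma> (fst (c F))) (snd (c F)) = F"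
      if "F \<in> functors X L" for F
    proof -
      have "\<exists>j\<in>Obj J. \<exists>F'\<in>functors X (fob D j). comp_func (\<gamma> j) F' = F" by (rule ex[OF that])
      then obtain j F' where "j \<in> Obj J" "F' \<in> functors X (fob D j)" "comp_func (\<gamma> j) F' = F" by blast
      then have "\<exists>t. fst t \<in> Obj J \<and> snd t \<in> functors X (fob D (fst t)) \<and> comp_func (\<gamma> (fst t)) (snd t) = F"
        by (intro exI[of _ "(j, F')"]) simp
      then show ?thesis unfolding c_def by (rule someI_ex)
    qed
    \<comment> \<open>The value is computed at a factorization chosen by \<open>c\<close>; the fact
      \<open>wd\<close> shows that any other factorization gives the same value.\<close>
    define h where "h = (\<lambda>F\<in>functors X L. \<mu> (fst (c F)) (snd (c F)))"
    have gF: "comp_func (\<gamma> j) F \<in> functors X L" if "j \<in> Obj J" "F \<in> functors X (fob D j)" for j F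
      using comp_functors[OF X that(2) g[OF that(1)]] .
    have h: "h (comp_func (\<gamma> j) F) = \<mu> j F" if "j \<in> Obj J" "F \<in> functors X (fob D j)" for j F
    proof -
      have "\<mu> (fst (c (comp_func (\<gamma> j) F))) (snd (c (comp_func (\<gamma> j) F))) = \<mu> j F"
        by (rule wd) (use c[OF gF[OF that]] that in auto)
      then show ?thesis using gF[OF that] by (simp add: h_def)
    qed
    have hB: "h F \<in> B" if "F \<in> functors X L" for F
      using c[OF that] mB that by (auto simp: h_def)
    show "\<exists>!h. h \<in> functors X L \<rightarrow>\<^sub>E B \<and> (\<forall>j\<in>Obj J. \<forall>f\<in>functors X (fob D j). h (comp_func (\<gamma> j) f) = \<mu> j f)"
    proof (rule ex1I[of _ h])
      show "h \<in> functors X L \<rightarrow>\<^sub>E B \<and> (\<forall>j\<in>Obj J. \<forall>f\<in>functors X (fob D j). h (comp_func (\<gamma> j) f) = \<mu> j f)"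
        using h hB by (auto simp: h_def)
      fix k assume k: "k \<in> functors X L \<rightarrow>\<^sub>E B \<and> (\<forall>j\<in>Obj J. \<forall>f\<in>functors X (fob D j). k (comp_func (\<gamma> j) f) = \<mu> j f)"
      show "k = h"
      proof
        fix F
        show "k F = h F"
        proof (cases "F \<in> functors X L")
          case True
          have "k (comp_func (\<gamma> (fst (c F))) (snd (c F))) = \<mu> (fst (c F)) (snd (c F))"
            using k c[OF True] by blast
          then show ?thesis using c[OF True] True by (simp add: h_def)
        next
          case False
          then show ?thesis using k by (auto simp: h_def)
        qed
      qed
    qed
  qed
qed

section \<open>Finitely presentable categories\<close>

text \<open>A finite set is listed by a chosen list, and lists are coded as nested pairs. The
  injection supplies indices in \<open>'u\<close> for the diagram of finite subsets.\<close>

lemma ex_inj_finite_sets: "\<exists>e :: 'u::infinite set \<Rightarrow> 'u. inj_on e {G. finite G}"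
proof -
  obtain p :: "'u \<times> 'u \<Rightarrow> 'u" where p: "inj p" using ex_inj_pair by blast
  obtain c d :: 'u where cd: "c \<noteq> d" using ex_new_if_finite[OF infinite_UNIV, of "{undefined :: 'u}"] by auto
  \<comment> \<open>The element \<open>c\<close> tags a list cell and \<open>d\<close> the end of
    the list, so that lists of different lengths never share a code.\<close>
  define l where "l xs = foldr (\<lambda>x z. p (c, p (x, z))) xs (p (d, d))" for xs
  have l: "l xs = l ys \<Longrightarrow> xs = ys" for xs ys
  proof (induction xs arbitrary: ys)
    case Nil
    then show ?case using cd by (cases ys) (auto simp: l_def inj_eq[OF p])
  next
    case (Cons x xs)
    then show ?case using cd by (cases ys) (auto simp: l_def inj_eq[OF p])
  qed
  have s: "set (SOME xs. set xs = G) = G" if "finite G" for G :: "'u set"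
    using that by (rule someI_ex[OF finite_list])
  show ?thesis
    by (rule exI[of _ "\<lambda>G. l (SOME xs. set xs = G)"], rule inj_onI) (use s l in \<open>metis mem_Collect_eq\<close>)
qed

text \<open>
  Every category is the filtered colimit of its subcategories generated by finite sets of arrows,
  so that a finitely presentable category is one of them.
\<close>

locale finite_subcategories =
  fixes A :: "('u::infinite, 'u) cat" and e :: "'u set \<Rightarrow> 'u" and pr :: "'u \<times> 'u \<Rightarrow> 'u"
  assumes A: "category A" and e: "inj_on e {G. finite G}" and pr: "inj pr"
begin

definition indices :: "'u set" where "indices = e ` {G. finite G \<and> G \<subseteq> Arr A}"

definition de :: "'u \<Rightarrow> 'u set" where "de = inv_into {G. finite G} e"

lemma de_e: "finite G \<Longrightarrow> de (e G) = G"
  unfolding de_def by (rule inv_into_f_f[OF e]) simp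

lemma indices: "x \<in> indices \<Longrightarrow> finite (de x) \<and> de x \<subseteq> Arr A \<and> e (de x) = x"
  by (auto simp: indices_def de_e)

lemma e_indices: "finite G \<Longrightarrow> G \<subseteq> Arr A \<Longrightarrow> e G \<in> indices"
  by (auto simp: indices_def)

text \<open>The poset of finite subsets of \<open>Arr A\<close> under inclusion. Subsets are coded
  by \<open>e\<close>, and an arrow is coded as the pair of its source and target.\<close>

definition index_cat :: "('u, 'u) cat" where
  "index_cat = \<lparr>Obj = indices, Arr = pr ` {(x, y). x \<in> indices \<and> y \<in> indices \<and> de x \<subseteq> de y},
     Dom = (\<lambda>p. fst (inv pr p)), Cod = (\<lambda>p. snd (inv pr p)), Ide = (\<lambda>x. pr (x, x)),
     Comp = (\<lambda>g f. pr (fst (inv pr f), snd (inv pr g)))\<rparr>"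

lemma index_cat_sel [simp]:
  "Obj index_cat = indices" "pr (x, y) \<in> Arr index_cat \<longleftrightarrow> x \<in> indices \<and> y \<in> indices \<and> de x \<subseteq> de y"
  "Dom index_cat (pr (x, y)) = x" "Cod index_cat (pr (x, y)) = y" "Ide index_cat x = pr (x, x)"
  "Comp index_cat (pr (y', z)) (pr (x, y)) = pr (x, z)"
  using pr by (auto simp: index_cat_def inj_eq)

lemma index_catE:
  assumes "p \<in> Arr index_cat"
  obtains x y where "p = pr (x, y)" "x \<in> indices" "y \<in> indices" "de x \<subseteq> de y"
  using assms by (auto simp: index_cat_def)

lemma category_index_cat: "category index_cat"
  unfolding category_def by (auto elim!: index_catE)

lemma filtered_index_cat: "filtered index_cat"
  unfolding filtered_def
proof (intro conjI category_index_cat ballI)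
  show "Obj index_cat \<noteq> {}" using e_indices[of "{}"] by auto
next
  fix i j assume ij: "i \<in> Obj index_cat" "j \<in> Obj index_cat"
  let ?k = "e (de i \<union> de j)"
  have k: "?k \<in> indices" "de ?k = de i \<union> de j"
    using ij indices[of i] indices[of j] by (simp_all add: e_indices de_e)
  then have "pr (i, ?k) \<in> hom index_cat i ?k" "pr (j, ?k) \<in> hom index_cat j ?k"
    using ij by (auto simp: hom_iff)
  then show "\<exists>k\<in>Obj index_cat. hom index_cat i k \<noteq> {} \<and> hom index_cat j k \<noteq> {}"
    using k by (intro bexI[of _ ?k]) auto
next
  fix i j f g assume ij: "i \<in> Obj index_cat" "j \<in> Obj index_cat" "f \<in> hom index_cat i j" "g \<in> hom index_cat i j"
  then have "f = g" by (auto simp: hom_iff elim!: index_catE)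
  moreover have "Ide index_cat j \<in> hom index_cat j j"
    using ij(2) categoryD(3-5)[OF category_index_cat] by (simp add: hom_iff)
  ultimately show "\<exists>k\<in>Obj index_cat. \<exists>h\<in>hom index_cat j k. Comp index_cat h f = Comp index_cat h g"
    using ij(2) by blast
qed

definition obs :: "'u set \<Rightarrow> 'u set" where "obs G = Dom A ` G \<union> Cod A ` G"

text \<open>The objects are cut down to the endpoints of \<open>G\<close> before generating, because
  \<open>generated\<close> adjoins the identity of every object present. Finite \<open>G\<close>
  thus gives a subcategory with finitely many objects.\<close>

definition sub :: "'u set \<Rightarrow> ('u, 'u) cat" where
  "sub G = A\<lparr>Obj := obs G, Arr := generated (A\<lparr>Obj := obs G\<rparr>) G\<rparr>"

lemma sub_sel [simp]:
  "Obj (sub G) = obs G" "Dom (sub G) = Dom A" "Cod (sub G) = Cod A" "Ide (sub G) = Ide A" "Comp (sub G) = Comp A"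
  by (simp_all add: sub_def)

lemma obs_Obj: "G \<subseteq> Arr A \<Longrightarrow> x \<in> obs G \<Longrightarrow> x \<in> Obj A"
  using A by (auto simp: obs_def)

lemma sub_Arr:
  assumes G: "G \<subseteq> Arr A" and f: "f \<in> Arr (sub G)"
  shows "f \<in> Arr A" "Dom A f \<in> obs G" "Cod A f \<in> obs G"
proof -
  have "f \<in> generated (A\<lparr>Obj := obs G\<rparr>) G" using f by (simp add: sub_def)
  then have "f \<in> Arr A \<and> Dom A f \<in> obs G \<and> Cod A f \<in> obs G"
    by induction (use G A obs_Obj[OF G] in \<open>auto simp: obs_def\<close>)
  then show "f \<in> Arr A" "Dom A f \<in> obs G" "Cod A f \<in> obs G" by auto
qed

lemma sub_closed:
  "g \<in> G \<Longrightarrow> g \<in> Arr (sub G)" "x \<in> obs G \<Longrightarrow> Ide A x \<in> Arr (sub G)"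
  "f \<in> Arr (sub G) \<Longrightarrow> g \<in> Arr (sub G) \<Longrightarrow> Dom A g = Cod A f \<Longrightarrow> Comp A g f \<in> Arr (sub G)"
  using generated.gen[of g G "A\<lparr>Obj := obs G\<rparr>"] generated.ide[of x "A\<lparr>Obj := obs G\<rparr>" G]
    generated.comp[of f "A\<lparr>Obj := obs G\<rparr>" G g] by (simp_all add: sub_def)

lemma category_sub:
  assumes G: "G \<subseteq> Arr A"
  shows "category (sub G)"
  unfolding category_def using sub_Arr[OF G] sub_closed[where G = G] obs_Obj[OF G] A
  by (auto simp: category_assoc[OF A])

lemma sub_mono:
  assumes "G \<subseteq> H"
  shows "obs G \<subseteq> obs H" "Arr (sub G) \<subseteq> Arr (sub H)"
proof -
  show o: "obs G \<subseteq> obs H" using assms by (auto simp: obs_def)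
  show "Arr (sub G) \<subseteq> Arr (sub H)"
  proof
    fix f assume "f \<in> Arr (sub G)"
    then have "f \<in> generated (A\<lparr>Obj := obs G\<rparr>) G" by (simp add: sub_def)
    then show "f \<in> Arr (sub H)"
      by induction (use assms o sub_closed[where G = H] in auto)
  qed
qed

definition incl :: "('u, 'u) cat \<Rightarrow> ('u, 'u) cat \<Rightarrow> ('u, 'u, 'u, 'u) func" where
  "incl B C = \<lparr>fdom = B, fcod = C, fob = (\<lambda>x\<in>Obj B. x), far = (\<lambda>f\<in>Arr B. f)\<rparr>"

lemma incl_sel [simp]:
  "fdom (incl B C) = B" "fcod (incl B C) = C" "x \<in> Obj B \<Longrightarrow> fob (incl B C) x = x" "f \<in> Arr B \<Longrightarrow> far (incl B C) f = f"
  by (simp_all add: incl_def)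

lemma incl_functors:
  assumes "category B" "Obj B \<subseteq> Obj C" "Arr B \<subseteq> Arr C" "Dom B = Dom C" "Cod B = Cod C" "Ide B = Ide C" "Comp B = Comp C"
  shows "incl B C \<in> functors B C"
  by (rule functorsI) (use assms categoryD(1-6)[OF assms(1)] in \<open>auto simp: incl_def\<close>)

lemma incl_sub: "G \<subseteq> H \<Longrightarrow> H \<subseteq> Arr A \<Longrightarrow> incl (sub G) (sub H) \<in> functors (sub G) (sub H)"
  by (rule incl_functors) (use category_sub[of G] sub_mono[of G H] in auto)

lemma incl_sub_A: "G \<subseteq> Arr A \<Longrightarrow> incl (sub G) A \<in> functors (sub G) A"
  by (rule incl_functors) (use category_sub[of G] sub_Arr[of G] obs_Obj[of G] in auto)

definition diag :: "('u, 'u, ('u, 'u) cat, ('u, 'u, 'u, 'u) func) func" where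
  "diag = \<lparr>fdom = index_cat, fcod = und CAT, fob = (\<lambda>x\<in>indices. sub (de x)),
     far = (\<lambda>p\<in>Arr index_cat. incl (sub (de (fst (inv pr p)))) (sub (de (snd (inv pr p)))))\<rparr>"

lemma diag_sel [simp]:
  "fdom diag = index_cat" "fcod diag = und CAT" "x \<in> indices \<Longrightarrow> fob diag x = sub (de x)"
  "pr (x, y) \<in> Arr index_cat \<Longrightarrow> far diag (pr (x, y)) = incl (sub (de x)) (sub (de y))"
  using pr by (simp_all add: diag_def)

lemma diag_functor: "is_functor diag"
proof -
  have "diag \<in> functors index_cat (und CAT)"
  proof (rule functorsI)
    fix p assume "p \<in> Arr index_cat"
    then obtain x y where p: "p = pr (x, y)" "x \<in> indices" "y \<in> indices" "de x \<subseteq> de y" by (rule index_catE)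
    then have i: "incl (sub (de x)) (sub (de y)) \<in> functors (sub (de x)) (sub (de y))"
      using incl_sub indices by blast
    then show "far diag p \<in> Mor CAT" "Dom (und CAT) (far diag p) = fob diag (Dom index_cat p)"
      "Cod (und CAT) (far diag p) = fob diag (Cod index_cat p)"
      using p functorsD[OF i] category_sub indices by (simp_all add: CAT_def)
  next
    fix x assume x: "x \<in> Obj index_cat"
    then show "fob diag x \<in> Ob CAT" using category_sub indices by (simp add: CAT_def)
    show "far diag (Ide index_cat x) = Ide (und CAT) (fob diag x)"
      using x by (simp add: CAT_def) (simp add: incl_def id_func_def)
  next
    fix f g assume fg: "f \<in> Arr index_cat" "g \<in> Arr index_cat" "Dom index_cat g = Cod index_cat f"
    obtain x y where f: "f = pr (x, y)" "x \<in> indices" "y \<in> indices" "de x \<subseteq> de y" using fg(1) by (rule index_catE)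
    obtain y' z where g: "g = pr (y', z)" "y' \<in> indices" "z \<in> indices" "de y' \<subseteq> de z" using fg(2) by (rule index_catE)
    have y: "y' = y" using fg(3) f g by simp
    have "comp_func (incl (sub (de y)) (sub (de z))) (incl (sub (de x)) (sub (de y))) = incl (sub (de x)) (sub (de z))"
      using sub_mono[OF f(4)] by (auto simp: comp_func_def incl_def intro!: ext)
    then show "far diag (Comp index_cat g f) = Comp (und CAT) (far diag g) (far diag f)"
      using f g y by (auto simp: CAT_def)
  qed (simp_all add: diag_def)
  then show ?thesis by (rule functorsD(1))
qed

sublocale filtered_diagram index_cat diag
  by unfold_locales (use filtered_index_cat diag_functor in simp_all)

definition inclusions :: "'u \<Rightarrow> ('u, 'u, 'u, 'u) func" where "inclusions x = incl (sub (de x)) A"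

text \<open>Each arrow and each composable pair lies in the subcategory generated by a finite set,
  so a cocone prescribes a functor on \<open>A\<close> piece by piece, and there is no freedom in
  it.\<close>

lemma inclusions_colimit: "colimit_cocone diag A inclusions"
  unfolding colimit_cocone_def
proof (intro conjI allI impI)
  have s: "sub (de x) = fob diag x" if "x \<in> indices" for x using that by simp
  show "cocone diag A inclusions"
    unfolding cocone_iff
  proof (intro conjI ballI A)
    show "inclusions j \<in> functors (fob diag j) A" if "j \<in> Obj index_cat" for j
      using that incl_sub_A indices by (simp add: inclusions_def)
    fix p assume "p \<in> Arr index_cat"
    then obtain x y where p: "p = pr (x, y)" "x \<in> indices" "y \<in> indices" "de x \<subseteq> de y" by (rule index_catE)
    show "comp_func (inclusions (Cod index_cat p)) (far diag p) = inclusions (Dom index_cat p)"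
      using p sub_mono[OF p(4)] by (auto simp: inclusions_def comp_func_def incl_def intro!: ext)
  qed
next
  fix B \<mu> assume co: "cocone diag B \<mu>"
  have B: "category B" and m: "\<And>x. x \<in> indices \<Longrightarrow> \<mu> x \<in> functors (sub (de x)) B"
    and mp: "\<And>p. p \<in> Arr index_cat \<Longrightarrow> comp_func (\<mu> (Cod index_cat p)) (far diag p) = \<mu> (Dom index_cat p)"
    using co by (auto simp: cocone_iff)
  \<comment> \<open>The values prescribed at two finite sets are compared through their
    union.\<close>
  have mm: "fob (\<mu> (e G)) x = fob (\<mu> (e H)) x" "far (\<mu> (e G)) f = far (\<mu> (e H)) f"
    if G: "finite G" "finite H" "G \<subseteq> Arr A" "H \<subseteq> Arr A" and x: "x \<in> obs G" "x \<in> obs H"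
      and f: "f \<in> Arr (sub G)" "f \<in> Arr (sub H)" for G H x f
  proof -
    have k: "fob (\<mu> (e G)) x = fob (\<mu> (e (G \<union> H))) x \<and> far (\<mu> (e G)) f = far (\<mu> (e (G \<union> H))) f"
      if G: "finite G" "finite H" "G \<subseteq> Arr A" "H \<subseteq> Arr A" and x: "x \<in> obs G" and f: "f \<in> Arr (sub G)" for G H
    proof -
      have i: "e G \<in> indices" "e (G \<union> H) \<in> indices" "de (e G) = G" "de (e (G \<union> H)) = G \<union> H"
        using G by (simp_all add: e_indices de_e)
      then have "comp_func (\<mu> (e (G \<union> H))) (incl (sub G) (sub (G \<union> H))) = \<mu> (e G)"
        using mp[of "pr (e G, e (G \<union> H))"] by simp
      then show ?thesis using x f comp_func_sel(3)[of x "incl (sub G) (sub (G \<union> H))" "\<mu> (e (G \<union> H))"]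
        comp_func_sel(4)[of f "incl (sub G) (sub (G \<union> H))" "\<mu> (e (G \<union> H))"] by simp
    qed
    show "fob (\<mu> (e G)) x = fob (\<mu> (e H)) x" "far (\<mu> (e G)) f = far (\<mu> (e H)) f"
      using k[OF G x(1) f(1)] k[OF G(2,1,4,3) x(2) f(2)] by (simp_all add: Un_commute)
  qed
  have sing: "f \<in> Arr A \<Longrightarrow> f \<in> Arr (sub {f})" for f by (rule sub_closed(1)) simp
  have obs1: "x \<in> Obj A \<Longrightarrow> x \<in> obs {Ide A x}" for x using A by (simp add: obs_def)
  \<comment> \<open>The smallest piece that contains the argument is used: an arrow is generated by
    itself, and an object is an endpoint of its identity. By \<open>mm\<close>, every larger piece
    gives the same value.\<close>
  define h where "h = \<lparr>fdom = A, fcod = B, fob = (\<lambda>x\<in>Obj A. fob (\<mu> (e {Ide A x})) x), far = (\<lambda>f\<in>Arr A. far (\<mu> (e {f})) f)\<rparr>"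
  have h1: "far h f = far (\<mu> (e G)) f" if "finite G" "G \<subseteq> Arr A" "f \<in> Arr (sub G)" for G f
    using that mm(2)[of "{f}" G "Dom A f" f] sub_Arr[OF that(2,3)] sing[of f] by (simp add: h_def obs_def)
  have h0: "fob h x = fob (\<mu> (e G)) x" if "finite G" "G \<subseteq> Arr A" "x \<in> obs G" for G x
    using that mm(1)[of "{Ide A x}" G x "Ide A x"] obs_Obj[OF that(2,3)] obs1[of x] sub_closed(2)[OF that(3)]
      sing[of "Ide A x"] A by (simp add: h_def)
  have mG: "\<mu> (e G) \<in> functors (sub G) B" if "finite G" "G \<subseteq> Arr A" for G
    using m[of "e G"] e_indices[OF that] de_e[OF that(1)] by simp
  have hf: "h \<in> functors A B"
  proof (rule functorsI)
    fix f assume f: "f \<in> Arr A"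
    have G: "finite {f}" "{f} \<subseteq> Arr A" and fs: "f \<in> Arr (sub {f})" using f sing by auto
    have o: "Dom A f \<in> obs {f}" "Cod A f \<in> obs {f}" by (auto simp: obs_def)
    show "far h f \<in> Arr B" "Dom B (far h f) = fob h (Dom A f)" "Cod B (far h f) = fob h (Cod A f)"
      using functorsD'[OF mG[OF G]] fs h1[OF G fs] h0[OF G o(1)] h0[OF G o(2)] by simp_all
  next
    fix x assume x: "x \<in> Obj A"
    have G: "finite {Ide A x}" "{Ide A x} \<subseteq> Arr A" using x A by auto
    have o: "x \<in> obs {Ide A x}" using obs1[OF x] .
    show "fob h x \<in> Obj B" "far h (Ide A x) = Ide B (fob h x)"
      using functorsD'[OF mG[OF G]] o h1[OF G sub_closed(2)[OF o]] h0[OF G o] by simp_all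
  next
    fix f g assume fg: "f \<in> Arr A" "g \<in> Arr A" "Dom A g = Cod A f"
    have G: "finite {f, g}" "{f, g} \<subseteq> Arr A" using fg by auto
    have s: "f \<in> Arr (sub {f, g})" "g \<in> Arr (sub {f, g})" by (auto intro: sub_closed(1))
    show "far h (Comp A g f) = Comp B (far h g) (far h f)"
      using functorsD'(6)[OF mG[OF G]] s fg(3) h1[OF G s(1)] h1[OF G s(2)] h1[OF G sub_closed(3)[OF s fg(3)]] by simp
  qed (simp_all add: h_def)
  have hc: "comp_func h (inclusions j) = \<mu> j" if j: "j \<in> indices" for j
  proof -
    have G: "finite (de j)" "de j \<subseteq> Arr A" and ej: "e (de j) = j" using indices[OF j] by auto
    show ?thesis
      by (rule functors_eqI[OF comp_functors[OF category_sub[OF G(2)] incl_sub_A[OF G(2)] hf] m[OF j], folded inclusions_def])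
        (use h0[OF G] h1[OF G] ej in \<open>simp_all add: inclusions_def\<close>)
  qed
  have inH: "k \<in> hom (fcod diag) A B \<longleftrightarrow> k \<in> functors A B" for k
    using hom_CAT[OF A B] by simp
  have CC: "Comp (fcod diag) = comp_func" by (simp add: CAT_def)
  show "\<exists>!h. h \<in> hom (fcod diag) A B \<and> (\<forall>j\<in>Obj (fdom diag). Comp (fcod diag) h (inclusions j) = \<mu> j)"
    unfolding inH CC
  proof (rule ex1I[of _ h])
    show "h \<in> functors A B \<and> (\<forall>j\<in>Obj (fdom diag). comp_func h (inclusions j) = \<mu> j)"
      using hf hc by simp
    fix k assume k: "k \<in> functors A B \<and> (\<forall>j\<in>Obj (fdom diag). comp_func k (inclusions j) = \<mu> j)"
    show "k = h"
    proof (rule functors_eqI_arr[OF A B _ hf])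
      fix f assume f: "f \<in> Arr A"
      have i: "e {f} \<in> indices" "de (e {f}) = {f}" using f by (simp_all add: e_indices de_e)
      have c: "comp_func k (inclusions (e {f})) = \<mu> (e {f})" using k i(1) by simp
      show "far k f = far h f"
        using comp_func_sel(4)[of f "inclusions (e {f})" k, unfolded c] sing[OF f] f i(2)
        by (simp add: h_def inclusions_def)
    qed (use k in simp)
  qed
qed

text \<open>The identity of \<open>A\<close> factors through the inclusion of one of the finitely
  generated subcategories, which therefore contains every object and every arrow.\<close>

lemma factors_finitely_generated:
  assumes "factors_through_stages A"
  shows "finitely_generated A"
proof -
  obtain j F where j: "j \<in> indices" "F \<in> functors A (sub (de j))" "comp_func (inclusions j) F = id_func A"
    using assms inclusions_colimit filtered_diagram_axioms id_functors[OF A]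
    unfolding factors_through_stages_def by fastforce
  have G: "finite (de j)" "de j \<subseteq> Arr A" using indices[OF j(1)] by auto
  note F = functorsD'[OF j(2)]
  have "f \<in> Arr (sub (de j))" if f: "f \<in> Arr A" for f
  proof -
    have "far (inclusions j) (far F f) = f"
      using comp_func_sel(4)[of f F "inclusions j"] functorsD(2)[OF j(2)] f unfolding j(3) by simp
    then show ?thesis using F(2)[OF f] by (simp add: inclusions_def)
  qed
  moreover have "Arr (sub (de j)) \<subseteq> generated A (de j)"
  proof
    fix f assume "f \<in> Arr (sub (de j))"
    then have "f \<in> generated (A\<lparr>Obj := obs (de j)\<rparr>) (de j)" by (simp add: sub_def)
    then show "f \<in> generated A (de j)"
      by induction (use obs_Obj[OF G(2)] in \<open>auto intro: generated.intros\<close>)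
  qed
  moreover have "Obj A \<subseteq> obs (de j)"
  proof
    fix x assume x: "x \<in> Obj A"
    have "fob (inclusions j) (fob F x) = x"
      using comp_func_sel(3)[of x F "inclusions j"] functorsD(2)[OF j(2)] x unfolding j(3) by simp
    then show "x \<in> obs (de j)" using F(1)[OF x] by (simp add: inclusions_def)
  qed
  ultimately show ?thesis
    unfolding finitely_generated_def using G by (auto simp: obs_def intro: finite_subset)
qed

end

text \<open>Splits preservation of filtered colimits into two conditions, in the form in which they
  are verified for terminal categories and for products.\<close>

lemma finitely_presentable_iff:
  fixes X :: "('u::infinite, 'u) cat"
  shows "finitely_presentable X \<longleftrightarrow> category X \<and> finitely_generated X \<and> factors_through_stages X"
proof
  assume fp: "finitely_presentable X"
  then have X: "category X" by (simp add: finitely_presentable_def)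
  obtain e :: "'u set \<Rightarrow> 'u" where e: "inj_on e {G. finite G}" using ex_inj_finite_sets by blast
  obtain pr :: "'u \<times> 'u \<Rightarrow> 'u" where pr: "inj pr" using ex_inj_pair by blast
  interpret finite_subcategories X e pr using X e pr by unfold_locales
  show "category X \<and> finitely_generated X \<and> factors_through_stages X"
    using X finitely_presentable_factors[OF fp] factors_finitely_generated by blast
qed (use finitely_presentableI in blast)

section \<open>Finite presentability of terminal categories and binary products\<close>

lemma point_functors:
  assumes "category I" "category X" "x \<in> Obj X"
  shows "point I X x \<in> functors I X"
  by (rule functorsI) (use assms in \<open>simp_all add: point_def\<close>)

lemma point_sel [simp]:
  "fdom (point I X x) = I" "fcod (point I X x) = X"
  "i \<in> Obj I \<Longrightarrow> fob (point I X x) i = x" "f \<in> Arr I \<Longrightarrow> far (point I X x) f = Ide X x"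
  by (simp_all add: point_def)

lemma terminal_categoryE:
  assumes "terminal_category I"
  obtains i where "category I" "Obj I = {i}" "Arr I = {Ide I i}"
proof -
  obtain x f where I: "category I" "Obj I = {x}" "Arr I = {f}"
    using assms unfolding terminal_category_def by blast
  have "Ide I x \<in> Arr I" using I(1,2) by simp
  then show thesis using that I by simp
qed

text \<open>A functor out of a terminal category is an object of the colimit, and objects come from
  stages because their identities do.\<close>

lemma terminal_finitely_presentable:
  fixes I :: "('u::infinite, 'u) cat"
  assumes "terminal_category I"
  shows "finitely_presentable I"
proof -
  obtain i where I: "category I" "Obj I = {i}" "Arr I = {Ide I i}" by (rule terminal_categoryE[OF assms])
  have "finitely_generated I"
    unfolding finitely_generated_def using I by (auto intro!: exI[of _ "{Ide I i}"] generated.intros)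
  moreover have "factors_through_stages I"
    unfolding factors_through_stages_def
  proof (intro allI impI ballI)
    fix J and D :: "('u, 'u, ('u, 'u) cat, ('u, 'u, 'u, 'u) func) func" and L \<gamma> F
    assume "filtered_diagram J D" and c: "colimit_cocone D L \<gamma>" and F: "F \<in> functors I L"
    interpret filtered_diagram J D by fact
    have L: "category L" and g: "\<And>j. j \<in> Obj J \<Longrightarrow> \<gamma> j \<in> functors (fob D j) L"
      using colimit_cocone_cocone[OF c] by (auto simp: cocone_iff)
    have y: "fob F i \<in> Obj L" using functorsD'(1)[OF F] I by simp
    obtain j a where j: "j \<in> Obj J" "a \<in> Arr (fob D j)" "far (\<gamma> j) a = Ide L (fob F i)"
      using colimit_surj[OF c, of "Ide L (fob F i)"] L y by auto
    \<comment> \<open>An arrow that is mapped to an identity need not be an identity itself, so its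
      domain is taken as the object at stage \<open>j\<close>.\<close>
    let ?z = "Dom (fob D j) a"
    have z: "?z \<in> Obj (fob D j)" "fob (\<gamma> j) ?z = fob F i"
      using j functorsD'(3)[OF g[OF j(1)] j(2)] L y by simp_all
    have p: "point I (fob D j) ?z \<in> functors I (fob D j)"
      by (rule point_functors) (use I j z in simp_all)
    have "comp_func (\<gamma> j) (point I (fob D j) ?z) = F"
      by (rule functors_eqI_arr[OF I(1) L comp_functors[OF I(1) p g[OF j(1)]] F])
        (use I z functorsD'(5)[OF g[OF j(1)]] functorsD'(5)[OF F] in simp)
    then show "\<exists>j\<in>Obj J. \<exists>F'\<in>functors I (fob D j). comp_func (\<gamma> j) F' = F"
      using j(1) p by blast
  qed
  ultimately show ?thesis using I by (simp add: finitely_presentable_iff)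
qed

text \<open>Brings the two middle factors of a fourfold composite together, so that they can be
  exchanged.\<close>

lemma category_assoc4:
  assumes B: "category B" and "p \<in> Arr B" "q \<in> Arr B" "r \<in> Arr B" "s \<in> Arr B"
    "Dom B r = Cod B s" "Dom B q = Cod B r" "Dom B p = Cod B q"
  shows "Comp B (Comp B p q) (Comp B r s) = Comp B p (Comp B (Comp B q r) s)"
  using assms by (simp add: category_assoc[OF B])

text \<open>Commuting squares can be pasted in each variable, so commutation on generators spreads
  to all pairs of arrows. A pair is then sent to one of the two equal composites round its square,
  and functoriality is a single exchange of middle factors.\<close>

lemma product_functor_from_slices:
  assumes Q: "product_of X A Q k0 k1" and X: "category X" and A: "category A" and B: "category B"
    and S: "S \<subseteq> Arr X" "Arr X \<subseteq> generated X S" and T: "T \<subseteq> Arr A" "Arr A \<subseteq> generated A T"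
    and G: "\<And>a. a \<in> Obj A \<Longrightarrow> G a \<in> functors X B" and K: "\<And>x. x \<in> Obj X \<Longrightarrow> K x \<in> functors A B"
    and o: "\<And>x a. x \<in> Obj X \<Longrightarrow> a \<in> Obj A \<Longrightarrow> fob (G a) x = fob (K x) a"
    and sq: "\<And>u v. u \<in> S \<Longrightarrow> v \<in> T \<Longrightarrow> Comp B (far (G (Cod A v)) u) (far (K (Dom X u)) v) =
       Comp B (far (K (Cod X u)) v) (far (G (Dom A v)) u)"
  shows "\<exists>H\<in>functors Q B. (\<forall>u\<in>Arr X. \<forall>v\<in>Arr A. far H (k1 u v) = Comp B (far (G (Cod A v)) u) (far (K (Dom X u)) v))"
proof -
  note g = functorsD'[OF G] and k = functorsD'[OF K]
  let ?sq = "\<lambda>u v. Comp B (far (G (Cod A v)) u) (far (K (Dom X u)) v) = Comp B (far (K (Cod X u)) v) (far (G (Dom A v)) u)"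
  have 1: "?sq u v" if v: "v \<in> T" and u: "u \<in> Arr X" for u v
  proof -
    have v': "v \<in> Arr A" using v T by blast
    have "u \<in> Arr X \<and> ?sq u v"
    proof (rule generated_induct[OF X S(1)])
      show "u \<in> generated X S" using u S by blast
      show "s \<in> S \<Longrightarrow> ?sq s v" for s using sq v by blast
      show "x \<in> Obj X \<Longrightarrow> ?sq (Ide X x) v" for x
        using v' X A B by (simp add: g k o)
      fix r s assume rs: "r \<in> Arr X" "s \<in> Arr X" "Dom X s = Cod X r" "?sq r v" "?sq s v"
      let ?a = "Dom A v" and ?b = "Cod A v" and ?x = "Dom X r" and ?y = "Cod X r" and ?z = "Cod X s"
      have "Comp B (far (G ?b) (Comp X s r)) (far (K ?x) v) = Comp B (far (G ?b) s) (Comp B (far (G ?b) r) (far (K ?x) v))"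
        using rs(1-3) v' X A by (simp add: g k o category_assoc[OF B])
      also have "\<dots> = Comp B (far (G ?b) s) (Comp B (far (K ?y) v) (far (G ?a) r))"
        using rs(4) by simp
      also have "\<dots> = Comp B (Comp B (far (G ?b) s) (far (K ?y) v)) (far (G ?a) r)"
        using rs(1-3) v' X A by (simp add: g k o category_assoc[OF B])
      also have "\<dots> = Comp B (Comp B (far (K ?z) v) (far (G ?a) s)) (far (G ?a) r)"
        using rs(3,5) by simp
      also have "\<dots> = Comp B (far (K ?z) v) (far (G ?a) (Comp X s r))"
        using rs(1-3) v' X A by (simp add: g k o category_assoc[OF B])
      finally show "?sq (Comp X s r) v" using rs(1-3) X by simp
    qed
    then show ?thesis ..
  qed
  \<comment> \<open>The second induction runs over \<open>v\<close> and may use arbitrary arrows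
    \<open>u\<close>, since the first one has left the generators in that variable.\<close>
  have 2: "?sq u v" if u: "u \<in> Arr X" and v: "v \<in> Arr A" for u v
  proof -
    have "v \<in> Arr A \<and> ?sq u v"
    proof (rule generated_induct[OF A T(1)])
      show "v \<in> generated A T" using v T by blast
      show "s \<in> T \<Longrightarrow> ?sq u s" for s using 1 u by blast
      show "x \<in> Obj A \<Longrightarrow> ?sq u (Ide A x)" for x
        using u X A B by (simp add: g k o[symmetric])
      fix r s assume rs: "r \<in> Arr A" "s \<in> Arr A" "Dom A s = Cod A r" "?sq u r" "?sq u s"
      let ?x = "Dom X u" and ?y = "Cod X u" and ?a = "Dom A r" and ?b = "Cod A r" and ?c = "Cod A s"
      have "Comp B (far (G ?c) u) (far (K ?x) (Comp A s r)) = Comp B (Comp B (far (G ?c) u) (far (K ?x) s)) (far (K ?x) r)"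
        using rs(1-3) u X A by (simp add: g k o category_assoc[OF B])
      also have "\<dots> = Comp B (Comp B (far (K ?y) s) (far (G ?b) u)) (far (K ?x) r)"
        using rs(3,5) by simp
      also have "\<dots> = Comp B (far (K ?y) s) (Comp B (far (G ?b) u) (far (K ?x) r))"
        using rs(1-3) u X A by (simp add: g k o category_assoc[OF B])
      also have "\<dots> = Comp B (far (K ?y) s) (Comp B (far (K ?y) r) (far (G ?a) u))"
        using rs(4) by simp
      also have "\<dots> = Comp B (far (K ?y) (Comp A s r)) (far (G ?a) u)"
        using rs(1-3) u X A by (simp add: g k o category_assoc[OF B])
      finally show "?sq u (Comp A s r)" using rs(1-3) A by simp
    qed
    then show ?thesis ..
  qed
  have "\<exists>H\<in>functors Q B. (\<forall>x\<in>Obj X. \<forall>a\<in>Obj A. fob H (k0 x a) = fob (K x) a) \<and>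
     (\<forall>u\<in>Arr X. \<forall>v\<in>Arr A. far H (k1 u v) = Comp B (far (G (Cod A v)) u) (far (K (Dom X u)) v))"
  proof (rule product_functor_ex[OF Q X A])
    fix u v u' v' assume u: "u \<in> Arr X" "v \<in> Arr A" "u' \<in> Arr X" "v' \<in> Arr A" "Dom X u' = Cod X u" "Dom A v' = Cod A v"
    let ?c = "Cod A v'" and ?x = "Dom X u"
    have "Comp B (far (G ?c) (Comp X u' u)) (far (K ?x) (Comp A v' v)) =
        Comp B (Comp B (far (G ?c) u') (far (G ?c) u)) (Comp B (far (K ?x) v') (far (K ?x) v))"
      using u X A by (simp add: g k)
    also have "\<dots> = Comp B (far (G ?c) u') (Comp B (Comp B (far (G ?c) u) (far (K ?x) v')) (far (K ?x) v))"
      by (rule category_assoc4[OF B]) (use u X A in \<open>simp_all add: g k o\<close>)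
    also have "\<dots> = Comp B (far (G ?c) u') (Comp B (Comp B (far (K (Cod X u)) v') (far (G (Cod A v)) u)) (far (K ?x) v))"
      using 2[OF u(1,4)] u(6) by simp
    also have "\<dots> = Comp B (Comp B (far (G ?c) u') (far (K (Cod X u)) v')) (Comp B (far (G (Cod A v)) u) (far (K ?x) v))"
      by (rule category_assoc4[OF B, symmetric]) (use u X A in \<open>simp_all add: g k o\<close>)
    finally show "Comp B (far (G (Cod A (Comp A v' v))) (Comp X u' u)) (far (K (Dom X (Comp X u' u))) (Comp A v' v)) =
        Comp B (Comp B (far (G (Cod A v')) u') (far (K (Dom X u')) v')) (Comp B (far (G (Cod A v)) u) (far (K (Dom X u)) v))"
      using u X A by simp
  qed (use X A B in \<open>simp_all add: g k o\<close>)
  then show ?thesis by blast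
qed

lemma product_finitely_generated:
  assumes Q: "product_of X A Q k0 k1" and X: "category X" and A: "category A" and QC: "category Q"
    and fX: "finitely_generated X" and fA: "finitely_generated A"
  shows "finitely_generated Q"
proof -
  note q = product_ofD[OF Q]
  obtain S where S: "finite (Obj X)" "finite S" "S \<subseteq> Arr X" "Arr X \<subseteq> generated X S"
    using fX by (auto simp: finitely_generated_def)
  obtain T where T: "finite (Obj A)" "finite T" "T \<subseteq> Arr A" "Arr A \<subseteq> generated A T"
    using fA by (auto simp: finitely_generated_def)
  \<comment> \<open>Generators of one factor paired with identities of the other. This set is finite
    because both factors have finitely many objects; a general pair is the composite of one arrow of
    each kind.\<close>
  let ?R = "(\<lambda>(u, a). k1 u (Ide A a)) ` (S \<times> Obj A) \<union> (\<lambda>(x, v). k1 (Ide X x) v) ` (Obj X \<times> T)"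
  have 1: "k1 u (Ide A a) \<in> generated Q ?R" if "u \<in> Arr X" "a \<in> Obj A" for u a
  proof -
    have "u \<in> Arr X \<and> k1 u (Ide A a) \<in> generated Q ?R"
    proof (rule generated_induct[OF X S(3)])
      show "u \<in> generated X S" using that S by blast
      show "s \<in> S \<Longrightarrow> k1 s (Ide A a) \<in> generated Q ?R" for s
        using that by (intro generated.gen) auto
      show "x \<in> Obj X \<Longrightarrow> k1 (Ide X x) (Ide A a) \<in> generated Q ?R" for x
        using that q(5)[of x a] generated.ide[of "k0 x a" Q ?R] q(1) by simp
      fix r s assume rs: "r \<in> Arr X" "s \<in> Arr X" "Dom X s = Cod X r"
        "k1 r (Ide A a) \<in> generated Q ?R" "k1 s (Ide A a) \<in> generated Q ?R"
      show "k1 (Comp X s r) (Ide A a) \<in> generated Q ?R"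
        using generated.comp[OF rs(4,5)] rs(1-3) that(2) A q(3,4) q(6)[of r s "Ide A a" "Ide A a"] by simp
    qed
    then show ?thesis ..
  qed
  have 2: "k1 (Ide X x) v \<in> generated Q ?R" if "v \<in> Arr A" "x \<in> Obj X" for v x
  proof -
    have "v \<in> Arr A \<and> k1 (Ide X x) v \<in> generated Q ?R"
    proof (rule generated_induct[OF A T(3)])
      show "v \<in> generated A T" using that T by blast
      show "s \<in> T \<Longrightarrow> k1 (Ide X x) s \<in> generated Q ?R" for s
        using that by (intro generated.gen) auto
      show "a \<in> Obj A \<Longrightarrow> k1 (Ide X x) (Ide A a) \<in> generated Q ?R" for a
        using that q(5)[of x a] generated.ide[of "k0 x a" Q ?R] q(1) by simp
      fix r s assume rs: "r \<in> Arr A" "s \<in> Arr A" "Dom A s = Cod A r"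
        "k1 (Ide X x) r \<in> generated Q ?R" "k1 (Ide X x) s \<in> generated Q ?R"
      show "k1 (Ide X x) (Comp A s r) \<in> generated Q ?R"
        using generated.comp[OF rs(4,5)] rs(1-3) that(2) X q(3,4) q(6)[of "Ide X x" "Ide X x" r s] by simp
    qed
    then show ?thesis ..
  qed
  have "Arr Q \<subseteq> generated Q ?R"
  proof
    fix f assume "f \<in> Arr Q"
    then obtain u v where f: "u \<in> Arr X" "v \<in> Arr A" "f = k1 u v" using q(8) by blast
    have "f = Comp Q (k1 u (Ide A (Cod A v))) (k1 (Ide X (Dom X u)) v)"
      using f X A q(6)[of "Ide X (Dom X u)" u v "Ide A (Cod A v)"] by simp
    then show "f \<in> generated Q ?R"
      using generated.comp[OF 2[of v "Dom X u"] 1[of u "Cod A v"]] f X A q(3,4) by simp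
  qed
  moreover have "?R \<subseteq> Arr Q" using S T X A q(2) by auto
  moreover have "Obj Q \<subseteq> (\<lambda>(x, a). k0 x a) ` (Obj X \<times> Obj A)" using q(7) by fast
  ultimately show ?thesis
    unfolding finitely_generated_def using S T by (intro conjI exI[of _ ?R]) (auto intro: finite_subset)
qed

text \<open>The slices of \<open>F\<close> are finitely many functors on the factors, and each of
  them lifts to a stage. Lifts at a common stage need not fit together, but what is missing is a
  finite set of equations that hold in the colimit. Hence they hold at a later stage, where the
  slices can be reassembled.\<close>

lemma product_factors_through_stages:
  fixes X A Q :: "('u::infinite, 'u) cat"
  assumes Q: "product_of X A Q k0 k1" and X: "category X" and A: "category A" and QC: "category Q"
    and fX: "finitely_generated X" "factors_through_stages X" and fA: "finitely_generated A" "factors_through_stages A"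
  shows "factors_through_stages Q"
  unfolding factors_through_stages_def
proof (intro allI impI ballI)
  fix J and D :: "('u, 'u, ('u, 'u) cat, ('u, 'u, 'u, 'u) func) func" and L \<gamma> F
  assume "filtered_diagram J D" and c: "colimit_cocone D L \<gamma>" and F: "F \<in> functors Q L"
  interpret filtered_diagram J D by fact
  note q = product_ofD[OF Q] and f = functorsD'[OF F]
  have co: "cocone D L \<gamma>" by (rule colimit_cocone_cocone[OF c])
  have L: "category L" and g: "\<And>j. j \<in> Obj J \<Longrightarrow> \<gamma> j \<in> functors (fob D j) L"
    and gp: "\<And>p. p \<in> Arr J \<Longrightarrow> comp_func (\<gamma> (Cod J p)) (far D p) = \<gamma> (Dom J p)"
    using co by (auto simp: cocone_iff)
  obtain S where S: "finite (Obj X)" "finite S" "S \<subseteq> Arr X" "Arr X \<subseteq> generated X S"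
    using fX by (auto simp: finitely_generated_def)
  obtain T where T: "finite (Obj A)" "finite T" "T \<subseteq> Arr A" "Arr A \<subseteq> generated A T"
    using fA by (auto simp: finitely_generated_def)
  \<comment> \<open>The slice of \<open>F\<close> with the second variable fixed at the object
    \<open>a\<close>, that is, at the arrow \<open>Ide A a\<close>; \<open>sA\<close> is the other
    slice.\<close>
  define sX where "sX a = \<lparr>fdom = X, fcod = L, fob = (\<lambda>x\<in>Obj X. fob F (k0 x a)), far = (\<lambda>u\<in>Arr X. far F (k1 u (Ide A a)))\<rparr>" for a
  define sA where "sA x = \<lparr>fdom = A, fcod = L, fob = (\<lambda>a\<in>Obj A. fob F (k0 x a)), far = (\<lambda>v\<in>Arr A. far F (k1 (Ide X x) v))\<rparr>" for x
  have sX: "sX a \<in> functors X L" if a: "a \<in> Obj A" for a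
  proof (rule functorsI)
    fix r s assume rs: "r \<in> Arr X" "s \<in> Arr X" "Dom X s = Cod X r"
    show "far (sX a) (Comp X s r) = Comp L (far (sX a) s) (far (sX a) r)"
      using rs a X A q(6)[of r s "Ide A a" "Ide A a"] f(6)[of "k1 r (Ide A a)" "k1 s (Ide A a)"] q(2-4) by (simp add: sX_def)
  qed (use a X A q(1-5) f(1-5) q(5)[symmetric] in \<open>simp_all add: sX_def\<close>)
  have sA: "sA x \<in> functors A L" if x: "x \<in> Obj X" for x
  proof (rule functorsI)
    fix r s assume rs: "r \<in> Arr A" "s \<in> Arr A" "Dom A s = Cod A r"
    show "far (sA x) (Comp A s r) = Comp L (far (sA x) s) (far (sA x) r)"
      using rs x X A q(6)[of "Ide X x" "Ide X x" r s] f(6)[of "k1 (Ide X x) r" "k1 (Ide X x) s"] q(2-4) by (simp add: sA_def)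
  qed (use x X A q(1-5) f(1-5) q(5)[symmetric] in \<open>simp_all add: sA_def\<close>)
  \<comment> \<open>Says that \<open>G\<close> and \<open>K\<close> lift all slices to index
    \<open>m\<close>. The property is stable under transition maps, which allows the stage to be
    advanced once for each of the two kinds of equations.\<close>
  define stage where "stage m G K \<longleftrightarrow> m \<in> Obj J \<and>
      (\<forall>a\<in>Obj A. G a \<in> functors X (fob D m) \<and> comp_func (\<gamma> m) (G a) = sX a) \<and>
      (\<forall>x\<in>Obj X. K x \<in> functors A (fob D m) \<and> comp_func (\<gamma> m) (K x) = sA x)" for m G K
  have move: "comp_func (far D r) H \<in> functors Z (fob D (Cod J r)) \<and> comp_func (\<gamma> (Cod J r)) (comp_func (far D r) H) = comp_func (\<gamma> (Dom J r)) H"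
    if "category Z" "r \<in> Arr J" "H \<in> functors Z (fob D (Dom J r))" for Z :: "('u, 'u) cat" and r H
    using comp_functors[OF that(1,3) D_functors[OF that(2)]] gp[OF that(2)]
      comp_func_assoc[OF that(1,3) D_functors[OF that(2)] g[of "Cod J r"]] that(2) by simp
  have push: "stage (Cod J r) (\<lambda>a. comp_func (far D r) (G a)) (\<lambda>x. comp_func (far D r) (K x))"
    if "stage (Dom J r) G K" "r \<in> Arr J" for r G K
    using that move[OF X that(2)] move[OF A that(2)] unfolding stage_def by simp
  have "\<exists>j\<in>Obj J. \<exists>F'\<in>functors X (fob D j). comp_func (\<gamma> j) F' = sX a" if "a \<in> Obj A" for a
    using fX(2) sX[OF that] c filtered_diagram_axioms unfolding factors_through_stages_def by blast
  then obtain jX FX where jX: "\<And>a. a \<in> Obj A \<Longrightarrow> jX a \<in> Obj J" "\<And>a. a \<in> Obj A \<Longrightarrow> FX a \<in> functors X (fob D (jX a))"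
    "\<And>a. a \<in> Obj A \<Longrightarrow> comp_func (\<gamma> (jX a)) (FX a) = sX a" by metis
  have "\<exists>j\<in>Obj J. \<exists>F'\<in>functors A (fob D j). comp_func (\<gamma> j) F' = sA x" if "x \<in> Obj X" for x
    using fA(2) sA[OF that] c filtered_diagram_axioms unfolding factors_through_stages_def by blast
  then obtain jA FA where jA: "\<And>a. a \<in> Obj X \<Longrightarrow> jA a \<in> Obj J" "\<And>a. a \<in> Obj X \<Longrightarrow> FA a \<in> functors A (fob D (jA a))"
    "\<And>a. a \<in> Obj X \<Longrightarrow> comp_func (\<gamma> (jA a)) (FA a) = sA a" by metis
  \<comment> \<open>The objects of the two factors are put into a disjoint sum, so that one upper
    bound serves both families of lifts.\<close>
  have "\<exists>m\<in>Obj J. \<forall>n\<in>Inl ` Obj A \<union> Inr ` Obj X. \<exists>p\<in>Arr J. Dom J p = case_sum jX jA n \<and> Cod J p = m"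
    by (rule upper_bound_finite) (use S T jX jA in auto)
  then obtain m where m: "m \<in> Obj J" "\<And>a. a \<in> Obj A \<Longrightarrow> \<exists>p\<in>Arr J. Dom J p = jX a \<and> Cod J p = m"
    "\<And>x. x \<in> Obj X \<Longrightarrow> \<exists>p\<in>Arr J. Dom J p = jA x \<and> Cod J p = m" by (auto simp: ball_Un)
  obtain pX where pX: "\<And>a. a \<in> Obj A \<Longrightarrow> pX a \<in> Arr J" "\<And>a. a \<in> Obj A \<Longrightarrow> Dom J (pX a) = jX a" "\<And>a. a \<in> Obj A \<Longrightarrow> Cod J (pX a) = m"
    using m(2) by metis
  obtain pA where pA: "\<And>a. a \<in> Obj X \<Longrightarrow> pA a \<in> Arr J" "\<And>a. a \<in> Obj X \<Longrightarrow> Dom J (pA a) = jA a" "\<And>a. a \<in> Obj X \<Longrightarrow> Cod J (pA a) = m"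
    using m(3) by metis
  define G where "G a = comp_func (far D (pX a)) (FX a)" for a
  define K where "K x = comp_func (far D (pA x)) (FA x)" for x
  have st: "stage m G K"
    unfolding stage_def
  proof (intro conjI ballI)
    fix a assume a: "a \<in> Obj A"
    show "G a \<in> functors X (fob D m)" "comp_func (\<gamma> m) (G a) = sX a"
      using move[OF X pX(1)[OF a], of "FX a"] jX[OF a] pX[OF a] by (simp_all add: G_def)
  next
    fix x assume x: "x \<in> Obj X"
    show "K x \<in> functors A (fob D m)" "comp_func (\<gamma> m) (K x) = sA x"
      using move[OF A pA(1)[OF x], of "FA x"] jA[OF x] pA[OF x] by (simp_all add: K_def)
  qed (rule m(1))
  have Dm: "category (fob D m)" using m(1) by simp
  have image: "stage m G K \<Longrightarrow> a \<in> Obj A \<Longrightarrow> u \<in> Arr X \<Longrightarrow> far (\<gamma> m) (far (G a) u) = far F (k1 u (Ide A a))"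
    "stage m G K \<Longrightarrow> x \<in> Obj X \<Longrightarrow> v \<in> Arr A \<Longrightarrow> far (\<gamma> m) (far (K x) v) = far F (k1 (Ide X x) v)" for m G K a u x v
    using comp_func_sel(4)[of u "G a" "\<gamma> m"] comp_func_sel(4)[of v "K x" "\<gamma> m"]
      functorsD(2)[of "G a" X "fob D m"] functorsD(2)[of "K x" A "fob D m"]
    unfolding stage_def by (simp_all add: sX_def sA_def)
  \<comment> \<open>The two lifted slices through \<open>k0 x a\<close> should have the same value
    there. The equation is expressed by identity arrows, because germs are compared as
    arrows.\<close>
  let ?R1 = "(\<lambda>(x, a). (far (G a) (Ide X x), far (K x) (Ide A a))) ` (Obj X \<times> Obj A)"
  have "\<exists>r\<in>Arr J. Dom J r = m \<and> (\<forall>(a, b)\<in>?R1. act r a = act r b)"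
  proof (rule equalize_finite[OF _ m(1)])
    show "finite ?R1" using S T by simp
    fix s t assume "(s, t) \<in> ?R1"
    then obtain x a where x: "x \<in> Obj X" "a \<in> Obj A" "s = far (G a) (Ide X x)" "t = far (K x) (Ide A a)" by auto
    have i: "Ide X x \<in> Arr X" "Ide A a \<in> Arr A" using x X A by simp_all
    have GK: "G a \<in> functors X (fob D m)" "K x \<in> functors A (fob D m)" using st x unfolding stage_def by simp_all
    have 1: "s \<in> Arr (fob D m)" "t \<in> Arr (fob D m)"
      using x i functorsD'(2)[OF GK(1)] functorsD'(2)[OF GK(2)] by simp_all
    have "far (\<gamma> m) s = far (\<gamma> m) t"
      using image(1)[OF st x(2) i(1)] image(2)[OF st x(1) i(2)] x by simp
    then show "s \<in> Arr (fob D m) \<and> t \<in> Arr (fob D m) \<and> eqv (m, s) (m, t)"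
      using 1 colimit_eqv[OF c m(1) _ m(1)] by blast
  qed
  then obtain r1 where r1: "r1 \<in> Arr J" "Dom J r1 = m"
    "\<And>x a. x \<in> Obj X \<Longrightarrow> a \<in> Obj A \<Longrightarrow> act r1 (far (G a) (Ide X x)) = act r1 (far (K x) (Ide A a))" by fast
  define n G1 K1 where "n = Cod J r1" and "G1 a = comp_func (far D r1) (G a)" and "K1 x = comp_func (far D r1) (K x)" for a x
  have n: "n \<in> Obj J" "category (fob D n)" using r1 by (simp_all add: n_def)
  have st1: "stage n G1 K1"
    using push[of r1 G K] st r1 by (simp add: n_def G1_def[abs_def] K1_def[abs_def])
  have G1: "\<And>a. a \<in> Obj A \<Longrightarrow> G1 a \<in> functors X (fob D n)" "\<And>x. x \<in> Obj X \<Longrightarrow> K1 x \<in> functors A (fob D n)"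
    using st1 by (auto simp: stage_def)
  note g1 = functorsD'[OF G1(1)] and k1' = functorsD'[OF G1(2)]
  have o1: "fob (G1 a) x = fob (K1 x) a" if "x \<in> Obj X" "a \<in> Obj A" for x a
  proof -
    have fd: "fdom (G a) = X" "fdom (K x) = A" using st that unfolding stage_def by (auto simp: functorsD)
    have "far (G1 a) (Ide X x) = far (K1 x) (Ide A a)"
      using r1(3)[OF that] that X A by (simp add: G1_def K1_def act_def fd)
    then have "Ide (fob D n) (fob (G1 a) x) = Ide (fob D n) (fob (K1 x) a)"
      using g1(5)[OF that(2,1)] k1'(5)[OF that] by simp
    then show ?thesis using g1(1)[OF that(2,1)] k1'(1)[OF that] n(2) by (metis categoryD(4))
  qed
  \<comment> \<open>With the objects matched, both composites round the square of two generators
    exist at stage \<open>n\<close>; these are the equations still to be enforced.\<close>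
  let ?R2 = "(\<lambda>(u, v). (Comp (fob D n) (far (G1 (Cod A v)) u) (far (K1 (Dom X u)) v),
      Comp (fob D n) (far (K1 (Cod X u)) v) (far (G1 (Dom A v)) u))) ` (S \<times> T)"
  have "\<exists>r\<in>Arr J. Dom J r = n \<and> (\<forall>(a, b)\<in>?R2. act r a = act r b)"
  proof (rule equalize_finite[OF _ n(1)])
    show "finite ?R2" using S T by simp
    fix s t assume "(s, t) \<in> ?R2"
    then obtain u v where u: "u \<in> Arr X" "v \<in> Arr A"
      "s = Comp (fob D n) (far (G1 (Cod A v)) u) (far (K1 (Dom X u)) v)"
      "t = Comp (fob D n) (far (K1 (Cod X u)) v) (far (G1 (Dom A v)) u)" using S(3) T(3) by auto
    have a: "s \<in> Arr (fob D n)" "t \<in> Arr (fob D n)"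
      using u X A n(2) by (simp_all add: g1 k1' o1)
    note gn = functorsD'(6)[OF g[OF n(1)]]
    have "far (\<gamma> n) s = Comp L (far F (k1 u (Ide A (Cod A v)))) (far F (k1 (Ide X (Dom X u)) v))"
      using u X A gn image[OF st1] by (simp add: g1 k1' o1)
    \<comment> \<open>In the product, \<open>k1 u v\<close> factors through the two sides of the
      square in either order, so both composites have the same image in \<open>L\<close>.\<close>
    also have "\<dots> = far F (k1 u v)"
      using u X A q(2-4) f(6)[of "k1 (Ide X (Dom X u)) v" "k1 u (Ide A (Cod A v))"]
        q(6)[of "Ide X (Dom X u)" u v "Ide A (Cod A v)"] by simp
    also have "\<dots> = Comp L (far F (k1 (Ide X (Cod X u)) v)) (far F (k1 u (Ide A (Dom A v))))"
      using u X A q(2-4) f(6)[of "k1 u (Ide A (Dom A v))" "k1 (Ide X (Cod X u)) v"]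
        q(6)[of u "Ide X (Cod X u)" "Ide A (Dom A v)" v] by simp
    also have "\<dots> = far (\<gamma> n) t"
      using u X A gn image[OF st1] by (simp add: g1 k1' o1)
    finally show "s \<in> Arr (fob D n) \<and> t \<in> Arr (fob D n) \<and> eqv (n, s) (n, t)"
      using a colimit_eqv[OF c n(1) _ n(1)] by blast
  qed
  then obtain r2 where r2: "r2 \<in> Arr J" "Dom J r2 = n"
    "\<And>u v. u \<in> S \<Longrightarrow> v \<in> T \<Longrightarrow> act r2 (Comp (fob D n) (far (G1 (Cod A v)) u) (far (K1 (Dom X u)) v)) =
       act r2 (Comp (fob D n) (far (K1 (Cod X u)) v) (far (G1 (Dom A v)) u))" by fast
  define l G2 K2 where "l = Cod J r2" and "G2 a = comp_func (far D r2) (G1 a)" and "K2 x = comp_func (far D r2) (K1 x)" for a x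
  have l: "l \<in> Obj J" "category (fob D l)" using r2 by (simp_all add: l_def)
  have st2: "stage l G2 K2"
    using push[of r2 G1 K1] st1 r2 by (simp add: l_def G2_def[abs_def] K2_def[abs_def])
  have G2: "\<And>a. a \<in> Obj A \<Longrightarrow> G2 a \<in> functors X (fob D l)" "\<And>x. x \<in> Obj X \<Longrightarrow> K2 x \<in> functors A (fob D l)"
    using st2 by (auto simp: stage_def)
  note fd = functorsD(2)[OF G1(1)] functorsD(2)[OF G1(2)]
  have o2: "fob (G2 a) x = fob (K2 x) a" if "x \<in> Obj X" "a \<in> Obj A" for x a
    using o1[OF that] that by (simp add: G2_def K2_def fd)
  have sq: "Comp (fob D l) (far (G2 (Cod A v)) u) (far (K2 (Dom X u)) v) = Comp (fob D l) (far (K2 (Cod X u)) v) (far (G2 (Dom A v)) u)"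
    if "u \<in> S" "v \<in> T" for u v
  proof -
    have uv: "u \<in> Arr X" "v \<in> Arr A" using that S T by auto
    show ?thesis
      using r2(3)[OF that] uv X A r2(1,2) n(2)
        act_Comp[of r2 "far (K1 (Dom X u)) v" "far (G1 (Cod A v)) u"] act_Comp[of r2 "far (G1 (Dom A v)) u" "far (K1 (Cod X u)) v"]
      by (simp add: l_def G2_def K2_def fd g1 k1' o1 act_def)
  qed
  obtain H where H: "H \<in> functors Q (fob D l)" "\<And>u v. u \<in> Arr X \<Longrightarrow> v \<in> Arr A \<Longrightarrow>
      far H (k1 u v) = Comp (fob D l) (far (G2 (Cod A v)) u) (far (K2 (Dom X u)) v)"
    using product_functor_from_slices[OF Q X A l(2) S(3,4) T(3,4) G2 o2 sq] by blast
  note g2 = functorsD'[OF G2(1)] and k2' = functorsD'[OF G2(2)]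
  have "comp_func (\<gamma> l) H = F"
  proof (rule functors_eqI_arr[OF QC L comp_functors[OF QC H(1) g[OF l(1)]] F])
    fix z assume z: "z \<in> Arr Q"
    then obtain u v where u: "u \<in> Arr X" "v \<in> Arr A" "z = k1 u v" using q(8) by blast
    have "far (\<gamma> l) (far H z) = Comp L (far F (k1 u (Ide A (Cod A v)))) (far F (k1 (Ide X (Dom X u)) v))"
      using u X A functorsD'(6)[OF g[OF l(1)]] image[OF st2] by (simp add: H g2 k2' o2)
    also have "\<dots> = far F z"
      using u X A q(2-4) f(6)[of "k1 (Ide X (Dom X u)) v" "k1 u (Ide A (Cod A v))"]
        q(6)[of "Ide X (Dom X u)" u v "Ide A (Cod A v)"] by simp
    finally show "far (comp_func (\<gamma> l) H) z = far F z" using z functorsD[OF H(1)] by simp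
  qed
  then show "\<exists>j\<in>Obj J. \<exists>F'\<in>functors Q (fob D j). comp_func (\<gamma> j) F' = F" using l(1) H(1) by blast
qed

section \<open>Powers in the opposite of FP\<close>

text \<open>Pairs of objects and pairs of arrows are coded by one injection into \<open>'u\<close>,
  which keeps the product a small category.\<close>

lemma product_category_ex:
  fixes X A :: "('u::infinite, 'u) cat"
  assumes X: "category X" and A: "category A"
  shows "\<exists>(Q :: ('u, 'u) cat) k0 k1. category Q \<and> product_of X A Q k0 k1"
proof -
  obtain p :: "'u \<times> 'u \<Rightarrow> 'u" where p: "inj p" using ex_inj_pair by blast
  note pe = inj_eq[OF p] inv_f_f[OF p]
  define Q where "Q = \<lparr>Obj = p ` (Obj X \<times> Obj A), Arr = p ` (Arr X \<times> Arr A),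
     Dom = (\<lambda>z. p (Dom X (fst (inv p z)), Dom A (snd (inv p z)))),
     Cod = (\<lambda>z. p (Cod X (fst (inv p z)), Cod A (snd (inv p z)))),
     Ide = (\<lambda>z. p (Ide X (fst (inv p z)), Ide A (snd (inv p z)))),
     Comp = (\<lambda>z z'. p (Comp X (fst (inv p z)) (fst (inv p z')), Comp A (snd (inv p z)) (snd (inv p z'))))\<rparr>"
  have "category Q"
    unfolding category_def using X A by (auto simp: Q_def pe category_assoc[OF X] category_assoc[OF A])
  moreover have "product_of X A Q (\<lambda>x a. p (x, a)) (\<lambda>u v. p (u, v))"
    unfolding product_of_def bij_betw_def by (auto simp: Q_def pe inj_on_def)
  ultimately show ?thesis by blast
qed

text \<open>The coordinate bijections are composed with the isomorphism. This allows the coded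
  product to be exchanged for its representative in a skeleton.\<close>

lemma product_of_iso:
  assumes Q: "product_of X A Q k0 k1" and X: "category X" and A: "category A"
    and F: "F \<in> functors Q R" "is_iso_func F"
  shows "product_of X A R (\<lambda>x a. fob F (k0 x a)) (\<lambda>u v. far F (k1 u v))"
proof -
  note q = product_ofD[OF Q] and f = functorsD'[OF F(1)]
  have b: "bij_betw (fob F \<circ> (\<lambda>(x, a). k0 x a)) (Obj X \<times> Obj A) (Obj R)"
    "bij_betw (far F \<circ> (\<lambda>(x, a). k1 x a)) (Arr X \<times> Arr A) (Arr R)"
    using Q is_iso_func_bij[OF F] by (auto simp: product_of_def intro: bij_betw_trans)
  have e: "fob F \<circ> (\<lambda>(x, a). k0 x a) = (\<lambda>(x, a). fob F (k0 x a))" "far F \<circ> (\<lambda>(x, a). k1 x a) = (\<lambda>(x, a). far F (k1 x a))"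
    by auto
  show ?thesis
    unfolding product_of_def
  proof (intro conjI ballI impI b[unfolded e])
    fix u u' v v' assume u: "u \<in> Arr X" "u' \<in> Arr X" "v \<in> Arr A" "v' \<in> Arr A" "Dom X u' = Cod X u" "Dom A v' = Cod A v"
    show "Comp R (far F (k1 u' v')) (far F (k1 u v)) = far F (k1 (Comp X u' u) (Comp A v' v))"
      using u q(6)[OF u] f(6)[of "k1 u v" "k1 u' v'"] q(2-4) by simp
  next
    fix x a assume "x \<in> Obj X" "a \<in> Obj A"
    then show "Ide R (fob F (k0 x a)) = far F (k1 (Ide X x) (Ide A a))"
      using f(5)[of "k0 x a"] q(1,5) by simp
  qed (simp_all add: f q)
qed

lemma finitely_presentable_category: "finitely_presentable X \<Longrightarrow> category X"
  by (simp add: finitely_presentable_def)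

section \<open>The skeleton of finitely presentable categories and its canonical powers\<close>

locale FP_setting =
  fixes FP :: "('u::infinite, 'u) cat set"
  assumes skeleton: "FP_skeleton FP"
begin

lemma FP_fp: "X \<in> FP \<Longrightarrow> finitely_presentable X"
  using skeleton by (simp add: FP_skeleton_def)

lemma FP_category: "X \<in> FP \<Longrightarrow> category X"
  using FP_fp finitely_presentable_category by blast

text \<open>The two conditions of \<open>finitely_presentable_iff\<close> hold for the coded
  product, which is then carried to its isomorphic copy in the skeleton.\<close>

lemma FP_product:
  fixes X A :: "('u, 'u) cat"
  assumes X: "finitely_presentable X" and A: "finitely_presentable A"
  obtains Q k0 k1 where "Q \<in> FP" "product_of X A Q k0 k1"
proof -
  note c = finitely_presentable_category[OF X] finitely_presentable_category[OF A]
  obtain Q :: "('u, 'u) cat" and k0 k1 where Q: "category Q" "product_of X A Q k0 k1"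
    using product_category_ex[OF c] by blast
  have "finitely_presentable Q"
    using X A product_finitely_generated[OF Q(2) c Q(1)] product_factors_through_stages[OF Q(2) c Q(1)] Q(1)
    unfolding finitely_presentable_iff by blast
  then obtain R where R: "R \<in> FP" "isomorphic_cat Q R" using skeleton unfolding FP_skeleton_def by blast
  then obtain F where "F \<in> functors Q R" "is_iso_func F" by (auto simp: isomorphic_cat_def)
  then show thesis using product_of_iso[OF Q(2) c] that R(1) by blast
qed

lemma terminal_iso:
  assumes I: "terminal_category I" and J: "terminal_category J"
  shows "isomorphic_cat I J"
proof -
  obtain i where i: "category I" "Obj I = {i}" "Arr I = {Ide I i}" by (rule terminal_categoryE[OF I])
  obtain j where j: "category J" "Obj J = {j}" "Arr J = {Ide J j}" by (rule terminal_categoryE[OF J])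
  have p: "point I J j \<in> functors I J" by (rule point_functors) (use i j in simp_all)
  have "is_iso_func (point I J j)"
    by (rule is_iso_funcI[OF i(1) p _ _ j(1)]) (use i j in \<open>simp_all add: bij_betw_def\<close>)
  then show ?thesis using p by (auto simp: isomorphic_cat_def)
qed

text \<open>Terminal categories are finitely presentable and isomorphic to each other, so a skeleton
  contains exactly one; this makes the definite description \<open>FP_one\<close>
  meaningful.\<close>

lemma FP_one: "FP_one FP \<in> FP" "terminal_category (FP_one FP)"
proof -
  define I :: "('u, 'u) cat" where "I = \<lparr>Obj = {undefined}, Arr = {undefined}, Dom = (\<lambda>_. undefined), Cod = (\<lambda>_. undefined),
     Ide = (\<lambda>_. undefined), Comp = (\<lambda>_ _. undefined)\<rparr>"
  have "category I" unfolding category_def by (simp add: I_def)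
  then have I: "terminal_category I" by (simp add: terminal_category_def I_def)
  then obtain Y where Y: "Y \<in> FP" "isomorphic_cat I Y" "\<And>Z. Z \<in> FP \<Longrightarrow> isomorphic_cat I Z \<Longrightarrow> Z = Y"
    using skeleton terminal_finitely_presentable[OF I] unfolding FP_skeleton_def by blast
  obtain F where F: "F \<in> functors I Y" "is_iso_func F" using Y(2) by (auto simp: isomorphic_cat_def)
  have "terminal_category Y"
    using is_iso_func_bij[OF F] FP_category[OF Y(1)] by (auto simp: terminal_category_def I_def bij_betw_def)
  then have "\<exists>!I. I \<in> FP \<and> terminal_category I"
    using Y terminal_iso[OF I] by blast
  from theI'[OF this] show "FP_one FP \<in> FP" "terminal_category (FP_one FP)"
    unfolding FP_one_def by auto
qed

abbreviation "one \<equiv> FP_one FP"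

definition pt :: 'u where "pt = (SOME i. Obj one = {i})"

lemma one: "category one" "Obj one = {pt}" "Arr one = {Ide one pt}"
proof -
  obtain i where i: "category one" "Obj one = {i}" "Arr one = {Ide one i}" by (rule terminal_categoryE[OF FP_one(2)])
  have "Obj one = {pt}" unfolding pt_def by (rule someI[of _ i]) (rule i(2))
  then show "category one" "Obj one = {pt}" "Arr one = {Ide one pt}" using i by auto
qed

lemma two_category_FP_op: "two_category (FP_op FP)"
  by (rule two_category_op) (rule two_category_Cat_on, rule FP_category)

lemma functor_one_eqI:
  assumes "F \<in> functors one Y" "G \<in> functors one Y" "fob F pt = fob G pt" "category Y"
  shows "F = G"
  by (rule functors_eqI[OF assms(1,2)]) (use assms(3) functorsD'(5)[OF assms(1)] functorsD'(5)[OF assms(2)] one in auto)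

lemma nattr_one_eqI:
  assumes "is_nattr \<eta>" "is_nattr \<theta>" "ndom \<eta> \<in> functors one Y" "ndom \<theta> = ndom \<eta>" "ncod \<theta> = ncod \<eta>" "ncmp \<eta> pt = ncmp \<theta> pt"
  shows "\<eta> = \<theta>"
  by (rule nattr_eqI[OF assms(1-5)]) (use assms(6) one in auto)

text \<open>The action on arrows of the isomorphism between \<open>X\<close> and the category of
  functors from \<open>one\<close> to \<open>X\<close>.\<close>

definition arrow_nattr :: "('u, 'u) cat \<Rightarrow> 'u \<Rightarrow> ('u, 'u, 'u, 'u) nattr" where
  "arrow_nattr X a = \<lparr>ndom = point one X (Dom X a), ncod = point one X (Cod X a), ncmp = (\<lambda>_\<in>Obj one. a)\<rparr>"

lemma arrow_nattr_sel [simp]: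
  "ndom (arrow_nattr X a) = point one X (Dom X a)" "ncod (arrow_nattr X a) = point one X (Cod X a)"
  "ncmp (arrow_nattr X a) pt = a"
  using one by (simp_all add: arrow_nattr_def)

lemma arrow_nattr:
  assumes X: "category X" and a: "a \<in> Arr X"
  shows "is_nattr (arrow_nattr X a)"
  by (rule is_nattrI[of _ one X]) (use assms one point_functors[OF one(1) X] in \<open>simp_all add: arrow_nattr_def\<close>)

lemma canonical_functor_sel:
  "fdom (canonical_functor FP X) = X" "fcod (canonical_functor FP X) = hom_cat (FP_op FP) X one"
  "x \<in> Obj X \<Longrightarrow> fob (canonical_functor FP X) x = point one X x"
  "a \<in> Arr X \<Longrightarrow> far (canonical_functor FP X) a = arrow_nattr X a"
  by (simp_all add: canonical_functor_def Let_def arrow_nattr_def)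

lemma canonical_functor_functors:
  assumes X: "X \<in> FP"
  shows "canonical_functor FP X \<in> functors X (hom_cat (FP_op FP) X one)"
proof -
  have XC: "category X" by (rule FP_category[OF X])
  note p = point_functors[OF one(1) XC]
  show ?thesis
  proof (rule hom_cat_functorI[OF two_category_FP_op XC])
    fix a b assume ab: "a \<in> Arr X" "b \<in> Arr X" "Dom X b = Cod X a"
    have "arrow_nattr X (Comp X b a) = vcomp_nattr (arrow_nattr X b) (arrow_nattr X a)"
      by (rule nattr_one_eqI[of _ _ X]) (use ab XC one p in \<open>auto intro!: arrow_nattr vcomp_nattr_is_nattr\<close>)
    then show "far (canonical_functor FP X) (Comp X b a) = Comp (vert (FP_op FP)) (far (canonical_functor FP X) b) (far (canonical_functor FP X) a)"
      using ab XC by (simp add: canonical_functor_sel)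
  next
    fix x assume x: "x \<in> Obj X"
    have "arrow_nattr X (Ide X x) = id_nattr (point one X x)"
      by (rule nattr_one_eqI[of _ _ X]) (use x XC one p in \<open>auto intro!: arrow_nattr id_nattr_is_nattr dest: functorsD\<close>)
    then show "far (canonical_functor FP X) (Ide X x) = Ide (vert (FP_op FP)) (fob (canonical_functor FP X) x)"
      using x XC by (simp add: canonical_functor_sel)
  qed (use X XC FP_one functorsD(1)[OF p] in \<open>auto simp: canonical_functor_sel arrow_nattr\<close>, auto simp: canonical_functor_def Let_def)
qed

text \<open>In the opposite of FP, a 1-cell from \<open>Y\<close> to \<open>X\<close> is a functor
  from \<open>X\<close> to \<open>Y\<close>, and a 1-cell from \<open>Y\<close> to
  \<open>one\<close> is an object of \<open>Y\<close>. Under these identifications the comparison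
  functor does nothing: each datum is recovered from its image by evaluation at
  \<open>pt\<close>.\<close>

lemma canonical_power:
  assumes X: "X \<in> FP"
  shows "is_power (FP_op FP) X one X (canonical_functor FP X)"
proof -
  let ?K = "FP_op FP" and ?c = "canonical_functor FP X"
  have XC: "category X" by (rule FP_category[OF X])
  note p = point_functors[OF one(1) XC] and c = canonical_functor_sel
  \<comment> \<open>Evaluation at \<open>pt\<close> undoes composition with the cone: here it
    returns the value of \<open>f\<close> at an arrow, and in \<open>cell\<close> the component of a
    2-cell.\<close>
  have arr: "ncmp (hcomp ?K (far ?c a) (Ide (vert ?K) f)) pt = far f a"
    if "is_functor f" "fdom f = X" "category (fcod f)" "a \<in> Arr X" for a f
    using that XC is_functorD(2-4)[OF that(1), of a] is_functorD(1)[OF that(1), of "Cod X a"] one by (simp add: c)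
  have cell: "ncmp (hcomp ?K (Ide (vert ?K) (fob ?c x)) \<alpha>) pt = ncmp \<alpha> x"
    if "is_nattr \<alpha>" "ndom \<alpha> \<in> functors X Y" "category Y" "x \<in> Obj X" for \<alpha> x Y
    using that XC one is_nattrD[OF that(1,2)] functorsD[OF that(2)] functorsD'[OF that(2)] by (simp add: c)
  show ?thesis
  proof (rule is_powerI[OF two_category_FP_op XC _ _ canonical_functor_functors[OF X]])
    fix f g assume "f \<in> Mor ?K" "Cod (und ?K) f = X" "g \<in> Mor ?K" "Cod (und ?K) g = X" "Dom (und ?K) f = Dom (und ?K) g"
      and x: "\<And>x. x \<in> Obj X \<Longrightarrow> Comp (und ?K) (fob ?c x) f = Comp (und ?K) (fob ?c x) g"
      and a: "\<And>a. a \<in> Arr X \<Longrightarrow> hcomp ?K (far ?c a) (Ide (vert ?K) f) = hcomp ?K (far ?c a) (Ide (vert ?K) g)"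
    then have f: "is_functor f" "fdom f = X" "fcod f \<in> FP" "is_functor g" "fdom g = X" "fcod g = fcod f" by auto
    have Y: "category (fcod f)" by (rule FP_category[OF f(3)])
    show "f = g"
    proof (rule functors_eqI[of _ X "fcod f"])
      fix y assume y: "y \<in> Obj X"
      have "fob (comp_func f (point one X y)) pt = fob (comp_func g (point one X y)) pt"
        using x[OF y] y by (simp add: c)
      then show "fob f y = fob g y" using one by simp
    next
      fix b assume b: "b \<in> Arr X"
      show "far f b = far g b"
        using arr[OF f(1,2) Y b] arr[OF f(4,5) _ b] f(6) Y a[OF b] by simp
    qed (use f in \<open>simp_all add: functors_def\<close>)
  next
    fix Y F assume Y: "Y \<in> Ob ?K" and F: "F \<in> functors X (hom_cat ?K Y one)"
    have Y': "Y \<in> FP" and YC: "category Y" using Y FP_category by auto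
    note h = hom_cat_functorD[OF two_category_FP_op F]
    have Fx: "fob F x \<in> functors one Y" if "x \<in> Obj X" for x using h(1-3)[OF that] by (simp add: functors_def)
    have Fa: "is_nattr (far F a)" "ndom (far F a) = fob F (Dom X a)" "ncod (far F a) = fob F (Cod X a)"
      "ndom (far F a) \<in> functors one Y" "ncod (far F a) \<in> functors one Y" if "a \<in> Arr X" for a
      using h(4-6)[OF that] Fx[of "Dom X a"] Fx[of "Cod X a"] that XC by simp_all
    have pto: "pt \<in> Obj one" using one by simp
    note fx = functorsD'[OF Fx] and fa = is_nattrD(2-4)[OF Fa(1,4) pto]
    \<comment> \<open>The functor is read off the cone by evaluating each of its members at the only
      object of \<open>one\<close>.\<close>
    define f where "f = \<lparr>fdom = X, fcod = Y, fob = (\<lambda>x\<in>Obj X. fob (fob F x) pt), far = (\<lambda>a\<in>Arr X. ncmp (far F a) pt)\<rparr>"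
    have f: "f \<in> functors X Y"
    proof (rule functorsI)
      fix a b assume ab: "a \<in> Arr X" "b \<in> Arr X" "Dom X b = Cod X a"
      show "far f (Comp X b a) = Comp Y (far f b) (far f a)"
        using ab XC h(8)[OF ab] Fa(4)[OF ab(1)] one functorsD[OF Fa(4)[OF ab(1)]] by (simp add: f_def)
    next
      fix x assume x: "x \<in> Obj X"
      show "far f (Ide X x) = Ide Y (fob f x)"
        using x XC h(7)[OF x] functorsD[OF Fx[OF x]] pto by (simp add: f_def)
    qed (use XC fx(1) fa Fa(2,3) pto in \<open>simp_all add: f_def\<close>)
    have 1: "comp_func f (point one X x) = fob F x" if "x \<in> Obj X" for x
      by (rule functor_one_eqI[OF comp_functors[OF one(1) p[OF that] f] Fx[OF that] _ YC])
        (use that pto in \<open>simp add: f_def\<close>)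
    have 2: "hcomp ?K (far ?c a) (Ide (vert ?K) f) = far F a" if a: "a \<in> Arr X" for a
    proof (rule nattr_one_eqI[OF _ Fa(1)[OF a], where Y = Y])
      have fs: "is_functor f" "fdom f = X" "fcod f = Y" using functorsD[OF f] by simp_all
      show "is_nattr (hcomp ?K (far ?c a) (Ide (vert ?K) f))"
        using a XC YC fs by (auto simp: c one intro!: hcomp_nattr_is_nattr arrow_nattr id_nattr_is_nattr)
      show "ncmp (hcomp ?K (far ?c a) (Ide (vert ?K) f)) pt = ncmp (far F a) pt"
        using arr[OF fs(1,2) _ a] fs YC a by (simp add: f_def)
    qed (use a XC 1 Fa in \<open>simp_all add: c\<close>)
    show "\<exists>f. f \<in> Mor ?K \<and> Dom (und ?K) f = Y \<and> Cod (und ?K) f = X \<and>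
       (\<forall>x\<in>Obj X. Comp (und ?K) (fob ?c x) f = fob F x) \<and> (\<forall>a\<in>Arr X. hcomp ?K (far ?c a) (Ide (vert ?K) f) = far F a)"
      using functorsD[OF f] X Y' 1 2 by (intro exI[of _ f]) (simp add: c)
  next
    fix \<alpha> \<beta> assume "\<alpha> \<in> Cell ?K" "Cod (und ?K) (Dom (vert ?K) \<alpha>) = X" "\<beta> \<in> Cell ?K"
      "Dom (vert ?K) \<beta> = Dom (vert ?K) \<alpha>" "Cod (vert ?K) \<beta> = Cod (vert ?K) \<alpha>"
      and e: "\<And>x. x \<in> Obj X \<Longrightarrow> hcomp ?K (Ide (vert ?K) (fob ?c x)) \<alpha> = hcomp ?K (Ide (vert ?K) (fob ?c x)) \<beta>"
    then have a: "is_nattr \<alpha>" "is_nattr \<beta>" "ndom \<beta> = ndom \<alpha>" "ncod \<beta> = ncod \<alpha>" "ndom \<alpha> \<in> functors X (fcod (ndom \<alpha>))" "fcod (ndom \<alpha>) \<in> FP"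
      by (auto simp: functors_def)
    show "\<alpha> = \<beta>"
    proof (rule nattr_eqI[OF a(1,2,5,3,4)])
      fix x assume x: "x \<in> Obj X"
      show "ncmp \<alpha> x = ncmp \<beta> x"
        using cell[OF a(1,5) FP_category[OF a(6)] x] cell[OF a(2) _ FP_category[OF a(6)] x] a(3,5) e[OF x] by simp
    qed
  next
    fix f g \<sigma> assume "f \<in> Mor ?K" "Cod (und ?K) f = X" "g \<in> Mor ?K" "Cod (und ?K) g = X" "Dom (und ?K) f = Dom (und ?K) g"
      and "\<And>x. x \<in> Obj X \<Longrightarrow> \<sigma> x \<in> Cell ?K" "\<And>x. x \<in> Obj X \<Longrightarrow> Dom (vert ?K) (\<sigma> x) = Comp (und ?K) (fob ?c x) f"
        "\<And>x. x \<in> Obj X \<Longrightarrow> Cod (vert ?K) (\<sigma> x) = Comp (und ?K) (fob ?c x) g"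
      and n: "\<And>a. a \<in> Arr X \<Longrightarrow> Comp (vert ?K) (\<sigma> (Cod X a)) (hcomp ?K (far ?c a) (Ide (vert ?K) f)) =
         Comp (vert ?K) (hcomp ?K (far ?c a) (Ide (vert ?K) g)) (\<sigma> (Dom X a))"
    then have f: "is_functor f" "fdom f = X" "fcod f \<in> FP" "is_functor g" "fdom g = X" "fcod g = fcod f"
      and s: "\<And>x. x \<in> Obj X \<Longrightarrow> is_nattr (\<sigma> x)" "\<And>x. x \<in> Obj X \<Longrightarrow> ndom (\<sigma> x) = comp_func f (point one X x)"
        "\<And>x. x \<in> Obj X \<Longrightarrow> ncod (\<sigma> x) = comp_func g (point one X x)" by (auto simp: c)
    have Y: "category (fcod f)" by (rule FP_category[OF f(3)])
    have ff: "f \<in> functors X (fcod f)" "g \<in> functors X (fcod f)" using f by (simp_all add: functors_def)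
    have pto: "pt \<in> Obj one" using one by simp
    have sd: "ndom (\<sigma> x) \<in> functors one (fcod f)" if "x \<in> Obj X" for x
      using comp_functors[OF one(1) p[OF that] ff(1)] s(2)[OF that] by simp
    define \<alpha> where "\<alpha> = \<lparr>ndom = f, ncod = g, ncmp = (\<lambda>x\<in>Obj X. ncmp (\<sigma> x) pt)\<rparr>"
    have \<alpha>: "is_nattr \<alpha>"
    proof (rule is_nattrI[of _ X "fcod f"])
      fix a assume a: "a \<in> Arr X"
      have "ncmp (vcomp_nattr (\<sigma> (Cod X a)) (hcomp ?K (far ?c a) (Ide (vert ?K) f))) pt =
         ncmp (vcomp_nattr (hcomp ?K (far ?c a) (Ide (vert ?K) g)) (\<sigma> (Dom X a))) pt" using n[OF a] by simp
      moreover have "ncmp (vcomp_nattr (\<sigma> (Cod X a)) (hcomp ?K (far ?c a) (Ide (vert ?K) f))) pt = Comp (fcod f) (ncmp (\<sigma> (Cod X a)) pt) (far f a)"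
        using arr[OF f(1,2) Y a] pto a by (simp add: c)
      moreover have "ncmp (vcomp_nattr (hcomp ?K (far ?c a) (Ide (vert ?K) g)) (\<sigma> (Dom X a))) pt = Comp (fcod f) (far g a) (ncmp (\<sigma> (Dom X a)) pt)"
        using arr[OF f(4,5) _ a] Y f(6) pto functorsD[OF sd[of "Dom X a"]] a XC by simp
      ultimately show "Comp (fcod f) (ncmp \<alpha> (Cod X a)) (far (ndom \<alpha>) a) = Comp (fcod f) (far (ncod \<alpha>) a) (ncmp \<alpha> (Dom X a))"
        using a XC by (simp add: \<alpha>_def)
    qed (use ff is_nattrD(2-4)[OF s(1) sd pto] s(2,3) pto in \<open>simp_all add: \<alpha>_def\<close>)
    have "hcomp ?K (Ide (vert ?K) (fob ?c x)) \<alpha> = \<sigma> x" if x: "x \<in> Obj X" for x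
    proof (rule nattr_one_eqI[OF _ s(1)[OF x], where Y = "fcod f"])
      show "is_nattr (hcomp ?K (Ide (vert ?K) (fob ?c x)) \<alpha>)"
        using x XC Y f \<alpha> functorsD[OF p[OF x]] by (auto simp: c one \<alpha>_def[THEN arg_cong[of _ _ ndom]] intro!: hcomp_nattr_is_nattr id_nattr_is_nattr)
      show "ncmp (hcomp ?K (Ide (vert ?K) (fob ?c x)) \<alpha>) pt = ncmp (\<sigma> x) pt"
        using cell[OF \<alpha> _ Y x] ff x by (simp add: \<alpha>_def)
    qed (use x s sd in \<open>simp_all add: c \<alpha>_def\<close>)
    then show "\<exists>\<alpha>. \<alpha> \<in> Cell ?K \<and> Dom (vert ?K) \<alpha> = f \<and> Cod (vert ?K) \<alpha> = g \<and>
       (\<forall>x\<in>Obj X. hcomp ?K (Ide (vert ?K) (fob ?c x)) \<alpha> = \<sigma> x)"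
      using \<alpha> f X by (intro exI[of _ \<alpha>]) (simp add: \<alpha>_def)
  qed (use X FP_one in simp_all)
qed

end

section \<open>Models\<close>

context FP_setting
begin

text \<open>
  The last property is stated at two types because an obtained fact is not polymorphic; it is needed
  both for the theory and for the target of a model.
\<close>

lemma power_of_power_FP:
  fixes X :: "('u, 'u) cat"
  assumes X: "finitely_presentable X" and A: "A \<in> FP"
  obtains Q \<kappa> where "Q \<in> FP" "\<kappa> \<in> functors X (hom_cat (FP_op FP) Q A)"
    "\<And>(K :: ('o, 'm, 'c) two_cat) T. two_category K \<Longrightarrow> two_functor (FP_op FP) K T \<Longrightarrow>
      (\<And>Y. Y \<in> FP \<Longrightarrow> is_power K Y (F0 T one) (F0 T Y) (comp_func (hom_action (FP_op FP) K T Y one) (canonical_functor FP Y))) \<Longrightarrow>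
      is_power K X (F0 T A) (F0 T Q) (comp_func (hom_action (FP_op FP) K T Q A) \<kappa>)"
    "\<And>(K :: ('o', 'm', 'c') two_cat) T. two_category K \<Longrightarrow> two_functor (FP_op FP) K T \<Longrightarrow>
      (\<And>Y. Y \<in> FP \<Longrightarrow> is_power K Y (F0 T one) (F0 T Y) (comp_func (hom_action (FP_op FP) K T Y one) (canonical_functor FP Y))) \<Longrightarrow>
      is_power K X (F0 T A) (F0 T Q) (comp_func (hom_action (FP_op FP) K T Q A) \<kappa>)"
proof -
  note XC = finitely_presentable_category[OF X] and AC = FP_category[OF A]
  obtain Q k0 k1 where Q: "Q \<in> FP" "product_of X A Q k0 k1" by (rule FP_product[OF X FP_fp[OF A]])
  note QC = FP_category[OF Q(1)] and q = product_ofD[OF Q(2)]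
  let ?F = "FP_op FP"
  \<comment> \<open>The inclusion of the slice at \<open>x\<close> into the product, which in the
    opposite is a 1-cell from \<open>Q\<close> to \<open>A\<close>. These are the projections that
    are to make \<open>Q\<close> a power of \<open>A\<close> by \<open>X\<close>.\<close>
  define k where "k x = \<lparr>fdom = A, fcod = Q, fob = (\<lambda>a\<in>Obj A. k0 x a), far = (\<lambda>v\<in>Arr A. k1 (Ide X x) v)\<rparr>" for x
  define n where "n u = \<lparr>ndom = k (Dom X u), ncod = k (Cod X u), ncmp = (\<lambda>a\<in>Obj A. k1 u (Ide A a))\<rparr>" for u
  define \<kappa> where "\<kappa> = \<lparr>fdom = X, fcod = hom_cat ?F Q A, fob = (\<lambda>x\<in>Obj X. k x), far = (\<lambda>u\<in>Arr X. n u)\<rparr>"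
  have k: "k x \<in> functors A Q" if x: "x \<in> Obj X" for x
  proof (rule functorsI)
    fix r s assume rs: "r \<in> Arr A" "s \<in> Arr A" "Dom A s = Cod A r"
    show "far (k x) (Comp A s r) = Comp Q (far (k x) s) (far (k x) r)"
      using rs x XC AC q(6)[of "Ide X x" "Ide X x" r s] by (simp add: k_def)
  qed (use x XC AC q(1-5) in \<open>simp_all add: k_def\<close>)
  have nn: "is_nattr (n u)" if u: "u \<in> Arr X" for u
  proof (rule is_nattrI[of _ A Q])
    fix v assume v: "v \<in> Arr A"
    show "Comp Q (ncmp (n u) (Cod A v)) (far (ndom (n u)) v) = Comp Q (far (ncod (n u)) v) (ncmp (n u) (Dom A v))"
      using u v XC AC q(6)[of "Ide X (Dom X u)" u v "Ide A (Cod A v)"] q(6)[of u "Ide X (Cod X u)" "Ide A (Dom A v)" v]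
      by (simp add: n_def k_def)
  qed (use u XC AC q(1-5) k in \<open>simp_all add: n_def k_def[THEN arg_cong, of fob]\<close>)
  have \<kappa>: "\<kappa> \<in> functors X (hom_cat ?F Q A)"
  proof (rule hom_cat_functorI[OF two_category_FP_op XC])
    fix r s assume rs: "r \<in> Arr X" "s \<in> Arr X" "Dom X s = Cod X r"
    have "n (Comp X s r) = vcomp_nattr (n s) (n r)"
    proof (rule nattr_eqI[of _ _ A Q])
      show "is_nattr (n (Comp X s r))" by (rule nn) (use rs XC in simp)
      show "is_nattr (vcomp_nattr (n s) (n r))"
        by (rule vcomp_nattr_nattr[OF AC QC nn[OF rs(1)] nn[OF rs(2)]]) (use rs k[of "Dom X r"] XC in \<open>simp_all add: n_def\<close>)
      fix a assume a: "a \<in> Obj A"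
      show "ncmp (n (Comp X s r)) a = ncmp (vcomp_nattr (n s) (n r)) a"
        using rs a AC q(6)[of r s "Ide A a" "Ide A a"] by (simp add: n_def k_def)
    qed (use rs XC k in \<open>simp_all add: n_def\<close>)
    then show "far \<kappa> (Comp X s r) = Comp (vert ?F) (far \<kappa> s) (far \<kappa> r)"
      using rs XC by (simp add: \<kappa>_def)
  next
    fix x assume x: "x \<in> Obj X"
    have "n (Ide X x) = id_nattr (k x)"
    proof (rule nattr_eqI[of _ _ A Q])
      show "is_nattr (n (Ide X x))" by (rule nn) (use x XC in simp)
      show "is_nattr (id_nattr (k x))" by (rule id_nattr_nattr[OF AC QC k[OF x]])
      fix a assume a: "a \<in> Obj A"
      show "ncmp (n (Ide X x)) a = ncmp (id_nattr (k x)) a"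
        using x a q(5)[OF x a] by (simp add: n_def k_def)
    qed (use x XC k[OF x] in \<open>simp_all add: n_def\<close>)
    then show "far \<kappa> (Ide X x) = Ide (vert ?F) (fob \<kappa> x)"
      using x XC by (simp add: \<kappa>_def)
  next
    fix x assume x: "x \<in> Obj X"
    show "fob \<kappa> x \<in> Mor ?F" "Dom (und ?F) (fob \<kappa> x) = Q" "Cod (und ?F) (fob \<kappa> x) = A"
      using x functorsD[OF k[OF x]] A Q by (simp_all add: \<kappa>_def)
  next
    fix u assume u: "u \<in> Arr X"
    show "far \<kappa> u \<in> Cell ?F" "Dom (vert ?F) (far \<kappa> u) = fob \<kappa> (Dom X u)" "Cod (vert ?F) (far \<kappa> u) = fob \<kappa> (Cod X u)"
      using u XC nn[OF u] functorsD[OF k[of "Dom X u"]] functorsD[OF k[of "Cod X u"]] A Q by (simp_all add: \<kappa>_def n_def)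
  qed (simp_all add: \<kappa>_def)
  \<comment> \<open>The projections of the two layers compose to a projection of \<open>Q\<close> at
    the corresponding pair. This and \<open>e1\<close>, its version for 2-cells, are the
    compatibilities that \<open>power_of_power\<close> asks for.\<close>
  have e0: "Comp (und ?F) (fob (canonical_functor FP A) a) (fob \<kappa> x) = fob (canonical_functor FP Q) (k0 x a)"
    if "x \<in> Obj X" "a \<in> Obj A" for x a
  proof -
    have "comp_func (k x) (point one A a) = point one Q (k0 x a)"
      by (rule functor_one_eqI[OF comp_functors[OF one(1) point_functors[OF one(1) AC that(2)] k[OF that(1)]] point_functors[OF one(1) QC q(1)[OF that]] _ QC])
        (use that one in \<open>simp add: k_def\<close>)
    then show ?thesis using that q(1) by (simp add: canonical_functor_sel \<kappa>_def)
  qed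
  have e1: "hcomp ?F (far (canonical_functor FP A) v) (far \<kappa> u) = far (canonical_functor FP Q) (k1 u v)"
    if uv: "u \<in> Arr X" "v \<in> Arr A" for u v
  proof -
    have x: "Dom X u \<in> Obj X" "Cod X u \<in> Obj X" "Dom A v \<in> Obj A" "Cod A v \<in> Obj A" using uv XC AC by simp_all
    have cp: "comp_func (k x) (point one A a) = point one Q (k0 x a)" if "x \<in> Obj X" "a \<in> Obj A" for x a
      using e0[OF that] that q(1) by (simp add: canonical_functor_sel \<kappa>_def)
    have p: "point one A (Dom A v) \<in> functors one A" "point one Q (k0 (Dom X u) (Dom A v)) \<in> functors one Q"
      by (rule point_functors[OF one(1)]; use x AC QC q(1) in simp)+
    have "hcomp_nattr (n u) (arrow_nattr A v) = arrow_nattr Q (k1 u v)"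
    proof (rule nattr_one_eqI[OF _ arrow_nattr[OF QC q(2)[OF uv]], where Y = Q])
      show "is_nattr (hcomp_nattr (n u) (arrow_nattr A v))"
        by (rule hcomp_nattr_nattr[OF one(1) AC QC arrow_nattr[OF AC uv(2)] nn[OF uv(1)]])
          (use p k x in \<open>simp_all add: n_def\<close>)
      show "ncmp (hcomp_nattr (n u) (arrow_nattr A v)) pt = ncmp (arrow_nattr Q (k1 u v)) pt"
        using uv x XC AC one q(6)[of "Ide X (Dom X u)" u v "Ide A (Cod A v)"] by (simp add: n_def k_def)
    qed (use uv x q(3,4) cp p in \<open>simp_all add: n_def\<close>)
    then show ?thesis using uv q(2) by (simp add: canonical_functor_sel \<kappa>_def)
  qed
  \<comment> \<open>The equations \<open>e0\<close> and \<open>e1\<close> live in the opposite of FP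
    and are carried to \<open>K\<close> by \<open>T\<close>. In \<open>K\<close> itself, the input
    consists of the powers of the image of \<open>one\<close> by \<open>A\<close> and by
    \<open>Q\<close>.\<close>
  have main: "is_power K X (F0 T A) (F0 T Q) (comp_func (hom_action ?F K T Q A) \<kappa>)"
    if K: "two_category K" and T: "two_functor ?F K T"
      and p: "\<And>Y. Y \<in> FP \<Longrightarrow> is_power K Y (F0 T one) (F0 T Y) (comp_func (hom_action ?F K T Y one) (canonical_functor FP Y))"
    for K :: "('x, 'y, 'z) two_cat" and T
  proof -
    note t = two_functorD[OF T] and F = two_category_FP_op
    note hk = hom_action_cone[OF F K T XC \<kappa>] and ha = hom_action_cone[OF F K T AC canonical_functor_functors[OF A]]
      and hq = hom_action_cone[OF F K T QC canonical_functor_functors[OF Q(1)]]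
    note kf = hom_cat_functorD[OF F \<kappa>] and af = hom_cat_functorD[OF F canonical_functor_functors[OF A]]
    show ?thesis
    proof (rule power_of_power[OF K XC AC QC Q(2) p[OF A] p[OF Q(1)] hk(1)])
      fix x a assume xa: "x \<in> Obj X" "a \<in> Obj A"
      show "Comp (und K) (fob (comp_func (hom_action ?F K T A one) (canonical_functor FP A)) a) (fob (comp_func (hom_action ?F K T Q A) \<kappa>) x) =
          fob (comp_func (hom_action ?F K T Q one) (canonical_functor FP Q)) (k0 x a)"
        unfolding hk(2)[OF xa(1)] ha(2)[OF xa(2)] hq(2)[OF q(1)[OF xa]] e0[OF xa, symmetric]
        by (rule t(6)[symmetric]) (use kf(1,3)[OF xa(1)] af(1,2)[OF xa(2)] in simp_all)
    next
      fix u v assume uv: "u \<in> Arr X" "v \<in> Arr A"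
      show "hcomp K (far (comp_func (hom_action ?F K T A one) (canonical_functor FP A)) v) (far (comp_func (hom_action ?F K T Q A) \<kappa>) u) =
          far (comp_func (hom_action ?F K T Q one) (canonical_functor FP Q)) (k1 u v)"
        unfolding hk(3)[OF uv(1)] ha(3)[OF uv(2)] hq(3)[OF q(2)[OF uv]] e1[OF uv, symmetric]
        by (rule t(12)[symmetric]) (use kf(3-5)[of "Dom X u"] kf(4,5)[OF uv(1)] af(4,5)[OF uv(2)] af(2)[of "Dom A v"] uv XC AC in simp_all)
    qed
  qed
  show thesis by (rule that[OF Q(1) \<kappa> main main])
qed

end

lemma hom_action_comp:
  assumes K: "two_category K" and L: "two_category L" and M: "two_category M"
    and F: "two_functor K L F" and G: "two_functor L M G" and X: "category X" and \<gamma>: "\<gamma> \<in> functors X (hom_cat K P A)"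
    and PA: "P \<in> Ob K" "A \<in> Ob K"
  shows "comp_func (hom_action L M G (F0 F P) (F0 F A)) (comp_func (hom_action K L F P A) \<gamma>) =
     comp_func (hom_action K M (comp_two_func K G F) P A) \<gamma>"
proof -
  note h = hom_action_cone[OF K L F X \<gamma>] and k = hom_action_cone[OF L M G X h(1)]
    and l = hom_action_cone[OF K M comp_two_functor[OF K L M F G] X \<gamma>] and g = hom_cat_functorD[OF K \<gamma>]
  show ?thesis
    by (rule functors_eqI[OF k(1)]) (use l PA in \<open>simp_all add: h k g\<close>)
qed

text \<open>The uniqueness property for 1-cells first identifies the source of the cell with its
  target; the one for 2-cells then identifies the cell with the identity there.\<close>

lemma power_identity_cell:
  assumes K: "two_category K" and X: "category X" and p: "is_power K X A P \<gamma>"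
    and \<theta>: "\<theta> \<in> Cell K" "Cod (und K) (Dom (vert K) \<theta>) = P"
    and i: "\<And>x. x \<in> Obj X \<Longrightarrow> is_identity (vert K) (hcomp K (Ide (vert K) (fob \<gamma> x)) \<theta>)"
  shows "is_identity (vert K) \<theta>"
proof -
  have Cv: "category (vert K)" using K by simp
  note g = hom_cat_functorD[OF K is_powerD(3)[OF K X p]]
  let ?I = "Ide (vert K)" and ?h = "hcomp K" and ?v = "Comp (vert K)" and ?f = "Dom (vert K) \<theta>" and ?g = "Cod (vert K) \<theta>"
  have 1: "?h (?I (fob \<gamma> x)) \<theta> = ?I (Comp (und K) (fob \<gamma> x) ?f)" "Comp (und K) (fob \<gamma> x) ?f = Comp (und K) (fob \<gamma> x) ?g"
    if x: "x \<in> Obj X" for x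
  proof -
    show "Comp (und K) (fob \<gamma> x) ?f = Comp (und K) (fob \<gamma> x) ?g"
      using is_identityD(3)[OF Cv i[OF x]] x \<theta> by (simp add: g K)
    show "?h (?I (fob \<gamma> x)) \<theta> = ?I (Comp (und K) (fob \<gamma> x) ?f)"
      using is_identityD(2)[OF Cv i[OF x]] x \<theta> by (simp add: g K)
  qed
  \<comment> \<open>Equality of 1-cells into a power is tested on arrows of \<open>X\<close> too.
    Both whiskerings of \<open>far \<gamma> a\<close> equal its horizontal composite with
    \<open>\<theta>\<close>, since the projected cells at the two ends are identities.\<close>
  have 2: "?h (far \<gamma> a) (?I ?f) = ?h (far \<gamma> a) (?I ?g)" if a: "a \<in> Arr X" for a
  proof -
    let ?x = "?I (fob \<gamma> (Dom X a))" and ?y = "?I (fob \<gamma> (Cod X a))"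
    have "?h (?v ?y (far \<gamma> a)) (?v \<theta> (?I ?f)) = ?v (?h ?y \<theta>) (?h (far \<gamma> a) (?I ?f))"
      by (rule interchange) (use a \<theta> in \<open>simp_all add: g K X\<close>)
    moreover have "?h (?v (far \<gamma> a) ?x) (?v (?I ?g) \<theta>) = ?v (?h (far \<gamma> a) (?I ?g)) (?h ?x \<theta>)"
      by (rule interchange) (use a \<theta> in \<open>simp_all add: g K X\<close>)
    moreover have "?v ?y (far \<gamma> a) = far \<gamma> a" "?v (far \<gamma> a) ?x = far \<gamma> a" "?v \<theta> (?I ?f) = \<theta>" "?v (?I ?g) \<theta> = \<theta>"
      using a \<theta> by (simp_all add: g K X)
    moreover have "?v (?h ?y \<theta>) (?h (far \<gamma> a) (?I ?f)) = ?h (far \<gamma> a) (?I ?f)"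
      using 1(1)[of "Cod X a"] a \<theta> by (simp add: g K X)
    moreover have "?v (?h (far \<gamma> a) (?I ?g)) (?h ?x \<theta>) = ?h (far \<gamma> a) (?I ?g)"
      using 1[of "Dom X a"] a \<theta> by (simp add: g K X)
    ultimately show ?thesis by simp
  qed
  have fg: "?f = ?g"
    by (rule is_power_eq[OF K X p]) (use \<theta> 1(2) 2 K in simp_all)
  have "\<theta> = ?I ?f"
    by (rule is_power_cell_eq[OF K X p \<theta>]) (use \<theta> 1(1) K g fg[symmetric] in simp_all)
  then show ?thesis using \<theta> K by (metis is_identity_Ide two_categoryD(3) two_category_Mor(1))
qed

section \<open>Identity components of weak transformations\<close>

lemma is_identity_comp_left:
  assumes "category A" "is_identity A f" "g \<in> Arr A" "Dom A f = Cod A g"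
  shows "Comp A f g = g"
  using is_identityD(2)[OF assms(1,2)] assms by (metis categoryD(10))

lemma is_identity_comp_right:
  assumes "category A" "is_identity A f" "g \<in> Arr A" "Dom A g = Cod A f"
  shows "Comp A g f = g"
  using is_identityD(2,3)[OF assms(1,2)] assms by (metis categoryD(9))

lemma comp_identities_commute:
  assumes "category A" "is_identity A f" "is_identity A g" "Dom A g = Cod A f"
  shows "Comp A g f = Comp A f g"
proof -
  note f = is_identityD(1,3)[OF assms(1,2)] and g = is_identityD(1,3)[OF assms(1,3)]
  have "Dom A f = Cod A g" using f(2) g(2) assms(4) by metis
  then show ?thesis
    using is_identity_comp_left[OF assms(1,3) f(1) assms(4)] is_identity_comp_right[OF assms(1,3) f(1)] by metis
qed

text \<open>Of the two cells in the formula for a composite 1-cell, the whiskered component at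
  \<open>g\<close> is an identity and drops out. The lax and the colax formula differ in the order
  of these cells and so give the same result.\<close>

lemma weak_natural_identity_comp:
  assumes K: "two_category K" and L: "two_category L" and \<phi>: "weak_natural w K L \<phi>"
    and f: "f \<in> Mor K" "g \<in> Mor K" "Dom (und K) g = Cod (und K) f"
    and i: "is_identity (vert L) (t2 \<phi> g)"
  shows "t2 \<phi> (Comp (und K) g f) = hcomp L (Ide (vert L) (F1 (tcod \<phi>) g)) (t2 \<phi> f)"
proof -
  have Cu: "category (und L)" and Cv: "category (vert L)" and Ku: "category (und K)" using L K by simp_all
  note n = weak_naturalD[OF \<phi>]
  note F = two_functorD[OF n(1)] two_functorD[OF n(2)]
  have j: "is_identity (vert L) (hcomp L (t2 \<phi> g) (Ide (vert L) (F1 (tdom \<phi>) f)))"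
    using is_identity_hcomp[OF L _ i, of "Ide (vert L) (F1 (tdom \<phi>) f)"] f n F L K weak_natural_boundary(1,4)[OF \<phi> f(2)]
    by (cases "w = Colax") (simp_all add: category_assoc[OF Cu])
  show ?thesis
  proof (cases "w = Colax")
    case True
    note b = weak_natural_boundary(3,4)[OF \<phi> _ True]
    show ?thesis
      unfolding weak_natural_comp(2)[OF \<phi> f True]
      by (rule is_identity_comp_right[OF Cv j]) (use f in \<open>simp_all add: n F b L K category_assoc[OF Cu]\<close>)
  next
    case False
    note b = weak_natural_boundary(1,2)[OF \<phi> _ False]
    show ?thesis
      unfolding weak_natural_comp(1)[OF \<phi> f False]
      by (rule is_identity_comp_left[OF Cv j]) (use f in \<open>simp_all add: n F b L K category_assoc[OF Cu]\<close>)
  qed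
qed

lemma restrict_transf_sel [simp]:
  "tdom (restrict_transf H \<phi> S) = comp_two_func H (tdom \<phi>) S" "tcod (restrict_transf H \<phi> S) = comp_two_func H (tcod \<phi>) S"
  "X \<in> Ob H \<Longrightarrow> t1 (restrict_transf H \<phi> S) X = t1 \<phi> (F0 S X)" "f \<in> Mor H \<Longrightarrow> t2 (restrict_transf H \<phi> S) f = t2 \<phi> (F1 S f)"
  "X \<notin> Ob H \<Longrightarrow> t1 (restrict_transf H \<phi> S) X = undefined" "f \<notin> Mor H \<Longrightarrow> t2 (restrict_transf H \<phi> S) f = undefined"
  by (simp_all add: restrict_transf_def)

text \<open>Identities have no direction, so components that are identities satisfy the strict
  conditions whatever \<open>w\<close> is. In the colax case the composition formula arrives in the
  opposite order, and its two identity cells are exchanged.\<close>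

lemma restrict_transf_strict:
  assumes H: "two_category H" and K: "two_category K" and L: "two_category L"
    and S: "two_functor H K S" and \<phi>: "weak_natural w K L \<phi>"
    and i: "\<And>f. f \<in> Mor H \<Longrightarrow> is_identity (vert L) (t2 \<phi> (F1 S f))"
  shows "weak_natural Strict H L (restrict_transf H \<phi> S)"
proof -
  have Cu: "category (und L)" and Cv: "category (vert L)" and Hu: "category (und H)" and Hv: "category (vert H)" using L H by simp_all
  note n = weak_naturalD[OF \<phi>]
  note F = two_functorD[OF n(1)] two_functorD[OF n(2)] and s = two_functorD[OF S]
  \<comment> \<open>An identity component has equal source and target, so its boundary can be
    described in the same way for colax and for the other transformations.\<close>
  have b: "Dom (vert L) (t2 \<phi> (F1 S f)) = Comp (und L) (F1 (tcod \<phi>) (F1 S f)) (t1 \<phi> (Dom (und K) (F1 S f)))"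
    "Cod (vert L) (t2 \<phi> (F1 S f)) = Comp (und L) (t1 \<phi> (Cod (und K) (F1 S f))) (F1 (tdom \<phi>) (F1 S f))"
    "Comp (und L) (F1 (tcod \<phi>) (F1 S f)) (t1 \<phi> (Dom (und K) (F1 S f))) = Comp (und L) (t1 \<phi> (Cod (und K) (F1 S f))) (F1 (tdom \<phi>) (F1 S f))"
    if "f \<in> Mor H" for f
    using weak_natural_boundary(1-4)[OF \<phi> s(2)[OF that]] is_identityD(3)[OF Cv i[OF that]] by (cases "w = Colax"; simp)+
  show ?thesis
  proof (rule weak_naturalI_lax)
    show "two_functor H L (tdom (restrict_transf H \<phi> S))" "two_functor H L (tcod (restrict_transf H \<phi> S))"
      using comp_two_functor[OF H K L S n(1)] comp_two_functor[OF H K L S n(2)] by simp_all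
    fix f g assume fg: "f \<in> Mor H" "g \<in> Mor H" "Dom (und H) g = Cod (und H) f"
    have Sfg: "F1 S f \<in> Mor K" "F1 S g \<in> Mor K" "Dom (und K) (F1 S g) = Cod (und K) (F1 S f)" using fg s by simp_all
    let ?l = "hcomp L (Ide (vert L) (F1 (tcod \<phi>) (F1 S g))) (t2 \<phi> (F1 S f))"
      and ?r = "hcomp L (t2 \<phi> (F1 S g)) (Ide (vert L) (F1 (tdom \<phi>) (F1 S f)))"
    have lr: "is_identity (vert L) ?l" "is_identity (vert L) ?r"
      using fg Sfg by (auto intro!: is_identity_hcomp[OF L] simp: i n F s b H K L)
    have "t2 \<phi> (F1 S (Comp (und H) g f)) = Comp (vert L) ?r ?l"
    proof (cases "w = Colax")
      case True
      have "Comp (vert L) ?l ?r = Comp (vert L) ?r ?l"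
        by (rule comp_identities_commute[OF Cv lr(2,1)])
          (use fg Sfg weak_natural_boundary(3,4)[OF \<phi> _ True] in \<open>simp add: n F L H K s category_assoc[OF Cu]\<close>)
      then show ?thesis using weak_natural_comp(2)[OF \<phi> Sfg True] fg s by simp
    next
      case False
      then show ?thesis using weak_natural_comp(1)[OF \<phi> Sfg False] fg s by simp
    qed
    then show "t2 (restrict_transf H \<phi> S) (Comp (und H) g f) =
      Comp (vert L) (hcomp L (t2 (restrict_transf H \<phi> S) g) (Ide (vert L) (F1 (tdom (restrict_transf H \<phi> S)) f)))
       (hcomp L (Ide (vert L) (F1 (tcod (restrict_transf H \<phi> S)) g)) (t2 (restrict_transf H \<phi> S) f))"
      using fg Hu by simp
  next
    fix \<alpha> assume \<alpha>: "\<alpha> \<in> Cell H"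
    have Sa: "F2 S \<alpha> \<in> Cell K" using \<alpha> s by simp
    let ?f = "Dom (vert H) \<alpha>" and ?g = "Cod (vert H) \<alpha>"
    let ?M = "hcomp L (Ide (vert L) (t1 \<phi> (Cod (und K) (F1 S ?f)))) (F2 (tdom \<phi>) (F2 S \<alpha>))"
      and ?N = "hcomp L (F2 (tcod \<phi>) (F2 S \<alpha>)) (Ide (vert L) (t1 \<phi> (Dom (und K) (F1 S ?f))))"
    have fg: "?f \<in> Mor H" "?g \<in> Mor H" using \<alpha> H by simp_all
    have m: "?M \<in> Cell L" "?N \<in> Cell L" using \<alpha> fg H by (simp_all add: n F s L)
    have md: "Dom (vert L) ?M = Comp (und L) (t1 \<phi> (Cod (und K) (F1 S ?f))) (F1 (tdom \<phi>) (F1 S ?f))"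
      "Cod (vert L) ?M = Comp (und L) (t1 \<phi> (Cod (und K) (F1 S ?g))) (F1 (tdom \<phi>) (F1 S ?g))"
      "Dom (vert L) ?N = Comp (und L) (F1 (tcod \<phi>) (F1 S ?f)) (t1 \<phi> (Dom (und K) (F1 S ?f)))"
      "Cod (vert L) ?N = Comp (und L) (F1 (tcod \<phi>) (F1 S ?g)) (t1 \<phi> (Dom (und K) (F1 S ?g)))"
      using \<alpha> fg H by (simp_all add: n F s L)
    have c: "Comp (vert L) ?M (t2 \<phi> (F1 S ?f)) = ?M" "Comp (vert L) (t2 \<phi> (F1 S ?g)) ?N = ?N"
       "Comp (vert L) ?N (t2 \<phi> (F1 S ?f)) = ?N" "Comp (vert L) (t2 \<phi> (F1 S ?g)) ?M = ?M"
      using is_identity_comp_right[OF Cv i[OF fg(1)] m(1)] is_identity_comp_left[OF Cv i[OF fg(2)] m(2)]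
        is_identity_comp_right[OF Cv i[OF fg(1)] m(2)] is_identity_comp_left[OF Cv i[OF fg(2)] m(1)]
      unfolding md b(1,2)[OF fg(1)] b(1,2)[OF fg(2)] by (simp_all add: b(3)[OF fg(1)] b(3)[OF fg(2)])
    have "?M = ?N"
    proof (cases "w = Colax")
      case True
      show ?thesis using weak_natural_cell(2)[OF \<phi> Sa True] \<alpha> c by (simp add: s)
    next
      case False
      show ?thesis using weak_natural_cell(1)[OF \<phi> Sa False] \<alpha> c by (simp add: s)
    qed
    then show "Comp (vert L)
        (hcomp L (Ide (vert L) (t1 (restrict_transf H \<phi> S) (Cod (und H) ?f))) (F2 (tdom (restrict_transf H \<phi> S)) \<alpha>))
        (t2 (restrict_transf H \<phi> S) ?f) =
      Comp (vert L) (t2 (restrict_transf H \<phi> S) ?g)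
        (hcomp L (F2 (tcod (restrict_transf H \<phi> S)) \<alpha>) (Ide (vert L) (t1 (restrict_transf H \<phi> S) (Dom (und H) ?f))))"
      using \<alpha> fg c H by (simp add: s)
  qed (simp_all add: n F s b i H L)
qed

text \<open>The component at a unit is an identity by the unit axiom, and by
  \<open>weak_natural_identity_comp\<close> the component at a composite is a whiskered
  identity.\<close>

lemma generated_identity_components:
  assumes K: "two_category K" and L: "two_category L" and \<phi>: "weak_natural w K L \<phi>"
    and G: "G \<subseteq> Mor K" "\<And>g. g \<in> G \<Longrightarrow> is_identity (vert L) (t2 \<phi> g)" and f: "f \<in> generated (und K) G"
  shows "is_identity (vert L) (t2 \<phi> f)"
proof -
  have Ku: "category (und K)" using K by simp
  have "f \<in> Mor K \<and> is_identity (vert L) (t2 \<phi> f)"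
  proof (rule generated_induct[OF Ku G(1) f G(2)])
    fix X assume "X \<in> Ob K"
    then show "is_identity (vert L) (t2 \<phi> (Ide (und K) X))"
      using weak_naturalD[OF \<phi>] L by simp
  next
    fix f g assume fg: "f \<in> Mor K" "g \<in> Mor K" "Dom (und K) g = Cod (und K) f"
      "is_identity (vert L) (t2 \<phi> f)" "is_identity (vert L) (t2 \<phi> g)"
    note n = weak_naturalD[OF \<phi>]
    show "is_identity (vert L) (t2 \<phi> (Comp (und K) g f))"
      unfolding weak_natural_identity_comp[OF K L \<phi> fg(1-3,5)]
      by (rule is_identity_hcomp[OF L fg(4)])
        (use fg(1-3) weak_natural_boundary(1,4)[OF \<phi> fg(1)] K in
          \<open>cases "w = Colax"; simp add: n L two_functorD[OF n(1)] two_functorD[OF n(2)]\<close>)+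
  qed
  then show ?thesis ..
qed

section \<open>Sketches\<close>

lemma one_two_cat_sel [simp]:
  "Ob one_two_cat = UNIV" "Mor one_two_cat = UNIV" "Cell one_two_cat = UNIV" "Obj (vert one_two_cat) = UNIV"
  "Dom (und one_two_cat) = id" "Cod (und one_two_cat) = id" "Ide (und one_two_cat) = id"
  "Dom (vert one_two_cat) = id" "Cod (vert one_two_cat) = id" "Ide (vert one_two_cat) = id"
  "Comp (und one_two_cat) f g = ()" "Comp (vert one_two_cat) f g = ()" "hcomp one_two_cat f g = ()"
  by (simp_all add: one_two_cat_def Let_def)

lemma two_category_one: "two_category one_two_cat"
  by (rule two_categoryI) (auto simp: category_def)

lemma pick_sel [simp]:
  "F0 (pick K X) i = X" "F1 (pick K X) f = Ide (und K) X" "F2 (pick K X) \<theta> = Ide (vert K) (Ide (und K) X)"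
  by (simp_all add: pick_def)

lemma two_functor_pick:
  assumes "two_category K" "X \<in> Ob K"
  shows "two_functor one_two_cat K (pick K X)"
  by (rule two_functorI) (use assms in simp_all)

lemma two_category_CAT: "two_category CAT"
  unfolding CAT_def by (rule two_category_Cat_on) simp

lemma power_cone_sel [simp]:
  "shape (power_cone K X A P \<gamma>) = one_two_cat" "weight (power_cone K X A P \<gamma>) = pick CAT X"
  "diagram (power_cone K X A P \<gamma>) = pick K A" "apex (power_cone K X A P \<gamma>) = P" "legs (power_cone K X A P \<gamma>) i = \<gamma>"
  by (simp_all add: power_cone_def)

lemma comp_pick:
  assumes "two_functor K L H" "A \<in> Ob K" "two_category K"
  shows "comp_two_func one_two_cat H (pick K A) = pick L (F0 H A)"
  using assms two_functorD[OF assms(1)] by (simp add: comp_two_func_def pick_def restrict_def)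

lemma map_power_cone:
  assumes "two_functor K L H" "A \<in> Ob K" "two_category K"
  shows "map_wcone K L H (power_cone K X A P \<gamma>) = power_cone L X (F0 H A) (F0 H P) (comp_func (hom_action K L H P A) \<gamma>)"
  using comp_pick[OF assms] by (simp add: map_wcone_def power_cone_def restrict_def)

lemma tight_power_cone_sel:
  "fshape (tight_cone (power_cone K X A P \<gamma>)) = chordate one_two_cat"
  "F0 (fweight (tight_cone (power_cone K X A P \<gamma>))) i = identity_embedding X"
  "F1 (fweight (tight_cone (power_cone K X A P \<gamma>))) f = (identity_embedding X, id_func X, identity_embedding X)"
  "F2 (fweight (tight_cone (power_cone K X A P \<gamma>))) \<theta> = (identity_embedding X, id_nattr (id_func X), identity_embedding X)"
  "fdiagram (tight_cone (power_cone K X A P \<gamma>)) = pick K A"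
  "fapex (tight_cone (power_cone K X A P \<gamma>)) = P" "flegs (tight_cone (power_cone K X A P \<gamma>)) i = \<gamma>"
  by (simp_all add: tight_cone_def Let_def CAT_def)

lemma map_tight_power_cone:
  assumes "two_functor (loose K) (loose L) H" "A \<in> Ob (loose K)" "two_category (loose K)"
  shows "map_fcone K L H (tight_cone (power_cone (loose K) X A P \<gamma>)) =
    tight_cone (power_cone (loose L) X (F0 H A) (F0 H P) (comp_func (hom_action (loose K) (loose L) H P A) \<gamma>))"
proof -
  have e: "fweight (tight_cone (power_cone (loose K) X A P \<gamma>)) = fweight (tight_cone (power_cone (loose L) X (F0 H A) (F0 H P) \<gamma>'))" for \<gamma>'
    by (simp add: tight_cone_def Let_def)
  show ?thesis
    by (rule fcone.equality)
      (simp_all add: map_fcone_def Let_def tight_power_cone_sel chordate_def comp_pick[OF assms] e[symmetric] fun_eq_iff)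
qed

text \<open>Weight, diagram, apex and legs of the cone give back the parameters of the power.
  Through this, membership among the specified cones can be turned back into \<open>is_power\<close>
  for the given data.\<close>

lemma tight_power_cone_inject:
  assumes "tight_cone (power_cone K X A P \<gamma>) = tight_cone (power_cone L X' A' P' \<gamma>')"
  shows "X = X'" "A = A'" "P = P'" "\<gamma> = \<gamma>'"
proof -
  have "identity_embedding X = identity_embedding X'"
    using tight_power_cone_sel(2)[of K X A P \<gamma> "()"] tight_power_cone_sel(2)[of L X' A' P' \<gamma>' "()"] assms by simp
  then show "X = X'" by (simp add: identity_embedding_def)
  show "A = A'"
    using tight_power_cone_sel(5)[of K X A P \<gamma>] tight_power_cone_sel(5)[of L X' A' P' \<gamma>'] assms pick_sel(1) by metis
  show "P = P'"
    using tight_power_cone_sel(6)[of K X A P \<gamma>] tight_power_cone_sel(6)[of L X' A' P' \<gamma>'] assms by simp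
  show "\<gamma> = \<gamma>'"
    using tight_power_cone_sel(7)[of K X A P \<gamma> "()"] tight_power_cone_sel(7)[of L X' A' P' \<gamma>' "()"] assms by simp
qed

lemma FF_sel:
  "Ob (loose FF) = {A. full_embedding A}"
  "Mor (loose FF) = {(A, F, B). full_embedding A \<and> full_embedding B \<and> F \<in> functors (eloose A) (eloose B)}"
  "Obj (vert (loose FF)) = {(A, F, B). full_embedding A \<and> full_embedding B \<and> F \<in> functors (eloose A) (eloose B)}"
  "Cell (loose FF) = {(A, \<eta>, B). is_nattr \<eta> \<and> full_embedding A \<and> full_embedding B \<and>
     ndom \<eta> \<in> functors (eloose A) (eloose B) \<and> ncod \<eta> \<in> functors (eloose A) (eloose B)}"
  "Dom (und (loose FF)) (A, F, B) = A" "Cod (und (loose FF)) (A, F, B) = B"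
  "Ide (und (loose FF)) A = (A, id_func (eloose A), A)"
  "Comp (und (loose FF)) (B', G, C) (A, F, B) = (A, comp_func G F, C)"
  "Dom (vert (loose FF)) (A, \<eta>, B) = (A, ndom \<eta>, B)" "Cod (vert (loose FF)) (A, \<eta>, B) = (A, ncod \<eta>, B)"
  "Ide (vert (loose FF)) (A, F, B) = (A, id_nattr F, B)"
  "Comp (vert (loose FF)) (A', \<theta>, B') (A, \<eta>, B) = (A, vcomp_nattr \<theta> \<eta>, B)"
  "hcomp (loose FF) (B', \<theta>, C) (A, \<eta>, B) = (A, hcomp_nattr \<theta> \<eta>, C)"
  "tight FF = {(A, F, B). full_embedding A \<and> full_embedding B \<and> F \<in> functors (eloose A) (eloose B) \<and> fob F ` etight A \<subseteq> etight B}"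
  by (auto simp: FF_def Let_def)

text \<open>The shape is terminal, so the naturality conditions concern identities, and
  functoriality of the weight consists of unit laws. What the cone itself contributes is a functor
  into the hom-category whose values on objects are tight.\<close>

lemma is_fcone_tight_power:
  assumes K: "f_category K" and X: "category X" and A: "A \<in> Ob (loose K)" and P: "P \<in> Ob (loose K)"
    and \<gamma>: "\<gamma> \<in> functors X (hom_cat (loose K) P A)" and t: "fob \<gamma> ` Obj X \<subseteq> tight K"
  shows "is_fcone K (tight_cone (power_cone (loose K) X A P \<gamma>))"
    (is "is_fcone K ?c")
proof -
  have L: "two_category (loose K)" using K by (simp add: f_category_def)
  have Cx: "X \<in> Ob CAT" using X by (simp add: CAT_def)
  note h = hcomp_id[OF two_category_CAT] and CI = two_category_Mor(3)[OF two_category_CAT]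
  have em: "full_embedding (identity_embedding X)" "eloose (identity_embedding X) = X" "etight (identity_embedding X) = Obj X"
    using X by (simp_all add: full_embedding_def identity_embedding_def)
  have i: "id_func X \<in> functors X X" "is_nattr (id_nattr (id_func X))"
    "comp_func (id_func X) (id_func X) = id_func X"
    using X comp_func_id(1)[OF X X] by (auto intro: id_functors id_nattr_nattr)
  have v: "vcomp_nattr (id_nattr (id_func X)) (id_nattr (id_func X)) = id_nattr (id_func X)"
    using categoryD(9)[OF two_categoryD(2)[OF two_category_CAT], of "id_nattr (id_func X)" "id_func X"] i functorsD[OF i(1)] X
    by (simp add: CAT_def)
  have hh: "hcomp_nattr (id_nattr (id_func X)) (id_nattr (id_func X)) = id_nattr (id_func X)"
    using hcomp_Ide[OF two_category_CAT, of "id_func X" "id_func X"] i functorsD[OF i(1)] X by (simp add: CAT_def)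
  have c1: "f_category (chordate one_two_cat)"
    using two_category_one by (auto simp: f_category_def chordate_def)
  have "two_functor one_two_cat (loose FF) (fweight ?c)"
    by (rule two_functorI) (use i v hh in \<open>simp_all add: tight_power_cone_sel FF_sel em\<close>)
  then have c2: "f_functor (chordate one_two_cat) FF (fweight ?c)"
    unfolding f_functor_def chordate_def using i(1) X by (auto simp: tight_power_cone_sel FF_sel em)
  have c3: "f_functor (chordate one_two_cat) K (pick (loose K) A)"
    unfolding f_functor_def chordate_def using two_functor_pick[OF L A] K A by (auto simp: f_category_def)
  \<comment> \<open>Forgetting tightness gives back the original cone, so the condition on loose
    parts can be checked on \<open>power_cone\<close>.\<close>
  have w: "loose_cone ?c = power_cone (loose K) X A P \<gamma>"
    by (rule wcone.equality) (auto simp: loose_cone_def tight_power_cone_sel Let_def chordate_def em pick_def CAT_def)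
  have c4: "is_wcone (loose K) (loose_cone ?c)"
    unfolding w is_wcone_def Let_def
    using two_category_one two_functor_pick[OF two_category_CAT Cx] two_functor_pick[OF L A] P \<gamma> A L
      hom_cat_functorD[OF L \<gamma>] X
    by (simp add: lwhisker_def rwhisker_def extensional_def) (simp add: CAT_def)
  show ?thesis
    unfolding is_fcone_def using c1 c2 c3 c4 t by (simp add: tight_power_cone_sel em)
qed

text \<open>\<open>sketch_model\<close> includes the requirement that the target be an \<F>-sketch.
  Tightness of the projections holds because the target is chordate.\<close>

lemma f_sketch_all_powers:
  assumes C: "two_category C"
  shows "f_sketch (plus_sketch (all_powers_sketch C) :: (unit, unit, unit, 'u, 'u, 'o, 'm, 'c) fsketch)"
proof -
  have f: "f_category (chordate C)" using C by (auto simp: f_category_def chordate_def)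
  have "is_fcone (chordate C) (tight_cone (power_cone C X A P \<gamma>))"
    if "finitely_presentable X" "is_power C X A P \<gamma>" for X :: "('u, 'u) cat" and A P \<gamma>
  proof -
    have X: "category X" using that by (simp add: finitely_presentable_def)
    note p = is_powerD[OF C X that(2)]
    show ?thesis
      using is_fcone_tight_power[OF f X, of A P \<gamma>] p hom_cat_functorD(1)[OF C p(3)] by (auto simp: chordate_def)
  qed
  then show ?thesis
    using f by (auto simp: f_sketch_def plus_sketch_def all_powers_sketch_def)
qed

section \<open>The sketch of an algebraic 2-theory and its models\<close>

locale two_theory = FP_setting FP for FP :: "('u::infinite, 'u) cat set" +
  fixes \<S> :: "(('u, 'u) cat, 'm, 'c) two_cat"
    and S :: "(('u, 'u) cat, ('u, 'u, 'u, 'u) func, ('u, 'u, 'u, 'u) nattr, ('u, 'u) cat, 'm, 'c) two_func"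
  assumes alg: "algebraic_two_theory FP \<S> S"
begin

lemma S: "two_category \<S>" "two_functor (FP_op FP) \<S> S" "Ob \<S> = FP" "X \<in> FP \<Longrightarrow> F0 S X = X"
  using alg by (simp_all add: algebraic_two_theory_def)

definition cone :: "('u, 'u) cat \<Rightarrow> ('u, 'u, 'm, 'c) func" where
  "cone X = comp_func (hom_action (FP_op FP) \<S> S X one) (canonical_functor FP X)"

text \<open>The canonical cones are powers in the opposite of FP, and \<open>S\<close> preserves
  them. Since \<open>S\<close> fixes objects, the apex is \<open>X\<close> and the base is
  \<open>one\<close> again.\<close>

lemma cone_power: "X \<in> FP \<Longrightarrow> is_power \<S> X one X (cone X)"
  using alg canonical_power[of X] FP_fp[of X] S(4) FP_one(1)
  unfolding algebraic_two_theory_def preserves_powers_def cone_def by fastforce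

lemma cone_sel:
  assumes "X \<in> FP"
  shows "x \<in> Obj X \<Longrightarrow> fob (cone X) x = F1 S (point one X x)"
  using hom_action_cone(2)[OF two_category_FP_op S(1,2) FP_category[OF assms] canonical_functor_functors[OF assms]]
  by (simp add: cone_def canonical_functor_sel)

lemma cone_functors: "X \<in> FP \<Longrightarrow> cone X \<in> functors X (hom_cat \<S> X one)"
  using is_powerD(3)[OF S(1) FP_category cone_power] by blast

lemma theory_sketch_eq:
  "theory_sketch FP \<S> S = \<lparr>sk_cat = \<S>, sk_cones = {power_cone \<S> X one X (cone X) | X. X \<in> FP}\<rparr>"
proof -
  have "map_wcone (FP_op FP) \<S> S (power_cone (FP_op FP) X one X (canonical_functor FP X)) = power_cone \<S> X one X (cone X)"
    if "X \<in> FP" for X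
    using map_power_cone[OF S(2) _ two_category_FP_op, where A = one and X = X and P = X and \<gamma> = "canonical_functor FP X"] FP_one(1) S(4) that by (simp add: cone_def)
  then show ?thesis unfolding theory_sketch_def setcompr_eq_image by (simp cong: image_cong_simp)
qed

text \<open>The converse has to deal with a power in \<open>\<S>\<close> whose cone is arbitrary. By
  \<open>preserves_power_cong\<close> it may be replaced by the image under \<open>S\<close> of a
  cone built in the opposite of FP; what is then examined is the composite of \<open>M\<close> with
  \<open>S\<close>, a 2-functor on the opposite of FP.\<close>

lemma theory_model_iff:
  fixes C :: "('p, 'n, 'd) two_cat"
  assumes C: "two_category C"
  shows "theory_model \<S> C M \<longleftrightarrow> two_functor \<S> C M \<and>
    (\<forall>Y\<in>FP. is_power C Y (F0 M one) (F0 M Y) (comp_func (hom_action \<S> C M Y one) (cone Y)))"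
proof
  assume "theory_model \<S> C M"
  then show "two_functor \<S> C M \<and>
      (\<forall>Y\<in>FP. is_power C Y (F0 M one) (F0 M Y) (comp_func (hom_action \<S> C M Y one) (cone Y)))"
    using cone_power FP_fp unfolding theory_model_def preserves_powers_def by blast
next
  assume "two_functor \<S> C M \<and>
    (\<forall>Y\<in>FP. is_power C Y (F0 M one) (F0 M Y) (comp_func (hom_action \<S> C M Y one) (cone Y)))"
  then have M: "two_functor \<S> C M"
    and p: "\<And>Y. Y \<in> FP \<Longrightarrow> is_power C Y (F0 M one) (F0 M Y) (comp_func (hom_action \<S> C M Y one) (cone Y))" by auto
  let ?T = "comp_two_func (FP_op FP) M S"
  have T: "two_functor (FP_op FP) C ?T" by (rule comp_two_functor[OF two_category_FP_op S(1) C S(2) M])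
  have T0: "F0 ?T X = F0 M X" if "X \<in> FP" for X using that S(4) by simp
  have MS: "comp_func (hom_action \<S> C M Q A) (comp_func (hom_action (FP_op FP) \<S> S Q A) \<gamma>) = comp_func (hom_action (FP_op FP) C ?T Q A) \<gamma>"
    if "Q \<in> FP" "A \<in> FP" "category X" "\<gamma> \<in> functors X (hom_cat (FP_op FP) Q A)" for Q A \<gamma> and X :: "('u, 'u) cat"
    using hom_action_comp[OF two_category_FP_op S(1) C S(2) M that(3,4)] that S(4) by simp
  have "is_power C X (F0 M A) (F0 M P) (comp_func (hom_action \<S> C M P A) \<gamma>)"
    if X: "finitely_presentable X" and P: "is_power \<S> X A P \<gamma>" for X :: "('u, 'u) cat" and A P \<gamma>
  proof -
    note XC = finitely_presentable_category[OF X]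
    have A: "A \<in> FP" using is_powerD(1)[OF S(1) XC P] S(3) by simp
    \<comment> \<open>One cone \<open>\<kappa>\<close> serves two 2-functors: \<open>S\<close>, to
      exhibit a power in \<open>\<S>\<close> with which the given one can be compared, and
      \<open>?T\<close>, to see that \<open>M\<close> preserves it.\<close>
    obtain Q \<kappa> where Q: "Q \<in> FP" and \<kappa>: "\<kappa> \<in> functors X (hom_cat (FP_op FP) Q A)"
      and Sp: "\<And>(K :: (('u, 'u) cat, 'm, 'c) two_cat) T. two_category K \<Longrightarrow> two_functor (FP_op FP) K T \<Longrightarrow>
      (\<And>Y. Y \<in> FP \<Longrightarrow> is_power K Y (F0 T one) (F0 T Y) (comp_func (hom_action (FP_op FP) K T Y one) (canonical_functor FP Y))) \<Longrightarrow>
      is_power K X (F0 T A) (F0 T Q) (comp_func (hom_action (FP_op FP) K T Q A) \<kappa>)"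
      and Cp: "\<And>(K :: ('p, 'n, 'd) two_cat) T. two_category K \<Longrightarrow> two_functor (FP_op FP) K T \<Longrightarrow>
      (\<And>Y. Y \<in> FP \<Longrightarrow> is_power K Y (F0 T one) (F0 T Y) (comp_func (hom_action (FP_op FP) K T Y one) (canonical_functor FP Y))) \<Longrightarrow>
      is_power K X (F0 T A) (F0 T Q) (comp_func (hom_action (FP_op FP) K T Q A) \<kappa>)"
      by (rule power_of_power_FP[OF X A]) blast
    have q: "is_power \<S> X A Q (comp_func (hom_action (FP_op FP) \<S> S Q A) \<kappa>)"
      using Sp[OF S(1,2)] cone_power S(4) FP_one(1) A Q by (simp add: cone_def)
    have "is_power C X (F0 ?T A) (F0 ?T Q) (comp_func (hom_action (FP_op FP) C ?T Q A) \<kappa>)"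
    proof (rule Cp[OF C T])
      fix Y assume Y: "Y \<in> FP"
      show "is_power C Y (F0 ?T one) (F0 ?T Y) (comp_func (hom_action (FP_op FP) C ?T Y one) (canonical_functor FP Y))"
        using p[OF Y] MS[OF Y FP_one(1) FP_category[OF Y] canonical_functor_functors[OF Y]] T0[OF Y] T0[OF FP_one(1)]
        by (simp add: cone_def)
    qed
    then have "is_power C X (F0 M A) (F0 M Q) (comp_func (hom_action \<S> C M Q A) (comp_func (hom_action (FP_op FP) \<S> S Q A) \<kappa>))"
      using MS[OF Q A XC \<kappa>] T0[OF A] T0[OF Q] by simp
    then show ?thesis
      by (rule preserves_power_cong[OF S(1) C M XC P q])
  qed
  then show "theory_model \<S> C M" using M unfolding theory_model_def preserves_powers_def by blast
qed

abbreviation "\<S>\<Pi> \<equiv> Pi_sketch (theory_sketch FP \<S> S)"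

lemma projections_eq: "projections (theory_sketch FP \<S> S) = {F1 S (point one X x) | X x. X \<in> FP \<and> x \<in> Obj X}"
proof -
  have "projections (theory_sketch FP \<S> S) = (\<Union>X\<in>FP. fob (cone X) ` Obj X)"
    unfolding projections_def theory_sketch_eq setcompr_eq_image by simp
  also have "\<dots> = (\<Union>X\<in>FP. (\<lambda>x. F1 S (point one X x)) ` Obj X)"
    using cone_sel by (intro SUP_cong image_cong refl) auto
  finally show ?thesis by blast
qed

lemma point_Mor: "X \<in> FP \<Longrightarrow> x \<in> Obj X \<Longrightarrow> point one X x \<in> Mor (FP_op FP)"
  using point_functors[OF one(1) FP_category] FP_one(1) by (auto dest: functorsD)

lemma projections_Mor: "projections (theory_sketch FP \<S> S) \<subseteq> Mor \<S>"
  unfolding projections_eq using point_Mor two_functorD(2)[OF S(2)] by blast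

lemma Pi_sketch_sel:
  "loose (fsk_cat \<S>\<Pi>) = \<S>" "tight (fsk_cat \<S>\<Pi>) = generated (und \<S>) (projections (theory_sketch FP \<S> S))"
  "fsk_cones \<S>\<Pi> = {tight_cone (power_cone \<S> X one X (cone X)) | X. X \<in> FP}"
  by (auto simp: Pi_sketch_def theory_sketch_eq)

lemma tight_Mor: "f \<in> tight (fsk_cat \<S>\<Pi>) \<Longrightarrow> f \<in> Mor \<S>"
  using generated_induct[OF two_categoryD(1)[OF S(1)] projections_Mor, of f "\<lambda>_. True"] by (simp add: Pi_sketch_sel)

lemma f_category_Pi_sketch: "f_category (fsk_cat \<S>\<Pi>)"
  unfolding f_category_def Pi_sketch_sel
  using S(1) tight_Mor by (auto simp: Pi_sketch_sel intro: generated.intros)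

lemma f_sketch_Pi_sketch: "f_sketch \<S>\<Pi>"
  unfolding f_sketch_def
proof (intro conjI f_category_Pi_sketch ballI)
  fix c assume "c \<in> fsk_cones \<S>\<Pi>"
  then obtain X where X: "X \<in> FP" "c = tight_cone (power_cone \<S> X one X (cone X))" by (auto simp: Pi_sketch_sel)
  have "fob (cone X) ` Obj X \<subseteq> tight (fsk_cat \<S>\<Pi>)"
    using X(1) by (auto simp: Pi_sketch_sel projections_eq cone_sel intro!: generated.gen)
  then show "is_fcone (fsk_cat \<S>\<Pi>) c"
    using is_fcone_tight_power[OF f_category_Pi_sketch FP_category[OF X(1)], of one X "cone X"] X S(3) FP_one(1) cone_functors
    by (simp add: Pi_sketch_sel)
qed

text \<open>Tightness is preserved because the target is chordate, and the condition on specified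
  cones is the criterion of \<open>theory_model_iff\<close>, cone by cone.\<close>

lemma sketch_model_iff:
  fixes C :: "('p, 'n, 'd) two_cat"
  assumes C: "two_category C"
  shows "sketch_model \<S>\<Pi> (plus_sketch (all_powers_sketch C)) M \<longleftrightarrow> theory_model \<S> C M"
proof -
  let ?C = "plus_sketch (all_powers_sketch C) :: (unit, unit, unit, 'u, 'u, 'p, 'n, 'd) fsketch"
  have sel: "loose (fsk_cat ?C) = C" "tight (fsk_cat ?C) = Mor C"
    "fsk_cones ?C = {tight_cone (power_cone C X A P \<gamma>) | X A P \<gamma>. finitely_presentable X \<and> is_power C X A P \<gamma>}"
    by (simp_all add: plus_sketch_def all_powers_sketch_def chordate_def) blast
  have ff: "f_functor (fsk_cat \<S>\<Pi>) (fsk_cat ?C) M \<longleftrightarrow> two_functor \<S> C M"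
  proof -
    have "F1 M ` tight (fsk_cat \<S>\<Pi>) \<subseteq> Mor C" if M: "two_functor \<S> C M"
      using tight_Mor two_functorD(2)[OF M] by blast
    then show ?thesis unfolding f_functor_def sel Pi_sketch_sel(1) by blast
  qed
  have cones: "map_fcone (fsk_cat \<S>\<Pi>) (fsk_cat ?C) M ` fsk_cones \<S>\<Pi> \<subseteq> fsk_cones ?C \<longleftrightarrow>
     (\<forall>Y\<in>FP. is_power C Y (F0 M one) (F0 M Y) (comp_func (hom_action \<S> C M Y one) (cone Y)))" if M: "two_functor \<S> C M"
  proof -
    have m: "map_fcone (fsk_cat \<S>\<Pi>) (fsk_cat ?C) M (tight_cone (power_cone \<S> Y one Y (cone Y))) =
        tight_cone (power_cone C Y (F0 M one) (F0 M Y) (comp_func (hom_action \<S> C M Y one) (cone Y)))" for Y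
      using map_tight_power_cone[of "fsk_cat \<S>\<Pi>" "fsk_cat ?C" M one Y Y "cone Y"] M S FP_one(1) by (simp add: sel Pi_sketch_sel)
    have "tight_cone (power_cone C Y A P \<gamma>) \<in> fsk_cones ?C \<longleftrightarrow> is_power C Y A P \<gamma>" if "Y \<in> FP" for Y A P \<gamma>
    proof
      assume "tight_cone (power_cone C Y A P \<gamma>) \<in> fsk_cones ?C"
      then obtain X' A' P' \<gamma>' where e: "tight_cone (power_cone C Y A P \<gamma>) = tight_cone (power_cone C X' A' P' \<gamma>')"
        and p: "is_power C X' A' P' \<gamma>'" unfolding sel by blast
      show "is_power C Y A P \<gamma>" using p unfolding tight_power_cone_inject[OF e] .
    qed (use FP_fp[OF that] in \<open>auto simp: sel\<close>)
    then show ?thesis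
      unfolding Pi_sketch_sel(3) setcompr_eq_image image_image image_subset_iff m by simp
  qed
  show ?thesis
    unfolding sketch_model_def theory_model_iff[OF C] ff
    using f_sketch_Pi_sketch f_sketch_all_powers[OF C] cones by blast
qed

text \<open>From left to right, projections are images of 1-cells of the opposite of FP, and
  identity components spread along composites. From right to left, \<open>F1 S f\<close> followed by
  a projection is again a projection, so the component at \<open>F1 S f\<close> becomes an identity
  after each projection of a power. The power is one in the codomain model, because that is where
  the component ends.\<close>

lemma strict_restriction_iff:
  assumes C: "two_category C" and \<phi>: "weak_natural w \<S> C \<phi>"
    and N: "theory_model \<S> C (tcod \<phi>)"
  shows "weak_natural Strict (FP_op FP) C (restrict_transf (FP_op FP) \<phi> S) \<longleftrightarrow>
    (\<forall>f\<in>tight (fsk_cat \<S>\<Pi>). is_identity (vert C) (t2 \<phi> f))"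
proof
  assume s: "weak_natural Strict (FP_op FP) C (restrict_transf (FP_op FP) \<phi> S)"
  have "is_identity (vert C) (t2 \<phi> g)" if g: "g \<in> projections (theory_sketch FP \<S> S)" for g
  proof -
    obtain X x where x: "X \<in> FP" "x \<in> Obj X" "g = F1 S (point one X x)" using g unfolding projections_eq by blast
    show ?thesis
      using weak_natural_boundary(5)[OF s point_Mor[OF x(1,2)]] restrict_transf_sel(4)[OF point_Mor[OF x(1,2)], of \<phi> S] x(3) by simp
  qed
  then show "\<forall>f\<in>tight (fsk_cat \<S>\<Pi>). is_identity (vert C) (t2 \<phi> f)"
    using generated_identity_components[OF S(1) C \<phi> projections_Mor] by (simp add: Pi_sketch_sel)
next
  assume t: "\<forall>f\<in>tight (fsk_cat \<S>\<Pi>). is_identity (vert C) (t2 \<phi> f)"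
  have pi: "is_identity (vert C) (t2 \<phi> (F1 S (point one X x)))" if "X \<in> FP" "x \<in> Obj X" for X x
    using t that by (auto simp: Pi_sketch_sel projections_eq intro: generated.gen)
  note n = weak_naturalD[OF \<phi>] and s = two_functorD[OF S(2)]
  note m = two_functorD[OF n(1)] two_functorD[OF n(2)]
  have Cu: "category (und C)" using C by simp
  show "weak_natural Strict (FP_op FP) C (restrict_transf (FP_op FP) \<phi> S)"
  proof (rule restrict_transf_strict[OF two_category_FP_op S(1) C S(2) \<phi>])
    fix f assume f: "f \<in> Mor (FP_op FP)"
    define Y where "Y = Cod (und (FP_op FP)) f"
    have Y: "Y \<in> FP" using f by (simp add: Y_def)
    have YC: "category Y" by (rule FP_category[OF Y])
    have p: "is_power C Y (F0 (tcod \<phi>) one) (F0 (tcod \<phi>) Y) (comp_func (hom_action \<S> C (tcod \<phi>) Y one) (cone Y))"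
      using N Y unfolding theory_model_iff[OF C] by blast
    have Sf: "F1 S f \<in> Mor \<S>" "Cod (und \<S>) (F1 S f) = Y" using s(2)[OF f] s(4)[OF f] S(4)[OF Y] by (simp_all add: Y_def)
    show "is_identity (vert C) (t2 \<phi> (F1 S f))"
    proof (rule power_identity_cell[OF C YC p])
      show "t2 \<phi> (F1 S f) \<in> Cell C" using n Sf by simp
      show "Cod (und C) (Dom (vert C) (t2 \<phi> (F1 S f))) = F0 (tcod \<phi>) Y"
        using weak_natural_boundary(1,4)[OF \<phi> Sf(1)] Sf S(1) categoryD(1)[OF two_categoryD(1)[OF S(1)] Sf(1)] by (cases "w = Colax") (simp_all add: m n Cu S(3) Y)
      fix y assume y: "y \<in> Obj Y"
      let ?p = "point one Y y" and ?X = "fcod f" and ?x = "fob f y"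
      have f': "f \<in> functors Y ?X" "?X \<in> FP" using f by (simp_all add: Y_def functors_def)
      have x: "?x \<in> Obj ?X" using functorsD'(1)[OF f'(1) y] .
      note pm = point_Mor[OF Y y]
      \<comment> \<open>A functor applied to a point is a point. Hence the projection at
        \<open>y\<close> after \<open>F1 S f\<close> is the projection at \<open>fob f y\<close>,
        whose component is an identity by hypothesis.\<close>
      have "comp_func f ?p = point one ?X ?x"
        by (rule functor_one_eqI[OF comp_functors[OF one(1) point_functors[OF one(1) YC y] f'(1)]
              point_functors[OF one(1) FP_category[OF f'(2)] x] _ FP_category[OF f'(2)]])
          (use one in simp)
      then have c: "Comp (und \<S>) (F1 S ?p) (F1 S f) = F1 S (point one ?X ?x)"
        using s(6)[OF f pm] by (simp add: Y_def)
      have d: "Dom (und \<S>) (F1 S ?p) = Cod (und \<S>) (F1 S f)"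
        using s(3)[OF pm] Sf(2) S(4)[OF Y] by simp
      have "t2 \<phi> (F1 S (point one ?X ?x)) = hcomp C (Ide (vert C) (F1 (tcod \<phi>) (F1 S ?p))) (t2 \<phi> (F1 S f))"
        using weak_natural_identity_comp[OF S(1) C \<phi> Sf(1) s(2)[OF pm] d pi[OF Y y]] c by simp
      moreover have "fob (comp_func (hom_action \<S> C (tcod \<phi>) Y one) (cone Y)) y = F1 (tcod \<phi>) (F1 S ?p)"
        using hom_action_cone(2)[OF S(1) C n(2) YC cone_functors[OF Y] y] cone_sel[OF Y y] by simp
      ultimately show "is_identity (vert C) (hcomp C (Ide (vert C) (fob (comp_func (hom_action \<S> C (tcod \<phi>) Y one) (cone Y)) y)) (t2 \<phi> (F1 S f)))"
        using pi[OF f'(2) x] by simp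
    qed
  qed
qed

text \<open>\<open>isomorphic_two_cat\<close> demands 2-categories on both sides. Beyond
  \<open>two_category_transf\<close>, this needs that identity components at tight morphisms are
  present in identity transformations and survive composition.\<close>

lemma two_category_FMod:
  assumes C: "two_category C"
  shows "two_category (transf_two_cat w \<S> C \<M> {\<phi>. \<forall>f\<in>tight (fsk_cat \<S>\<Pi>). is_identity (vert C) (t2 \<phi> f)})"
proof (rule two_category_transf[OF S(1) C])
  fix M assume "two_functor \<S> C M"
  then show "id_transf \<S> C M \<in> {\<phi>. \<forall>f\<in>tight (fsk_cat \<S>\<Pi>). is_identity (vert C) (t2 \<phi> f)}"
    using tight_Mor two_functorD(2)[of \<S> C M] C by simp
next
  fix \<phi> \<psi>
  assume t: "\<phi> \<in> {\<phi>. \<forall>f\<in>tight (fsk_cat \<S>\<Pi>). is_identity (vert C) (t2 \<phi> f)}" "\<psi> \<in> {\<phi>. \<forall>f\<in>tight (fsk_cat \<S>\<Pi>). is_identity (vert C) (t2 \<phi> f)}"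
    and \<phi>: "weak_natural w \<S> C \<phi>" and \<psi>: "weak_natural w \<S> C \<psi>" and m: "tdom \<psi> = tcod \<phi>"
  have Cu: "category (und C)" and Cv: "category (vert C)" and Su: "category (und \<S>)" using C S(1) by simp_all
  note n = weak_naturalD[OF \<phi>] weak_naturalD[OF \<psi>]
  note F = two_functorD[OF weak_naturalD(1)[OF \<phi>]] two_functorD[OF weak_naturalD(2)[OF \<phi>]] two_functorD[OF weak_naturalD(2)[OF \<psi>]]
  have "is_identity (vert C) (t2 (comp_transf w \<S> C \<psi> \<phi>) f)" if f: "f \<in> tight (fsk_cat \<S>\<Pi>)" for f
  proof -
    have f': "f \<in> Mor \<S>" by (rule tight_Mor[OF f])
    have i: "is_identity (vert C) (t2 \<phi> f)" "is_identity (vert C) (t2 \<psi> f)" using t f by auto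
    show ?thesis
    proof (cases "w = Colax")
      case True
      note b = weak_natural_boundary(3,4)[OF \<phi> f' True] weak_natural_boundary(3,4)[OF \<psi> f' True]
      show ?thesis using f' True
        by (auto intro!: is_identity_comp is_identity_hcomp simp: i n F b m C S(1) category_assoc[OF Cu])
    next
      case False
      note b = weak_natural_boundary(1,2)[OF \<phi> f' False] weak_natural_boundary(1,2)[OF \<psi> f' False]
      show ?thesis using f' False
        by (auto intro!: is_identity_comp is_identity_hcomp simp: i n F b m C S(1) category_assoc[OF Cu])
    qed
  qed
  then show "comp_transf w \<S> C \<psi> \<phi> \<in> {\<phi>. \<forall>f\<in>tight (fsk_cat \<S>\<Pi>). is_identity (vert C) (t2 \<phi> f)}" by blast
qed

text \<open>Both sides are \<open>transf_two_cat\<close> for the same weakness, source and target,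
  so it suffices that the models coincide and that the two conditions on transformations coincide
  between models.\<close>

lemma Mod_eq_FMod:
  assumes C: "two_category C"
  shows "Mod w FP \<S> S C = loose (FMod w \<S>\<Pi> (plus_sketch (all_powers_sketch C)))"
proof -
  have l: "loose (fsk_cat (plus_sketch (all_powers_sketch C))) = C"
    by (simp add: plus_sketch_def all_powers_sketch_def chordate_def)
  let ?T = "{\<phi>. weak_natural Strict (FP_op FP) C (restrict_transf (FP_op FP) \<phi> S)}"
    and ?T' = "{\<phi>. \<forall>f\<in>tight (fsk_cat \<S>\<Pi>). is_identity (vert C) (t2 \<phi> f)}"
  \<comment> \<open>The two conditions are compared inside the set that
    \<open>transf_two_cat\<close> forms, because \<open>strict_restriction_iff\<close> relies on the
    codomain being a model.\<close>
  have "{\<phi> \<in> ?T. weak_natural w \<S> C \<phi> \<and> tdom \<phi> \<in> {M. theory_model \<S> C M} \<and> tcod \<phi> \<in> {M. theory_model \<S> C M}} =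
     {\<phi> \<in> ?T'. weak_natural w \<S> C \<phi> \<and> tdom \<phi> \<in> {M. theory_model \<S> C M} \<and> tcod \<phi> \<in> {M. theory_model \<S> C M}}"
    using strict_restriction_iff[OF C] by blast
  then have "transf_two_cat w \<S> C {M. theory_model \<S> C M} ?T = transf_two_cat w \<S> C {M. theory_model \<S> C M} ?T'"
    unfolding transf_two_cat_def by (simp only:)
  then show ?thesis
    unfolding Mod_def FMod_def Let_def l Pi_sketch_sel(1) sketch_model_iff[OF C] by simp
qed

end

lemma isomorphic_two_cat_refl:
  assumes "two_category K"
  shows "isomorphic_two_cat K K"
proof -
  have "comp_two_func K (id_two_func K) (id_two_func K) = id_two_func K"
    by (auto simp: comp_two_func_def id_two_func_def intro!: ext)
  then show ?thesis using assms id_two_functor[OF assms] unfolding isomorphic_two_cat_def by blast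
qed

theorem proposition8p13:
  fixes FP :: "('u::infinite, 'u) cat set"
    and \<S> :: "(('u, 'u) cat, 'm, 'c) two_cat"
    and S :: "(('u, 'u) cat, ('u, 'u, 'u, 'u) func, ('u, 'u, 'u, 'u) nattr,
               ('u, 'u) cat, 'm, 'c) two_func"
    and C :: "('p, 'n, 'd) two_cat"
    and w :: weakness
  assumes "FP_skeleton FP"
    and "algebraic_two_theory FP \<S> S"
    and "two_category C"
  shows "isomorphic_two_cat (Mod w FP \<S> S C)
           (loose (FMod w (Pi_sketch (theory_sketch FP \<S> S)) (plus_sketch (all_powers_sketch C))))"
proof -
  interpret two_theory FP \<S> S
    by unfold_locales (rule assms)+
  have l: "loose (fsk_cat (plus_sketch (all_powers_sketch C))) = C"
    by (simp add: plus_sketch_def all_powers_sketch_def chordate_def)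
  have "two_category (loose (FMod w \<S>\<Pi> (plus_sketch (all_powers_sketch C))))"
    unfolding FMod_def Let_def using two_category_FMod[OF assms(3)] by (simp add: Pi_sketch_sel(1) l)
  then show ?thesis
    unfolding Mod_eq_FMod[OF assms(3)] by (rule isomorphic_two_cat_refl)
qed

end
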